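(* Let $M$ be an $n$-dimensional manifold with asymptotic coordinates, and let $g$ be a smooth Riemannian metric on $M$ which is asymptotically flat in $C^2_\delta$ for some $\delta>(n-2)/2$ and whose scalar curvature $R(g)$ is integrable. Let $g(t)$, $t\in[0,T]$, be the short time solution of the Ricci flow $\frac{\partial}{\partial t}g_{ij}=-2R_{ij}$ with $g(0)=g$ constructed by Shi. Then $R(g(t))\in L^1$ for all $t\in(0,T]$, and the ADM mass is constant along the flow: $m(g(t))=m(g)$ for all $t\in[0,T]$.
   Context: Asymptotic coordinates: $K_0\subset M$ is a compact set and $x=(x^1,\ldots,x^n)$ is a diffeomorphism from $M\setminus K_0$ onto $\mathbf{R}^n\setminus B$, where $B$ is the unit ball. Fix a smooth metric $h$ on $M$ which is the Euclidean metric outside $K_0$, and a smooth positive function $\rho$ equal to $|x|$ for $|x|\geqslant 2$ and equal to $1$ on the unit ball, regarded as a function on $M$ via the asymptotic coordinates (equal to $1$ on $K_0$). Set $$\|f\|_{C^{k}_\delta}=\sup\rho^{\delta}|f|+\sup\rho^{\delta+1}|\nabla f|+\cdots+\sup\rho^{\delta+k}|\nabla^k f|,$$ with derivatives and norms taken with respect to $h$. A metric $g$ is asymptotically flat in $C^{k}_\delta$ if $\delta>0$ and $g_{ij}-h_{ij}\in C^{k}_\delta(M\setminus K_0)$. ADM mass: for $g$ asymptotically flat in $C^2_\delta$ with $\delta>(n-2)/2$ and with $R(g)\in L^1$, $$m(g)=\lim_{r\to\infty}\int_{\partial B_r}\big(g_{ij,j}-g_{jj,i}\big)\,dS^i,$$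 where $\partial B_r=\{|x|=r\}$, derivatives are taken in the asymptotic coordinates, repeated indices are summed, and $dS^i$ is the outward unit normal component times the surface measure. Shi's solution: for a complete initial metric with bounded curvature (such as an asymptotically flat metric in $C^2_\delta$), Shi's theorem gives a solution of the Ricci flow on some interval $[0,T]$, $T>0$, consisting of complete metrics with curvature uniformly bounded on $M\times[0,T]$. It is known that $g(t)$ then remains asymptotically flat in $C^2_\delta$, with $\|g(t)-h\|_{C^2_\delta}$ bounded uniformly for $t\in[0,T]$. *)

theory Defs
  imports "HOL-Analysis.Analysis"
begin

section \<open>Differentiability classes\<close>

text \<open>Derivatives are taken within \<open>S\<close>. This is only used where they are uniquely determined:
  for open \<open>S\<close>, and for products of a nondegenerate compact time interval and an open
  set, where it gives smoothness up to the initial and the final time.\<close>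

primrec Ck_on :: "nat \<Rightarrow> 'a::euclidean_space set \<Rightarrow> ('a \<Rightarrow> 'b::real_normed_vector) \<Rightarrow> bool" where
  "Ck_on 0 S f \<longleftrightarrow> continuous_on S f"
| "Ck_on (Suc k) S f \<longleftrightarrow> f differentiable_on S \<and>
     (\<forall>b\<in>Basis. Ck_on k S (\<lambda>x. frechet_derivative f (at x within S) b))"

definition smooth_on :: "'a::euclidean_space set \<Rightarrow> ('a \<Rightarrow> 'b::real_normed_vector) \<Rightarrow> bool" where
  "smooth_on S f \<longleftrightarrow> (\<forall>k. Ck_on k S f)"

definition pd :: "'n \<Rightarrow> (real^'n \<Rightarrow> real) \<Rightarrow> real^'n \<Rightarrow> real" where
  "pd i f y = frechet_derivative f (at y) (axis i 1)"

section \<open>Smooth manifolds and Riemannian metrics\<close>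

text \<open>A chart is a pair of its domain and its coordinate map; values of the
  coordinate map outside the domain are irrelevant.\<close>

type_synonym ('m, 'n) chart = "'m set \<times> ('m \<Rightarrow> real^'n)"

abbreviation chart_image :: "('m, 'n) chart \<Rightarrow> (real^'n) set" where
  "chart_image c \<equiv> snd c ` fst c"

definition is_chart :: "('m::topological_space, 'n::finite) chart \<Rightarrow> bool" where
  "is_chart c \<longleftrightarrow> open (fst c) \<and> open (chart_image c) \<and>
     homeomorphism (fst c) (chart_image c) (snd c) (inv_into (fst c) (snd c))"

definition transition :: "('m, 'n) chart \<Rightarrow> ('m, 'n) chart \<Rightarrow> real^'n \<Rightarrow> real^'n" where
  "transition c d = snd d \<circ> inv_into (fst c) (snd c)"

definition compatible :: "('m, 'n::finite) chart \<Rightarrow> ('m, 'n) chart \<Rightarrow> bool" where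
  "compatible c d \<longleftrightarrow> smooth_on (snd c ` (fst c \<inter> fst d)) (transition c d) \<and>
     smooth_on (snd d ` (fst c \<inter> fst d)) (transition d c)"

text \<open>A smooth structure is a maximal smooth atlas.\<close>

definition smooth_structure :: "('m::topological_space, 'n::finite) chart set \<Rightarrow> bool" where
  "smooth_structure A \<longleftrightarrow>
     (\<forall>c\<in>A. is_chart c) \<and> (\<Union>c\<in>A. fst c) = UNIV \<and> (\<forall>c\<in>A. \<forall>d\<in>A. compatible c d) \<and>
     (\<forall>c. is_chart c \<and> (\<forall>d\<in>A. compatible c d) \<longrightarrow> c \<in> A)"

definition chart_at :: "('m, 'n) chart set \<Rightarrow> 'm \<Rightarrow> ('m, 'n) chart" where
  "chart_at A p = (SOME c. c \<in> A \<and> p \<in> fst c)"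

text \<open>A covariant 2-tensor field is given by its component matrix in every chart, as a function of
  the coordinates of that chart.\<close>

type_synonym ('m, 'n) field2 = "('m, 'n) chart \<Rightarrow> real^'n \<Rightarrow> real^'n^'n"

definition riemannian_metric :: "('m, 'n::finite) chart set \<Rightarrow> ('m, 'n) field2 \<Rightarrow> bool" where
  "riemannian_metric A g \<longleftrightarrow>
     (\<forall>c\<in>A. smooth_on (chart_image c) (g c)) \<and>
     (\<forall>c\<in>A. \<forall>y\<in>chart_image c. transpose (g c y) = g c y \<and> (\<forall>v. v \<noteq> 0 \<longrightarrow> v \<bullet> (g c y *v v) > 0)) \<and>
     (\<forall>c\<in>A. \<forall>d\<in>A. \<forall>p\<in>fst c \<inter> fst d.
        let J = matrix (frechet_derivative (transition c d) (at (snd c p)))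
        in g c (snd c p) = transpose J ** g d (snd d p) ** J)"

section \<open>Curvature in local coordinates\<close>

definition christoffel :: "(real^'n \<Rightarrow> real^'n^'n) \<Rightarrow> 'n::finite \<Rightarrow> 'n \<Rightarrow> 'n \<Rightarrow> real^'n \<Rightarrow> real" where
  "christoffel G k i j y = (\<Sum>l\<in>UNIV. matrix_inv (G y) $ k $ l *
     (pd i (\<lambda>z. G z $ j $ l) y + pd j (\<lambda>z. G z $ i $ l) y - pd l (\<lambda>z. G z $ i $ j) y)) / 2"

text \<open>\<open>riemann G l k i j\<close> is the \<open>l\<close>-component of \<open>R(\<partial>\<^sub>i, \<partial>\<^sub>j) \<partial>\<^sub>k\<close>, with
  \<open>R(X, Y) = [\<nabla>\<^sub>X, \<nabla>\<^sub>Y] - \<nabla>\<^bsub>[X, Y]\<^esub>\<close>; round spheres have positive Ricci curvature.\<close>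

definition riemann ::
    "(real^'n \<Rightarrow> real^'n^'n) \<Rightarrow> 'n::finite \<Rightarrow> 'n \<Rightarrow> 'n \<Rightarrow> 'n \<Rightarrow> real^'n \<Rightarrow> real" where
  "riemann G l k i j y =
     pd i (christoffel G l j k) y - pd j (christoffel G l i k) y +
     (\<Sum>m\<in>UNIV. christoffel G l i m y * christoffel G m j k y
               - christoffel G l j m y * christoffel G m i k y)"

definition ricci :: "(real^'n \<Rightarrow> real^'n^'n) \<Rightarrow> 'n::finite \<Rightarrow> 'n \<Rightarrow> real^'n \<Rightarrow> real" where
  "ricci G i j y = (\<Sum>k\<in>UNIV. riemann G k i k j y)"

definition scal :: "(real^'n::finite \<Rightarrow> real^'n^'n) \<Rightarrow> real^'n \<Rightarrow> real" where
  "scal G y = (\<Sum>i\<in>UNIV. \<Sum>j\<in>UNIV. matrix_inv (G y) $ i $ j * ricci G i j y)"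

definition scalar_curvature ::
    "('m, 'n::finite) chart set \<Rightarrow> ('m, 'n) field2 \<Rightarrow> 'm \<Rightarrow> real" where
  "scalar_curvature A g p = (let c = chart_at A p in scal (g c) (snd c p))"

text \<open>Components of covariant tensors of arbitrary rank are indexed by lists of indices;
  \<open>cov_deriv\<close> puts the differentiation index first.\<close>

definition tensor_norm ::
    "(real^'n \<Rightarrow> real^'n^'n) \<Rightarrow> nat \<Rightarrow> ('n::finite list \<Rightarrow> real^'n \<Rightarrow> real) \<Rightarrow> real^'n \<Rightarrow> real" where
  "tensor_norm G m F y = sqrt (\<Sum>I | length I = m. \<Sum>J | length J = m.
     (\<Prod>q<m. matrix_inv (G y) $ (I ! q) $ (J ! q)) * F I y * F J y)"

definition cov_deriv ::
    "(real^'n \<Rightarrow> real^'n^'n) \<Rightarrow> ('n::finite list \<Rightarrow> real^'n \<Rightarrow> real) \<Rightarrow> 'n list \<Rightarrow> real^'n \<Rightarrow> real" where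
  "cov_deriv G F I y = (case I of [] \<Rightarrow> 0 | k # J \<Rightarrow>
     pd k (F J) y - (\<Sum>q<length J. \<Sum>l\<in>UNIV. christoffel G l k (J ! q) y * F (J[q := l]) y))"

definition tensor2 :: "(real^'n \<Rightarrow> real^'n^'n) \<Rightarrow> 'n list \<Rightarrow> real^'n \<Rightarrow> real" where
  "tensor2 G I y = G y $ (I ! 0) $ (I ! 1)"

definition riemann_lowered ::
    "(real^'n \<Rightarrow> real^'n^'n) \<Rightarrow> 'n::finite list \<Rightarrow> real^'n \<Rightarrow> real" where
  "riemann_lowered G I y =
     (\<Sum>l\<in>UNIV. G y $ (I ! 0) $ l * riemann G l (I ! 1) (I ! 2) (I ! 3) y)"

section \<open>Volume and integrability\<close>

definition is_volume_measure ::
    "('m::topological_space, 'n::finite) chart set \<Rightarrow> ('m, 'n) field2 \<Rightarrow> 'm measure \<Rightarrow> bool" where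
  "is_volume_measure A g \<mu> \<longleftrightarrow> sets \<mu> = sets borel \<and>
     (\<forall>c\<in>A. \<forall>B\<in>sets borel. B \<subseteq> fst c \<longrightarrow>
        emeasure \<mu> B =
          (\<integral>\<^sup>+ y. ennreal (sqrt (det (g c y))) * indicator (snd c ` B) y \<partial>lborel))"

definition scalar_curvature_L1 ::
    "('m::topological_space, 'n::finite) chart set \<Rightarrow> ('m, 'n) field2 \<Rightarrow> bool" where
  "scalar_curvature_L1 A g \<longleftrightarrow>
     (\<exists>\<mu>. is_volume_measure A g \<mu> \<and> integrable \<mu> (scalar_curvature A g))"

section \<open>Completeness\<close>

definition pw_C1_curve ::
    "('m::topological_space, 'n::finite) chart set \<Rightarrow> (real \<Rightarrow> 'm) \<Rightarrow> bool" where
  "pw_C1_curve A \<gamma> \<longleftrightarrow> path \<gamma> \<and>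
     (\<forall>c\<in>A. \<forall>a b. 0 \<le> a \<and> a < b \<and> b \<le> 1 \<and> \<gamma> ` {a..b} \<subseteq> fst c \<longrightarrow>
        (snd c \<circ> \<gamma>) piecewise_C1_differentiable_on {a..b})"

definition speed ::
    "('m, 'n::finite) chart set \<Rightarrow> ('m, 'n) field2 \<Rightarrow> (real \<Rightarrow> 'm) \<Rightarrow> real \<Rightarrow> real" where
  "speed A g \<gamma> s =
     (let c = chart_at A (\<gamma> s); v = vector_derivative (snd c \<circ> \<gamma>) (at s)
      in sqrt (v \<bullet> (g c (snd c (\<gamma> s)) *v v)))"

text \<open>The library's piecewise continuously differentiable functions may have unbounded
  derivative near the exceptional points. The length is therefore an extended
  nonnegative integral, which is infinite for curves that are not rectifiable.\<close>

definition curve_length ::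
    "('m, 'n::finite) chart set \<Rightarrow> ('m, 'n) field2 \<Rightarrow> (real \<Rightarrow> 'm) \<Rightarrow> ennreal" where
  "curve_length A g \<gamma> = (\<integral>\<^sup>+ s. ennreal (speed A g \<gamma> s) * indicator {0..1} s \<partial>lborel)"

definition riem_dist ::
    "('m::topological_space, 'n::finite) chart set \<Rightarrow> ('m, 'n) field2 \<Rightarrow> 'm \<Rightarrow> 'm \<Rightarrow> ennreal" where
  "riem_dist A g p q =
     (INF \<gamma>\<in>{\<gamma>. pw_C1_curve A \<gamma> \<and> pathstart \<gamma> = p \<and> pathfinish \<gamma> = q}. curve_length A g \<gamma>)"

definition complete_metric ::
    "('m::topological_space, 'n::finite) chart set \<Rightarrow> ('m, 'n) field2 \<Rightarrow> bool" where
  "complete_metric A g \<longleftrightarrow>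
     (\<forall>X :: nat \<Rightarrow> 'm. (\<forall>e>0. \<exists>N. \<forall>i\<ge>N. \<forall>j\<ge>N. riem_dist A g (X i) (X j) < e) \<longrightarrow> convergent X)"

section \<open>Ricci flow\<close>

definition ricci_flow ::
    "('m, 'n::finite) chart set \<Rightarrow> real \<Rightarrow> (real \<Rightarrow> ('m, 'n) field2) \<Rightarrow> bool" where
  "ricci_flow A T g \<longleftrightarrow>
     (\<forall>t\<in>{0..T}. riemannian_metric A (g t)) \<and>
     (\<forall>c\<in>A. smooth_on ({0..T} \<times> chart_image c) (\<lambda>(t, y). g t c y)) \<and>
     (\<forall>c\<in>A. \<forall>y\<in>chart_image c. \<forall>t\<in>{0..T}. \<forall>i j.
        ((\<lambda>s. g s c y $ i $ j) has_real_derivative - 2 * ricci (g t c) i j y) (at t within {0..T}))"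

text \<open>The class of solutions provided by Shi's existence theorem.\<close>

definition shi_solution ::
    "('m::topological_space, 'n::finite) chart set \<Rightarrow> real \<Rightarrow> (real \<Rightarrow> ('m, 'n) field2) \<Rightarrow> bool" where
  "shi_solution A T g \<longleftrightarrow> 0 < T \<and> ricci_flow A T g \<and>
     (\<forall>t\<in>{0..T}. complete_metric A (g t)) \<and>
     (\<exists>C. \<forall>t\<in>{0..T}. \<forall>c\<in>A. \<forall>y\<in>chart_image c.
        tensor_norm (g t c) 4 (riemann_lowered (g t c)) y \<le> C)"

section \<open>Asymptotic flatness\<close>

text \<open>As the atlas is maximal, a diffeomorphism of the open set \<open>- K0\<close> onto the exterior of
  the closed unit ball is the same thing as a chart with this domain and image.\<close>

definition asymptotic_coordinates ::
    "('m::topological_space, 'n::finite) chart set \<Rightarrow> 'm set \<Rightarrow> ('m \<Rightarrow> real^'n) \<Rightarrow> bool" where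
  "asymptotic_coordinates A K0 x \<longleftrightarrow>
     compact K0 \<and> (- K0, x) \<in> A \<and> x ` (- K0) = - cball 0 1"

definition background_metric ::
    "('m, 'n::finite) chart set \<Rightarrow> 'm set \<Rightarrow> ('m \<Rightarrow> real^'n) \<Rightarrow> ('m, 'n) field2 \<Rightarrow> bool" where
  "background_metric A K0 x h \<longleftrightarrow>
     riemannian_metric A h \<and> (\<forall>y\<in>x ` (- K0). h (- K0, x) y = mat 1)"

definition weight_function ::
    "'m set \<Rightarrow> ('m \<Rightarrow> real^'n::finite) \<Rightarrow> ('m \<Rightarrow> real) \<Rightarrow> bool" where
  "weight_function K0 x \<rho> \<longleftrightarrow>
     (\<exists>w :: real^'n \<Rightarrow> real. smooth_on UNIV w \<and> (\<forall>y. w y > 0) \<and>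
        (\<forall>y. norm y \<ge> 2 \<longrightarrow> w y = norm y) \<and> (\<forall>y. norm y \<le> 1 \<longrightarrow> w y = 1) \<and>
        (\<forall>p. \<rho> p = (if p \<in> K0 then 1 else w (x p))))"

text \<open>The norm of \<open>C\<^sup>k\<^sub>\<delta>(S)\<close> for a 2-tensor \<open>f\<close>. The supremum runs over the points of \<open>S\<close> and
  all charts around them; the pointwise norms do not depend on the chart when \<open>f\<close> transforms
  as a tensor. The norm is \<open>\<infinity>\<close> if some derivative is not controlled by the weights.\<close>

definition weighted_Ck_norm ::
    "('m, 'n::finite) chart set \<Rightarrow> ('m, 'n) field2 \<Rightarrow> ('m \<Rightarrow> real) \<Rightarrow> 'm set \<Rightarrow>
     nat \<Rightarrow> real \<Rightarrow> ('m, 'n) field2 \<Rightarrow> ennreal" where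
  "weighted_Ck_norm A h \<rho> S k \<delta> f =
     (\<Sum>l\<le>k. SUP (c, p)\<in>{(c, p). c \<in> A \<and> p \<in> fst c \<inter> S}.
        ennreal (\<rho> p powr (\<delta> + real l) *
          tensor_norm (h c) (l + 2) ((cov_deriv (h c) ^^ l) (tensor2 (f c))) (snd c p)))"

definition asymptotically_flat ::
    "('m, 'n::finite) chart set \<Rightarrow> 'm set \<Rightarrow> ('m, 'n) field2 \<Rightarrow> ('m \<Rightarrow> real) \<Rightarrow>
     nat \<Rightarrow> real \<Rightarrow> ('m, 'n) field2 \<Rightarrow> bool" where
  "asymptotically_flat A K0 h \<rho> k \<delta> g \<longleftrightarrow>
     \<delta> > 0 \<and> weighted_Ck_norm A h \<rho> (- K0) k \<delta> (\<lambda>c y. g c y - h c y) < \<infinity>"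

section \<open>ADM mass\<close>

text \<open>Surface measure on the sphere of radius \<open>r > 0\<close> in \<open>\<real>\<^sup>n\<close>: the measure of a set \<open>E\<close> is \<open>n/r\<close> times
  the Lebesgue measure of the cone \<open>{s *\<^sub>R y | 0 < s < 1, y \<in> E}\<close> over it, as in the polar coordinates
  formula.\<close>

definition sphere_measure :: "real \<Rightarrow> (real^'n::finite) measure" where
  "sphere_measure r = scale_measure (ennreal (real CARD('n) / r))
     (distr (restrict_space lborel (ball 0 r - {0})) borel (\<lambda>y. (r / norm y) *\<^sub>R y))"

definition adm_flux :: "(real^'n::finite \<Rightarrow> real^'n^'n) \<Rightarrow> real \<Rightarrow> real" where
  "adm_flux G r = (LINT y|sphere_measure r.
     (\<Sum>i\<in>UNIV. (\<Sum>j\<in>UNIV. pd j (\<lambda>z. G z $ i $ j) y - pd i (\<lambda>z. G z $ j $ j) y) * (y $ i / norm y)))"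

text \<open>This is meaningful only if the limit exists; statements about the mass must assert
  that separately.\<close>

definition adm_mass :: "(real^'n::finite \<Rightarrow> real^'n^'n) \<Rightarrow> real" where
  "adm_mass G = Lim at_top (adm_flux G)"

end

theory Submission
  imports Defs
begin

text \<open>
  The flow equation makes the Ricci curvature a time derivative of the metric, so it inherits the
  transformation rule of the metric, and the scalar curvature \<open>S\<close> is a well-defined continuous
  function on \<open>M\<close>. By Shi's curvature bound only its behaviour at infinity in the asymptotic chart
  matters. There \<open>\<partial>\<^sub>t S = \<Delta>S + 2|Ric|\<^sup>2\<close>, where \<open>|Ric|\<^sup>2 = O(|x|\<^bsup>-2\<delta>-4\<^esup>)\<close> is integrable because
  \<open>2\<delta> + 2 > n\<close>. Testing with a regularised sign of \<open>S\<close> times a cutoff bounds \<open>\<integral>|S|\<close> over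
  \<open>r\<^sub>0 < |x| < \<rho>\<close> by its initial value, a constant, and \<open>\<rho>\<^bsup>-2\<^esup>\<close> times the same integral over
  the annulus \<open>\<rho> < |x| < 2\<rho>\<close>; the trivial polynomial bound of the latter improves by iteration to a
  uniform one, hence \<open>S(t)\<close> is integrable.

  Since \<open>S = \<partial>\<^sub>i(g\<^sub>i\<^sub>j\<^sub>,\<^sub>j - g\<^sub>j\<^sub>j\<^sub>,\<^sub>i) + O(|x|\<^bsup>-2\<delta>-2\<^esup>)\<close>, the flux through large spheres converges. Its limit
  is also the limit of the averages of the flux against the gradient of a cutoff at radius \<open>\<rho>\<close>; after
  an integration by parts these depend on \<open>g\<close> without derivatives, and their time derivative contains
  \<open>Ric\<close> against second derivatives of the cutoff. By the contracted Bianchi identity the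
  latter reduces to \<open>\<rho>\<^bsup>-2\<^esup>\<close> times the integral of \<open>|S| + |x|\<^bsup>-2\<delta>-2\<^esup>\<close> over an annulus, which tends to \<open>0\<close>.
\<close>

section \<open>Smooth functions on open sets\<close>

text \<open>Decay is known for the metric and two of its derivatives only. The gradient of
  \<open>S\<close> and the derivatives of the Ricci tensor, which enter the time derivative of the
  flux, have no known bound. This shapes both halves: such derivatives are moved by integration by
  parts onto a cutoff or onto coefficients with at most two derivatives of the metric, and the one
  quadratic gradient term that remains has a favourable sign. It is also why the mass is compared at
  two times through averages over annuli rather than single spheres. The exponent
  \<open>2 * \<delta> + 2\<close> is the order of the quadratic errors, such as products of
  Christoffel symbols or of metric minus identity with curvature; exceeding the dimension makes them
  integrable. A second obstacle is that chart components are arbitrary outside the chart image: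
  cutoffs with compact support inside the image restore continuity, and the flux integrand calls for
  measurability of the derivative of an arbitrary function. Curvature identities are matrix
  identities for connection matrices over commuting directions.\<close>

lemma frechet_derivative_within_cong:
  assumes "x \<in> S" "\<And>x. x \<in> S \<Longrightarrow> f x = g x"
  shows "frechet_derivative f (at x within S) = frechet_derivative g (at x within S)"
proof -
  \<comment> \<open>\<open>frechet_derivative\<close> is chosen among all derivatives within
    \<open>S\<close>; equal sets of candidates give equal choices, unique or not.\<close>
  have "(f has_derivative D) (at x within S) \<longleftrightarrow> (g has_derivative D) (at x within S)" for D
    using assms by (metis has_derivative_transform)
  then show ?thesis by (simp add: frechet_derivative_def)
qed

lemma differentiable_on_cong:
  assumes "\<And>x. x \<in> S \<Longrightarrow> f x = g x"
  shows "f differentiable_on S \<longleftrightarrow> g differentiable_on S"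
proof -
  have "(f has_derivative D) (at x within S) \<longleftrightarrow> (g has_derivative D) (at x within S)" if "x \<in> S" for D x
    using assms that by (metis has_derivative_transform)
  then show ?thesis by (simp add: differentiable_on_def differentiable_def)
qed

lemma Ck_on_cong:
  assumes "\<And>x. x \<in> S \<Longrightarrow> f x = g x"
  shows "Ck_on k S f \<longleftrightarrow> Ck_on k S g"
  using assms
proof (induction k arbitrary: f g)
  case 0
  then show ?case by (simp cong: continuous_on_cong)
next
  case (Suc k)
  have "Ck_on k S (\<lambda>x. frechet_derivative f (at x within S) b) \<longleftrightarrow>
        Ck_on k S (\<lambda>x. frechet_derivative g (at x within S) b)" for b
    by (rule Suc.IH) (use frechet_derivative_within_cong Suc.prems in metis)
  moreover have "f differentiable_on S \<longleftrightarrow> g differentiable_on S"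
    using Suc.prems by (rule differentiable_on_cong)
  ultimately show ?case by simp
qed

lemma Ck_on_SucD: "Ck_on (Suc k) S f \<Longrightarrow> Ck_on k S f"
proof (induction k arbitrary: f)
  case 0
  then show ?case by (auto intro: differentiable_imp_continuous_on)
next
  case (Suc k)
  note P = Ck_on.simps(2)[of "Suc k" S f, THEN iffD1, OF Suc.prems]
  show ?case
    by (rule Ck_on.simps(2)[of k S f, THEN iffD2])
       (intro conjI ballI conjunct1[OF P] Suc.IH conjunct2[OF P, THEN bspec])
qed

lemma Ck_on_Suc_open:
  assumes "open U"
  shows "Ck_on (Suc k) U f \<longleftrightarrow> (\<forall>x\<in>U. f differentiable (at x)) \<and>
     (\<forall>b\<in>Basis. Ck_on k U (\<lambda>x. frechet_derivative f (at x) b))"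
proof -
  have "Ck_on k U (\<lambda>x. frechet_derivative f (at x within U) b) \<longleftrightarrow>
      Ck_on k U (\<lambda>x. frechet_derivative f (at x) b)" for b
    by (rule Ck_on_cong) (simp add: at_within_open[OF _ assms])
  then show ?thesis
    by (simp add: differentiable_on_eq_differentiable_at assms)
qed

lemma Ck_on_open_subset:
  assumes "open U" "U \<subseteq> S" "Ck_on k S f"
  shows "Ck_on k U f"
  using assms(3)
proof (induction k arbitrary: f)
  case 0
  then show ?case using assms continuous_on_subset by auto
next
  case (Suc k)
  have *: "at x within S = at x" if "x \<in> U" for x
    using that assms by (metis at_within_open_subset)
  have "Ck_on k U (\<lambda>x. frechet_derivative f (at x) b)" if "b \<in> Basis" for b
  proof -
    have "Ck_on k U (\<lambda>x. frechet_derivative f (at x within S) b)"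
      using Suc that by auto
    then show ?thesis by (subst Ck_on_cong[where g="\<lambda>x. frechet_derivative f (at x within S) b"]) (auto simp: *)
  qed
  moreover have "f differentiable (at x)" if "x \<in> U" for x
    using Suc.prems that assms(2) *[OF that] by (metis Ck_on.simps(2) differentiable_onD subsetD)
  ultimately show ?case unfolding Ck_on_Suc_open[OF assms(1)] by blast
qed

lemma smooth_on_open_subset: "open U \<Longrightarrow> U \<subseteq> S \<Longrightarrow> smooth_on S f \<Longrightarrow> smooth_on U f"
  unfolding smooth_on_def using Ck_on_open_subset by blast

text \<open>The counterpart of \<open>pd\<close> for an arbitrary direction in an arbitrary
  Euclidean space, so that one calculus serves slices of constant time and space-time alike.\<close>

definition dd :: "'a::euclidean_space \<Rightarrow> ('a \<Rightarrow> real) \<Rightarrow> 'a \<Rightarrow> real" where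
  "dd v f z = frechet_derivative f (at z) v"

lemma pd_eq_dd: "pd i f y = dd (axis i 1) f y"
  by (simp add: pd_def dd_def)

lemma dd_eqI: "(f has_derivative D) (at z) \<Longrightarrow> dd v f z = D v"
  by (simp add: dd_def frechet_derivative_at[symmetric])

lemma smooth_on_differentiable: "open U \<Longrightarrow> smooth_on U f \<Longrightarrow> z \<in> U \<Longrightarrow> f differentiable (at z)"
  unfolding smooth_on_def using Ck_on_Suc_open by blast

lemma smooth_on_has_derivative:
  "open U \<Longrightarrow> smooth_on U f \<Longrightarrow> z \<in> U \<Longrightarrow> (f has_derivative (\<lambda>v. dd v f z)) (at z)"
  using smooth_on_differentiable[of U f z] by (simp add: dd_def frechet_derivative_works)

lemma smooth_on_continuous_on: "smooth_on U f \<Longrightarrow> continuous_on U f"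
  unfolding smooth_on_def by (metis Ck_on.simps(1))

lemma smooth_on_cong: "(\<And>x. x \<in> U \<Longrightarrow> f x = g x) \<Longrightarrow> smooth_on U f \<longleftrightarrow> smooth_on U g"
  unfolding smooth_on_def using Ck_on_cong by blast

lemma dd_cong:
  assumes "open U" "z \<in> U" "\<And>x. x \<in> U \<Longrightarrow> f x = g x"
  shows "dd v f z = dd v g z"
  using frechet_derivative_within_cong[of z U f g] assms by (simp add: dd_def at_within_open[OF assms(2,1)])

lemma Ck_on_SucI:
  assumes "open U" "\<And>x. x \<in> U \<Longrightarrow> (f has_derivative D x) (at x)"
    "\<And>b. b \<in> Basis \<Longrightarrow> Ck_on k U (\<lambda>x. D x b)"
  shows "Ck_on (Suc k) U f"
proof -
  have "frechet_derivative f (at x) = D x" if "x \<in> U" for x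
    using frechet_derivative_at[OF assms(2)[OF that]] by simp
  then have "Ck_on k U (\<lambda>x. frechet_derivative f (at x) b)" if "b \<in> Basis" for b
    using assms(3)[OF that] by (subst Ck_on_cong[where g="\<lambda>x. D x b"]) auto
  then show ?thesis unfolding Ck_on_Suc_open[OF assms(1)] using assms(2) by (auto intro: differentiableI)
qed

lemma Ck_on_SucD2:
  assumes "open U" "Ck_on (Suc k) U f"
  shows "Ck_on k U f" "\<And>x. x \<in> U \<Longrightarrow> (f has_derivative frechet_derivative f (at x)) (at x)"
    "\<And>b. b \<in> Basis \<Longrightarrow> Ck_on k U (\<lambda>x. frechet_derivative f (at x) b)"
  using Ck_on_SucD[OF assms(2)] assms(2)[unfolded Ck_on_Suc_open[OF assms(1)]] by (auto simp: frechet_derivative_works)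

lemma Ck_on_const: "open U \<Longrightarrow> Ck_on k U (\<lambda>x. c)"
proof (induction k arbitrary: c)
  case (Suc k)
  show ?case by (rule Ck_on_SucI[where D="\<lambda>x v. 0"]) (use Suc in auto)
qed simp

lemma Ck_on_linear:
  assumes "open U" "bounded_linear h" "Ck_on k U f"
  shows "Ck_on k U (\<lambda>x. h (f x))"
  using assms(3)
proof (induction k arbitrary: f)
  case 0
  then show ?case using assms(2) by (auto intro: bounded_linear.continuous_on)
next
  case (Suc k)
  note * = Ck_on_SucD2[OF assms(1) Suc.prems]
  show ?case
    by (rule Ck_on_SucI[where D="\<lambda>x v. h (frechet_derivative f (at x) v)", OF assms(1)])
       (use * Suc.IH assms(2) in \<open>auto intro: bounded_linear.has_derivative\<close>)
qed

lemma Ck_on_add: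
  assumes "open U" "Ck_on k U f" "Ck_on k U g"
  shows "Ck_on k U (\<lambda>x. f x + g x)"
  using assms(2,3)
proof (induction k arbitrary: f g)
  case 0
  then show ?case by (auto intro: continuous_intros)
next
  case (Suc k)
  note * = Ck_on_SucD2[OF assms(1) Suc.prems(1)] Ck_on_SucD2[OF assms(1) Suc.prems(2)]
  show ?case
    by (rule Ck_on_SucI[where D="\<lambda>x v. frechet_derivative f (at x) v + frechet_derivative g (at x) v", OF assms(1)])
       (use * Suc.IH in \<open>auto intro: has_derivative_add\<close>)
qed

lemma Ck_on_mult:
  fixes f g :: "'a::euclidean_space \<Rightarrow> real"
  assumes "open U" "Ck_on k U f" "Ck_on k U g"
  shows "Ck_on k U (\<lambda>x. f x * g x)"
  using assms(2,3)
proof (induction k arbitrary: f g)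
  case 0
  then show ?case by (auto intro: continuous_intros)
next
  case (Suc k)
  note * = Ck_on_SucD2[OF assms(1) Suc.prems(1)] Ck_on_SucD2[OF assms(1) Suc.prems(2)]
  show ?case
    by (rule Ck_on_SucI[where D="\<lambda>x v. f x * frechet_derivative g (at x) v + frechet_derivative f (at x) v * g x", OF assms(1)])
       (use * Suc.IH in \<open>auto intro!: has_derivative_mult Ck_on_add assms(1)\<close>)
qed

text \<open>The derivative of the reciprocal is a product that contains the reciprocal again, and to
  that the induction hypothesis of one order less applies.\<close>

lemma Ck_on_inverse:
  fixes f :: "'a::euclidean_space \<Rightarrow> real"
  assumes "open U" "Ck_on k U f" "\<And>x. x \<in> U \<Longrightarrow> f x \<noteq> 0"
  shows "Ck_on k U (\<lambda>x. inverse (f x))"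
  using assms(2)
proof (induction k)
  case 0
  then show ?case using assms(3) by (auto intro: continuous_intros)
next
  case (Suc k)
  note * = Ck_on_SucD2[OF assms(1) Suc.prems(1)]
  have "Ck_on k U (\<lambda>x. (-1) * (inverse (f x) * frechet_derivative f (at x) v * inverse (f x)))"
    if "v \<in> Basis" for v
    by (intro Ck_on_mult Ck_on_const assms(1) Suc.IH * that)
  then show ?case
    by (intro Ck_on_SucI[where D="\<lambda>x v. - (inverse (f x) * frechet_derivative f (at x) v * inverse (f x))", OF assms(1)])
       (use * assms(3) in \<open>auto intro!: has_derivative_inverse\<close>)
qed

named_theorems smooth

lemma smooth_on_const [smooth]: "open U \<Longrightarrow> smooth_on U (\<lambda>x. c)"
  by (simp add: smooth_on_def Ck_on_const)

lemma smooth_on_linear: "open U \<Longrightarrow> bounded_linear h \<Longrightarrow> smooth_on U f \<Longrightarrow> smooth_on U (\<lambda>x. h (f x))"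
  by (simp add: smooth_on_def Ck_on_linear)

lemma smooth_on_add [smooth]:
  "open U \<Longrightarrow> smooth_on U f \<Longrightarrow> smooth_on U g \<Longrightarrow> smooth_on U (\<lambda>x. f x + g x)"
  by (simp add: smooth_on_def Ck_on_add)

lemma smooth_on_mult [smooth]:
  fixes f g :: "'a::euclidean_space \<Rightarrow> real"
  shows "open U \<Longrightarrow> smooth_on U f \<Longrightarrow> smooth_on U g \<Longrightarrow> smooth_on U (\<lambda>x. f x * g x)"
  by (simp add: smooth_on_def Ck_on_mult)

lemma smooth_on_uminus [smooth]:
  "open U \<Longrightarrow> smooth_on U f \<Longrightarrow> smooth_on U (\<lambda>x. - f x)"
  by (rule smooth_on_linear) (auto intro: bounded_linear_minus[OF bounded_linear_ident])

lemma smooth_on_diff [smooth]: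
  assumes "open U" "smooth_on U f" "smooth_on U g" shows "smooth_on U (\<lambda>x. f x - g x)"
  using smooth_on_add[OF assms(1,2) smooth_on_uminus[OF assms(1,3)]] by simp

lemma smooth_on_sum [smooth]:
  assumes "open U" "\<And>i. i \<in> I \<Longrightarrow> smooth_on U (f i)"
  shows "smooth_on U (\<lambda>x. \<Sum>i\<in>I. f i x)"
  using assms(2) by (induction I rule: infinite_finite_induct) (auto intro: smooth assms(1))

lemma smooth_on_prod [smooth]:
  fixes f :: "'i \<Rightarrow> 'a::euclidean_space \<Rightarrow> real"
  assumes "open U" "\<And>i. i \<in> I \<Longrightarrow> smooth_on U (f i)"
  shows "smooth_on U (\<lambda>x. \<Prod>i\<in>I. f i x)"
  using assms(2) by (induction I rule: infinite_finite_induct) (auto intro: smooth assms(1))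

lemma smooth_on_inverse [smooth]:
  fixes f :: "'a::euclidean_space \<Rightarrow> real"
  shows "open U \<Longrightarrow> smooth_on U f \<Longrightarrow> (\<And>x. x \<in> U \<Longrightarrow> f x \<noteq> 0) \<Longrightarrow> smooth_on U (\<lambda>x. inverse (f x))"
  by (simp add: smooth_on_def Ck_on_inverse)

lemma smooth_on_divide_const [smooth]:
  fixes f :: "'a::euclidean_space \<Rightarrow> real"
  assumes "open U" "smooth_on U f" shows "smooth_on U (\<lambda>x. f x / c)"
  using smooth_on_mult[OF assms(1) smooth_on_const[OF assms(1), of "inverse c"] assms(2)] by (simp add: field_simps)

lemma smooth_on_dd [smooth]:
  assumes "open U" "smooth_on U f"
  shows "smooth_on U (dd v f)"
proof -
  \<comment> \<open>\<open>Ck_on\<close> controls derivatives along basis vectors; a general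
    direction is a combination of these with constant coefficients.\<close>
  have *: "dd v f x = (\<Sum>b\<in>Basis. (v \<bullet> b) * dd b f x)" if "x \<in> U" for x
  proof -
    have "linear (\<lambda>v. dd v f x)"
      using smooth_on_has_derivative[OF assms that] has_derivative_linear by blast
    then have "dd (\<Sum>b\<in>Basis. (v \<bullet> b) *\<^sub>R b) f x = (\<Sum>b\<in>Basis. dd ((v \<bullet> b) *\<^sub>R b) f x)"
      by (rule linear_sum)
    also have "\<dots> = (\<Sum>b\<in>Basis. (v \<bullet> b) * dd b f x)"
      using linear_cmul[OF \<open>linear (\<lambda>v. dd v f x)\<close>] by simp
    finally show ?thesis by (simp add: euclidean_representation)
  qed
  have "smooth_on U (\<lambda>x. dd b f x)" if "b \<in> Basis" for b
    unfolding smooth_on_def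
  proof
    fix k
    have "Ck_on (Suc k) U f" using assms(2) by (auto simp: smooth_on_def)
    then show "Ck_on k U (\<lambda>x. dd b f x)"
      using that Ck_on_SucD2(3)[OF assms(1)] by (simp add: dd_def)
  qed
  then have "smooth_on U (\<lambda>x. \<Sum>b\<in>Basis. (v \<bullet> b) * dd b f x)"
    by (auto intro!: smooth assms(1))
  then show ?thesis by (subst smooth_on_cong[OF *]) auto
qed

lemma dd_const [simp]: "dd v (\<lambda>x. c) z = 0"
  by (simp add: dd_def)

context
  fixes U :: "'a::euclidean_space set" and z
  assumes U: "open U" "z \<in> U"
begin

lemma dd_add: "smooth_on U f \<Longrightarrow> smooth_on U g \<Longrightarrow> dd v (\<lambda>x. f x + g x) z = dd v f z + dd v g z"
  by (rule dd_eqI) (intro has_derivative_add smooth_on_has_derivative[OF U(1) _ U(2)])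

lemma dd_diff: "smooth_on U f \<Longrightarrow> smooth_on U g \<Longrightarrow> dd v (\<lambda>x. f x - g x) z = dd v f z - dd v g z"
  by (rule dd_eqI) (auto intro!: has_derivative_diff smooth_on_has_derivative U)

lemma dd_uminus: "smooth_on U f \<Longrightarrow> dd v (\<lambda>x. - f x) z = - dd v f z"
  by (rule dd_eqI) (auto intro!: has_derivative_minus smooth_on_has_derivative U)

lemma dd_mult: "smooth_on U f \<Longrightarrow> smooth_on U g \<Longrightarrow>
    dd v (\<lambda>x. f x * g x) z = dd v f z * g z + f z * dd v g z"
  by (rule dd_eqI, subst add.commute) (intro has_derivative_mult smooth_on_has_derivative[OF U(1) _ U(2)])

lemma dd_sum: "(\<And>i. i \<in> I \<Longrightarrow> smooth_on U (f i)) \<Longrightarrow> dd v (\<lambda>x. \<Sum>i\<in>I. f i x) z = (\<Sum>i\<in>I. dd v (f i) z)"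
  by (rule dd_eqI) (auto intro!: has_derivative_sum smooth_on_has_derivative U)

lemma dd_cmult: "smooth_on U f \<Longrightarrow> dd v (\<lambda>x. c * f x) z = c * dd v f z"
  by (subst dd_mult) (auto intro: smooth U)

lemma dd_divide_const: "smooth_on U f \<Longrightarrow> dd v (\<lambda>x. f x / c) z = dd v f z / c"
  using dd_cmult[of f v "inverse c"] by (simp add: field_simps)

end

lemma DERIV_along_line:
  assumes "open U" "smooth_on U f" "z + s *\<^sub>R v \<in> U"
  shows "((\<lambda>s. f (z + s *\<^sub>R v)) has_real_derivative dd v f (z + s *\<^sub>R v)) (at s)"
proof -
  have "((\<lambda>s. f (z + s *\<^sub>R v)) has_derivative (\<lambda>h. dd (h *\<^sub>R v) f (z + s *\<^sub>R v))) (at s)"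
    by (rule has_derivative_compose[of "\<lambda>s. z + s *\<^sub>R v" "\<lambda>h. h *\<^sub>R v", OF _ smooth_on_has_derivative[OF assms]])
       (auto intro!: derivative_eq_intros)
  moreover have "dd (h *\<^sub>R v) f (z + s *\<^sub>R v) = dd v f (z + s *\<^sub>R v) * h" for h
    using linear_cmul[OF has_derivative_linear[OF smooth_on_has_derivative[OF assms]], of h v] by simp
  ultimately show ?thesis by (simp add: has_field_derivative_def)
qed

text \<open>The second difference over a parallelogram equals either iterated derivative at some
  nearby point, by the mean value theorem applied twice.\<close>

lemma second_difference_mvt:
  assumes "open U" "smooth_on U f" "ball z r \<subseteq> U" "0 < h" "h * (norm u + norm v) < r"
  shows "\<exists>w\<in>ball z r. dist w z \<le> h * (norm u + norm v) \<and>
    f (z + h *\<^sub>R u + h *\<^sub>R v) - f (z + h *\<^sub>R u) - f (z + h *\<^sub>R v) + f z = h * h * dd v (dd u f) w"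
proof -
  have nrm: "norm (s *\<^sub>R u + t *\<^sub>R v) \<le> h * (norm u + norm v)"
    if "s \<in> {0..h}" "t \<in> {0..h}" for s t
  proof -
    have "norm (s *\<^sub>R u + t *\<^sub>R v) \<le> s * norm u + t * norm v"
      using that by (intro norm_triangle_le) auto
    also have "\<dots> \<le> h * norm u + h * norm v"
      using that by (intro add_mono mult_right_mono) auto
    finally show ?thesis by (simp add: algebra_simps)
  qed
  have mem: "z + s *\<^sub>R u + t *\<^sub>R v \<in> ball z r" if "s \<in> {0..h}" "t \<in> {0..h}" for s t
  proof -
    have "dist z (z + s *\<^sub>R u + t *\<^sub>R v) = norm (s *\<^sub>R u + t *\<^sub>R v)"
      by (simp add: dist_norm norm_minus_commute algebra_simps)
    then show ?thesis using nrm[OF that] assms(5) by simp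
  qed
  then have memU: "z + s *\<^sub>R u + t *\<^sub>R v \<in> U" if "s \<in> {0..h}" "t \<in> {0..h}" for s t
    using that assms(3) by blast
  define p where "p s = f ((z + h *\<^sub>R v) + s *\<^sub>R u) - f (z + s *\<^sub>R u)" for s
  have dp: "(p has_real_derivative dd u f ((z + h *\<^sub>R v) + s *\<^sub>R u) - dd u f (z + s *\<^sub>R u)) (at s)"
    if "s \<in> {0..h}" for s
    unfolding p_def
    by (intro DERIV_diff DERIV_along_line assms(1,2)) (use memU[of s h] memU[of s 0] that assms in \<open>auto simp: algebra_simps\<close>)
  obtain s where s: "0 < s" "s < h" "p h - p 0 = (h - 0) * (dd u f ((z + h *\<^sub>R v) + s *\<^sub>R u) - dd u f (z + s *\<^sub>R u))"
    using MVT2[of 0 h p "\<lambda>s. dd u f ((z + h *\<^sub>R v) + s *\<^sub>R u) - dd u f (z + s *\<^sub>R u)"] dp assms(4) by auto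
  define q where "q t = dd u f ((z + s *\<^sub>R u) + t *\<^sub>R v)" for t
  have dq: "(q has_real_derivative dd v (dd u f) ((z + s *\<^sub>R u) + t *\<^sub>R v)) (at t)"
    if "t \<in> {0..h}" for t
    unfolding q_def
    by (intro DERIV_along_line smooth assms(1,2)) (use memU[of s t] that s assms(1,2) in auto)
  obtain t where t: "0 < t" "t < h" "q h - q 0 = (h - 0) * dd v (dd u f) ((z + s *\<^sub>R u) + t *\<^sub>R v)"
    using MVT2[of 0 h q "\<lambda>t. dd v (dd u f) ((z + s *\<^sub>R u) + t *\<^sub>R v)"] dq assms(4) by auto
  show ?thesis
  proof (intro bexI conjI)
    show "z + s *\<^sub>R u + t *\<^sub>R v \<in> ball z r" using mem s t by auto
    have "dist (z + s *\<^sub>R u + t *\<^sub>R v) z = norm (s *\<^sub>R u + t *\<^sub>R v)"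
      by (simp add: dist_norm algebra_simps)
    then show "dist (z + s *\<^sub>R u + t *\<^sub>R v) z \<le> h * (norm u + norm v)"
      using nrm[of s t] s t by auto
    have "p h - p 0 = h * (h * dd v (dd u f) ((z + s *\<^sub>R u) + t *\<^sub>R v))"
      using s(3) t(3) by (simp add: q_def algebra_simps)
    then show "f (z + h *\<^sub>R u + h *\<^sub>R v) - f (z + h *\<^sub>R u) - f (z + h *\<^sub>R v) + f z =
        h * h * dd v (dd u f) (z + s *\<^sub>R u + t *\<^sub>R v)"
      by (simp add: p_def algebra_simps)
  qed
qed

text \<open>One and the same second difference over a small parallelogram equals either iterated
  derivative at points close to \<open>z\<close>. If the two differed at \<open>z\<close>,
  continuity would keep them apart near \<open>z\<close>.\<close>

lemma dd_commute:
  assumes "open U" "smooth_on U f" "z \<in> U"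
  shows "dd u (dd v f) z = dd v (dd u f) z"
proof (rule ccontr)
  assume neq: "dd u (dd v f) z \<noteq> dd v (dd u f) z"
  define e where "e = \<bar>dd u (dd v f) z - dd v (dd u f) z\<bar> / 2"
  have e: "e > 0" using neq by (simp add: e_def)
  have c: "isCont (dd u (dd v f)) z" "isCont (dd v (dd u f)) z"
    using assms by (auto intro!: continuous_on_interior[OF smooth_on_continuous_on] smooth simp: interior_open)
  obtain r0 where r0: "r0 > 0" "ball z r0 \<subseteq> U" using assms openE by metis
  obtain r1 where r1: "r1 > 0" "\<And>w. dist w z < r1 \<Longrightarrow> dist (dd u (dd v f) w) (dd u (dd v f) z) < e"
    using c(1) e unfolding continuous_at_eps_delta by blast
  obtain r2 where r2: "r2 > 0" "\<And>w. dist w z < r2 \<Longrightarrow> dist (dd v (dd u f) w) (dd v (dd u f) z) < e"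
    using c(2) e unfolding continuous_at_eps_delta by blast
  define r where "r = min r0 (min r1 r2)"
  have r: "r > 0" "ball z r \<subseteq> U" using r0 r1 r2 by (auto simp: r_def)
  define h where "h = r / (2 * (norm u + norm v + 1))"
  have pos: "norm u + norm v + 1 > 0" by (simp add: add_nonneg_pos)
  have h: "h > 0" using r pos by (simp add: h_def)
  have "h * (norm u + norm v) < h * (2 * (norm u + norm v + 1))"
    using h by (intro mult_strict_left_mono) (auto simp: add_nonneg_pos)
  also have "\<dots> = r" using pos by (simp add: h_def)
  finally have hr: "h * (norm u + norm v) < r" "h * (norm v + norm u) < r" by (auto simp: add.commute)
  obtain w1 where w1: "w1 \<in> ball z r"
    "f (z + h *\<^sub>R u + h *\<^sub>R v) - f (z + h *\<^sub>R u) - f (z + h *\<^sub>R v) + f z = h * h * dd v (dd u f) w1"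
    using second_difference_mvt[OF assms(1,2) r(2) h hr(1)] by blast
  obtain w2 where w2: "w2 \<in> ball z r"
    "f (z + h *\<^sub>R v + h *\<^sub>R u) - f (z + h *\<^sub>R v) - f (z + h *\<^sub>R u) + f z = h * h * dd u (dd v f) w2"
    using second_difference_mvt[OF assms(1,2) r(2) h hr(2)] by blast
  have "h * h * dd v (dd u f) w1 = h * h * dd u (dd v f) w2"
    using w1(2) w2(2) by (simp add: algebra_simps)
  then have eq: "dd v (dd u f) w1 = dd u (dd v f) w2" using h by simp
  have "dist (dd u (dd v f) w2) (dd u (dd v f) z) < e" "dist (dd v (dd u f) w1) (dd v (dd u f) z) < e"
    using r1(2)[of w2] r2(2)[of w1] w1(1) w2(1) by (auto simp: r_def dist_commute)
  then show False using eq by (auto simp: e_def dist_real_def abs_if split: if_splits)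
qed

section \<open>Matrix-valued functions\<close>

lemma matrix_mult_distribs:
  fixes A B C :: "real^'n^'n"
  shows "(A + B) ** C = A ** C + B ** C" "A ** (B + C) = A ** B + A ** C"
    "(A - B) ** C = A ** C - B ** C" "A ** (B - C) = A ** B - A ** C"
    "(- A) ** C = - (A ** C)" "A ** (- C) = - (A ** C)" "0 ** A = 0" "A ** 0 = 0"
  by (simp_all add: matrix_matrix_mult_def vec_eq_iff sum.distrib sum_subtractf sum_negf algebra_simps)

lemma transpose_distribs:
  fixes A B :: "real^'n^'n"
  shows "transpose (A + B) = transpose A + transpose B" "transpose (A - B) = transpose A - transpose B"
    "transpose (- A) = - transpose A" "transpose (A ** B) = transpose B ** transpose A"
  by (simp_all add: transpose_def vec_eq_iff matrix_matrix_mult_def mult.commute)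

lemma matrix_mult_nth: "((A :: real^'n^'n) ** B) $ i $ j = (\<Sum>k\<in>UNIV. A $ i $ k * B $ k $ j)"
  by (simp add: matrix_matrix_mult_def)

lemma transpose_nth: "transpose A $ i $ j = A $ j $ i"
  by (simp add: transpose_def)

text \<open>Entrywise, because the product rules above are those for real-valued functions.\<close>

definition msmooth :: "'a::euclidean_space set \<Rightarrow> ('a \<Rightarrow> real^'n^'n) \<Rightarrow> bool" where
  "msmooth U A \<longleftrightarrow> (\<forall>i j. smooth_on U (\<lambda>z. A z $ i $ j))"

definition dM :: "'a::euclidean_space \<Rightarrow> ('a \<Rightarrow> real^'n^'n) \<Rightarrow> 'a \<Rightarrow> real^'n^'n" where
  "dM v A z = (\<chi> i j. dd v (\<lambda>z. A z $ i $ j) z)"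

lemma dM_nth: "dM v A z $ i $ j = dd v (\<lambda>z. A z $ i $ j) z"
  by (simp add: dM_def)

lemma msmoothD: "msmooth U A \<Longrightarrow> smooth_on U (\<lambda>z. A z $ i $ j)"
  by (simp add: msmooth_def)

lemma msmooth_closure [smooth]:
  fixes A B :: "'a::euclidean_space \<Rightarrow> real^'n^'n"
  assumes "open U"
  shows "msmooth U A \<Longrightarrow> msmooth U B \<Longrightarrow> msmooth U (\<lambda>z. A z + B z)"
    "msmooth U A \<Longrightarrow> msmooth U B \<Longrightarrow> msmooth U (\<lambda>z. A z - B z)"
    "msmooth U A \<Longrightarrow> msmooth U (\<lambda>z. - A z)"
    "msmooth U A \<Longrightarrow> msmooth U B \<Longrightarrow> msmooth U (\<lambda>z. A z ** B z)"
    "msmooth U A \<Longrightarrow> msmooth U (\<lambda>z. transpose (A z))"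
    "msmooth U A \<Longrightarrow> msmooth U (dM v A)"
  using assms by (auto simp: msmooth_def matrix_mult_nth transpose_nth dM_nth intro!: smooth)

lemma dM_cong:
  assumes "open U" "z \<in> U" "\<And>x. x \<in> U \<Longrightarrow> A x = B x"
  shows "dM v A z = dM v B z"
  unfolding dM_def vec_eq_iff vec_lambda_beta by (intro allI dd_cong[OF assms(1,2)]) (simp add: assms(3))

lemma dM_const [simp]: "dM v (\<lambda>z. c) z = 0"
  by (simp add: dM_def vec_eq_iff)

lemma dM_transpose: "dM v (\<lambda>z. transpose (A z)) z = transpose (dM v A z)"
  by (simp add: dM_def vec_eq_iff transpose_nth)

context
  fixes U :: "'a::euclidean_space set" and z
  assumes U: "open U" "z \<in> U"
begin

lemma dM_add: "msmooth U A \<Longrightarrow> msmooth U B \<Longrightarrow> dM v (\<lambda>x. A x + B x) z = dM v A z + dM v B z"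
  by (simp add: vec_eq_iff dM_nth dd_add[OF U] msmoothD)

lemma dM_diff: "msmooth U A \<Longrightarrow> msmooth U B \<Longrightarrow> dM v (\<lambda>x. A x - B x) z = dM v A z - dM v B z"
  by (simp add: vec_eq_iff dM_nth dd_diff[OF U] msmoothD)

lemma dM_uminus: "msmooth U A \<Longrightarrow> dM v (\<lambda>x. - A x) z = - dM v A z"
  by (simp add: vec_eq_iff dM_nth dd_uminus[OF U] msmoothD)

lemma dM_mult:
  assumes "msmooth U A" "msmooth U B"
  shows "dM v (\<lambda>x. A x ** B x) z = dM v A z ** B z + A z ** dM v B z"
proof -
  have "dd v (\<lambda>x. \<Sum>k\<in>UNIV. A x $ i $ k * B x $ k $ j) z =
      (\<Sum>k\<in>UNIV. dd v (\<lambda>x. A x $ i $ k) z * B z $ k $ j + A z $ i $ k * dd v (\<lambda>x. B x $ k $ j) z)" for i j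
    using assms by (simp add: dd_sum[OF U] dd_mult[OF U] msmoothD smooth_on_mult U)
  then show ?thesis
    by (simp add: vec_eq_iff dM_nth matrix_mult_nth sum.distrib)
qed

lemma dM_commute: "msmooth U A \<Longrightarrow> dM u (dM v A) z = dM v (dM u A) z"
  using dd_commute[OF U(1) _ U(2)] by (simp add: vec_eq_iff dM_nth msmoothD)

end

lemma posdef_inverse:
  fixes A :: "real^'n^'n"
  assumes "\<And>v. v \<noteq> 0 \<Longrightarrow> v \<bullet> (A *v v) > 0"
  shows "A ** matrix_inv A = mat 1" "matrix_inv A ** A = mat 1" "det A \<noteq> 0"
proof -
  have "\<exists>B. B ** A = mat 1"
    unfolding matrix_left_invertible_ker using assms by (metis inner_zero_right less_irrefl)
  then have inv: "invertible A" by (simp add: invertible_left_inverse)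
  then have "\<exists>B. A ** B = mat 1 \<and> B ** A = mat 1" by (simp add: invertible_def)
  then have "A ** matrix_inv A = mat 1 \<and> matrix_inv A ** A = mat 1"
    unfolding matrix_inv_def by (rule someI_ex)
  then show "A ** matrix_inv A = mat 1" "matrix_inv A ** A = mat 1" by auto
  show "det A \<noteq> 0" using inv by (simp add: invertible_det_nz)
qed

text \<open>Exhibits the entries of the inverse as quotients of polynomials in the entries of
  \<open>A\<close>; smoothness and continuity of the inverse metric come from this formula.\<close>

lemma matrix_inv_cramer:
  fixes A :: "real^'n^'n"
  assumes "A ** matrix_inv A = mat 1" "det A \<noteq> 0"
  shows "matrix_inv A $ i $ j = det (\<chi> k l. if l = i then (axis j 1 :: real^'n) $ k else A $ k $ l) * inverse (det A)"
proof -
  have "A *v (matrix_inv A *v axis j 1) = axis j 1"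
    by (simp add: matrix_vector_mul_assoc assms)
  then have "matrix_inv A *v axis j 1 = (\<chi> i. det (\<chi> k l. if l = i then (axis j 1 :: real^'n) $ k else A $ k $ l) / det A)"
    using cramer[OF assms(2)] by blast
  then have "(matrix_inv A *v axis j 1) $ i = det (\<chi> k l. if l = i then (axis j 1 :: real^'n) $ k else A $ k $ l) / det A" by simp
  moreover have "(matrix_inv A *v axis j 1) $ i = matrix_inv A $ i $ j"
    by (simp add: matrix_vector_mult_basis column_def)
  ultimately show ?thesis by (simp add: divide_inverse)
qed

lemma bounded_linear_entry: "bounded_linear (\<lambda>A :: real^'n^'m. A $ i $ j)"
  using bounded_linear_compose[OF bounded_linear_vec_nth bounded_linear_vec_nth] .

lemma smooth_on_det:
  assumes "open U" "msmooth U A"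
  shows "smooth_on U (\<lambda>z. det (A z))"
  unfolding det_def using assms by (auto intro!: smooth simp: msmoothD)

lemma msmooth_inverse:
  assumes U: "open U" and sm: "msmooth U A"
    and pos: "\<And>z v. z \<in> U \<Longrightarrow> v \<noteq> 0 \<Longrightarrow> v \<bullet> (A z *v v) > 0"
  shows "msmooth U (\<lambda>z. matrix_inv (A z))"
  unfolding msmooth_def
proof (intro allI)
  fix i j
  let ?B = "\<lambda>z. \<chi> k l. if l = i then (axis j 1 :: real^'b) $ k else A z $ k $ l"
  have eq: "matrix_inv (A z) $ i $ j = det (?B z) * inverse (det (A z))" if "z \<in> U" for z
  proof -
    note inv = posdef_inverse[OF pos[OF that]]
    show ?thesis by (rule matrix_inv_cramer[OF inv(1,3)])
  qed
  have "msmooth U ?B"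
    unfolding msmooth_def
  proof (intro allI)
    fix k l
    show "smooth_on U (\<lambda>z. ?B z $ k $ l)"
      using sm U by (cases "l = i") (auto simp: msmoothD intro: smooth)
  qed
  then have "smooth_on U (\<lambda>z. det (?B z) * inverse (det (A z)))"
    using sm U posdef_inverse(3)[OF pos] by (auto intro!: smooth smooth_on_det)
  then show "smooth_on U (\<lambda>z. matrix_inv (A z) $ i $ j)"
    by (subst smooth_on_cong[OF eq]) auto
qed

section \<open>Curvature in a frame of coordinate directions\<close>

text \<open>The directions \<open>e i\<close> need not span the ambient space: with \<open>'a = real \<times> real^'n\<close> the
  same formulas describe a time-dependent metric, whose time derivative is a further
  direction commuting with the \<open>e i\<close>.\<close>

definition Chr where
  "Chr e G k i j z = (\<Sum>l\<in>UNIV. matrix_inv (G z) $ k $ l *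
     (dd (e i) (\<lambda>z. G z $ j $ l) z + dd (e j) (\<lambda>z. G z $ i $ l) z - dd (e l) (\<lambda>z. G z $ i $ j) z)) / 2"

definition Gam :: "('n::finite \<Rightarrow> 'a::euclidean_space) \<Rightarrow> ('a \<Rightarrow> real^'n^'n) \<Rightarrow> 'n \<Rightarrow> 'a \<Rightarrow> real^'n^'n" where
  "Gam e G a z = (\<chi> l k. Chr e G l a k z)"

text \<open>With the connection arranged as matrices \<open>Gam e G i\<close>, curvature is the
  matrix-valued two-form \<open>d\<Gamma> + \<Gamma> \<and> \<Gamma>\<close>. For coordinate
  directions its entry in row \<open>l\<close> and column \<open>k\<close> is
  \<open>riemann G l k i j\<close>.\<close>

definition Om :: "('n::finite \<Rightarrow> 'a::euclidean_space) \<Rightarrow> ('a \<Rightarrow> real^'n^'n) \<Rightarrow> 'n \<Rightarrow> 'n \<Rightarrow> 'a \<Rightarrow> real^'n^'n" where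
  "Om e G i j z = dM (e i) (Gam e G j) z - dM (e j) (Gam e G i) z
     + Gam e G i z ** Gam e G j z - Gam e G j z ** Gam e G i z"

definition Rc :: "('n::finite \<Rightarrow> 'a::euclidean_space) \<Rightarrow> ('a \<Rightarrow> real^'n^'n) \<Rightarrow> 'a \<Rightarrow> real^'n^'n" where
  "Rc e G z = (\<chi> k j. \<Sum>i\<in>UNIV. Om e G i j z $ i $ k)"

definition Sc :: "('n::finite \<Rightarrow> 'a::euclidean_space) \<Rightarrow> ('a \<Rightarrow> real^'n^'n) \<Rightarrow> 'a \<Rightarrow> real" where
  "Sc e G z = (\<Sum>i\<in>UNIV. \<Sum>j\<in>UNIV. matrix_inv (G z) $ i $ j * Rc e G z $ i $ j)"

section \<open>Connection and curvature matrices of a metric\<close>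

locale metric_frame =
  fixes U :: "'a::euclidean_space set" and e :: "'n::finite \<Rightarrow> 'a" and G :: "'a \<Rightarrow> real^'n^'n"
  assumes open_U: "open U" and smooth_G: "msmooth U G"
    and sym_G: "\<And>z. z \<in> U \<Longrightarrow> transpose (G z) = G z"
    and pos_G: "\<And>z v. z \<in> U \<Longrightarrow> v \<noteq> 0 \<Longrightarrow> v \<bullet> (G z *v v) > 0"
begin

definition "H z = matrix_inv (G z)"
abbreviation "D a \<equiv> dd (e a)"
abbreviation "\<Gamma> \<equiv> Gam e G"
abbreviation "\<Omega> \<equiv> Om e G"
abbreviation "R \<equiv> Rc e G"
abbreviation "S \<equiv> Sc e G"
text \<open>The Ricci tensor with its first index raised. Likewise \<open>K\<close> is the curvature
  with the lower matrix index raised, which turns metric compatibility into antisymmetry of a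
  matrix.\<close>

definition "M z = H z ** R z"
definition "K i j z = \<Omega> i j z ** H z"
text \<open>Christoffel symbols of the first kind, that is, before an index is raised with
  \<open>H\<close>.\<close>

definition "Lam a z = (\<chi> l k. (D a (\<lambda>z. G z $ k $ l) z + D k (\<lambda>z. G z $ a $ l) z - D l (\<lambda>z. G z $ a $ k) z) / 2)"

lemmas mult_simps = matrix_mult_distribs matrix_mul_assoc

lemma GH: assumes "z \<in> U" shows "G z ** H z = mat 1" "H z ** G z = mat 1" "det (G z) \<noteq> 0"
  using posdef_inverse[of "G z"] pos_G[OF assms] by (auto simp: H_def)

lemma G_sym: "z \<in> U \<Longrightarrow> G z $ i $ j = G z $ j $ i"
  using sym_G[of z] by (metis transpose_nth)

lemma H_sym: assumes "z \<in> U" shows "transpose (H z) = H z" "H z $ i $ j = H z $ j $ i"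
proof -
  have "transpose (H z) ** G z = mat 1"
    using arg_cong[OF GH(1)[OF assms], of transpose] sym_G[OF assms] by (simp add: transpose_distribs)
  then have "transpose (H z) ** (G z ** H z) = H z" by (simp add: matrix_mul_assoc)
  then show *: "transpose (H z) = H z" by (simp add: GH assms)
  show "H z $ i $ j = H z $ j $ i" using * by (metis transpose_nth)
qed

lemma smooth_H: "msmooth U H"
  using msmooth_inverse[OF open_U smooth_G pos_G] unfolding H_def[abs_def] .

lemma Gam_eq: "\<Gamma> a z = H z ** Lam a z"
  by (simp add: vec_eq_iff Gam_def Chr_def matrix_mult_nth Lam_def H_def sum_divide_distrib)

lemma smooth_Lam: "msmooth U (Lam a)"
  unfolding msmooth_def Lam_def using open_U smooth_G by (auto intro!: smooth simp: msmoothD)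

lemma smooth_Gam: "msmooth U (\<Gamma> a)"
proof -
  have "\<Gamma> a = (\<lambda>z. H z ** Lam a z)" by (simp add: Gam_eq fun_eq_iff)
  then show ?thesis using smooth_H smooth_Lam open_U by (auto intro!: smooth)
qed

lemma smooth_Om: "msmooth U (\<Omega> i j)"
  unfolding Om_def[abs_def] using smooth_Gam open_U by (auto intro!: smooth)

lemma smooth_Rc: "msmooth U R"
  unfolding msmooth_def Rc_def using open_U smooth_Om by (auto intro!: smooth simp: msmoothD)

lemma smooth_K: "msmooth U (K i j)"
  unfolding K_def[abs_def] using open_U smooth_Om smooth_H by (auto intro!: smooth)

lemma smooth_M: "msmooth U M"
  unfolding M_def[abs_def] using open_U smooth_Rc smooth_H by (auto intro!: smooth)

lemma smooth_Sc: "smooth_on U S"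
  unfolding Sc_def[abs_def] H_def[symmetric] using open_U smooth_Rc smooth_H
  by (auto intro!: smooth simp: msmoothD)

lemma Gam_sym:
  assumes "z \<in> U" shows "\<Gamma> a z $ l $ k = \<Gamma> k z $ l $ a"
proof -
  have "D m (\<lambda>z. G z $ a $ k) z = D m (\<lambda>z. G z $ k $ a) z" for m
    by (rule dd_cong[OF open_U assms]) (rule G_sym)
  then show ?thesis by (simp add: Gam_def Chr_def add.commute)
qed

lemma Lam_plus_transpose:
  assumes "z \<in> U" shows "Lam a z + transpose (Lam a z) = dM (e a) G z"
proof -
  have sym: "D m (\<lambda>z. G z $ p $ q) z = D m (\<lambda>z. G z $ q $ p) z" for m p q
    by (rule dd_cong[OF open_U assms]) (rule G_sym)
  have "(Lam a z + transpose (Lam a z)) $ l $ k = dM (e a) G z $ l $ k" for l k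
    using sym[of a k l] by (simp add: Lam_def dM_nth transpose_nth field_simps)
  then show ?thesis by (simp add: vec_eq_iff)
qed

lemma G_Gam: "z \<in> U \<Longrightarrow> G z ** \<Gamma> a z = Lam a z"
  by (simp add: Gam_eq matrix_mul_assoc GH)

text \<open>Parallelism of the metric in matrix form: the symmetric part of the first-kind symbols
  is half the derivative of \<open>G\<close>.\<close>

lemma dM_G:
  assumes "z \<in> U" shows "dM (e a) G z = transpose (\<Gamma> a z) ** G z + G z ** \<Gamma> a z"
proof -
  have "transpose (\<Gamma> a z) ** G z = transpose (Lam a z)"
    using arg_cong[OF G_Gam[OF assms], of transpose] by (simp add: transpose_distribs sym_G assms)
  then show ?thesis using Lam_plus_transpose[OF assms] G_Gam[OF assms] by (metis add.commute)
qed

lemma dM_H_general: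
  assumes "z \<in> U" shows "dM v H z = - (H z ** dM v G z ** H z)"
proof -
  have "dM v (\<lambda>z. G z ** H z) z = dM v (\<lambda>z. mat 1) z"
    by (rule dM_cong[OF open_U assms]) (simp add: GH)
  then have "dM v G z ** H z + G z ** dM v H z = 0"
    using dM_mult[OF open_U assms smooth_G smooth_H] by simp
  then have "H z ** (dM v G z ** H z + G z ** dM v H z) = 0" by (simp add: matrix_mult_distribs)
  then have "H z ** dM v G z ** H z + dM v H z = 0"
    by (simp only: mult_simps GH(2)[OF assms] matrix_mul_lid)
  then show ?thesis by (simp add: eq_neg_iff_add_eq_0 add.commute)
qed

lemma dM_H:
  assumes "z \<in> U" shows "dM (e a) H z = - (\<Gamma> a z ** H z) - H z ** transpose (\<Gamma> a z)"
proof -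
  have "H z ** (transpose (\<Gamma> a z) ** G z + G z ** \<Gamma> a z) ** H z =
     H z ** transpose (\<Gamma> a z) ** (G z ** H z) + (H z ** G z) ** \<Gamma> a z ** H z"
    by (simp add: mult_simps)
  then show ?thesis unfolding dM_H_general[OF assms] dM_G[OF assms] by (simp add: GH assms)
qed

text \<open>The inverse metric is parallel, so its iterated derivatives in two directions differ by
  the curvature acting on it, \<open>\<Omega> H + H \<Omega>^T\<close>. Derivatives commute, so this
  expression vanishes.\<close>

lemma K_transpose:
  assumes z: "z \<in> U" shows "transpose (K i j z) = - K i j z"
proof -
  have E: "dM (e i) (dM (e j) H) z =
     - (dM (e i) (\<Gamma> j) z ** H z + \<Gamma> j z ** (- (\<Gamma> i z ** H z) - H z ** transpose (\<Gamma> i z)))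
     - ((- (\<Gamma> i z ** H z) - H z ** transpose (\<Gamma> i z)) ** transpose (\<Gamma> j z)
        + H z ** transpose (dM (e i) (\<Gamma> j) z))" for i j
  proof -
    have "dM (e i) (dM (e j) H) z = dM (e i) (\<lambda>z. - (\<Gamma> j z ** H z) - H z ** transpose (\<Gamma> j z)) z"
      by (rule dM_cong[OF open_U z]) (rule dM_H)
    also have "\<dots> = - (dM (e i) (\<Gamma> j) z ** H z + \<Gamma> j z ** dM (e i) H z)
       - (dM (e i) H z ** transpose (\<Gamma> j z) + H z ** transpose (dM (e i) (\<Gamma> j) z))"
      using smooth_H smooth_Gam open_U
      by (simp add: dM_diff[OF open_U z] dM_uminus[OF open_U z] dM_mult[OF open_U z] smooth dM_transpose)
    finally show ?thesis by (simp add: dM_H z)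
  qed
  \<comment> \<open>\<open>P\<close> and \<open>Q\<close> stand for the derivatives of the
    connection matrices, \<open>A\<close> and \<open>B\<close> for the matrices themselves,
    \<open>X\<close> for \<open>H\<close>. The right-hand side is then \<open>E\<close> with the two
    directions exchanged, minus \<open>E\<close>.\<close>
  have alg: "(P - Q + A ** B - B ** A) ** X + X ** transpose (P - Q + A ** B - B ** A) =
     - (Q ** X + A ** (- (B ** X) - X ** transpose B)) - ((- (B ** X) - X ** transpose B) ** transpose A + X ** transpose Q)
     - (- (P ** X + B ** (- (A ** X) - X ** transpose A)) - ((- (A ** X) - X ** transpose A) ** transpose B + X ** transpose P))"
    for P Q A B X :: "real^'n^'n"
    by (simp add: mult_simps transpose_distribs algebra_simps)
  have "\<Omega> i j z ** H z + H z ** transpose (\<Omega> i j z) = 0"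
    unfolding Om_def alg E[symmetric] using dM_commute[OF open_U z smooth_H] by simp
  then have "H z ** transpose (\<Omega> i j z) = - K i j z"
    by (simp add: K_def eq_neg_iff_add_eq_0 add.commute)
  then show ?thesis
    by (simp add: K_def transpose_distribs H_sym z)
qed

lemma K_antisym: "z \<in> U \<Longrightarrow> K i j z $ l $ k = - K i j z $ k $ l"
  using K_transpose[of z i j] by (metis transpose_nth vector_uminus_component)

lemma Om_swap: "\<Omega> j i z = - \<Omega> i j z"
  by (simp add: Om_def)

lemma K_swap: "K j i z = - K i j z"
  by (simp add: K_def Om_swap[of j i] matrix_mult_distribs)

lemma dM_K_add:
  assumes z: "z \<in> U"
  shows "dM (e a) (K i j) z + \<Gamma> a z ** K i j z + K i j z ** transpose (\<Gamma> a z) =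
    (dM (e a) (\<Omega> i j) z + \<Gamma> a z ** \<Omega> i j z - \<Omega> i j z ** \<Gamma> a z) ** H z"
proof -
  have "dM (e a) (K i j) z = dM (e a) (\<Omega> i j) z ** H z + \<Omega> i j z ** dM (e a) H z"
    unfolding K_def[abs_def] by (rule dM_mult[OF open_U z smooth_Om smooth_H])
  then show ?thesis
    by (simp add: dM_H z mult_simps K_def)
qed

text \<open>The exterior covariant derivative of the curvature of a connection vanishes: second
  derivatives of \<Gamma> cancel as directions commute, the remainder by matrix algebra. Covariant
  differentiation concerns the matrix indices here, and passes from \<Omega> to \<open>K\<close>
  because \<open>H\<close> is parallel.\<close>

lemma second_bianchi:
  assumes z: "z \<in> U"
  shows "(dM (e a) (K i j) z + \<Gamma> a z ** K i j z + K i j z ** transpose (\<Gamma> a z)) +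
    (dM (e i) (K j a) z + \<Gamma> i z ** K j a z + K j a z ** transpose (\<Gamma> i z)) +
    (dM (e j) (K a i) z + \<Gamma> j z ** K a i z + K a i z ** transpose (\<Gamma> j z)) = 0"
proof -
  have dOm: "dM (e a) (\<Omega> i j) z = dM (e a) (dM (e i) (\<Gamma> j)) z - dM (e a) (dM (e j) (\<Gamma> i)) z
     + (dM (e a) (\<Gamma> i) z ** \<Gamma> j z + \<Gamma> i z ** dM (e a) (\<Gamma> j) z)
     - (dM (e a) (\<Gamma> j) z ** \<Gamma> i z + \<Gamma> j z ** dM (e a) (\<Gamma> i) z)" for a i j
    unfolding Om_def[abs_def] using smooth_Gam open_U
    by (simp add: dM_diff[OF open_U z] dM_add[OF open_U z] dM_mult[OF open_U z] smooth)
  note c = dM_commute[OF open_U z smooth_Gam]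
  have "(dM (e a) (\<Omega> i j) z + \<Gamma> a z ** \<Omega> i j z - \<Omega> i j z ** \<Gamma> a z) +
    (dM (e i) (\<Omega> j a) z + \<Gamma> i z ** \<Omega> j a z - \<Omega> j a z ** \<Gamma> i z) +
    (dM (e j) (\<Omega> a i) z + \<Gamma> j z ** \<Omega> a i z - \<Omega> a i z ** \<Gamma> j z) = 0"
    unfolding dOm c[of "e i" "e a" j] c[of "e j" "e a" i] c[of "e j" "e i" a]
    unfolding Om_def by (simp add: mult_simps algebra_simps)
  then show ?thesis
    unfolding dM_K_add[OF z] by (simp flip: matrix_mult_distribs(1))
qed

end

section \<open>The contracted Bianchi identity\<close>

lemma sum_antisym_zero:
  fixes f :: "'n::finite \<Rightarrow> 'n \<Rightarrow> real"
  assumes "\<And>i j. f j i = - f i j"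
  shows "(\<Sum>i\<in>UNIV. \<Sum>j\<in>UNIV. f i j) = 0"
proof -
  have "(\<Sum>i\<in>UNIV. \<Sum>j\<in>UNIV. f i j) = (\<Sum>i\<in>UNIV. \<Sum>j\<in>UNIV. f j i)"
    by (rule sum.swap)
  also have "\<dots> = - (\<Sum>i\<in>UNIV. \<Sum>j\<in>UNIV. f i j)"
    by (subst assms) (simp add: sum_negf)
  finally show ?thesis by simp
qed

context metric_frame
begin

lemma M_eq:
  assumes "z \<in> U" shows "M z $ k $ j = (\<Sum>i\<in>UNIV. K i j z $ i $ k)"
proof -
  have "M z $ k $ j = (\<Sum>m\<in>UNIV. \<Sum>i\<in>UNIV. \<Omega> i j z $ i $ m * H z $ m $ k)"
    by (simp add: M_def matrix_mult_nth Rc_def sum_distrib_left H_sym(2)[OF assms, of k] mult.commute)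
  also have "\<dots> = (\<Sum>i\<in>UNIV. \<Sum>m\<in>UNIV. \<Omega> i j z $ i $ m * H z $ m $ k)"
    by (rule sum.swap)
  finally show ?thesis by (simp add: K_def matrix_mult_nth)
qed

lemma M_eq':
  assumes "z \<in> U" shows "(\<Sum>i\<in>UNIV. K j i z $ k $ i) = M z $ k $ j"
proof -
  have "K j i z $ k $ i = K i j z $ i $ k" for i
    using K_antisym[OF assms, of j i k i] by (simp add: K_swap[of i j])
  then show ?thesis by (simp add: M_eq assms)
qed

lemma S_eq:
  assumes "z \<in> U" shows "S z = (\<Sum>j\<in>UNIV. M z $ j $ j)"
proof -
  have "S z = (\<Sum>j\<in>UNIV. \<Sum>i\<in>UNIV. H z $ i $ j * R z $ i $ j)"
    unfolding Sc_def H_def by (rule sum.swap)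
  then show ?thesis by (simp add: M_def matrix_mult_nth H_sym(2)[OF assms])
qed

lemma dd_M:
  assumes z: "z \<in> U"
  shows "dd v (\<lambda>z. M z $ k $ j) z = (\<Sum>i\<in>UNIV. dM v (K i j) z $ i $ k)"
proof -
  have "dd v (\<lambda>z. M z $ k $ j) z = dd v (\<lambda>z. \<Sum>i\<in>UNIV. K i j z $ i $ k) z"
    by (rule dd_cong[OF open_U z]) (rule M_eq)
  then show ?thesis
    by (simp add: dd_sum[OF open_U z] smooth_K msmoothD dM_nth)
qed

lemma dd_S:
  assumes z: "z \<in> U"
  shows "dd v S z = (\<Sum>j\<in>UNIV. dd v (\<lambda>z. M z $ j $ j) z)"
proof -
  have "dd v S z = dd v (\<lambda>z. \<Sum>j\<in>UNIV. M z $ j $ j) z"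
    by (rule dd_cong[OF open_U z]) (rule S_eq)
  then show ?thesis
    by (simp add: dd_sum[OF open_U z] smooth_M msmoothD)
qed

lemma dM_K_antisym:
  assumes z: "z \<in> U" shows "dM v (K i j) z $ l $ k = - dM v (K i j) z $ k $ l"
proof -
  have "dd v (\<lambda>z. K i j z $ l $ k) z = dd v (\<lambda>z. - K i j z $ k $ l) z"
    by (rule dd_cong[OF open_U z]) (rule K_antisym)
  then show ?thesis
    by (simp add: dd_uminus[OF open_U z] smooth_K msmoothD dM_nth)
qed

lemma dM_K_swap:
  assumes z: "z \<in> U" shows "dM v (K j i) z = - dM v (K i j) z"
proof -
  have "dM v (K j i) z = dM v (\<lambda>z. - K i j z) z"
    by (rule dM_cong[OF open_U z]) (rule K_swap)
  then show ?thesis by (simp add: dM_uminus[OF open_U z] smooth_K)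
qed

text \<open>Entry \<open>i, j\<close> of the second Bianchi identity is summed over \<open>i\<close>
  and \<open>j\<close>. Of the nine sums two vanish, as a symmetric pair of indices of \<Gamma>
  meets an antisymmetric pair of \<open>K\<close>; in the others \<open>K\<close> is traced and
  becomes \<open>M\<close> or \<open>S\<close>. The result is that the divergence of Ricci is half
  the differential of \<open>S\<close>, with all Christoffel terms written out.\<close>

theorem contracted_bianchi:
  assumes z: "z \<in> U"
  shows "D a S z + 2 * (\<Sum>i\<in>UNIV. \<Sum>m\<in>UNIV. \<Gamma> a z $ i $ m * M z $ m $ i) =
    2 * (\<Sum>i\<in>UNIV. D i (\<lambda>z. M z $ i $ a) z) + 2 * (\<Sum>i\<in>UNIV. \<Sum>m\<in>UNIV. \<Gamma> i z $ i $ m * M z $ m $ a)"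
proof -
  let ?g = "\<lambda>a. \<Gamma> a z" and ?k = "\<lambda>i j. K i j z"
  have sw: "?k i j $ l $ k = - ?k j i $ l $ k" for i j l k by (simp add: K_swap[of i j])
  have an: "?k i j $ l $ k = - ?k i j $ k $ l" for i j l k by (rule K_antisym[OF z])
  have "0 = (\<Sum>i\<in>UNIV. \<Sum>j\<in>UNIV.
     (dM (e a) (K i j) z $ i $ j + (\<Sum>m\<in>UNIV. ?g a $ i $ m * ?k i j $ m $ j) + (\<Sum>m\<in>UNIV. ?k i j $ i $ m * ?g a $ j $ m)) +
     (dM (e i) (K j a) z $ i $ j + (\<Sum>m\<in>UNIV. ?g i $ i $ m * ?k j a $ m $ j) + (\<Sum>m\<in>UNIV. ?k j a $ i $ m * ?g i $ j $ m)) +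
     (dM (e j) (K a i) z $ i $ j + (\<Sum>m\<in>UNIV. ?g j $ i $ m * ?k a i $ m $ j) + (\<Sum>m\<in>UNIV. ?k a i $ i $ m * ?g j $ j $ m)))"
    (is "0 = (\<Sum>i\<in>UNIV. \<Sum>j\<in>UNIV. ?E i j)")
  proof -
    have "?E i j = 0" for i j
      using arg_cong[OF second_bianchi[OF z, of a i j], of "\<lambda>A. A $ i $ j"]
      by (simp add: matrix_mult_nth transpose_nth)
    then show ?thesis by simp
  qed
  also have "\<dots> = (\<Sum>i\<in>UNIV. \<Sum>j\<in>UNIV. dM (e a) (K i j) z $ i $ j)
     + (\<Sum>i\<in>UNIV. \<Sum>j\<in>UNIV. \<Sum>m\<in>UNIV. ?g a $ i $ m * ?k i j $ m $ j)
     + (\<Sum>i\<in>UNIV. \<Sum>j\<in>UNIV. \<Sum>m\<in>UNIV. ?k i j $ i $ m * ?g a $ j $ m)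
     + (\<Sum>i\<in>UNIV. \<Sum>j\<in>UNIV. dM (e i) (K j a) z $ i $ j)
     + (\<Sum>i\<in>UNIV. \<Sum>j\<in>UNIV. \<Sum>m\<in>UNIV. ?g i $ i $ m * ?k j a $ m $ j)
     + (\<Sum>i\<in>UNIV. \<Sum>j\<in>UNIV. \<Sum>m\<in>UNIV. ?k j a $ i $ m * ?g i $ j $ m)
     + (\<Sum>i\<in>UNIV. \<Sum>j\<in>UNIV. dM (e j) (K a i) z $ i $ j)
     + (\<Sum>i\<in>UNIV. \<Sum>j\<in>UNIV. \<Sum>m\<in>UNIV. ?g j $ i $ m * ?k a i $ m $ j)
     + (\<Sum>i\<in>UNIV. \<Sum>j\<in>UNIV. \<Sum>m\<in>UNIV. ?k a i $ i $ m * ?g j $ j $ m)"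
    by (simp add: sum.distrib)
  also have "(\<Sum>i\<in>UNIV. \<Sum>j\<in>UNIV. dM (e a) (K i j) z $ i $ j) = D a S z"
    by (subst sum.swap) (simp add: dd_S dd_M z)
  also have "(\<Sum>i\<in>UNIV. \<Sum>j\<in>UNIV. \<Sum>m\<in>UNIV. ?g a $ i $ m * ?k i j $ m $ j) =
      (\<Sum>i\<in>UNIV. \<Sum>m\<in>UNIV. ?g a $ i $ m * M z $ m $ i)"
  proof (rule sum.cong[OF refl])
    fix i
    show "(\<Sum>j\<in>UNIV. \<Sum>m\<in>UNIV. ?g a $ i $ m * ?k i j $ m $ j) = (\<Sum>m\<in>UNIV. ?g a $ i $ m * M z $ m $ i)"
      by (subst sum.swap) (simp add: M_eq'[OF z, symmetric] sum_distrib_left)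
  qed
  also have "(\<Sum>i\<in>UNIV. \<Sum>j\<in>UNIV. \<Sum>m\<in>UNIV. ?k i j $ i $ m * ?g a $ j $ m) =
      (\<Sum>i\<in>UNIV. \<Sum>m\<in>UNIV. ?g a $ i $ m * M z $ m $ i)"
  proof -
    have "(\<Sum>i\<in>UNIV. \<Sum>j\<in>UNIV. \<Sum>m\<in>UNIV. ?k i j $ i $ m * ?g a $ j $ m) =
      (\<Sum>j\<in>UNIV. \<Sum>i\<in>UNIV. \<Sum>m\<in>UNIV. ?k i j $ i $ m * ?g a $ j $ m)" by (rule sum.swap)
    also have "\<dots> = (\<Sum>j\<in>UNIV. \<Sum>m\<in>UNIV. \<Sum>i\<in>UNIV. ?k i j $ i $ m * ?g a $ j $ m)"
      by (intro sum.cong[OF refl] sum.swap)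
    also have "\<dots> = (\<Sum>j\<in>UNIV. \<Sum>m\<in>UNIV. ?g a $ j $ m * M z $ m $ j)"
      by (simp add: M_eq z sum_distrib_left mult.commute)
    finally show ?thesis .
  qed
  also have "(\<Sum>i\<in>UNIV. \<Sum>j\<in>UNIV. dM (e i) (K j a) z $ i $ j) = - (\<Sum>i\<in>UNIV. D i (\<lambda>z. M z $ i $ a) z)"
  proof -
    have "dM (e i) (K j a) z $ i $ j = - dM (e i) (K j a) z $ j $ i" for i j
      by (rule dM_K_antisym[OF z])
    then show ?thesis by (simp add: dd_M z sum_negf)
  qed
  also have "(\<Sum>i\<in>UNIV. \<Sum>j\<in>UNIV. \<Sum>m\<in>UNIV. ?g i $ i $ m * ?k j a $ m $ j) =
      - (\<Sum>i\<in>UNIV. \<Sum>m\<in>UNIV. ?g i $ i $ m * M z $ m $ a)"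
  proof -
    have *: "(\<Sum>j\<in>UNIV. ?k j a $ m $ j) = - M z $ m $ a" for m
    proof -
      have "(\<Sum>j\<in>UNIV. ?k j a $ m $ j) = (\<Sum>j\<in>UNIV. - ?k j a $ j $ m)"
        by (rule sum.cong[OF refl]) (rule an)
      then show ?thesis by (simp add: M_eq z sum_negf)
    qed
    have "(\<Sum>j\<in>UNIV. \<Sum>m\<in>UNIV. ?g i $ i $ m * ?k j a $ m $ j) =
        (\<Sum>m\<in>UNIV. ?g i $ i $ m * (\<Sum>j\<in>UNIV. ?k j a $ m $ j))" for i
      by (subst sum.swap) (simp add: sum_distrib_left)
    then show ?thesis by (simp add: * sum_negf)
  qed
  also have "(\<Sum>i\<in>UNIV. \<Sum>j\<in>UNIV. \<Sum>m\<in>UNIV. ?k j a $ i $ m * ?g i $ j $ m) = 0"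
  proof -
    have "(\<Sum>i\<in>UNIV. \<Sum>m\<in>UNIV. ?k j a $ i $ m * ?g i $ j $ m) = 0" for j
      by (rule sum_antisym_zero) (metis an Gam_sym[OF z] mult_minus_left)
    then show ?thesis by (subst sum.swap) simp
  qed
  also have "(\<Sum>i\<in>UNIV. \<Sum>j\<in>UNIV. dM (e j) (K a i) z $ i $ j) = - (\<Sum>i\<in>UNIV. D i (\<lambda>z. M z $ i $ a) z)"
    by (subst sum.swap) (simp add: dd_M z sum_negf dM_K_swap[OF z, of _ a])
  also have "(\<Sum>i\<in>UNIV. \<Sum>j\<in>UNIV. \<Sum>m\<in>UNIV. ?g j $ i $ m * ?k a i $ m $ j) = 0"
  proof -
    have "(\<Sum>j\<in>UNIV. \<Sum>m\<in>UNIV. ?g j $ i $ m * ?k a i $ m $ j) = 0" for i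
      by (rule sum_antisym_zero) (metis an Gam_sym[OF z] mult_minus_right)
    then show ?thesis by simp
  qed
  also have "(\<Sum>i\<in>UNIV. \<Sum>j\<in>UNIV. \<Sum>m\<in>UNIV. ?k a i $ i $ m * ?g j $ j $ m) =
      - (\<Sum>i\<in>UNIV. \<Sum>m\<in>UNIV. ?g i $ i $ m * M z $ m $ a)"
  proof -
    have "(\<Sum>i\<in>UNIV. \<Sum>j\<in>UNIV. \<Sum>m\<in>UNIV. ?k a i $ i $ m * ?g j $ j $ m) =
      (\<Sum>j\<in>UNIV. \<Sum>i\<in>UNIV. \<Sum>m\<in>UNIV. ?k a i $ i $ m * ?g j $ j $ m)" by (rule sum.swap)
    also have "\<dots> = (\<Sum>j\<in>UNIV. \<Sum>m\<in>UNIV. \<Sum>i\<in>UNIV. ?k a i $ i $ m * ?g j $ j $ m)"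
      by (intro sum.cong[OF refl] sum.swap)
    also have "\<dots> = - (\<Sum>j\<in>UNIV. \<Sum>m\<in>UNIV. ?g j $ j $ m * M z $ m $ a)"
      by (simp add: M_eq z sum_distrib_left sum_negf K_swap[of _ a] mult.commute)
    finally show ?thesis .
  qed
  finally show ?thesis by (simp add: algebra_simps)
qed

end

section \<open>Variation of the curvature under the flow\<close>

locale ricci_flow_frame = metric_frame +
  fixes \<tau> :: 'a
  assumes flow: "\<And>z i j. z \<in> U \<Longrightarrow> dd \<tau> (\<lambda>z. G z $ i $ j) z = - 2 * Rc e G z $ i $ j"
begin

lemma dM_flow: "z \<in> U \<Longrightarrow> dM \<tau> G z = - (R z + R z)"
  by (simp add: vec_eq_iff dM_nth flow)

text \<open>Read off from the flow equation: the Ricci matrix is a multiple of the time derivative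
  of the symmetric \<open>G\<close>. This takes the place of the first Bianchi identity.\<close>

lemma R_sym: assumes z: "z \<in> U" shows "transpose (R z) = R z" "R z $ i $ j = R z $ j $ i"
proof -
  have *: "R z $ i $ j = R z $ j $ i" for i j
  proof -
    have "dd \<tau> (\<lambda>z. G z $ i $ j) z = dd \<tau> (\<lambda>z. G z $ j $ i) z"
      by (rule dd_cong[OF open_U z]) (rule G_sym)
    then show ?thesis by (simp add: flow z)
  qed
  then show "R z $ i $ j = R z $ j $ i" .
  show "transpose (R z) = R z" using * by (simp add: vec_eq_iff transpose_nth)
qed

text \<open>The variation of the connection, a tensor, with its last index raised; \<open>A\<close>
  and \<open>B\<close> below are its two traces.\<close>

definition "C j z = dM \<tau> (\<Gamma> j) z ** H z"

lemma smooth_C: "msmooth U (C j)"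
  unfolding C_def[abs_def] using smooth_Gam smooth_H open_U by (auto intro!: smooth)

text \<open>To first order the curvature changes by the exterior covariant derivative of the change
  of the connection; multiplication by the parallel \<open>H\<close> turns this into a statement
  about \<open>C\<close>.\<close>

lemma dM_Om_H:
  assumes z: "z \<in> U"
  shows "dM \<tau> (\<Omega> i j) z ** H z =
    (dM (e i) (C j) z + C j z ** transpose (\<Gamma> i z) + \<Gamma> i z ** C j z) -
    (dM (e j) (C i) z + C i z ** transpose (\<Gamma> j z) + \<Gamma> j z ** C i z)"
proof -
  have dC: "dM (e i) (C j) z = dM \<tau> (dM (e i) (\<Gamma> j)) z ** H z + dM \<tau> (\<Gamma> j) z ** (- (\<Gamma> i z ** H z) - H z ** transpose (\<Gamma> i z))" for i j
    unfolding C_def[abs_def] using smooth_Gam smooth_H open_U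
    by (simp add: dM_mult[OF open_U z] smooth dM_H z dM_commute[OF open_U z smooth_Gam, of "e i"])
  have dOm: "dM \<tau> (\<Omega> i j) z = dM \<tau> (dM (e i) (\<Gamma> j)) z - dM \<tau> (dM (e j) (\<Gamma> i)) z
     + (dM \<tau> (\<Gamma> i) z ** \<Gamma> j z + \<Gamma> i z ** dM \<tau> (\<Gamma> j) z)
     - (dM \<tau> (\<Gamma> j) z ** \<Gamma> i z + \<Gamma> j z ** dM \<tau> (\<Gamma> i) z)"
    unfolding Om_def[abs_def] using smooth_Gam open_U
    by (simp add: dM_diff[OF open_U z] dM_add[OF open_U z] dM_mult[OF open_U z] smooth)
  show ?thesis
    unfolding dC dOm by (simp add: mult_simps C_def algebra_simps)
qed

definition "A i z = (\<Sum>j\<in>UNIV. C j z $ i $ j)"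
definition "B j z = (\<Sum>i\<in>UNIV. C i z $ i $ j)"

text \<open>Tracing both index pairs of \<open>dM_Om_H\<close> leaves the divergence of
  \<open>A\<close> minus that of \<open>B\<close>. The two sums in which \<Gamma> meets an untraced
  \<open>C\<close> cancel by the symmetry of \<Gamma>.\<close>

lemma palatini:
  assumes z: "z \<in> U"
  shows "(\<Sum>i\<in>UNIV. \<Sum>j\<in>UNIV. (dM \<tau> (\<Omega> i j) z ** H z) $ i $ j) =
    (\<Sum>i\<in>UNIV. D i (A i) z) + (\<Sum>i\<in>UNIV. \<Sum>m\<in>UNIV. \<Gamma> i z $ i $ m * A m z)
    - (\<Sum>i\<in>UNIV. D i (B i) z) - (\<Sum>i\<in>UNIV. \<Sum>m\<in>UNIV. \<Gamma> i z $ i $ m * B m z)"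
proof -
  let ?g = "\<lambda>a. \<Gamma> a z" and ?c = "\<lambda>i. C i z"
  have DA: "D i (A i) z = (\<Sum>j\<in>UNIV. dM (e i) (C j) z $ i $ j)" for i
    unfolding A_def[abs_def] by (simp add: dd_sum[OF open_U z] smooth_C msmoothD dM_nth)
  have DB: "D j (B j) z = (\<Sum>i\<in>UNIV. dM (e j) (C i) z $ i $ j)" for j
    unfolding B_def[abs_def] by (simp add: dd_sum[OF open_U z] smooth_C msmoothD dM_nth)
  have "(\<Sum>i\<in>UNIV. \<Sum>j\<in>UNIV. (dM \<tau> (\<Omega> i j) z ** H z) $ i $ j) =
    (\<Sum>i\<in>UNIV. \<Sum>j\<in>UNIV. dM (e i) (C j) z $ i $ j)
    + (\<Sum>i\<in>UNIV. \<Sum>j\<in>UNIV. \<Sum>m\<in>UNIV. ?c j $ i $ m * ?g i $ j $ m)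
    + (\<Sum>i\<in>UNIV. \<Sum>j\<in>UNIV. \<Sum>m\<in>UNIV. ?g i $ i $ m * ?c j $ m $ j)
    - (\<Sum>i\<in>UNIV. \<Sum>j\<in>UNIV. dM (e j) (C i) z $ i $ j)
    - (\<Sum>i\<in>UNIV. \<Sum>j\<in>UNIV. \<Sum>m\<in>UNIV. ?c i $ i $ m * ?g j $ j $ m)
    - (\<Sum>i\<in>UNIV. \<Sum>j\<in>UNIV. \<Sum>m\<in>UNIV. ?g j $ i $ m * ?c i $ m $ j)"
    by (simp add: dM_Om_H z matrix_mult_nth transpose_nth sum.distrib sum_subtractf)
  also have "(\<Sum>i\<in>UNIV. \<Sum>j\<in>UNIV. dM (e i) (C j) z $ i $ j) = (\<Sum>i\<in>UNIV. D i (A i) z)"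
    by (simp add: DA)
  also have "(\<Sum>i\<in>UNIV. \<Sum>j\<in>UNIV. dM (e j) (C i) z $ i $ j) = (\<Sum>i\<in>UNIV. D i (B i) z)"
    by (subst sum.swap) (simp add: DB)
  also have "(\<Sum>i\<in>UNIV. \<Sum>j\<in>UNIV. \<Sum>m\<in>UNIV. ?g i $ i $ m * ?c j $ m $ j) = (\<Sum>i\<in>UNIV. \<Sum>m\<in>UNIV. ?g i $ i $ m * A m z)"
    by (rule sum.cong[OF refl], subst sum.swap) (simp add: A_def sum_distrib_left)
  also have "(\<Sum>i\<in>UNIV. \<Sum>j\<in>UNIV. \<Sum>m\<in>UNIV. ?c i $ i $ m * ?g j $ j $ m) = (\<Sum>i\<in>UNIV. \<Sum>m\<in>UNIV. ?g i $ i $ m * B m z)"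
    by (subst sum.swap, rule sum.cong[OF refl], subst sum.swap) (simp add: B_def sum_distrib_left mult.commute)
  also have "(\<Sum>i\<in>UNIV. \<Sum>j\<in>UNIV. \<Sum>m\<in>UNIV. ?g j $ i $ m * ?c i $ m $ j) =
     (\<Sum>i\<in>UNIV. \<Sum>j\<in>UNIV. \<Sum>m\<in>UNIV. ?c j $ i $ m * ?g i $ j $ m)"
  proof -
    have "(\<Sum>i\<in>UNIV. \<Sum>j\<in>UNIV. \<Sum>m\<in>UNIV. ?c j $ i $ m * ?g i $ j $ m) =
      (\<Sum>j\<in>UNIV. \<Sum>i\<in>UNIV. \<Sum>m\<in>UNIV. ?c j $ i $ m * ?g i $ j $ m)" by (rule sum.swap)
    also have "\<dots> = (\<Sum>j\<in>UNIV. \<Sum>m\<in>UNIV. \<Sum>i\<in>UNIV. ?c j $ i $ m * ?g i $ j $ m)"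
      by (intro sum.cong[OF refl] sum.swap)
    also have "\<dots> = (\<Sum>j\<in>UNIV. \<Sum>m\<in>UNIV. \<Sum>i\<in>UNIV. ?g m $ j $ i * ?c j $ i $ m)"
      by (intro sum.cong[OF refl]) (simp add: Gam_sym[OF z] mult.commute)
    finally show ?thesis by simp
  qed
  finally show ?thesis by simp
qed

lemma dM_tau_Lam:
  assumes z: "z \<in> U"
  shows "dM \<tau> (Lam a) z $ l $ k =
    - (D a (\<lambda>z. R z $ k $ l) z + D k (\<lambda>z. R z $ a $ l) z - D l (\<lambda>z. R z $ a $ k) z)"
proof -
  have *: "dd \<tau> (D m (\<lambda>z. G z $ i $ j)) z = - 2 * D m (\<lambda>z. R z $ i $ j) z" for m i j
  proof -
    have "dd \<tau> (D m (\<lambda>z. G z $ i $ j)) z = D m (dd \<tau> (\<lambda>z. G z $ i $ j)) z"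
      by (rule dd_commute[OF open_U msmoothD[OF smooth_G] z])
    also have "\<dots> = D m (\<lambda>z. - 2 * R z $ i $ j) z"
      by (rule dd_cong[OF open_U z]) (rule flow)
    also have "\<dots> = - 2 * D m (\<lambda>z. R z $ i $ j) z"
      by (rule dd_cmult[OF open_U z msmoothD[OF smooth_Rc]])
    finally show ?thesis .
  qed
  show ?thesis
    using open_U msmoothD[OF smooth_G]
    by (simp add: dM_nth Lam_def dd_divide_const[OF open_U z] dd_diff[OF open_U z] dd_add[OF open_U z] smooth *)
qed

lemma G_dM_tau_Gam:
  assumes z: "z \<in> U"
  shows "G z ** dM \<tau> (\<Gamma> a) z = dM \<tau> (Lam a) z + (R z + R z) ** \<Gamma> a z"
proof -
  have "dM \<tau> (\<lambda>z. G z ** \<Gamma> a z) z = dM \<tau> (Lam a) z"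
    by (rule dM_cong[OF open_U z]) (rule G_Gam)
  then have "- (R z + R z) ** \<Gamma> a z + G z ** dM \<tau> (\<Gamma> a) z = dM \<tau> (Lam a) z"
    by (simp only: dM_mult[OF open_U z smooth_G smooth_Gam] dM_flow[OF z])
  then show ?thesis by (simp only: matrix_mult_distribs(5)) (simp add: algebra_simps)
qed

text \<open>Along the flow, \<open>A\<close> with its index lowered is the differential of
  \<open>S\<close> minus twice the divergence of Ricci, so the contracted Bianchi identity
  annihilates it.\<close>

lemma A_zero:
  assumes z: "z \<in> U" shows "A i z = 0"
proof -
  let ?g = "\<lambda>a. \<Gamma> a z" and ?\<rho> = "\<lambda>a i j. D a (\<lambda>z. R z $ i $ j) z"
  have GA: "(\<Sum>m\<in>UNIV. G z $ l $ m * A m z) = 0" for l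
  proof -
    \<comment> \<open>\<open>?Y\<close> and \<open>?Z\<close> are the two traces of the partial
      derivatives of Ricci, \<open>?W\<close> a Christoffel correction. The facts 1, 2 and 3 express
      \<open>A\<close>, the divergence of \<open>M\<close> and the derivative of \<open>S\<close>
      through them.\<close>
    let ?Y = "\<Sum>j\<in>UNIV. \<Sum>k\<in>UNIV. H z $ k $ j * ?\<rho> j k l"
    let ?Z = "\<Sum>j\<in>UNIV. \<Sum>k\<in>UNIV. H z $ k $ j * ?\<rho> l j k"
    let ?W = "\<Sum>j\<in>UNIV. \<Sum>k\<in>UNIV. H z $ k $ j * (R z ** ?g j) $ l $ k"
    have "(\<Sum>m\<in>UNIV. G z $ l $ m * A m z) = (\<Sum>m\<in>UNIV. \<Sum>j\<in>UNIV. G z $ l $ m * C j z $ m $ j)"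
      by (simp add: A_def sum_distrib_left)
    also have "\<dots> = (\<Sum>j\<in>UNIV. (G z ** C j z) $ l $ j)"
      by (subst sum.swap) (simp add: matrix_mult_nth)
    also have "\<dots> = (\<Sum>j\<in>UNIV. \<Sum>k\<in>UNIV. H z $ k $ j * (G z ** dM \<tau> (\<Gamma> j) z) $ l $ k)"
      unfolding C_def matrix_mul_assoc by (subst matrix_mult_nth) (simp add: mult.commute)
    also have "\<dots> = (\<Sum>j\<in>UNIV. \<Sum>k\<in>UNIV. - (H z $ k $ j * ?\<rho> j k l) - H z $ k $ j * ?\<rho> k j l
        + H z $ k $ j * ?\<rho> l j k + H z $ k $ j * (R z ** ?g j) $ l $ k + H z $ k $ j * (R z ** ?g j) $ l $ k)"
      by (intro sum.cong[OF refl], simp only: G_dM_tau_Gam[OF z] dM_tau_Lam[OF z] matrix_mult_distribs vector_add_component)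
         (simp add: algebra_simps)
    also have "\<dots> = - ?Y - (\<Sum>j\<in>UNIV. \<Sum>k\<in>UNIV. H z $ k $ j * ?\<rho> k j l) + ?Z + 2 * ?W"
      by (simp only: sum.distrib sum_subtractf sum_negf)
    also have "(\<Sum>j\<in>UNIV. \<Sum>k\<in>UNIV. H z $ k $ j * ?\<rho> k j l) = ?Y"
      by (subst sum.swap) (simp add: H_sym(2)[OF z])
    finally have 1: "(\<Sum>m\<in>UNIV. G z $ l $ m * A m z) = - 2 * ?Y + ?Z + 2 * ?W" by simp
    have "D j (\<lambda>z. M z $ j $ l) z = (\<Sum>k\<in>UNIV. H z $ k $ j * ?\<rho> j k l)
        - (\<Sum>m\<in>UNIV. ?g j $ j $ m * M z $ m $ l) - (\<Sum>k\<in>UNIV. H z $ k $ j * (R z ** ?g j) $ l $ k)" for j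
    proof -
      have "D j (\<lambda>z. M z $ j $ l) z = (dM (e j) H z ** R z + H z ** dM (e j) R z) $ j $ l"
        unfolding M_def[abs_def] dM_nth[symmetric] by (simp add: dM_mult[OF open_U z smooth_H smooth_Rc])
      also have "\<dots> = (H z ** dM (e j) R z) $ j $ l - (?g j ** (H z ** R z)) $ j $ l
          - (H z ** transpose (R z ** ?g j)) $ j $ l"
        by (simp add: dM_H z mult_simps transpose_distribs R_sym)
      finally show ?thesis
        by (simp add: matrix_mult_nth[of "H z"] matrix_mult_nth[of "?g j"] dM_nth transpose_nth H_sym(2)[OF z, of j]
            flip: M_def)
    qed
    then have 2: "(\<Sum>j\<in>UNIV. D j (\<lambda>z. M z $ j $ l) z) = ?Y - (\<Sum>j\<in>UNIV. \<Sum>m\<in>UNIV. ?g j $ j $ m * M z $ m $ l) - ?W"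
      by (simp add: sum_subtractf)
    have "D l S z = trace (dM (e l) M z)"
      by (simp add: dd_S z trace_def dM_nth)
    also have "dM (e l) M z = H z ** dM (e l) R z - ?g l ** M z - H z ** transpose (?g l) ** R z"
      unfolding M_def[abs_def] by (simp add: dM_mult[OF open_U z smooth_H smooth_Rc] dM_H z mult_simps)
    also have "trace \<dots> = trace (H z ** dM (e l) R z) - trace (?g l ** M z) - trace (H z ** transpose (?g l) ** R z)"
      by (simp add: trace_sub)
    also have "trace (H z ** transpose (?g l) ** R z) = trace (?g l ** M z)"
    proof -
      have "trace (H z ** transpose (?g l) ** R z) = trace (transpose (H z ** transpose (?g l) ** R z))"
        by (simp add: trace_def transpose_nth)
      also have "\<dots> = trace (R z ** (?g l ** H z))"
        by (simp add: transpose_distribs R_sym H_sym z)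
      also have "\<dots> = trace (?g l ** M z)"
        by (subst trace_mul_sym) (simp add: M_def matrix_mul_assoc)
      finally show ?thesis .
    qed
    also have "trace (?g l ** M z) = (\<Sum>i\<in>UNIV. \<Sum>m\<in>UNIV. ?g l $ i $ m * M z $ m $ i)"
      by (simp add: trace_def matrix_mult_nth)
    also have "trace (H z ** dM (e l) R z) = ?Z"
      by (simp add: trace_def matrix_mult_nth dM_nth H_sym(2)[OF z]) (subst sum.swap, intro sum.cong[OF refl], simp add: H_sym(2)[OF z])
    finally have 3: "D l S z = ?Z - 2 * (\<Sum>i\<in>UNIV. \<Sum>m\<in>UNIV. ?g l $ i $ m * M z $ m $ i)" by simp
    show ?thesis using contracted_bianchi[OF z, of l] 1 2 3 by linarith
  qed
  have "A i z = (\<Sum>m\<in>UNIV. (H z ** G z) $ i $ m * A m z)"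
    by (simp add: GH z mat_def if_distrib[of "\<lambda>x. x * _"] cong: if_cong)
  also have "\<dots> = (\<Sum>m\<in>UNIV. \<Sum>k\<in>UNIV. H z $ i $ k * (G z $ k $ m * A m z))"
    by (simp add: matrix_mult_nth sum_distrib_right mult.assoc)
  also have "\<dots> = (\<Sum>k\<in>UNIV. H z $ i $ k * (\<Sum>m\<in>UNIV. G z $ k $ m * A m z))"
    by (subst sum.swap) (simp add: sum_distrib_left)
  also have "\<dots> = 0" by (simp add: GA)
  finally show ?thesis .
qed

text \<open>Either side is the logarithmic derivative of \<open>sqrt (det G)\<close>; the first-kind
  symbols give it without differentiating a determinant.\<close>

lemma trace_Gam:
  assumes z: "z \<in> U" shows "trace (\<Gamma> k z) = trace (H z ** dM (e k) G z) / 2"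
proof -
  have "trace (H z ** transpose (Lam k z)) = trace (transpose (H z ** transpose (Lam k z)))"
    by (simp add: trace_def transpose_nth)
  also have "\<dots> = trace (H z ** Lam k z)"
    by (simp add: transpose_distribs H_sym z) (rule trace_mul_sym)
  finally have "trace (H z ** (Lam k z + transpose (Lam k z))) = 2 * trace (\<Gamma> k z)"
    by (simp add: matrix_mult_distribs trace_add Gam_eq)
  then show ?thesis by (simp add: Lam_plus_transpose z)
qed

lemma dd_trace:
  assumes "z \<in> U" "msmooth U X"
  shows "dd v (\<lambda>z. trace (X z)) z = trace (dM v X z)"
  unfolding trace_def dM_nth by (rule dd_sum[OF open_U assms(1)]) (rule msmoothD[OF assms(2)])

lemma dM_tau_H: "z \<in> U \<Longrightarrow> dM \<tau> H z = H z ** (R z + R z) ** H z"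
  by (simp add: dM_H_general dM_flow matrix_mult_distribs)

text \<open>Under the flow the volume density decreases at the relative rate \<open>S\<close>;
  differentiated along \<open>e k\<close>, this is the claim.\<close>

lemma dd_tau_trace_Gam:
  assumes z: "z \<in> U" shows "dd \<tau> (\<lambda>z. trace (\<Gamma> k z)) z = - D k S z"
proof -
  have "dd \<tau> (\<lambda>z. trace (\<Gamma> k z)) z = dd \<tau> (\<lambda>z. trace (H z ** dM (e k) G z) / 2) z"
    by (rule dd_cong[OF open_U z]) (rule trace_Gam)
  also have "\<dots> = dd \<tau> (\<lambda>z. trace (H z ** dM (e k) G z)) z / 2"
    by (rule dd_divide_const[OF open_U z]) (unfold trace_def, intro smooth_on_sum open_U msmoothD smooth smooth_H smooth_G)
  also have "dd \<tau> (\<lambda>z. trace (H z ** dM (e k) G z)) z = trace (dM \<tau> (\<lambda>z. H z ** dM (e k) G z) z)"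
    by (rule dd_trace[OF z]) (intro smooth open_U smooth_H smooth_G)
  also have "dM \<tau> (\<lambda>z. H z ** dM (e k) G z) z = H z ** (R z + R z) ** H z ** dM (e k) G z - H z ** (dM (e k) R z + dM (e k) R z)"
  proof -
    have "dM \<tau> (dM (e k) G) z = dM (e k) (dM \<tau> G) z" by (rule dM_commute[OF open_U z smooth_G])
    also have "\<dots> = dM (e k) (\<lambda>z. - (R z + R z)) z" by (rule dM_cong[OF open_U z]) (rule dM_flow)
    also have "\<dots> = - (dM (e k) R z + dM (e k) R z)"
      using open_U smooth_Rc by (simp only: dM_uminus[OF open_U z] dM_add[OF open_U z] smooth)
    finally have "dM \<tau> (dM (e k) G) z = - (dM (e k) R z + dM (e k) R z)" .
    moreover have "dM \<tau> (\<lambda>z. H z ** dM (e k) G z) z = dM \<tau> H z ** dM (e k) G z + H z ** dM \<tau> (dM (e k) G) z"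
      by (rule dM_mult[OF open_U z smooth_H]) (intro smooth open_U smooth_G)
    ultimately show ?thesis by (simp only: dM_tau_H[OF z] matrix_mult_distribs(6)) simp
  qed
  also have "trace \<dots> / 2 = trace (H z ** R z ** H z ** dM (e k) G z) - trace (H z ** dM (e k) R z)"
    by (simp only: matrix_mult_distribs trace_add trace_sub) simp
  also have "trace (H z ** R z ** H z ** dM (e k) G z) = trace (H z ** dM (e k) G z ** H z ** R z)"
    using trace_mul_sym[of "H z ** R z" "H z ** dM (e k) G z"] by (simp add: matrix_mul_assoc)
  finally have *: "dd \<tau> (\<lambda>z. trace (\<Gamma> k z)) z =
    trace (H z ** dM (e k) G z ** H z ** R z) - trace (H z ** dM (e k) R z)" .
  have "D k S z = trace (dM (e k) M z)"
    by (simp add: dd_S z trace_def dM_nth)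
  then have "D k S z = - trace (H z ** dM (e k) G z ** H z ** R z) + trace (H z ** dM (e k) R z)"
    unfolding M_def[abs_def] by (simp add: dM_mult[OF open_U z smooth_H smooth_Rc] dM_H_general z matrix_mult_distribs trace_sub)
  then show ?thesis using * by simp
qed

lemma B_eq:
  assumes z: "z \<in> U" shows "B j z = - (\<Sum>k\<in>UNIV. H z $ j $ k * D k S z)"
proof -
  have "(\<Sum>i\<in>UNIV. dM \<tau> (\<Gamma> i) z $ i $ k) = (\<Sum>i\<in>UNIV. dM \<tau> (\<Gamma> k) z $ i $ i)" for k
    unfolding dM_nth by (intro sum.cong[OF refl] dd_cong[OF open_U z]) (rule Gam_sym)
  then have *: "(\<Sum>i\<in>UNIV. dM \<tau> (\<Gamma> i) z $ i $ k) = - D k S z" for k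
    using dd_tau_trace_Gam[OF z, of k] dd_trace[OF z smooth_Gam, of \<tau> k] by (simp add: trace_def)
  have "B j z = (\<Sum>i\<in>UNIV. \<Sum>k\<in>UNIV. dM \<tau> (\<Gamma> i) z $ i $ k * H z $ k $ j)"
    by (simp add: B_def C_def matrix_mult_nth)
  also have "\<dots> = (\<Sum>k\<in>UNIV. H z $ j $ k * (\<Sum>i\<in>UNIV. dM \<tau> (\<Gamma> i) z $ i $ k))"
    by (subst sum.swap) (simp add: sum_distrib_left H_sym(2)[OF z, of j] mult.commute)
  finally show ?thesis by (simp add: * sum_negf)
qed

text \<open>\<open>S\<close> is the trace of \<open>M = H R\<close>. The derivative of
  \<open>H\<close> produces the square of Ricci; the traced derivative of \<open>R\<close> is, by
  \<open>palatini\<close>, the divergence of \<open>A - B\<close>, where \<open>A\<close> is zero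
  and \<open>B\<close> is minus the gradient of \<open>S\<close>. The last two sums are the
  Laplacian of \<open>S\<close> in coordinates.\<close>

theorem scalar_evolution:
  assumes z: "z \<in> U"
  shows "dd \<tau> S z = 2 * trace (M z ** M z) + (\<Sum>i\<in>UNIV. D i (\<lambda>z. \<Sum>k\<in>UNIV. H z $ i $ k * D k S z) z)
    + (\<Sum>i\<in>UNIV. \<Sum>m\<in>UNIV. \<Gamma> i z $ i $ m * (\<Sum>k\<in>UNIV. H z $ m $ k * D k S z))"
proof -
  have "dd \<tau> S z = trace (dM \<tau> M z)"
    by (simp add: dd_S z trace_def dM_nth)
  also have "dM \<tau> M z = M z ** M z + M z ** M z + H z ** dM \<tau> R z"
    unfolding M_def[abs_def] by (simp only: dM_mult[OF open_U z smooth_H smooth_Rc] dM_tau_H[OF z] mult_simps)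
  also have "trace \<dots> = 2 * trace (M z ** M z) + trace (H z ** dM \<tau> R z)"
    by (simp only: trace_add)
  also have "trace (H z ** dM \<tau> R z) = (\<Sum>i\<in>UNIV. \<Sum>j\<in>UNIV. (dM \<tau> (\<Omega> i j) z ** H z) $ i $ j)"
  proof -
    have dR: "dM \<tau> R z $ m $ j = (\<Sum>i\<in>UNIV. dM \<tau> (\<Omega> i j) z $ i $ m)" for m j
      unfolding dM_nth Rc_def by (simp add: dd_sum[OF open_U z] smooth_Om msmoothD)
    have "trace (H z ** dM \<tau> R z) = (\<Sum>j\<in>UNIV. \<Sum>m\<in>UNIV. \<Sum>i\<in>UNIV. dM \<tau> (\<Omega> i j) z $ i $ m * H z $ m $ j)"
      by (simp add: trace_def matrix_mult_nth dR sum_distrib_left H_sym(2)[OF z] mult.commute)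
    also have "\<dots> = (\<Sum>j\<in>UNIV. \<Sum>i\<in>UNIV. \<Sum>m\<in>UNIV. dM \<tau> (\<Omega> i j) z $ i $ m * H z $ m $ j)"
      by (intro sum.cong[OF refl] sum.swap)
    also have "\<dots> = (\<Sum>i\<in>UNIV. \<Sum>j\<in>UNIV. \<Sum>m\<in>UNIV. dM \<tau> (\<Omega> i j) z $ i $ m * H z $ m $ j)"
      by (rule sum.swap)
    finally show ?thesis by (simp add: matrix_mult_nth)
  qed
  also have "\<dots> = (\<Sum>i\<in>UNIV. D i (\<lambda>z. \<Sum>k\<in>UNIV. H z $ i $ k * D k S z) z)
    + (\<Sum>i\<in>UNIV. \<Sum>m\<in>UNIV. \<Gamma> i z $ i $ m * (\<Sum>k\<in>UNIV. H z $ m $ k * D k S z))"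
  proof -
    have DA: "D i (A i) z = 0" for i
      using dd_cong[OF open_U z, of "A i" "\<lambda>z. 0"] A_zero by simp
    have DB: "D i (B i) z = - D i (\<lambda>z. \<Sum>k\<in>UNIV. H z $ i $ k * D k S z) z" for i
    proof -
      have "D i (B i) z = D i (\<lambda>z. - (\<Sum>k\<in>UNIV. H z $ i $ k * D k S z)) z"
        by (rule dd_cong[OF open_U z]) (rule B_eq)
      also have "\<dots> = - D i (\<lambda>z. \<Sum>k\<in>UNIV. H z $ i $ k * D k S z) z"
        by (rule dd_uminus[OF open_U z]) (intro smooth open_U smooth_Sc msmoothD smooth_H)
      finally show ?thesis .
    qed
    show ?thesis
      unfolding palatini[OF z] DA DB by (simp add: A_zero B_eq z sum_negf)
  qed
  finally show ?thesis by (simp only: add.assoc)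
qed

end

section \<open>Compactly supported integrands\<close>

text \<open>Test fields contain cutoffs with finitely many derivatives, so smoothness is too much to
  ask of the integrands; this class is enough for integration by parts.\<close>

definition C1_on :: "'a::euclidean_space set \<Rightarrow> ('a \<Rightarrow> real) \<Rightarrow> bool" where
  "C1_on U f \<longleftrightarrow> (\<forall>y\<in>U. f differentiable (at y)) \<and> (\<forall>v. continuous_on U (dd v f))"

lemma has_derivative_dd: "f differentiable (at y) \<Longrightarrow> (f has_derivative (\<lambda>v. dd v f y)) (at y)"
  by (simp add: dd_def frechet_derivative_works)

lemma C1_on_has_derivative: "C1_on U f \<Longrightarrow> y \<in> U \<Longrightarrow> (f has_derivative (\<lambda>v. dd v f y)) (at y)"
  by (simp add: C1_on_def has_derivative_dd)

lemma C1_onI: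
  assumes "\<And>y. y \<in> U \<Longrightarrow> (f has_derivative D y) (at y)" "\<And>v. continuous_on U (\<lambda>y. D y v)"
  shows "C1_on U f"
proof -
  have "dd v f y = D y v" if "y \<in> U" for v y
    using dd_eqI[OF assms(1)[OF that]] .
  then have "continuous_on U (dd v f)" for v
    using assms(2)[of v] by (simp cong: continuous_on_cong)
  then show ?thesis using assms(1) by (auto simp: C1_on_def differentiable_def)
qed

lemma C1_on_smooth: "open U \<Longrightarrow> smooth_on U f \<Longrightarrow> C1_on U f"
  by (auto simp: C1_on_def intro: smooth_on_differentiable smooth_on_continuous_on smooth)

lemma C1_on_continuous: "C1_on U f \<Longrightarrow> continuous_on U f"
  by (auto simp: C1_on_def intro: continuous_at_imp_continuous_on differentiable_imp_continuous_within)

lemma C1_on_dd_continuous: "C1_on U f \<Longrightarrow> continuous_on U (dd v f)"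
  by (simp add: C1_on_def)

lemma C1_on_subset: "C1_on U f \<Longrightarrow> V \<subseteq> U \<Longrightarrow> C1_on V f"
  by (auto simp: C1_on_def intro: continuous_on_subset)

lemma dd_cmult_direction:
  assumes "f differentiable (at y)" shows "dd (c *\<^sub>R v) f y = c * dd v f y"
  using linear_cmul[OF has_derivative_linear[OF has_derivative_dd[OF assms]], of c v] by simp

lemma C1_on_mult:
  assumes "C1_on U f" "C1_on U g"
  shows "C1_on U (\<lambda>y. f y * g y)" "y \<in> U \<Longrightarrow> dd v (\<lambda>y. f y * g y) y = f y * dd v g y + dd v f y * g y"
proof -
  have *: "((\<lambda>y. f y * g y) has_derivative (\<lambda>v. f y * dd v g y + dd v f y * g y)) (at y)" if "y \<in> U" for y
    by (intro has_derivative_mult C1_on_has_derivative[OF _ that] assms)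
  show "C1_on U (\<lambda>y. f y * g y)"
    by (rule C1_onI[OF *]) (auto intro!: continuous_intros C1_on_continuous[OF assms(1)] C1_on_continuous[OF assms(2)] C1_on_dd_continuous assms)
  show "y \<in> U \<Longrightarrow> dd v (\<lambda>y. f y * g y) y = f y * dd v g y + dd v f y * g y"
    by (rule dd_eqI[OF *])
qed

lemma C1_on_sum:
  assumes "\<And>i. i \<in> I \<Longrightarrow> C1_on U (f i)"
  shows "C1_on U (\<lambda>y. \<Sum>i\<in>I. f i y)" "y \<in> U \<Longrightarrow> dd v (\<lambda>y. \<Sum>i\<in>I. f i y) y = (\<Sum>i\<in>I. dd v (f i) y)"
proof -
  have *: "((\<lambda>y. \<Sum>i\<in>I. f i y) has_derivative (\<lambda>v. \<Sum>i\<in>I. dd v (f i) y)) (at y)" if "y \<in> U" for y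
    by (intro has_derivative_sum C1_on_has_derivative[OF _ that] assms)
  show "C1_on U (\<lambda>y. \<Sum>i\<in>I. f i y)"
    by (rule C1_onI[OF *]) (auto intro!: continuous_intros C1_on_dd_continuous assms)
  show "y \<in> U \<Longrightarrow> dd v (\<lambda>y. \<Sum>i\<in>I. f i y) y = (\<Sum>i\<in>I. dd v (f i) y)"
    by (rule dd_eqI[OF *])
qed

lemma C1_on_diff:
  assumes "C1_on U f" "C1_on U g"
  shows "C1_on U (\<lambda>y. f y - g y)" "y \<in> U \<Longrightarrow> dd v (\<lambda>y. f y - g y) y = dd v f y - dd v g y"
proof -
  have *: "((\<lambda>y. f y - g y) has_derivative (\<lambda>v. dd v f y - dd v g y)) (at y)" if "y \<in> U" for y
    by (intro has_derivative_diff C1_on_has_derivative[OF _ that] assms)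
  show "C1_on U (\<lambda>y. f y - g y)"
    by (rule C1_onI[OF *]) (auto intro!: continuous_intros C1_on_dd_continuous assms)
  show "y \<in> U \<Longrightarrow> dd v (\<lambda>y. f y - g y) y = dd v f y - dd v g y"
    by (rule dd_eqI[OF *])
qed

lemma C1_on_chain:
  assumes "C1_on U f" and h: "\<And>x. (h has_real_derivative h' x) (at x)" and h': "continuous_on UNIV h'"
  shows "C1_on U (\<lambda>y. h (f y))" "y \<in> U \<Longrightarrow> dd v (\<lambda>y. h (f y)) y = h' (f y) * dd v f y"
proof -
  have *: "((\<lambda>y. h (f y)) has_derivative (\<lambda>v. h' (f y) * dd v f y)) (at y)" if "y \<in> U" for y
    using has_derivative_compose[OF C1_on_has_derivative[OF assms(1) that] h[of "f y", unfolded has_field_derivative_def]]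
    by simp
  show "C1_on U (\<lambda>y. h (f y))"
    by (rule C1_onI[OF *])
       (auto intro!: continuous_intros C1_on_dd_continuous C1_on_continuous[OF assms(1)] continuous_on_compose2[OF h'] assms)
  show "y \<in> U \<Longrightarrow> dd v (\<lambda>y. h (f y)) y = h' (f y) * dd v f y"
    by (rule dd_eqI[OF *])
qed

lemma continuous_on_open_cover2:
  fixes f :: "'a::t2_space \<Rightarrow> 'b::topological_space"
  assumes "open P" "open Q" "S \<subseteq> P \<union> Q" "continuous_on (S \<inter> P) f" "continuous_on (S \<inter> Q) f"
  shows "continuous_on S f"
  unfolding continuous_on_eq_continuous_within
proof
  fix x assume x: "x \<in> S"
  have *: "continuous (at x within S) f" if "x \<in> O'" "open O'" "continuous_on (S \<inter> O') f" for O'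
  proof -
    have "at x within S = at x within (S \<inter> O')"
      by (rule at_within_nhd[OF that(1,2)]) auto
    then show ?thesis using that x by (simp add: continuous_on_eq_continuous_within)
  qed
  show "continuous (at x within S) f" using * assms x by blast
qed

text \<open>Components of a metric are arbitrary outside the chart image. A factor supported in a
  closed part of the image makes the product vanish identically near the rest of the space.\<close>

lemma continuous_on_zero_extend:
  fixes f :: "'s::t2_space \<Rightarrow> 'a::euclidean_space \<Rightarrow> real"
  assumes "open E" "closed K" "K \<subseteq> E" "continuous_on (T \<times> E) (\<lambda>(t, y). f t y)"
    "\<And>t y. t \<in> T \<Longrightarrow> y \<notin> K \<Longrightarrow> f t y = 0"
  shows "continuous_on (T \<times> UNIV) (\<lambda>(t, y). f t y)"
proof (rule continuous_on_open_cover2[where P="UNIV \<times> E" and Q="UNIV \<times> (- K)"])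
  show "continuous_on ((T \<times> UNIV) \<inter> (UNIV \<times> E)) (\<lambda>(t, y). f t y)"
    using assms(4) by (simp add: Times_Int_Times)
  have "continuous_on ((T \<times> UNIV) \<inter> (UNIV \<times> (- K))) (\<lambda>_. 0 :: real)" by simp
  then show "continuous_on ((T \<times> UNIV) \<inter> (UNIV \<times> (- K))) (\<lambda>(t, y). f t y)"
    by (rule continuous_on_eq) (use assms(5) in auto)
qed (use assms in \<open>auto intro!: open_Times\<close>)

lemma continuous_on_zero_extend1:
  fixes f :: "'a::euclidean_space \<Rightarrow> real"
  assumes "open E" "closed K" "K \<subseteq> E" "continuous_on E f" "\<And>y. y \<notin> K \<Longrightarrow> f y = 0"
  shows "continuous_on UNIV f"
  by (rule continuous_on_open_cover2[where P=E and Q="- K"])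
     (use assms in \<open>auto intro: continuous_on_eq[of _ "\<lambda>_. 0"]\<close>)

lemma dd_zero_outside:
  assumes "closed K" "\<And>y. y \<notin> K \<Longrightarrow> w y = 0" "y \<notin> K"
  shows "dd v w y = 0"
  using dd_cong[of "- K" y w "\<lambda>_. 0"] assms by auto

lemma C1_zero_extend:
  assumes "open E" "closed K" "K \<subseteq> E" "C1_on E w" "\<And>y. y \<notin> K \<Longrightarrow> w y = 0"
  shows "C1_on UNIV w"
  unfolding C1_on_def
proof (intro conjI allI ballI)
  fix y
  show "w differentiable (at y)"
  proof (cases "y \<in> E")
    case False
    then have "y \<in> - K" using assms(3) by auto
    have "(w has_derivative (\<lambda>_. 0)) (at y)"
      by (rule has_derivative_transform_within_open[OF has_derivative_const[of 0], where s="- K"])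
         (use assms \<open>y \<in> - K\<close> in auto)
    then show ?thesis by (rule differentiableI)
  qed (use assms in \<open>auto simp: C1_on_def\<close>)
next
  fix v
  show "continuous_on UNIV (dd v w)"
    by (rule continuous_on_zero_extend1[OF assms(1-3)])
       (use assms in \<open>auto intro: dd_zero_outside C1_on_dd_continuous\<close>)
qed

lemma integrable_compact_support:
  fixes f :: "'a::euclidean_space \<Rightarrow> real"
  assumes "continuous_on UNIV f" "compact K" "\<And>y. y \<notin> K \<Longrightarrow> f y = 0"
  shows "integrable lborel f"
proof -
  have "integrable lborel (\<lambda>x. indicator K x *\<^sub>R f x)"
    by (rule borel_integrable_compact) (use assms in \<open>auto intro: continuous_on_subset\<close>)
  moreover have "(\<lambda>x. indicator K x *\<^sub>R f x) = f"
    using assms(3) by (auto simp: indicator_def fun_eq_iff)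
  ultimately show ?thesis by simp
qed

lemma integral_cbox_compact_support:
  fixes f :: "'a::euclidean_space \<Rightarrow> real"
  assumes "continuous_on UNIV f" "compact K" "\<And>y. y \<notin> K \<Longrightarrow> f y = 0" "K \<subseteq> cbox a b"
  shows "(LINT y|lborel. f y) = integral (cbox a b) f"
proof -
  have "(LINT y|lborel. f y) = integral UNIV f"
    by (rule integral_lborel[symmetric]) (rule integrable_compact_support[OF assms(1-3)])
  also have "\<dots> = integral UNIV (\<lambda>y. if y \<in> cbox a b then f y else 0)"
    by (rule arg_cong[where f="integral UNIV"], rule ext) (use assms in auto)
  finally show ?thesis by (simp add: integral_restrict_UNIV)
qed

lemma continuous_on_slice:
  assumes "continuous_on (T \<times> V) (\<lambda>(t, y). f t y)" "t \<in> T"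
  shows "continuous_on V (f t)"
proof -
  have "continuous_on V (\<lambda>y. (\<lambda>(t, y). f t y) (t, y))"
    by (rule continuous_on_compose2[OF assms(1)]) (use assms(2) in \<open>auto intro!: continuous_intros\<close>)
  then show ?thesis by simp
qed

text \<open>Compact support reduces the integral over the whole space to one over a fixed box.
  Derivatives are taken within \<open>T\<close>, so that the end points of a time interval are
  covered.\<close>

lemma leibniz_lborel:
  fixes f f' :: "real \<Rightarrow> 'a::euclidean_space \<Rightarrow> real"
  assumes E: "open E" "compact K" "K \<subseteq> E" and T: "convex T" "t \<in> T"
    and cont: "continuous_on (T \<times> E) (\<lambda>(t, y). f t y)" "continuous_on (T \<times> E) (\<lambda>(t, y). f' t y)"
    and zero: "\<And>t y. t \<in> T \<Longrightarrow> y \<notin> K \<Longrightarrow> f t y = 0" "\<And>t y. t \<in> T \<Longrightarrow> y \<notin> K \<Longrightarrow> f' t y = 0"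
    and deriv: "\<And>t y. t \<in> T \<Longrightarrow> y \<in> K \<Longrightarrow> ((\<lambda>t. f t y) has_real_derivative f' t y) (at t within T)"
  shows "((\<lambda>t. LINT y|lborel. f t y) has_real_derivative (LINT y|lborel. f' t y)) (at t within T)"
proof -
  have closedK: "closed K" using E by (simp add: compact_imp_closed)
  obtain a b where ab: "K \<subseteq> cbox a b"
    using bounded_subset_cbox_symmetric[OF compact_imp_bounded[OF E(2)]] by metis
  note c = continuous_on_zero_extend[OF E(1) closedK E(3)]
  have c1: "continuous_on (T \<times> UNIV) (\<lambda>(t, y). f t y)" by (rule c[OF cont(1)]) (use zero in auto)
  have c2: "continuous_on (T \<times> UNIV) (\<lambda>(t, y). f' t y)" by (rule c[OF cont(2)]) (use zero in auto)
  have eq: "(LINT y|lborel. f t y) = integral (cbox a b) (f t)" if "t \<in> T" for t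
    by (rule integral_cbox_compact_support[OF continuous_on_slice[OF c1 that] E(2) _ ab]) (use zero that in auto)
  have eq': "(LINT y|lborel. f' t y) = integral (cbox a b) (f' t)" if "t \<in> T" for t
    by (rule integral_cbox_compact_support[OF continuous_on_slice[OF c2 that] E(2) _ ab]) (use zero that in auto)
  have "((\<lambda>t. integral (cbox a b) (f t)) has_real_derivative integral (cbox a b) (f' t)) (at t within T)"
  proof (rule leibniz_rule_field_derivative)
    fix t y assume ty: "t \<in> T" "y \<in> cbox a b"
    show "((\<lambda>t. f t y) has_real_derivative f' t y) (at t within T)"
    proof (cases "y \<in> K")
      case False
      then have "((\<lambda>t. f t y) has_real_derivative 0) (at t within T)"
        by (intro has_field_derivative_transform_within[OF DERIV_const[of 0] zero_less_one]) (use zero ty in auto)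
      then show ?thesis using False zero ty by simp
    qed (use deriv ty in auto)
  next
    show "f t integrable_on cbox a b" if "t \<in> T" for t
      by (rule integrable_continuous) (use continuous_on_slice[OF c1 that] in \<open>auto intro: continuous_on_subset\<close>)
    show "continuous_on (T \<times> cbox a b) (\<lambda>(t, y). f' t y)"
      by (rule continuous_on_subset[OF c2]) auto
  qed (use T in auto)
  then show ?thesis
    unfolding eq'[OF T(2)] by (rule has_field_derivative_transform_within[OF _ zero_less_one]) (use T eq in auto)
qed

lemma continuous_on_lborel_param:
  fixes f :: "real \<Rightarrow> 'a::euclidean_space \<Rightarrow> real"
  assumes E: "open E" "compact K" "K \<subseteq> E"
    and cont: "continuous_on (T \<times> E) (\<lambda>(t, y). f t y)"
    and zero: "\<And>t y. t \<in> T \<Longrightarrow> y \<notin> K \<Longrightarrow> f t y = 0"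
  shows "continuous_on T (\<lambda>t. LINT y|lborel. f t y)"
proof -
  have closedK: "closed K" using E by (simp add: compact_imp_closed)
  obtain a b where ab: "K \<subseteq> cbox a b"
    using bounded_subset_cbox_symmetric[OF compact_imp_bounded[OF E(2)]] by metis
  have c1: "continuous_on (T \<times> UNIV) (\<lambda>(t, y). f t y)"
    by (rule continuous_on_zero_extend[OF E(1) closedK E(3) cont]) (use zero in auto)
  have eq: "(LINT y|lborel. f t y) = integral (cbox a b) (f t)" if "t \<in> T" for t
    by (rule integral_cbox_compact_support[OF continuous_on_slice[OF c1 that] E(2) _ ab]) (use zero that in auto)
  have "continuous_on T (\<lambda>t. integral (cbox a b) (f t))"
    by (rule integral_continuous_on_param) (rule continuous_on_subset[OF c1], auto)
  then show ?thesis using eq by (simp cong: continuous_on_cong)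
qed

text \<open>By translation invariance the integral of \<open>w (y + s *\<^sub>R v)\<close> does not
  depend on \<open>s\<close>; differentiation under the integral at \<open>s = 0\<close> gives the
  claim.\<close>

lemma integral_dd_zero:
  fixes w :: "'a::euclidean_space \<Rightarrow> real"
  assumes "open E" "compact K" "K \<subseteq> E" "C1_on E w" "\<And>y. y \<notin> K \<Longrightarrow> w y = 0"
  shows "(LINT y|lborel. dd v w y) = 0"
proof -
  have closedK: "closed K" using assms by (simp add: compact_imp_closed)
  have C1: "C1_on UNIV w" by (rule C1_zero_extend[OF assms(1) closedK assms(3-5)])
  \<comment> \<open>Contains the supports of all translates by \<open>s *\<^sub>R v\<close> with
    \<open>s\<close> between -1 and 1.\<close>
  define K' where "K' = (\<lambda>(s, y). y - s *\<^sub>R v) ` ({-1..1::real} \<times> K)"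
  have "compact K'" unfolding K'_def
    by (intro compact_continuous_image compact_Times assms(2))
       (auto simp: case_prod_unfold intro!: continuous_intros)
  have K': "y + s *\<^sub>R v \<notin> K" if "s \<in> {-1..1}" "y \<notin> K'" for s y
  proof
    assume "y + s *\<^sub>R v \<in> K"
    then have "(s, y + s *\<^sub>R v) \<in> {-1..1} \<times> K" using that by auto
    then have "(\<lambda>(s, y). y - s *\<^sub>R v) (s, y + s *\<^sub>R v) \<in> K'" unfolding K'_def by (rule imageI)
    then show False using that by simp
  qed
  have "((\<lambda>s. LINT y|lborel. w (y + s *\<^sub>R v)) has_real_derivative (LINT y|lborel. dd v w (y + 0 *\<^sub>R v))) (at 0 within {-1..1})"
  proof (rule leibniz_lborel[OF open_UNIV \<open>compact K'\<close>])
    show "continuous_on ({-1..1} \<times> UNIV) (\<lambda>(s, y). w (y + s *\<^sub>R v))"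
      unfolding case_prod_unfold by (rule continuous_on_compose2[OF C1_on_continuous[OF C1]]) (auto intro!: continuous_intros)
    show "continuous_on ({-1..1} \<times> UNIV) (\<lambda>(s, y). dd v w (y + s *\<^sub>R v))"
      unfolding case_prod_unfold by (rule continuous_on_compose2[OF C1_on_dd_continuous[OF C1]]) (auto intro!: continuous_intros)
    fix s :: real and y assume s: "s \<in> {-1..1}"
    { assume "y \<notin> K'"
      then show "w (y + s *\<^sub>R v) = 0" "dd v w (y + s *\<^sub>R v) = 0"
        using K'[OF s] assms(5) dd_zero_outside[OF closedK assms(5)] by auto }
    have "((\<lambda>s. w (y + s *\<^sub>R v)) has_derivative (\<lambda>h. dd (h *\<^sub>R v) w (y + s *\<^sub>R v))) (at s)"
      by (rule has_derivative_compose[of "\<lambda>s. y + s *\<^sub>R v" "\<lambda>h. h *\<^sub>R v", OF _ C1_on_has_derivative[OF C1 UNIV_I]])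
         (auto intro!: derivative_eq_intros)
    moreover have "dd (h *\<^sub>R v) w (y + s *\<^sub>R v) = dd v w (y + s *\<^sub>R v) * h" for h
      using C1 by (subst dd_cmult_direction) (auto simp: C1_on_def)
    ultimately show "((\<lambda>s. w (y + s *\<^sub>R v)) has_real_derivative dd v w (y + s *\<^sub>R v)) (at s within {-1..1})"
      unfolding has_field_derivative_def by (simp add: has_derivative_at_withinI)
  qed auto
  note deriv = this
  have const: "(LINT y|lborel. w (y + s *\<^sub>R v)) = (LINT y|lborel. w y)" for s
  proof -
    have "(LINT y|lborel. w y) = (LINT y|distr lborel borel ((+) (s *\<^sub>R v)). w y)"
      by (simp add: lborel_distr_plus)
    also have "\<dots> = (LINT y|lborel. w (s *\<^sub>R v + y))"
      by (rule integral_distr) (use C1_on_continuous[OF C1] in \<open>auto intro!: borel_measurable_continuous_onI\<close>)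
    finally show ?thesis by (simp add: add.commute)
  qed
  have "at 0 within {-1..1::real} = at 0"
    by (rule at_within_interior) simp
  then have "((\<lambda>s::real. LINT y|lborel. w y) has_real_derivative (LINT y|lborel. dd v w y)) (at 0)"
    using deriv unfolding const by simp
  then show ?thesis by (rule DERIV_unique[OF _ DERIV_const])
qed

section \<open>Cutoff functions\<close>

lemma DERIV_pos_part_power:
  assumes "k \<ge> 2"
  shows "((\<lambda>x. (max 0 x) ^ k) has_real_derivative real k * (max 0 x) ^ (k - 1)) (at x)"
proof -
  consider "x < 0" | "x = 0" | "x > 0" by linarith
  then show ?thesis
  proof cases
    case 1
    have "((\<lambda>x. (max 0 x) ^ k) has_real_derivative 0) (at x)"
      by (rule DERIV_cong_ev[THEN iffD2, OF refl _ refl DERIV_const[of 0]])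
         (use 1 assms in \<open>auto intro!: eventually_mono[OF eventually_nhds_in_open[of "{..<0}"]]\<close>)
    then show ?thesis using 1 assms by (simp add: zero_power)
  next
    case 3
    have "((\<lambda>x. x ^ k) has_real_derivative real k * x ^ (k - 1)) (at x)"
      by (auto intro!: derivative_eq_intros)
    then have "((\<lambda>x. (max 0 x) ^ k) has_real_derivative real k * x ^ (k - 1)) (at x)"
      by (rule has_field_derivative_transform_within_open[where S="{0<..}"]) (use 3 in auto)
    then show ?thesis using 3 by simp
  next
    case 2
    have "\<bar>(max 0 h) ^ k / h\<bar> \<le> \<bar>h\<bar>" if "\<bar>h\<bar> < 1" "h \<noteq> 0" for h :: real
    proof (cases "h > 0")
      case True
      have "h ^ k \<le> h ^ 2" using True that assms by (intro power_decreasing) auto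
      then show ?thesis using True by (simp add: field_simps power2_eq_square)
    qed (use assms in \<open>auto simp: power_0_left\<close>)
    then have "\<forall>\<^sub>F h in at 0. norm ((max 0 h) ^ k / h :: real) \<le> \<bar>h\<bar>"
      unfolding eventually_at by (intro exI[of _ 1]) (simp add: dist_norm)
    moreover have "((\<lambda>h::real. \<bar>h\<bar>) \<longlongrightarrow> 0) (at 0)"
      by (rule tendsto_rabs_zero[OF tendsto_ident_at])
    ultimately have "((\<lambda>h::real. (max 0 h) ^ k / h) \<longlongrightarrow> 0) (at 0)"
      by (rule Lim_null_comparison)
    then show ?thesis using 2 assms by (simp add: DERIV_def power_0_left)
  qed
qed

text \<open>The quintic smoothstep on \<open>[1, 2]\<close>, written with truncated powers so that it and its
  first two derivatives are given by one formula on the whole line.\<close>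

definition step :: "real \<Rightarrow> real" where
  "step u = (let a = max 0 (u - 1); b = max 0 (u - 2) in
     10 * a ^ 3 - 15 * a ^ 4 + 6 * a ^ 5 - (10 * b ^ 3 + 15 * b ^ 4 + 6 * b ^ 5))"

definition step1 :: "real \<Rightarrow> real" where
  "step1 u = (let a = max 0 (u - 1); b = max 0 (u - 2) in
     30 * a ^ 2 - 60 * a ^ 3 + 30 * a ^ 4 - (30 * b ^ 2 + 60 * b ^ 3 + 30 * b ^ 4))"

definition step2 :: "real \<Rightarrow> real" where
  "step2 u = (let a = max 0 (u - 1); b = max 0 (u - 2) in
     60 * a - 180 * a ^ 2 + 120 * a ^ 3 - (60 * b + 180 * b ^ 2 + 120 * b ^ 3))"

lemma DERIV_pos_part_shift:
  assumes "k \<ge> 2"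
  shows "((\<lambda>u. (max 0 (u - c)) ^ k) has_real_derivative real k * (max 0 (u - c)) ^ (k - 1)) (at u)"
proof -
  have "((\<lambda>u. u - c) has_real_derivative 1) (at u)" by (auto intro!: derivative_eq_intros)
  from DERIV_chain2[where f="\<lambda>x. (max 0 x) ^ k", OF DERIV_pos_part_power[OF assms] this]
  show ?thesis by simp
qed

lemma DERIV_step: "(step has_real_derivative step1 u) (at u)"
  unfolding step_def[abs_def] step1_def Let_def
  by (rule derivative_eq_intros DERIV_pos_part_shift refl | simp)+

lemma DERIV_step1: "(step1 has_real_derivative step2 u) (at u)"
  unfolding step1_def[abs_def] step2_def Let_def
  by (rule derivative_eq_intros DERIV_pos_part_shift refl | simp)+

lemma continuous_on_step: "continuous_on UNIV step" "continuous_on UNIV step1" "continuous_on UNIV step2"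
  unfolding step_def step1_def step2_def Let_def by (auto intro!: continuous_intros)

lemma step_le_1: "u \<le> 1 \<Longrightarrow> step u = 0" "u \<le> 1 \<Longrightarrow> step1 u = 0" "u \<le> 1 \<Longrightarrow> step2 u = 0"
  by (auto simp: step_def step1_def step2_def Let_def max_def)

text \<open>With \<open>a = b + 1\<close> one has
  \<open>10 a^3 - 15 a^4 + 6 a^5 = 1 + 10 b^3 + 15 b^4 + 6 b^5\<close>; this is why the same
  coefficients recur in \<open>b\<close>, all with one sign.\<close>

lemma step_ge_2: assumes "u \<ge> 2" shows "step u = 1" "step1 u = 0" "step2 u = 0"
proof -
  obtain b where u: "u = b + 2" "b \<ge> 0" using assms by (metis add.commute diff_add_cancel diff_ge_0_iff_ge)
  show "step u = 1" "step1 u = 0" "step2 u = 0"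
    using u(2) unfolding u(1) step_def step1_def step2_def Let_def
    by (simp_all add: max_def algebra_simps power2_eq_square power3_eq_cube power4_eq_xxxx eval_nat_numeral)
qed

lemma step1_nonneg: "step1 u \<ge> 0"
proof (cases "u \<ge> 2")
  case False
  define a where "a = max 0 (u - 1)"
  have "step1 u = 30 * (a * (1 - a))\<^sup>2"
    using False by (simp add: step1_def Let_def a_def[symmetric] max_def[of 0 "u - 2"] algebra_simps power2_eq_square power3_eq_cube power4_eq_xxxx)
  then show ?thesis by simp
qed (simp add: step_ge_2)

lemma step_mono: "u \<le> v \<Longrightarrow> step u \<le> step v"
  using DERIV_nonneg_imp_nondecreasing[of u v step] DERIV_step step1_nonneg by blast

lemma step_bounds: "0 \<le> step u" "step u \<le> 1"
  using step_mono[of "min u 1" u] step_mono[of u "max u 2"] by (auto simp: step_le_1 step_ge_2)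

lemma step_derivs_bounded: obtains B where "B > 0" "\<And>u. \<bar>step1 u\<bar> \<le> B" "\<And>u. \<bar>step2 u\<bar> \<le> B"
proof -
  have "bounded (step1 ` {1..2})" "bounded (step2 ` {1..2})"
    using continuous_on_step by (auto intro!: compact_imp_bounded compact_continuous_image intro: continuous_on_subset)
  then obtain B1 B2 where B: "\<And>u. u \<in> {1..2} \<Longrightarrow> \<bar>step1 u\<bar> \<le> B1" "\<And>u. u \<in> {1..2} \<Longrightarrow> \<bar>step2 u\<bar> \<le> B2"
    unfolding bounded_iff by fastforce
  have "\<bar>step1 u\<bar> \<le> max 1 (max B1 B2)" "\<bar>step2 u\<bar> \<le> max 1 (max B1 B2)" for u
    using B[of u] step_le_1[of u] step_ge_2[of u] by (cases "u \<le> 1"; cases "u \<ge> 2"; force)+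
  then show ?thesis using that[of "max 1 (max B1 B2)"] by auto
qed

section \<open>Measurability of derivatives\<close>

text \<open>The components of a field are unconstrained outside the image of the chart, but the
  integrand of the flux has to be measurable on the whole space. Fortunately the
  differentiability set of an arbitrary function is a Borel set, on which the
  derivative is Borel measurable.\<close>

context
  fixes f :: "'a::euclidean_space \<Rightarrow> real"
begin

text \<open>Two nearby points \<open>u\<close> and \<open>v\<close> are compared with each other
  rather than with \<open>y\<close>. The value \<open>f y\<close> then does not occur, and the set
  is closed for an arbitrary \<open>f\<close>.\<close>

definition near_linear :: "real \<Rightarrow> real \<Rightarrow> 'a \<Rightarrow> 'a set" where
  "near_linear \<epsilon> d l = {y. \<forall>u v. dist u y < d \<longrightarrow> dist v y < d \<longrightarrow>
     \<bar>f u - f v - l \<bullet> (u - v)\<bar> \<le> \<epsilon> * (dist u y + dist v y)}"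

lemma closed_near_linear: "closed (near_linear \<epsilon> d l)"
  unfolding closed_sequential_limits
proof (intro allI impI, elim conjE)
  fix x y assume x: "\<forall>n. x n \<in> near_linear \<epsilon> d l" and lim: "x \<longlonglongrightarrow> y"
  show "y \<in> near_linear \<epsilon> d l"
    unfolding near_linear_def mem_Collect_eq
  proof (intro allI impI)
    fix u v assume uv: "dist u y < d" "dist v y < d"
    have lu: "(\<lambda>n. dist u (x n)) \<longlonglongrightarrow> dist u y" and lv: "(\<lambda>n. dist v (x n)) \<longlonglongrightarrow> dist v y"
      by (auto intro!: tendsto_intros lim)
    have ev: "eventually (\<lambda>n. \<bar>f u - f v - l \<bullet> (u - v)\<bar> \<le> \<epsilon> * (dist u (x n) + dist v (x n))) sequentially"
      using order_tendstoD(2)[OF lu uv(1)] order_tendstoD(2)[OF lv uv(2)]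
    proof eventually_elim
      case (elim n)
      then show ?case using x[rule_format, of n] unfolding near_linear_def by blast
    qed
    have "(\<lambda>n. \<epsilon> * (dist u (x n) + dist v (x n))) \<longlonglongrightarrow> \<epsilon> * (dist u y + dist v y)"
      by (auto intro!: tendsto_intros lu lv)
    then show "\<bar>f u - f v - l \<bullet> (u - v)\<bar> \<le> \<epsilon> * (dist u y + dist v y)"
      by (rule tendsto_lowerbound[OF _ ev]) simp
  qed
qed

text \<open>Half of \<epsilon> absorbs the error of differentiability, the other half the distance
  of \<open>l\<close> from the gradient; hence slopes from a countable dense set are enough.\<close>

lemma near_linear_of_derivative:
  assumes g: "(f has_derivative (\<lambda>u. g \<bullet> u)) (at y)" and "\<epsilon> > 0" "norm (l - g) \<le> \<epsilon> / 2"
  shows "\<exists>n. y \<in> near_linear \<epsilon> (1 / real (Suc n)) l"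
proof -
  obtain d where d: "d > 0" "\<And>u. norm (u - y) < d \<Longrightarrow> norm (f u - f y - g \<bullet> (u - y)) \<le> \<epsilon> / 2 * norm (u - y)"
    using g assms(2) unfolding has_derivative_at_alt by (metis half_gt_zero)
  obtain n where n: "1 / real (Suc n) < d"
    using reals_Archimedean[OF d(1)] by (auto simp: inverse_eq_divide)
  have "y \<in> near_linear \<epsilon> (1 / real (Suc n)) l"
    unfolding near_linear_def mem_Collect_eq
  proof (intro allI impI)
    fix u v assume uv: "dist u y < 1 / real (Suc n)" "dist v y < 1 / real (Suc n)"
    have 1: "\<bar>f u - f y - g \<bullet> (u - y)\<bar> \<le> \<epsilon> / 2 * dist u y" "\<bar>f v - f y - g \<bullet> (v - y)\<bar> \<le> \<epsilon> / 2 * dist v y"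
      using d(2)[of u] d(2)[of v] uv n by (auto simp: dist_norm)
    have "\<bar>(l - g) \<bullet> (u - v)\<bar> \<le> norm (l - g) * norm (u - v)"
      by (rule Cauchy_Schwarz_ineq2)
    also have "\<dots> \<le> \<epsilon> / 2 * (dist u y + dist v y)"
      using assms(2,3) by (intro mult_mono) (auto simp: dist_norm[symmetric] dist_triangle2)
    finally have 2: "\<bar>(l - g) \<bullet> (u - v)\<bar> \<le> \<epsilon> / 2 * (dist u y + dist v y)" .
    have eq: "f u - f v - l \<bullet> (u - v) = (f u - f y - g \<bullet> (u - y)) - (f v - f y - g \<bullet> (v - y)) - (l - g) \<bullet> (u - v)"
      by (simp add: algebra_simps inner_diff)
    have "\<bar>f u - f v - l \<bullet> (u - v)\<bar> \<le> \<epsilon> / 2 * dist u y + \<epsilon> / 2 * dist v y + \<epsilon> / 2 * (dist u y + dist v y)"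
      unfolding eq using 1 2 by linarith
    then show "\<bar>f u - f v - l \<bullet> (u - v)\<bar> \<le> \<epsilon> * (dist u y + dist v y)"
      by (simp add: field_simps)
  qed
  then show ?thesis by blast
qed

text \<open>Approximate slopes of different accuracy agree up to the sum of their errors, so they
  form a Cauchy sequence. Its limit is the gradient and inherits the bound in direction
  \<open>w\<close>.\<close>

lemma derivative_of_near_linear:
  assumes nl: "\<And>k. y \<in> near_linear (1 / real (Suc k)) (d k) (l k)" and d: "\<And>k. d k > 0"
    and c: "\<And>k. l k \<bullet> w \<le> c + 1 / real (Suc k)"
  shows "\<exists>g. (f has_derivative (\<lambda>u. g \<bullet> u)) (at y) \<and> g \<bullet> w \<le> c"
proof -
  have bd: "\<bar>f u - f y - l k \<bullet> (u - y)\<bar> \<le> 1 / real (Suc k) * dist u y" if "dist u y < d k" for u k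
    using nl[of k, unfolded near_linear_def mem_Collect_eq, rule_format, of u y] that d[of k] by simp
  have diff: "norm (l k - l m) \<le> 1 / real (Suc k) + 1 / real (Suc m)" for k m
  proof (cases "l k = l m")
    case False
    \<comment> \<open>Both approximations are tested at a point displaced from \<open>y\<close>
      along the difference of the slopes, where they disagree most.\<close>
    define p where "p = l k - l m"
    define s where "s = min (d k) (d m) / (2 * norm p)"
    have np: "norm p > 0" using False by (simp add: p_def)
    have s: "s > 0" using np d by (simp add: s_def)
    have "s * norm p = min (d k) (d m) / 2" using np by (simp add: s_def)
    then have sm: "s * norm p < d k" "s * norm p < d m" using d[of k] d[of m] by auto
    have dist: "dist (y + s *\<^sub>R p) y = s * norm p" using s by (simp add: dist_norm)
    have "s * (norm p)\<^sup>2 = p \<bullet> (s *\<^sub>R p)" by (simp add: power2_norm_eq_inner)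
    also have "\<dots> \<le> \<bar>f (y + s *\<^sub>R p) - f y - l k \<bullet> (s *\<^sub>R p)\<bar> + \<bar>f (y + s *\<^sub>R p) - f y - l m \<bullet> (s *\<^sub>R p)\<bar>"
      unfolding p_def by (simp add: inner_diff_left algebra_simps)
    also have "\<dots> \<le> 1 / real (Suc k) * (s * norm p) + 1 / real (Suc m) * (s * norm p)"
      using bd[of "y + s *\<^sub>R p" k] bd[of "y + s *\<^sub>R p" m] sm by (simp add: dist)
    finally have "s * norm p * norm p \<le> s * norm p * (1 / real (Suc k) + 1 / real (Suc m))"
      by (simp add: power2_eq_square algebra_simps)
    then show ?thesis using s np by (simp add: p_def)
  qed simp
  have "Cauchy l"
  proof (rule CauchyI)
    fix e :: real assume "e > 0"
    then obtain N where N: "1 / real (Suc N) < e / 2"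
      using reals_Archimedean[of "e / 2"] by (auto simp: inverse_eq_divide)
    have "norm (l m - l n) < e" if "m \<ge> N" "n \<ge> N" for m n
    proof -
      have "1 / real (Suc m) \<le> 1 / real (Suc N)" "1 / real (Suc n) \<le> 1 / real (Suc N)"
        using that by (auto simp: field_simps)
      then show ?thesis using diff[of m n] N by simp
    qed
    then show "\<exists>M. \<forall>m\<ge>M. \<forall>n\<ge>M. norm (l m - l n) < e" by blast
  qed
  then obtain g where g: "l \<longlonglongrightarrow> g" using Cauchy_convergent convergentD by blast
  have "(f has_derivative (\<lambda>u. g \<bullet> u)) (at y)"
    unfolding has_derivative_at_alt
  proof (intro conjI allI impI bounded_linear_inner_right)
    fix e :: real assume "e > 0"
    have "(\<lambda>k. norm (l k - g) + 1 / real (Suc k)) \<longlonglongrightarrow> 0 + 0"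
      by (intro tendsto_add tendsto_norm_zero LIM_zero g LIMSEQ_inverse_real_of_nat[unfolded inverse_eq_divide])
    then obtain k where k: "norm (l k - g) + 1 / real (Suc k) < e"
      using \<open>e > 0\<close> order_tendstoD(2)[of _ "0 :: real" sequentially e] by (auto simp: eventually_sequentially)
    show "\<exists>da>0. \<forall>u. norm (u - y) < da \<longrightarrow> norm (f u - f y - g \<bullet> (u - y)) \<le> e * norm (u - y)"
    proof (intro exI[of _ "d k"] conjI d allI impI)
      fix u assume "norm (u - y) < d k"
      then have "\<bar>f u - f y - l k \<bullet> (u - y)\<bar> \<le> 1 / real (Suc k) * norm (u - y)"
        using bd[of u k] by (simp add: dist_norm)
      moreover have "\<bar>(l k - g) \<bullet> (u - y)\<bar> \<le> norm (l k - g) * norm (u - y)"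
        by (rule Cauchy_Schwarz_ineq2)
      moreover have "f u - f y - g \<bullet> (u - y) = (f u - f y - l k \<bullet> (u - y)) + (l k - g) \<bullet> (u - y)"
        by (simp add: inner_diff_left)
      ultimately have "norm (f u - f y - g \<bullet> (u - y)) \<le> (norm (l k - g) + 1 / real (Suc k)) * norm (u - y)"
        by (simp add: algebra_simps)
      also have "\<dots> \<le> e * norm (u - y)" using k by (intro mult_right_mono) auto
      finally show "norm (f u - f y - g \<bullet> (u - y)) \<le> e * norm (u - y)" .
    qed
  qed
  moreover have "g \<bullet> w \<le> c + 0"
  proof (rule LIMSEQ_le)
    show "(\<lambda>k. l k \<bullet> w) \<longlonglongrightarrow> g \<bullet> w" by (intro tendsto_intros g)
    show "(\<lambda>k. c + 1 / real (Suc k)) \<longlonglongrightarrow> c + 0"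
      by (intro tendsto_intros LIMSEQ_inverse_real_of_nat[unfolded inverse_eq_divide])
    show "\<exists>N. \<forall>n\<ge>N. l n \<bullet> w \<le> c + 1 / real (Suc n)" using c by blast
  qed
  ultimately show ?thesis by auto
qed

lemma differentiable_gradient:
  assumes "f differentiable (at y)" obtains g where "(f has_derivative (\<lambda>u. g \<bullet> u)) (at y)"
proof -
  define g where "g = (\<Sum>b\<in>Basis. dd b f y *\<^sub>R b)"
  note hd = has_derivative_dd[OF assms]
  have "dd u f y = g \<bullet> u" for u
  proof -
    have "dd u f y = dd (\<Sum>b\<in>Basis. (u \<bullet> b) *\<^sub>R b) f y" by (simp add: euclidean_representation)
    also have "\<dots> = (\<Sum>b\<in>Basis. dd ((u \<bullet> b) *\<^sub>R b) f y)" by (rule linear_sum[OF has_derivative_linear[OF hd]])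
    also have "\<dots> = (\<Sum>b\<in>Basis. (u \<bullet> b) * dd b f y)" by (simp add: dd_cmult_direction assms)
    finally have 1: "dd u f y = (\<Sum>b\<in>Basis. (u \<bullet> b) * dd b f y)" .
    have 2: "g \<bullet> u = (\<Sum>b\<in>Basis. dd b f y * (b \<bullet> u))" by (simp add: g_def inner_sum_left)
    show ?thesis unfolding 1 2 by (intro sum.cong) (auto simp: inner_commute)
  qed
  then show ?thesis using hd that by simp
qed

lemma measurable_derivative_set:
  "{y. f differentiable (at y) \<and> dd w f y \<le> c} \<in> sets borel"
proof -
  obtain D :: "'a set" where D: "countable D" "\<And>X. open X \<Longrightarrow> X \<noteq> {} \<Longrightarrow> \<exists>d\<in>D. d \<in> X"
    using countable_dense_exists by auto
  \<comment> \<open>The right-hand side is a countable intersection of countable unions of closed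
    sets; the constraint on the slope \<open>l\<close> encodes the bound on the derivative.\<close>
  have eq: "{y. f differentiable (at y) \<and> dd w f y \<le> c} =
    (\<Inter>k. \<Union>n. \<Union>l\<in>{l\<in>D. l \<bullet> w \<le> c + 1 / real (Suc k)}. near_linear (1 / real (Suc k)) (1 / real (Suc n)) l)"
    (is "?L = ?R")
  proof (intro equalityI subsetI)
    fix y assume "y \<in> ?L"
    then obtain g where g: "(f has_derivative (\<lambda>u. g \<bullet> u)) (at y)" and le: "g \<bullet> w \<le> c"
      using differentiable_gradient dd_eqI by (metis (mono_tags, lifting) mem_Collect_eq)
    show "y \<in> ?R"
    proof
      fix k
      define X where "X = ball g (1 / real (Suc k) / 2) \<inter> {l. l \<bullet> w < c + 1 / real (Suc k)}"
      have "g \<bullet> w < c + 1 / real (Suc k)" by (rule order_le_less_trans[OF le]) simp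
      then have "g \<in> X" by (simp add: X_def)
      moreover have "open X"
        unfolding X_def by (intro open_Int open_ball open_Collect_less continuous_intros)
      ultimately obtain l where l: "l \<in> D" "l \<in> X" using D(2)[of X] by blast
      then have "norm (l - g) \<le> 1 / real (Suc k) / 2"
        by (simp add: X_def dist_norm norm_minus_commute)
      then obtain n where "y \<in> near_linear (1 / real (Suc k)) (1 / real (Suc n)) l"
        using near_linear_of_derivative[OF g, of "1 / real (Suc k)" l] by auto
      then show "y \<in> (\<Union>n. \<Union>l\<in>{l\<in>D. l \<bullet> w \<le> c + 1 / real (Suc k)}. near_linear (1 / real (Suc k)) (1 / real (Suc n)) l)"
        using l by (intro UN_I[of n] UN_I[of l]) (auto simp: X_def)
    qed
  next
    fix y assume y: "y \<in> ?R"
    have "\<exists>n l. l \<bullet> w \<le> c + 1 / real (Suc k) \<and> y \<in> near_linear (1 / real (Suc k)) (1 / real (Suc n)) l" for k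
      using INT_D[OF y, of k] by blast
    then obtain n l where "\<And>k. l k \<bullet> w \<le> c + 1 / real (Suc k)"
      "\<And>k. y \<in> near_linear (1 / real (Suc k)) (1 / real (Suc (n k))) (l k)" by metis
    then obtain g where "(f has_derivative (\<lambda>u. g \<bullet> u)) (at y)" "g \<bullet> w \<le> c"
      using derivative_of_near_linear[of y "\<lambda>k. 1 / real (Suc (n k))" l w c] by auto
    then show "y \<in> ?L" using dd_eqI[of f _ y w] by (auto intro: differentiableI)
  qed
  have "countable {l\<in>D. l \<bullet> w \<le> c + 1 / real (Suc k)}" for k
    by (rule countable_subset[OF _ D(1)]) auto
  then show ?thesis
    unfolding eq by (intro sets.countable_INT' sets.countable_UN'' sets.countable_UN') (auto intro: borel_closed closed_near_linear)
qed

end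

lemma borel_measurable_dd [measurable]:
  fixes f :: "'a::euclidean_space \<Rightarrow> real"
  shows "dd w f \<in> borel_measurable borel"
proof -
  define D where "D = {y. f differentiable (at y)}"
  have "D = (\<Union>n::nat. {y. f differentiable (at y) \<and> dd w f y \<le> real n})"
    by (auto simp: D_def intro: real_arch_simple)
  then have D: "D \<in> sets borel" by (auto intro!: measurable_derivative_set)
  \<comment> \<open>Where \<open>f\<close> is not differentiable, \<open>frechet_derivative\<close>
    is a choice from an empty set of candidates, the same at all such points; so
    \<open>dd w f\<close> is constant there.\<close>
  have c0: "dd w f y = (SOME f' :: 'a \<Rightarrow> real. False) w" if "y \<notin> D" for y
  proof -
    have "(f has_derivative f') (at y) \<longleftrightarrow> False" for f'
      using that by (auto simp: D_def differentiable_def)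
    then show ?thesis by (simp add: dd_def frechet_derivative_def)
  qed
  show ?thesis
  proof (rule borel_measurableI_le)
    fix c
    have "{y. dd w f y \<le> c} = {y. f differentiable (at y) \<and> dd w f y \<le> c} \<union>
       (if (SOME f' :: 'a \<Rightarrow> real. False) w \<le> c then - D else {})"
      by (rule set_eqI, case_tac "x \<in> D") (use c0 in \<open>auto simp: D_def\<close>)
    also have "\<dots> \<in> sets borel" using D measurable_derivative_set[of f w c] by auto
    finally show "{y \<in> space borel. dd w f y \<le> c} \<in> sets borel" by simp
  qed
qed

section \<open>Integration over spheres\<close>

text \<open>The surface integral over the sphere of radius \<open>r\<close>: the ball is the cone
  over the sphere, and the integrand is constant along its rays.\<close>

definition sphint :: "('a::euclidean_space \<Rightarrow> real) \<Rightarrow> real \<Rightarrow> real" where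
  "sphint f r = (real DIM('a) / r) * (LINT z|lborel. indicator (ball 0 r - {0}) z * f ((r / norm z) *\<^sub>R z))"

lemma scale_measure_eq_density: "scale_measure c M = density M (\<lambda>_. c)"
  by (rule measure_eqI) (auto simp: emeasure_density nn_integral_cmult)

lemma integral_sphere_measure:
  fixes f :: "real^'n \<Rightarrow> real"
  assumes "r > 0" and [measurable]: "f \<in> borel_measurable borel"
  shows "(LINT y|sphere_measure r. f y) = sphint f r"
proof -
  have [measurable]: "(\<lambda>y::real^'n. (r / norm y) *\<^sub>R y) \<in> restrict_space lborel (ball 0 r - {0}) \<rightarrow>\<^sub>M borel"
    by (rule measurable_restrict_space1) measurable
  have "(LINT y|sphere_measure r. f y) = (real CARD('n) / r) *
      (LINT y|distr (restrict_space lborel (ball 0 r - {0})) borel (\<lambda>y. (r / norm y) *\<^sub>R y). f y)"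
    unfolding sphere_measure_def scale_measure_eq_density using assms(1)
    by (subst integral_density) auto
  also have "(LINT y|distr (restrict_space lborel (ball 0 r - {0})) borel (\<lambda>y. (r / norm y) *\<^sub>R y). f y)
     = (LINT y|restrict_space lborel (ball 0 r - {0}). f ((r / norm y) *\<^sub>R y))"
    by (rule integral_distr) auto
  also have "\<dots> = (LINT z|lborel. indicator (ball 0 r - {0}) z *\<^sub>R f ((r / norm z) *\<^sub>R z))"
    by (rule integral_restrict_space) simp
  finally show ?thesis by (simp add: sphint_def)
qed

text \<open>The density in radius and ball point whose image under
  \<open>(r / norm z) *\<^sub>R z\<close> is Lebesgue measure, as \<open>distr_polar\<close>
  shows.\<close>

definition sphere_kernel :: "'a::euclidean_space itself \<Rightarrow> real \<Rightarrow> 'a \<Rightarrow> real" where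
  "sphere_kernel _ r z = (real DIM('a) / r) * (indicator {0<..} r * indicator (ball 0 r - {0}) z)"

lemma sphere_kernel_eq:
  "sphere_kernel TYPE('a::euclidean_space) r z = (if 0 < norm z \<and> norm z < r then real DIM('a) / r else 0)"
proof (cases "0 < r")
  case False
  then have "\<not> norm z < r" using norm_ge_zero[of z] by linarith
  then show ?thesis using False by (simp add: sphere_kernel_def)
qed (auto simp: sphere_kernel_def)

text \<open>After exchanging the integrals, \<open>r = norm z * s\<close> makes the inner integral
  run along the ray through \<open>z\<close>. Rescaling space by \<open>s\<close> splits off the
  integral of \<open>u\<close> with the weight \<open>n / s^(n+1)\<close> on \<open>s > 1\<close>,
  whose total mass is 1.\<close>

lemma nn_integral_polar:
  fixes u :: "'a::euclidean_space \<Rightarrow> ennreal"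
  assumes [measurable]: "u \<in> borel_measurable borel"
  shows "(\<integral>\<^sup>+ r. \<integral>\<^sup>+ z. ennreal (sphere_kernel TYPE('a) r z) * u ((r / norm z) *\<^sub>R z) \<partial>lborel \<partial>lborel) = (\<integral>\<^sup>+ y. u y \<partial>lborel)"
proof -
  note ker = sphere_kernel_eq[where 'a='a]
  have [measurable]: "(\<lambda>(r, z). sphere_kernel TYPE('a) r z) \<in> borel_measurable (borel \<Otimes>\<^sub>M borel)"
    unfolding ker by measurable
  have "(\<integral>\<^sup>+ r. \<integral>\<^sup>+ z. ennreal (sphere_kernel TYPE('a) r z) * u ((r / norm z) *\<^sub>R z) \<partial>lborel \<partial>lborel) =
    (\<integral>\<^sup>+ z. \<integral>\<^sup>+ r. ennreal (sphere_kernel TYPE('a) r z) * u ((r / norm z) *\<^sub>R z) \<partial>lborel \<partial>lborel)"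
    by (rule lborel_pair.Fubini'[symmetric]) measurable
  also have "\<dots> = (\<integral>\<^sup>+ z. \<integral>\<^sup>+ s. ennreal (indicator {1<..} s * (real DIM('a) / s)) * u (s *\<^sub>R z) \<partial>lborel \<partial>lborel)"
  proof (rule nn_integral_cong_AE)
    have "AE z::'a in lborel. z \<noteq> 0" by (rule AE_lborel_singleton)
    then show "AE z in lborel. (\<integral>\<^sup>+ r. ennreal (sphere_kernel TYPE('a) r z) * u ((r / norm z) *\<^sub>R z) \<partial>lborel) =
       (\<integral>\<^sup>+ s. ennreal (indicator {1<..} s * (real DIM('a) / s)) * u (s *\<^sub>R z) \<partial>lborel)"
    proof eventually_elim
      case (elim z)
      have "(\<integral>\<^sup>+ r. ennreal (sphere_kernel TYPE('a) r z) * u ((r / norm z) *\<^sub>R z) \<partial>lborel) =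
         \<bar>norm z\<bar> * (\<integral>\<^sup>+ s. ennreal (sphere_kernel TYPE('a) (0 + norm z * s) z) * u (((0 + norm z * s) / norm z) *\<^sub>R z) \<partial>lborel)"
        by (rule nn_integral_real_affine) (use elim in \<open>auto simp: ker\<close>)
      also have "\<dots> = (\<integral>\<^sup>+ s. norm z * (ennreal (sphere_kernel TYPE('a) (0 + norm z * s) z) * u (((0 + norm z * s) / norm z) *\<^sub>R z)) \<partial>lborel)"
        by (simp add: ker nn_integral_cmult)
      also have "\<dots> = (\<integral>\<^sup>+ s. ennreal (indicator {1<..} s * (real DIM('a) / s)) * u (s *\<^sub>R z) \<partial>lborel)"
      proof (rule nn_integral_cong)
        fix s :: real
        have "norm z * sphere_kernel TYPE('a) (norm z * s) z = indicator {1<..} s * (real DIM('a) / s)"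
          using elim by (auto simp: ker indicator_def)
        moreover have "ennreal (norm z) * ennreal (sphere_kernel TYPE('a) (norm z * s) z) = ennreal (norm z * sphere_kernel TYPE('a) (norm z * s) z)"
          by (simp add: ennreal_mult')
        ultimately show "norm z * (ennreal (sphere_kernel TYPE('a) (0 + norm z * s) z) * u (((0 + norm z * s) / norm z) *\<^sub>R z)) =
            ennreal (indicator {1<..} s * (real DIM('a) / s)) * u (s *\<^sub>R z)"
          using elim by (simp add: mult.assoc[symmetric])
      qed
      finally show ?case .
    qed
  qed
  also have "\<dots> = (\<integral>\<^sup>+ s. \<integral>\<^sup>+ z. ennreal (indicator {1<..} s * (real DIM('a) / s)) * u (s *\<^sub>R z) \<partial>lborel \<partial>lborel)"
    by (rule lborel_pair.Fubini') measurable
  also have "\<dots> = (\<integral>\<^sup>+ s. ennreal (indicator {1<..} s * (real DIM('a) / s ^ (DIM('a) + 1))) * (\<integral>\<^sup>+ y. u y \<partial>lborel) \<partial>lborel)"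
  proof (rule nn_integral_cong)
    fix s :: real
    show "(\<integral>\<^sup>+ z. ennreal (indicator {1<..} s * (real DIM('a) / s)) * u (s *\<^sub>R z) \<partial>lborel) =
       ennreal (indicator {1<..} s * (real DIM('a) / s ^ (DIM('a) + 1))) * (\<integral>\<^sup>+ y. u y \<partial>lborel)"
    proof (cases "s > 1")
      case True
      have "(\<integral>\<^sup>+ y. u y \<partial>lborel) = (\<integral>\<^sup>+ y. u y \<partial>density (distr lborel borel (\<lambda>x. 0 + s *\<^sub>R x)) (\<lambda>_. ennreal (\<bar>s\<bar> ^ DIM('a))))"
        using lborel_affine[of s "0::'a"] True by simp
      also have "\<dots> = ennreal (s ^ DIM('a)) * (\<integral>\<^sup>+ z. u (s *\<^sub>R z) \<partial>lborel)"
        using True by (simp add: nn_integral_density nn_integral_distr nn_integral_cmult)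
      finally have I: "(\<integral>\<^sup>+ y. u y \<partial>lborel) = ennreal (s ^ DIM('a)) * (\<integral>\<^sup>+ z. u (s *\<^sub>R z) \<partial>lborel)" .
      have "ennreal (real DIM('a) / s ^ (DIM('a) + 1)) * (\<integral>\<^sup>+ y. u y \<partial>lborel) =
         ennreal (real DIM('a) / s ^ (DIM('a) + 1) * s ^ DIM('a)) * (\<integral>\<^sup>+ z. u (s *\<^sub>R z) \<partial>lborel)"
        unfolding I using True by (subst ennreal_mult) (auto simp: mult.assoc)
      also have "real DIM('a) / s ^ (DIM('a) + 1) * s ^ DIM('a) = real DIM('a) / s"
        using True by simp
      finally show ?thesis using True by (simp add: nn_integral_cmult)
    qed simp
  qed
  also have "\<dots> = (\<integral>\<^sup>+ s. ennreal (indicator {1<..} s * (real DIM('a) / s ^ (DIM('a) + 1))) \<partial>lborel) * (\<integral>\<^sup>+ y. u y \<partial>lborel)"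
    by (rule nn_integral_multc) measurable
  also have "(\<integral>\<^sup>+ s. ennreal (indicator {1<..} s * (real DIM('a) / s ^ (DIM('a) + 1))) \<partial>lborel) = 1"
  proof -
    have "(\<integral>\<^sup>+ s. ennreal (indicator {1<..} s * (real DIM('a) / s ^ (DIM('a) + 1))) \<partial>lborel) =
      (\<integral>\<^sup>+ s. ennreal (real DIM('a) / s ^ (DIM('a) + 1)) * indicator {1..} s \<partial>lborel)"
    proof (rule nn_integral_cong_AE)
      have "AE s::real in lborel. s \<noteq> 1" by (rule AE_lborel_singleton)
      then show "AE s in lborel. ennreal (indicator {1<..} s * (real DIM('a) / s ^ (DIM('a) + 1))) =
        ennreal (real DIM('a) / s ^ (DIM('a) + 1)) * indicator {1..} s"
        by eventually_elim (auto simp: indicator_def)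
    qed
    also have "\<dots> = ennreal (0 - (- inverse ((1::real) ^ DIM('a))))"
    proof (rule nn_integral_FTC_atLeast)
      fix x :: real assume "1 \<le> x"
      obtain m where m: "DIM('a) = Suc m" using DIM_positive[where 'a='a] gr0_conv_Suc by blast
      have "((\<lambda>x. - inverse (x ^ Suc m)) has_real_derivative
          inverse (x ^ Suc m) * (real (Suc m) * x ^ m) * inverse (x ^ Suc m)) (at x)"
        using DERIV_minus[OF DERIV_inverse'[OF DERIV_pow[of "Suc m" x]]] \<open>1 \<le> x\<close> by (simp del: power_Suc)
      moreover have "inverse (x ^ Suc m) * (real (Suc m) * x ^ m) * inverse (x ^ Suc m) = real (Suc m) / x ^ (Suc m + 1)"
        using \<open>1 \<le> x\<close> by (simp add: divide_simps)
      ultimately show "((\<lambda>x. - inverse (x ^ DIM('a))) has_real_derivative real DIM('a) / x ^ (DIM('a) + 1)) (at x)"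
        unfolding m by simp
    next
      have "((\<lambda>x::real. inverse (x ^ DIM('a))) \<longlongrightarrow> 0) at_top"
        by (intro tendsto_inverse_0_at_top filterlim_pow_at_top filterlim_ident DIM_positive)
      then show "((\<lambda>x::real. - inverse (x ^ DIM('a))) \<longlongrightarrow> 0) at_top"
        using tendsto_minus by fastforce
    qed auto
    finally show ?thesis by simp
  qed
  finally show ?thesis by simp
qed

text \<open>The polar formula as an identity of measures, from which the version for integrable
  functions of either sign follows by change of variables.\<close>

lemma distr_polar:
  "distr (density (lborel \<Otimes>\<^sub>M lborel) (\<lambda>(r, z). ennreal (sphere_kernel TYPE('a::euclidean_space) r z)))
     borel (\<lambda>(r, z). (r / norm z) *\<^sub>R z) = (lborel :: 'a measure)"
proof (rule measure_eqI)
  note ker = sphere_kernel_eq[where 'a='a]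
  have [measurable]: "(\<lambda>(r, z). sphere_kernel TYPE('a) r z) \<in> borel_measurable (borel \<Otimes>\<^sub>M borel)"
    unfolding ker by measurable
  fix X :: "'a set" assume "X \<in> sets (distr (density (lborel \<Otimes>\<^sub>M lborel) (\<lambda>(r, z). ennreal (sphere_kernel TYPE('a) r z)))
     borel (\<lambda>(r, z). (r / norm z) *\<^sub>R z))"
  then have [measurable]: "X \<in> sets borel" by simp
  let ?P = "density (lborel \<Otimes>\<^sub>M lborel) (\<lambda>(r, z). ennreal (sphere_kernel TYPE('a) r z))"
  have "emeasure (distr ?P borel (\<lambda>(r, z). (r / norm z) *\<^sub>R z)) X =
    (\<integral>\<^sup>+ y. indicator X y \<partial>distr ?P borel (\<lambda>(r, z). (r / norm z) *\<^sub>R z))"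
    by (rule nn_integral_indicator[symmetric]) simp
  also have "\<dots> = (\<integral>\<^sup>+ p. indicator X (case p of (r, z) \<Rightarrow> (r / norm z) *\<^sub>R z) \<partial>?P)"
    by (rule nn_integral_distr) measurable
  also have "\<dots> = (\<integral>\<^sup>+ p. (case p of (r, z) \<Rightarrow> ennreal (sphere_kernel TYPE('a) r z)) * indicator X (case p of (r, z) \<Rightarrow> (r / norm z) *\<^sub>R z) \<partial>(lborel \<Otimes>\<^sub>M lborel))"
    by (rule nn_integral_density) measurable
  also have "\<dots> = (\<integral>\<^sup>+ r. \<integral>\<^sup>+ z. ennreal (sphere_kernel TYPE('a) r z) * indicator X ((r / norm z) *\<^sub>R z) \<partial>lborel \<partial>lborel)"
    by (subst lborel.nn_integral_fst[symmetric]) (auto simp: case_prod_unfold)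
  also have "\<dots> = emeasure lborel X"
    by (simp add: nn_integral_polar)
  finally show "emeasure (distr ?P borel (\<lambda>(r, z). (r / norm z) *\<^sub>R z)) X = emeasure lborel X" .
qed simp

lemma integral_polar:
  fixes u :: "'a::euclidean_space \<Rightarrow> real"
  assumes u: "integrable lborel u"
  shows "integrable lborel (\<lambda>r. indicator {0<..} r * sphint u r)"
    "(LINT r|lborel. indicator {0<..} r * sphint u r) = (LINT y|lborel. u y)"
proof -
  note ker = sphere_kernel_eq[where 'a='a]
  have nn: "0 \<le> sphere_kernel TYPE('a) r z" for r z by (cases "0 < r") (auto simp: sphere_kernel_def)
  have km [measurable]: "(\<lambda>(r, z). sphere_kernel TYPE('a) r z) \<in> borel_measurable (borel \<Otimes>\<^sub>M borel)"
    unfolding ker by measurable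
  have [measurable]: "u \<in> borel_measurable borel" using u by auto
  let ?k = "\<lambda>p. case p of (r, z) \<Rightarrow> sphere_kernel TYPE('a) r z"
  let ?\<Phi> = "\<lambda>p::real \<times> 'a. case p of (r, z) \<Rightarrow> (r / norm z) *\<^sub>R z"
  let ?P = "density (lborel \<Otimes>\<^sub>M lborel) (\<lambda>p. ennreal (?k p))"
  have d: "distr ?P borel ?\<Phi> = lborel"
    using distr_polar[where 'a='a] by (simp add: case_prod_unfold)
  have \<Phi>: "?\<Phi> \<in> ?P \<rightarrow>\<^sub>M borel" by measurable
  have i1: "integrable ?P (\<lambda>p. u (?\<Phi> p))"
    using u by (subst (asm) d[symmetric]) (rule integrable_distr[OF \<Phi>])
  then have i2: "integrable (lborel \<Otimes>\<^sub>M lborel) (\<lambda>p. ?k p *\<^sub>R u (?\<Phi> p))"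
    by (subst (asm) integrable_density) (auto simp: nn)
  have "(LINT y|lborel. u y) = (LINT y|distr ?P borel ?\<Phi>. u y)" by (simp only: d)
  also have "\<dots> = (LINT p|?P. u (?\<Phi> p))" by (rule integral_distr[OF \<Phi>]) measurable
  also have "\<dots> = (LINT p|(lborel \<Otimes>\<^sub>M lborel). ?k p *\<^sub>R u (?\<Phi> p))"
    by (rule integral_density) (auto simp: nn)
  also have "\<dots> = (LINT r|lborel. LINT z|lborel. sphere_kernel TYPE('a) r z * u ((r / norm z) *\<^sub>R z))"
    by (subst lborel_pair.integral_fst'[OF i2, symmetric]) (simp add: case_prod_unfold)
  also have eq: "(\<lambda>r. LINT z|lborel. sphere_kernel TYPE('a) r z * u ((r / norm z) *\<^sub>R z)) = (\<lambda>r. indicator {0<..} r * sphint u r)"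
    by (rule ext) (simp add: sphere_kernel_def sphint_def mult.assoc indicator_def)
  finally show "(LINT r|lborel. indicator {0<..} r * sphint u r) = (LINT y|lborel. u y)" by simp
  have "integrable lborel (\<lambda>r. LINT z|lborel. sphere_kernel TYPE('a) r z * u ((r / norm z) *\<^sub>R z))"
    using lborel_pair.integrable_fst'[OF i2] by (simp add: case_prod_unfold)
  then show "integrable lborel (\<lambda>r. indicator {0<..} r * sphint u r)" by (simp only: eq)
qed

lemma integrable_zero_extend:
  fixes f :: "'a::euclidean_space \<Rightarrow> real"
  assumes "open E" "compact K" "K \<subseteq> E" "continuous_on E f" "\<And>y. y \<notin> K \<Longrightarrow> f y = 0"
  shows "integrable lborel f"
  by (rule integrable_compact_support[OF continuous_on_zero_extend1[OF assms(1) compact_imp_closed[OF assms(2)] assms(3-5)] assms(2,5)])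

lemma integral_lborel_scale:
  fixes g :: "'a::euclidean_space \<Rightarrow> real"
  assumes [measurable]: "g \<in> borel_measurable borel" and "r > 0"
  shows "(LINT z|lborel. g z) = r ^ DIM('a) * (LINT z|lborel. g (r *\<^sub>R z))"
proof -
  have "(LINT z|lborel. g z) = (LINT z|density (distr lborel borel (\<lambda>x. 0 + r *\<^sub>R x)) (\<lambda>_. ennreal (\<bar>r\<bar> ^ DIM('a))). g z)"
    using lborel_affine[of r "0::'a"] assms(2) by simp
  also have "\<dots> = r ^ DIM('a) * (LINT z|lborel. g (r *\<^sub>R z))"
    using assms(2) by (subst integral_density) (auto simp: integral_distr)
  finally show ?thesis .
qed

text \<open>Moves the dependence on \<open>r\<close> from the domain of integration into the
  integrand, where dominated convergence can handle it.\<close>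

lemma sphint_unit:
  fixes f :: "'a::euclidean_space \<Rightarrow> real"
  assumes [measurable]: "f \<in> borel_measurable borel" and r: "r > 0"
  shows "sphint f r = (real DIM('a) / r * r ^ DIM('a)) *
    (LINT z|lborel. indicator (ball 0 1 - {0}) z * f ((r / norm z) *\<^sub>R z))"
proof -
  have "(LINT z|lborel. indicator (ball 0 r - {0}) z * f ((r / norm z) *\<^sub>R z)) =
    r ^ DIM('a) * (LINT z|lborel. indicator (ball 0 r - {0}) (r *\<^sub>R z) * f ((r / norm (r *\<^sub>R z)) *\<^sub>R (r *\<^sub>R z)))"
    by (rule integral_lborel_scale[OF _ r])
       (intro borel_measurable_times borel_measurable_indicator measurable_compose[OF _ assms(1)], auto)
  also have "(\<lambda>z::'a. indicator (ball 0 r - {0}) (r *\<^sub>R z) * f ((r / norm (r *\<^sub>R z)) *\<^sub>R (r *\<^sub>R z))) =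
     (\<lambda>z. indicator (ball 0 1 - {0}) z * f ((r / norm z) *\<^sub>R z))"
    using r by (auto simp: fun_eq_iff indicator_def)
  finally show ?thesis by (simp add: sphint_def mult.assoc)
qed

lemma continuous_on_sphint:
  fixes f :: "'a::euclidean_space \<Rightarrow> real"
  assumes f [measurable]: "f \<in> borel_measurable borel" and a: "a \<ge> 0"
    and cont: "continuous_on {y. a < norm y} f"
  shows "continuous_on {a<..} (sphint f)"
proof -
  have "continuous_on {a<..} (\<lambda>r. LINT z|lborel. indicator (ball 0 1 - {0}) z * f ((r / norm z) *\<^sub>R z))"
  proof (rule continuous_on_sequentiallyI)
    fix u r assume u: "\<forall>n. u n \<in> {a<..}" and r: "r \<in> {a<..}" and lim: "u \<longlonglongrightarrow> r"
    \<comment> \<open>A convergent sequence with its limit is compact, so all spheres involved lie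
      in one compact set; the bound of \<open>f\<close> on it yields the dominating
      function.\<close>
    define C where "C = insert r (range u)"
    have C: "compact C" unfolding C_def by (rule compact_sequence_with_limit[OF lim])
    have Ca: "\<And>x. x \<in> C \<Longrightarrow> x > a" using u r by (auto simp: C_def)
    define K where "K = (norm -` C :: 'a set)"
    have "closed K" unfolding K_def
      by (intro closed_vimage compact_imp_closed C continuous_intros)
    moreover have "bounded K"
    proof -
      obtain B where "\<And>x. x \<in> C \<Longrightarrow> norm x \<le> B" using compact_imp_bounded[OF C] by (auto simp: bounded_iff)
      then have "norm x \<le> B" if "x \<in> K" for x
        using that \<open>\<And>x. x \<in> C \<Longrightarrow> norm x \<le> B\<close>[of "norm x"] unfolding K_def by simp
      then show ?thesis by (auto simp: bounded_iff)
    qed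
    ultimately have "compact K" by (simp add: compact_eq_bounded_closed)
    moreover have KE: "K \<subseteq> {y. a < norm y}" using Ca by (auto simp: K_def)
    ultimately have "bounded (f ` K)"
      by (intro compact_imp_bounded compact_continuous_image continuous_on_subset[OF cont])
    then obtain B where B: "\<And>y. y \<in> K \<Longrightarrow> \<bar>f y\<bar> \<le> B" "B > 0" by (auto simp: bounded_pos)
    have inK: "(s / norm z) *\<^sub>R z \<in> K" if "s \<in> C" "z \<noteq> 0" for s z
      using that a Ca[OF that(1)] by (simp add: K_def)
    show "(\<lambda>n. LINT z|lborel. indicator (ball 0 1 - {0}) z * f ((u n / norm z) *\<^sub>R z)) \<longlonglongrightarrow>
      (LINT z|lborel. indicator (ball 0 1 - {0}) z * f ((r / norm z) *\<^sub>R z))"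
    proof (rule integral_dominated_convergence[where w="\<lambda>z::'a. indicator (ball 0 1) z * B"])
      show "integrable lborel (\<lambda>z::'a. indicator (ball 0 1) z * B)"
        using emeasure_lborel_ball_finite[of "0::'a" 1] by (intro integrable_mult_left integrable_real_indicator) auto
      show "AE z in lborel. (\<lambda>n. indicator (ball 0 1 - {0}) z * f ((u n / norm z) *\<^sub>R z)) \<longlonglongrightarrow>
          indicator (ball 0 1 - {0}) z * f ((r / norm z) *\<^sub>R z)"
      proof (rule AE_I2)
        fix z :: 'a
        show "(\<lambda>n. indicator (ball 0 1 - {0}) z * f ((u n / norm z) *\<^sub>R z)) \<longlonglongrightarrow>
          indicator (ball 0 1 - {0}) z * f ((r / norm z) *\<^sub>R z)"
        proof (cases "z = 0")
          case False
          have "(\<lambda>n. f ((u n / norm z) *\<^sub>R z)) \<longlonglongrightarrow> f ((r / norm z) *\<^sub>R z)"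
          proof (rule continuous_on_tendsto_compose[OF cont])
            show "(\<lambda>n. (u n / norm z) *\<^sub>R z) \<longlonglongrightarrow> (r / norm z) *\<^sub>R z"
              using False by (intro tendsto_intros lim) auto
            show "(r / norm z) *\<^sub>R z \<in> {y. a < norm y}" using inK[of r z] KE False by (auto simp: C_def)
            show "\<forall>\<^sub>F n in sequentially. (u n / norm z) *\<^sub>R z \<in> {y. a < norm y}"
              by (intro always_eventually allI subsetD[OF KE inK]) (use False in \<open>auto simp: C_def\<close>)
          qed
          then show ?thesis by (intro tendsto_intros)
        qed simp
      qed
      fix n
      show "AE z in lborel. norm (indicator (ball 0 1 - {0}) z * f ((u n / norm z) *\<^sub>R z)) \<le> indicator (ball 0 1) z * B"
        using B inK[of "u n"] by (intro AE_I2) (auto simp: indicator_def C_def)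
    qed (simp_all, (intro borel_measurable_times borel_measurable_indicator measurable_compose[OF _ f], auto)+)
  qed
  then have "continuous_on {a<..} (\<lambda>r. (real DIM('a) / r * r ^ DIM('a)) * (LINT z|lborel. indicator (ball 0 1 - {0}) z * f ((r / norm z) *\<^sub>R z)))"
    using a by (intro continuous_intros) auto
  then show ?thesis
    by (rule continuous_on_eq) (use a in \<open>simp add: sphint_unit\<close>)
qed

section \<open>Radial functions and the divergence theorem on spheres\<close>

lemma dd_norm_compose:
  fixes y :: "'a::euclidean_space"
  assumes "y \<noteq> 0" "(\<psi> has_real_derivative d) (at (norm y))"
  shows "((\<lambda>y. \<psi> (norm y)) has_derivative (\<lambda>v. d * ((y \<bullet> v) / norm y))) (at y)"
proof -
  have "(norm has_derivative (\<lambda>v. (y \<bullet> v) / norm y)) (at y)"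
    using has_derivative_norm[OF assms(1)] by (simp add: sgn_div_norm inner_commute divide_inverse mult.commute)
  from has_derivative_compose[OF this assms(2)[unfolded has_field_derivative_def]]
  show ?thesis by simp
qed

lemma compact_annulus: "compact {y :: 'a::euclidean_space. p \<le> norm y \<and> norm y \<le> q}"
proof -
  have "closed {y :: 'a. p \<le> norm y \<and> norm y \<le> q}"
    by (intro closed_Collect_conj closed_Collect_le continuous_intros)
  moreover have "bounded {y :: 'a. p \<le> norm y \<and> norm y \<le> q}" by (auto simp: bounded_iff)
  ultimately show ?thesis by (simp add: compact_eq_bounded_closed)
qed

lemma open_exterior: "open {y :: 'a::euclidean_space. a < norm y}"
  by (intro open_Collect_less continuous_intros)

lemma sphint_radial: "r > 0 \<Longrightarrow> sphint (\<lambda>y. \<psi> (norm y) * u y) r = \<psi> r * sphint u r"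
proof -
  assume "r > 0"
  then have "(\<lambda>z. indicator (ball 0 r - {0}) z * (\<psi> (norm ((r / norm z) *\<^sub>R z)) * u ((r / norm z) *\<^sub>R z))) =
    (\<lambda>z. \<psi> r * (indicator (ball 0 r - {0}) z * u ((r / norm z) *\<^sub>R z)))"
    by (auto simp: fun_eq_iff indicator_def)
  then show ?thesis by (simp add: sphint_def)
qed

lemma integral_radial:
  fixes u :: "'a::euclidean_space \<Rightarrow> real"
  assumes a: "a \<ge> 0" "a < p" and g: "continuous_on {a<..} g" "\<And>r. r \<notin> {p..q} \<Longrightarrow> g r = 0"
    and u [measurable]: "u \<in> borel_measurable borel" and cu: "continuous_on {y. a < norm y} u"
  shows "(LINT y|lborel. g (norm y) * u y) = integral {p..q} (\<lambda>r. g r * sphint u r)"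
proof -
  have cn: "continuous_on {y::'a. a < norm y} (\<lambda>y. g (norm y))"
    by (rule continuous_on_compose2[OF g(1)]) (auto intro!: continuous_intros)
  have i: "integrable lborel (\<lambda>y. g (norm y) * u y)"
    by (rule integrable_zero_extend[OF open_exterior[of a] compact_annulus[of p q]])
       (use a g in \<open>auto intro!: continuous_intros cn cu\<close>)
  have "(LINT y|lborel. g (norm y) * u y) = (LINT r|lborel. indicator {0<..} r * sphint (\<lambda>y. g (norm y) * u y) r)"
    by (rule integral_polar(2)[OF i, symmetric])
  also have "\<dots> = (LINT r|lborel. g r * sphint u r)"
    using a g(2) by (intro Bochner_Integration.integral_cong refl) (auto simp: sphint_radial indicator_def)
  also have "\<dots> = integral (cbox p q) (\<lambda>r. g r * sphint u r)"
  proof (rule integral_cbox_compact_support)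
    have "continuous_on {a<..} (\<lambda>r. g r * sphint u r)"
      by (intro continuous_intros g continuous_on_sphint cu a u)
    then show "continuous_on UNIV (\<lambda>r. g r * sphint u r)"
      by (rule continuous_on_zero_extend1[where K="{p..q}", rotated 3]) (use g a in auto)
  qed (use g in auto)
  finally show ?thesis by simp
qed

text \<open>\<open>f\<close> is the component of \<open>V\<close> along the outward normal and
  \<open>dv\<close> the divergence. The equations are confined to the exterior, where the metric
  lives, while measurability is global.\<close>

locale flux_field =
  fixes a :: real and V :: "'n::finite \<Rightarrow> real^'n \<Rightarrow> real" and f dv :: "real^'n \<Rightarrow> real"
  assumes a: "a \<ge> 0" and V: "\<And>i. C1_on {y. a < norm y} (V i)"
    and f [measurable]: "f \<in> borel_measurable borel" and dv [measurable]: "dv \<in> borel_measurable borel"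
    and f_eq: "\<And>y. a < norm y \<Longrightarrow> f y = (\<Sum>i\<in>UNIV. V i y * (y $ i / norm y))"
    and dv_eq: "\<And>y. a < norm y \<Longrightarrow> dv y = (\<Sum>i\<in>UNIV. dd (axis i 1) (V i) y)"
begin

abbreviation "E \<equiv> {y::real^'n. a < norm y}"

lemma y_nonzero: "y \<in> E \<Longrightarrow> y \<noteq> 0" using a by auto

lemma cont_f: "continuous_on E f"
proof -
  have "continuous_on E (\<lambda>y. \<Sum>i\<in>UNIV. V i y * (y $ i / norm y))"
    using y_nonzero by (intro continuous_intros C1_on_continuous[OF V]) auto
  then show ?thesis by (rule continuous_on_eq) (simp add: f_eq)
qed

lemma cont_dv: "continuous_on E dv"
proof -
  have "continuous_on E (\<lambda>y. \<Sum>i\<in>UNIV. dd (axis i 1) (V i) y)"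
    by (intro continuous_intros C1_on_dd_continuous[OF V])
  then show ?thesis by (rule continuous_on_eq) (simp add: dv_eq)
qed

text \<open>The field \<open>\<psi> (norm y) * V i y\<close> has compact support, so its divergence
  has integral zero; the product rule splits that divergence into the two integrands.\<close>

lemma test_function:
  assumes pq: "a < p" and \<psi>: "\<And>r. a < r \<Longrightarrow> (\<psi> has_real_derivative \<psi>' r) (at r)"
    and cont: "continuous_on {a<..} \<psi>'"
    and zero: "\<And>r. r \<notin> {p..q} \<Longrightarrow> \<psi> r = 0" "\<And>r. r \<notin> {p..q} \<Longrightarrow> \<psi>' r = 0"
  shows "(LINT y|lborel. \<psi> (norm y) * dv y) + (LINT y|lborel. \<psi>' (norm y) * f y) = 0"
    "integrable lborel (\<lambda>y. \<psi> (norm y) * dv y)" "integrable lborel (\<lambda>y. \<psi>' (norm y) * f y)"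
proof -
  define K where "K = {y::real^'n. p \<le> norm y \<and> norm y \<le> q}"
  have K: "compact K" "K \<subseteq> E" using pq by (auto simp: K_def compact_annulus)
  have cont_n: "continuous_on E (\<lambda>y. \<psi>' (norm y))"
    by (rule continuous_on_compose2[OF cont]) (auto intro!: continuous_intros)
  have \<psi>C: "C1_on E (\<lambda>y. \<psi> (norm y))"
  proof (rule C1_onI)
    show "((\<lambda>y. \<psi> (norm y)) has_derivative (\<lambda>v. \<psi>' (norm y) * ((y \<bullet> v) / norm y))) (at y)" if "y \<in> E" for y
      by (rule dd_norm_compose[OF y_nonzero[OF that] \<psi>]) (use that in simp)
    show "continuous_on E (\<lambda>y. \<psi>' (norm y) * ((y \<bullet> v) / norm y))" for v
      by (intro continuous_intros cont_n) (use y_nonzero in auto)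
  qed
  show i1: "integrable lborel (\<lambda>y. \<psi> (norm y) * dv y)"
    by (rule integrable_zero_extend[OF open_exterior K])
       (use zero in \<open>auto intro!: continuous_intros C1_on_continuous[OF \<psi>C] cont_dv simp: K_def\<close>)
  show i2: "integrable lborel (\<lambda>y. \<psi>' (norm y) * f y)"
    by (rule integrable_zero_extend[OF open_exterior K])
       (use zero in \<open>auto intro!: continuous_intros cont_n cont_f simp: K_def\<close>)
  let ?w = "\<lambda>i y. \<psi> (norm y) * V i y"
  have w0: "?w i y = 0" if "y \<notin> K" for i y using zero that by (auto simp: K_def)
  have wC: "C1_on E (?w i)" for i by (rule C1_on_mult(1)[OF \<psi>C V])
  have int: "integrable lborel (dd (axis i 1) (?w i))" for i
    by (rule integrable_zero_extend[OF open_exterior K C1_on_dd_continuous[OF wC]])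
       (rule dd_zero_outside[OF compact_imp_closed[OF K(1)] w0])
  have eq: "(\<Sum>i\<in>UNIV. dd (axis i 1) (?w i) y) = \<psi> (norm y) * dv y + \<psi>' (norm y) * f y" for y
  proof (cases "y \<in> E")
    case True
    have "dd (axis i 1) (\<lambda>y. \<psi> (norm y)) y = \<psi>' (norm y) * (y $ i / norm y)" for i
      using True y_nonzero[OF True] dd_eqI[OF dd_norm_compose[of y \<psi> "\<psi>' (norm y)"] , of "axis i 1"] \<psi>[of "norm y"]
      by (simp add: inner_axis)
    then have "dd (axis i 1) (?w i) y = \<psi> (norm y) * dd (axis i 1) (V i) y + \<psi>' (norm y) * (V i y * (y $ i / norm y))" for i
      using C1_on_mult(2)[OF \<psi>C V True, of "axis i 1" i] by simp
    then show ?thesis using True by (simp add: sum.distrib f_eq dv_eq sum_distrib_left)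
  next
    case False
    then have "y \<notin> K" using K by auto
    then show ?thesis using zero dd_zero_outside[OF compact_imp_closed[OF K(1)] w0] by (auto simp: K_def)
  qed
  have "(LINT y|lborel. \<psi> (norm y) * dv y) + (LINT y|lborel. \<psi>' (norm y) * f y) =
     (LINT y|lborel. (\<Sum>i\<in>UNIV. dd (axis i 1) (?w i) y))"
    unfolding eq using i1 i2 by simp
  also have "\<dots> = (\<Sum>i\<in>UNIV. (LINT y|lborel. dd (axis i 1) (?w i) y))"
    by (rule Bochner_Integration.integral_sum) (rule int)
  also have "\<dots> = 0"
    using integral_dd_zero[OF open_exterior K wC w0] by simp
  finally show "(LINT y|lborel. \<psi> (norm y) * dv y) + (LINT y|lborel. \<psi>' (norm y) * f y) = 0" .
qed

lemma test_function_radial: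
  assumes pq: "a < p" "p < q" and \<psi>: "\<And>r. a < r \<Longrightarrow> (\<psi> has_real_derivative \<psi>' r) (at r)"
    and cont: "continuous_on {a<..} \<psi>'"
    and zero: "\<And>r. r \<notin> {p..q} \<Longrightarrow> \<psi> r = 0" "\<And>r. r \<notin> {p..q} \<Longrightarrow> \<psi>' r = 0"
  shows "integral {p..q} (\<lambda>r. \<psi> r * sphint dv r) + integral {p..q} (\<lambda>r. \<psi>' r * sphint f r) = 0"
proof -
  have c\<psi>: "continuous_on {a<..} \<psi>"
    using \<psi> by (auto intro!: continuous_at_imp_continuous_on DERIV_isCont)
  note t = test_function[OF pq(1) \<psi> cont zero]
  have 1: "(LINT y|lborel. \<psi> (norm y) * dv y) = integral {p..q} (\<lambda>r. \<psi> r * sphint dv r)"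
    by (rule integral_radial[OF a pq(1) c\<psi> zero(1) dv cont_dv])
  have 2: "(LINT y|lborel. \<psi>' (norm y) * f y) = integral {p..q} (\<lambda>r. \<psi>' r * sphint f r)"
    by (rule integral_radial[OF a pq(1) cont zero(2) f cont_f])
  show "integral {p..q} (\<lambda>r. \<psi> r * sphint dv r) + integral {p..q} (\<lambda>r. \<psi>' r * sphint f r) = 0"
    using t(1) 1 2 by simp
qed

text \<open>Testing with functions of the radius gives the divergence theorem in weak form; as both sides
  are continuous in the radius, it holds pointwise by the lemma of du Bois-Reymond.\<close>

lemma flux_derivative:
  assumes r: "a < r"
  shows "(sphint f has_real_derivative sphint dv r) (at r)"
proof -
  define p where "p = (a + r) / 2"
  define q where "q = r + 1"
  have pq: "a < p" "p < r" "r < q" "p < q" using r by (auto simp: p_def q_def)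
  let ?F = "sphint f" and ?d = "sphint dv"
  have cF: "continuous_on {a<..} ?F" and cd: "continuous_on {a<..} ?d"
    by (auto intro!: continuous_on_sphint a cont_f cont_dv)
  have sub: "{p..q} \<subseteq> {a<..}" using pq by auto
  define D where "D s = integral {p..s} ?d" for s
  have D: "(D has_real_derivative ?d s) (at s within {p..q})" if "s \<in> {p..q}" for s
    unfolding D_def by (rule integral_has_real_derivative[OF continuous_on_subset[OF cd sub] that])
  have cD: "continuous_on {p..q} D" using D by (meson DERIV_continuous_on)
  \<comment> \<open>The goal is that \<open>k\<close> is constant: then the flux is, up to a
    constant, the primitive \<open>D\<close> of \<open>sphint dv\<close>.\<close>
  define k where "k s = ?F s - D s" for s
  have ck: "continuous_on {p..q} k" unfolding k_def
    by (intro continuous_intros cD continuous_on_subset[OF cF sub])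
  define b where "b s = (max 0 (s - p))\<^sup>2 * (max 0 (q - s))\<^sup>2" for s
  \<comment> \<open>\<open>k\<close> is known to be continuous on \<open>{p..q}\<close>; clamping
    the argument extends it continuously to the line without changing products with
    \<open>b\<close>.\<close>
  define kk where "kk s = k (max p (min q s))" for s
  have ckk: "continuous_on UNIV kk" unfolding kk_def
    by (rule continuous_on_compose2[OF ck]) (use pq in \<open>auto intro!: continuous_intros\<close>)
  have cb: "continuous_on UNIV b" unfolding b_def by (intro continuous_intros)
  have bnn: "b s \<ge> 0" for s by (simp add: b_def)
  have bpos: "b s > 0" if "p < s" "s < q" for s using that by (simp add: b_def max_def)
  have b0: "b s = 0" if "s \<notin> {p..q}" for s using that by (auto simp: b_def max_def)
  have ib: "b integrable_on {p..q}" by (intro integrable_continuous_real continuous_on_subset[OF cb]) auto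
  have intb: "integral {p..q} b > 0"
  proof -
    have "integral {p..q} b = 0 \<longleftrightarrow> (\<forall>s\<in>{p..q}. b s = 0)"
      by (rule integral_eq_0_iff[OF continuous_on_subset[OF cb] pq(4)]) (use bnn in auto)
    moreover have "r \<in> {p..q}" "b r > 0" using bpos[OF pq(2,3)] pq by auto
    ultimately have "integral {p..q} b \<noteq> 0" by (metis less_irrefl)
    moreover have "integral {p..q} b \<ge> 0" by (rule integral_nonneg[OF ib]) (rule bnn)
    ultimately show ?thesis by simp
  qed
  \<comment> \<open>The mean of \<open>k\<close> with respect to the weight \<open>b\<close>. It
    gives \<beta> integral zero, so that the primitive \<psi> vanishes beyond \<open>q\<close> as
    well and is an admissible test function.\<close>
  define c where "c = integral {p..q} (\<lambda>s. b s * kk s) / integral {p..q} b"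
  define \<beta> where "\<beta> s = b s * (kk s - c)" for s
  have c\<beta>: "continuous_on UNIV \<beta>" unfolding \<beta>_def by (intro continuous_intros cb ckk)
  have \<beta>0: "\<beta> s = 0" if "s \<notin> {p..q}" for s using b0[OF that] by (simp add: \<beta>_def)
  have ibk: "(\<lambda>s. b s * kk s) integrable_on {p..q}"
    by (intro integrable_continuous_real continuous_intros continuous_on_subset[OF cb] continuous_on_subset[OF ckk]) auto
  have \<beta>int: "integral {p..q} \<beta> = 0"
  proof -
    have "integral {p..q} \<beta> = integral {p..q} (\<lambda>s. b s * kk s - b s * c)"
      by (simp add: \<beta>_def[abs_def] algebra_simps)
    also have "\<dots> = integral {p..q} (\<lambda>s. b s * kk s) - integral {p..q} b * c"
      using ibk ib by (subst Henstock_Kurzweil_Integration.integral_diff) (auto intro: integrable_on_mult_left)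
    finally show ?thesis using intb by (simp add: c_def)
  qed
  define \<psi> where "\<psi> s = integral {a..s} \<beta>" for s
  have i\<beta>: "\<beta> integrable_on {u..v}" for u v
    by (intro integrable_continuous_real continuous_on_subset[OF c\<beta>]) auto
  have \<psi>D: "(\<psi> has_real_derivative \<beta> s) (at s)" if "a < s" for s
  proof -
    have "(\<psi> has_real_derivative \<beta> s) (at s within {a..s+1})"
      unfolding \<psi>_def by (rule integral_has_real_derivative) (use that c\<beta> in \<open>auto intro: continuous_on_subset\<close>)
    then show ?thesis using that by (simp add: at_within_Icc_at)
  qed
  have z1: "\<psi> s = 0" if "s \<le> p" for s
    unfolding \<psi>_def using integral_cong[of "{a..s}" \<beta> "\<lambda>_. 0"] that by (simp add: \<beta>_def b_def)
  have \<psi>0: "\<psi> s = 0" if "s \<notin> {p<..<q}" for s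
  proof (cases "s \<le> p")
    case False
    then have s: "q \<le> s" using that by auto
    have "\<psi> s = integral {a..p} \<beta> + (integral {p..q} \<beta> + integral {q..s} \<beta>)"
      unfolding \<psi>_def using pq s i\<beta> by (simp add: Henstock_Kurzweil_Integration.integral_combine)
    moreover have "integral {a..p} \<beta> = 0" using z1[of p] by (simp add: \<psi>_def)
    moreover have "integral {q..s} \<beta> = 0"
      using integral_cong[of "{q..s}" \<beta> "\<lambda>_. 0"] by (simp add: \<beta>_def b_def)
    ultimately show ?thesis using \<beta>int by simp
  qed (rule z1)
  have T: "integral {p..q} (\<lambda>s. \<psi> s * ?d s) + integral {p..q} (\<lambda>s. \<beta> s * ?F s) = 0"
    by (rule test_function_radial[OF pq(1,4) \<psi>D]) (use c\<beta> \<psi>0 \<beta>0 in \<open>auto intro: continuous_on_subset\<close>)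
  have "((\<lambda>s. \<psi> s * D s) has_real_derivative \<psi> s * ?d s + \<beta> s * D s) (at s within {p..q})" if "s \<in> {p..q}" for s
    by (rule DERIV_mult'[OF has_field_derivative_at_within[OF \<psi>D] D[OF that]]) (use that pq in auto)
  then have ipp: "((\<lambda>s. \<psi> s * ?d s + \<beta> s * D s) has_integral (\<psi> q * D q - \<psi> p * D p)) {p..q}"
    using pq by (intro fundamental_theorem_of_calculus) (auto simp flip: has_real_derivative_iff_has_vector_derivative)
  have c\<psi>: "continuous_on {p..q} \<psi>" 
    by (rule continuous_at_imp_continuous_on) (use pq in \<open>auto intro!: DERIV_isCont[OF \<psi>D]\<close>)
  have i1: "(\<lambda>s. \<psi> s * ?d s) integrable_on {p..q}"
    by (intro integrable_continuous_real continuous_intros c\<psi> continuous_on_subset[OF cd sub])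
  have i2: "(\<lambda>s. \<beta> s * D s) integrable_on {p..q}"
    by (intro integrable_continuous_real continuous_intros cD continuous_on_subset[OF c\<beta>]) auto
  have i3: "(\<lambda>s. \<beta> s * ?F s) integrable_on {p..q}"
    by (intro integrable_continuous_real continuous_intros continuous_on_subset[OF cF sub] continuous_on_subset[OF c\<beta>]) auto
  have "integral {p..q} (\<lambda>s. \<psi> s * ?d s) + integral {p..q} (\<lambda>s. \<beta> s * D s) = 0"
    using integral_unique[OF ipp] \<psi>0 i1 i2 by (simp add: Henstock_Kurzweil_Integration.integral_add)
  then have "integral {p..q} (\<lambda>s. \<beta> s * ?F s) - integral {p..q} (\<lambda>s. \<beta> s * D s) = 0" using T by simp
  then have "integral {p..q} (\<lambda>s. \<beta> s * k s) = 0"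
    using i2 i3 by (simp add: k_def right_diff_distrib Henstock_Kurzweil_Integration.integral_diff)
  moreover have "integral {p..q} (\<lambda>s. \<beta> s * c) = 0" using \<beta>int by simp
  moreover have "(\<lambda>s. \<beta> s * k s) integrable_on {p..q}"
    by (intro integrable_continuous_real continuous_intros ck continuous_on_subset[OF c\<beta>]) auto
  ultimately have "integral {p..q} (\<lambda>s. \<beta> s * k s - \<beta> s * c) = 0"
    using i\<beta> by (subst Henstock_Kurzweil_Integration.integral_diff) (auto intro: integrable_on_mult_left)
  \<comment> \<open>As \<beta> is itself \<open>b * (k - c)\<close>, a square appears, and the
    vanishing integral forces \<open>k = c\<close> wherever \<open>b\<close> is positive.\<close>
  also have "integral {p..q} (\<lambda>s. \<beta> s * k s - \<beta> s * c) = integral {p..q} (\<lambda>s. b s * (k s - c)\<^sup>2)"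
    by (rule integral_cong) (auto simp: \<beta>_def kk_def power2_eq_square algebra_simps max_def min_def)
  finally have "integral {p..q} (\<lambda>s. b s * (k s - c)\<^sup>2) = 0" .
  moreover have "continuous_on {p..q} (\<lambda>s. b s * (k s - c)\<^sup>2)"
    by (intro continuous_intros ck continuous_on_subset[OF cb]) auto
  ultimately have z: "b s * (k s - c)\<^sup>2 = 0" if "s \<in> {p..q}" for s
    using integral_eq_0_iff[of p q "\<lambda>s. b s * (k s - c)\<^sup>2"] pq bnn that by simp
  then have kc: "?F s = D s + c" if "s \<in> {p<..<q}" for s
  proof -
    have "b s * (k s - c)\<^sup>2 = 0" "b s > 0" using bpos[of s] that z[of s] by auto
    then have "k s = c" by simp
    then show ?thesis by (simp add: k_def)
  qed
  have "((\<lambda>s. D s + c) has_real_derivative ?d r) (at r within {p..q})"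
    using D[of r] pq by (auto intro!: derivative_eq_intros)
  then have "((\<lambda>s. D s + c) has_real_derivative ?d r) (at r)"
    using pq by (simp add: at_within_Icc_at)
  then show ?thesis
    by (rule has_field_derivative_transform_within_open[where S="{p<..<q}"]) (use pq kc in auto)
qed

text \<open>By \<open>flux_derivative\<close> the flux is a primitive of \<open>sphint dv\<close>,
  which is integrable on a half-line by polar coordinates.\<close>

lemma flux_converges:
  assumes "set_integrable lborel {y. b < norm y} dv" "a \<le> b"
  shows "\<exists>m. (sphint f \<longlongrightarrow> m) at_top"
proof -
  let ?u = "\<lambda>y. indicator {y. b < norm y} y * dv y"
  have "integrable lborel ?u" using assms(1) by (simp add: set_integrable_def)
  then have i: "integrable lborel (\<lambda>r. indicator {0<..} r * sphint ?u r)" by (rule integral_polar)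
  define r0 where "r0 = b + 1"
  have r0: "r0 > 0" "r0 > b" using a assms(2) by (auto simp: r0_def)
  have "integrable lborel (\<lambda>r. indicator {r0..} r *\<^sub>R (indicator {0<..} r * sphint ?u r))"
    by (rule integrable_mult_indicator[OF _ i]) simp
  also have "(\<lambda>r. indicator {r0..} r *\<^sub>R (indicator {0<..} r * sphint ?u r)) = (\<lambda>r. indicator {r0..} r *\<^sub>R sphint dv r)"
  proof (rule ext)
    fix r
    show "indicator {r0..} r *\<^sub>R (indicator {0<..} r * sphint ?u r) = indicator {r0..} r *\<^sub>R sphint dv r"
    proof (cases "r0 \<le> r")
      case True
      have "sphint ?u r = sphint (\<lambda>y. indicator {b<..} (norm y) * dv y) r"
        by (rule arg_cong[where f="\<lambda>g. sphint g r"]) (auto simp: indicator_def)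
      also have "\<dots> = indicator {b<..} r * sphint dv r"
        using True r0 by (intro sphint_radial) auto
      finally show ?thesis using True r0 by simp
    qed simp
  qed
  finally have d: "set_integrable lborel {r0..} (sphint dv)" by (simp add: set_integrable_def)
  have eq: "set_lebesgue_integral lborel {r0..R} (sphint dv) = sphint f R - sphint f r0" if "r0 \<le> R" for R
  proof -
    have "(LINT x|lborel. indicator {r0..R} x *\<^sub>R sphint dv x) = sphint f R - sphint f r0"
    proof (rule integral_FTC_atLeastAtMost[OF that])
      show "(sphint f has_vector_derivative sphint dv x) (at x within {r0..R})" if "r0 \<le> x" "x \<le> R" for x
        using flux_derivative[of x] that r0 assms(2)
        by (auto intro: has_field_derivative_at_within simp flip: has_real_derivative_iff_has_vector_derivative)
      show "continuous_on {r0..R} (sphint dv)"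
        by (rule continuous_on_subset[OF continuous_on_sphint[OF dv a cont_dv]]) (use r0 assms(2) in auto)
    qed
    then show ?thesis by (simp add: set_lebesgue_integral_def)
  qed
  have "((\<lambda>R. set_lebesgue_integral lborel {r0..R} (sphint dv)) \<longlongrightarrow> set_lebesgue_integral lborel {r0..} (sphint dv)) at_top"
    by (rule tendsto_set_lebesgue_integral_at_top[OF _ d]) auto
  then have "((\<lambda>R. set_lebesgue_integral lborel {r0..R} (sphint dv) + sphint f r0) \<longlongrightarrow> set_lebesgue_integral lborel {r0..} (sphint dv) + sphint f r0) at_top"
    by (intro tendsto_intros)
  then have "(sphint f \<longlongrightarrow> set_lebesgue_integral lborel {r0..} (sphint dv) + sphint f r0) at_top"
    by (rule Lim_transform_eventually) (use eq in \<open>auto simp: eventually_at_top_linorder intro!: exI[of _ r0]\<close>)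
  then show ?thesis by blast
qed

end

text \<open>Polar coordinates reduce this to the convergence of the integral of
  \<open>r powr (n - 1 - p)\<close> over \<open>r \<ge> 1\<close>.\<close>

lemma integrable_norm_powr:
  assumes "p > real DIM('a::euclidean_space)"
  shows "integrable lborel (\<lambda>y::'a. indicator {y. 1 \<le> norm y} y * norm y powr (- p))"
proof (rule integrableI_nonneg)
  let ?u = "\<lambda>y::'a. ennreal (indicator {y. 1 \<le> norm y} y * norm y powr (- p))"
  define n where "n = real DIM('a)"
  define v where "v = unit_ball_vol n"
  have v: "v \<ge> 0" by (simp add: v_def n_def)
  have "(\<integral>\<^sup>+ y. ?u y \<partial>lborel) = (\<integral>\<^sup>+ r. \<integral>\<^sup>+ z. ennreal (sphere_kernel TYPE('a) r z) * ?u ((r / norm z) *\<^sub>R z) \<partial>lborel \<partial>lborel)"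
    by (rule nn_integral_polar[symmetric]) measurable
  also have "\<dots> \<le> (\<integral>\<^sup>+ r. ennreal (n * v * r powr (n - 1 - p)) * indicator {1..} r \<partial>lborel)"
  proof (rule nn_integral_mono)
    fix r :: real
    show "(\<integral>\<^sup>+ z. ennreal (sphere_kernel TYPE('a) r z) * ?u ((r / norm z) *\<^sub>R z) \<partial>lborel) \<le> ennreal (n * v * r powr (n - 1 - p)) * indicator {1..} r"
    proof (cases "r \<ge> 1")
      case True
      have "(\<integral>\<^sup>+ z. ennreal (sphere_kernel TYPE('a) r z) * ?u ((r / norm z) *\<^sub>R z) \<partial>lborel) \<le>
        (\<integral>\<^sup>+ z. ennreal (n / r * r powr (- p)) * indicator (ball 0 r) (z::'a) \<partial>lborel)"
      proof (rule nn_integral_mono)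
        fix z :: 'a
        show "ennreal (sphere_kernel TYPE('a) r z) * ?u ((r / norm z) *\<^sub>R z) \<le> ennreal (n / r * r powr (- p)) * indicator (ball 0 r) z"
          using True by (auto simp: sphere_kernel_eq n_def ennreal_mult[symmetric])
      qed
      also have "\<dots> = ennreal (n / r * r powr (- p)) * emeasure lborel (ball (0::'a) r)"
        by (rule nn_integral_cmult_indicator) simp
      also have "\<dots> = ennreal (n / r * r powr (- p) * (v * r ^ DIM('a)))"
        using True by (simp add: emeasure_ball v_def n_def ennreal_mult[symmetric])
      also have "n / r * r powr (- p) * (v * r ^ DIM('a)) = n * v * r powr (n - 1 - p)"
        using True by (simp add: n_def powr_diff powr_minus powr_realpow powr_add field_simps)
      finally show ?thesis using True by simp
    next
      case False
      then have "ennreal (sphere_kernel TYPE('a) r z) * ?u ((r / norm z) *\<^sub>R z) = 0" for z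
        by (cases "0 < r") (auto simp: sphere_kernel_def)
      then have "(\<integral>\<^sup>+ z. ennreal (sphere_kernel TYPE('a) r z) * ?u ((r / norm z) *\<^sub>R z) \<partial>lborel) = (\<integral>\<^sup>+ (z::'a). 0 \<partial>lborel)"
        by (intro nn_integral_cong)
      then show ?thesis by simp
    qed
  qed
  also have "\<dots> = ennreal (0 - (n * v * (1 powr (n - p) / (n - p))))"
  proof (rule nn_integral_FTC_atLeast)
    fix x :: real assume x: "1 \<le> x"
    show "((\<lambda>x. n * v * (x powr (n - p) / (n - p))) has_real_derivative n * v * x powr (n - 1 - p)) (at x)"
    proof -
      have "((\<lambda>x. x powr (n - p)) has_real_derivative (n - p) * x powr (n - p - 1)) (at x)"
        by (rule has_real_derivative_powr) (use x in simp)
      then have "((\<lambda>x. n * v * (x powr (n - p) / (n - p))) has_real_derivative n * v * ((n - p) * x powr (n - p - 1) / (n - p))) (at x)"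
        by (intro DERIV_cmult DERIV_cdivide)
      moreover have "n - p \<noteq> 0" "n - p - 1 = n - 1 - p" using assms by (auto simp: n_def)
      ultimately show ?thesis by simp
    qed
    show "0 \<le> n * v * x powr (n - 1 - p)" using v by (simp add: n_def)
  next
    have "((\<lambda>x. x powr (n - p)) \<longlongrightarrow> 0) at_top"
      by (rule tendsto_neg_powr) (use assms in \<open>auto simp: n_def filterlim_ident\<close>)
    then show "((\<lambda>x. n * v * (x powr (n - p) / (n - p))) \<longlongrightarrow> 0) at_top"
      using tendsto_mult_right_zero[OF tendsto_divide_zero] by blast
  qed measurable
  also have "\<dots> < \<infinity>" by simp
  finally show "(\<integral>\<^sup>+ y. ?u y \<partial>lborel) < \<infinity>" .
qed auto

section \<open>Asymptotically flat Ricci flow in asymptotic coordinates\<close>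

abbreviation "ax \<equiv> (\<lambda>i::'n::finite. axis i (1::real))"

lemma christoffel_eq: "christoffel G k i j y = Chr ax G k i j y"
  by (simp add: christoffel_def Chr_def pd_eq_dd)

lemma ricci_eq: "ricci G i j y = Rc ax G y $ i $ j"
proof -
  have "christoffel G k i j = Chr ax G k i j" for k i j by (rule ext) (rule christoffel_eq)
  then show ?thesis
    by (simp add: ricci_def riemann_def Rc_def Om_def dM_nth matrix_mult_nth Gam_def pd_eq_dd
        sum_subtractf add_diff_eq)
qed

lemma scal_eq: "scal G y = Sc ax G y"
  by (simp add: scal_def Sc_def ricci_eq)

section \<open>Matrices close to the identity\<close>

lemma abs_quadratic_form_le:
  fixes B :: "real^'n^'n"
  assumes "\<And>i j. \<bar>B $ i $ j\<bar> \<le> p"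
  shows "\<bar>v \<bullet> (B *v v)\<bar> \<le> (real CARD('n))\<^sup>2 * p * (norm v)\<^sup>2"
proof -
  have "v \<bullet> (B *v v) = (\<Sum>i\<in>UNIV. \<Sum>j\<in>UNIV. v $ i * (B $ i $ j * v $ j))"
    by (simp add: inner_vec_def matrix_vector_mult_def sum_distrib_left)
  also have "\<bar>\<dots>\<bar> \<le> (\<Sum>i\<in>(UNIV::'n set). \<Sum>j\<in>(UNIV::'n set). p * (norm v)\<^sup>2)"
  proof (intro order_trans[OF sum_abs] sum_mono)
    fix i j
    have "\<bar>v $ i * (B $ i $ j * v $ j)\<bar> = \<bar>v $ i\<bar> * \<bar>v $ j\<bar> * \<bar>B $ i $ j\<bar>" by (simp add: abs_mult)
    also have "\<dots> \<le> (norm v * norm v) * p"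
      using assms[of i j] by (intro mult_mono component_le_norm_cart) auto
    finally show "\<bar>v $ i * (B $ i $ j * v $ j)\<bar> \<le> p * (norm v)\<^sup>2" by (simp add: power2_eq_square mult.commute)
  qed
  finally show ?thesis by (simp add: power2_eq_square)
qed

text \<open>The quadratic form of \<open>A\<close> is at least half that of the identity. For a
  column \<open>v\<close> of the inverse, \<open>A *v v\<close> is a unit vector, and Cauchy-Schwarz
  yields \<open>norm v \<le> 2\<close>.\<close>

lemma near_identity_inverse:
  fixes A :: "real^'n^'n"
  assumes close: "\<And>i j. \<bar>A $ i $ j - mat 1 $ i $ j\<bar> \<le> p" and p: "(real CARD('n))\<^sup>2 * p \<le> 1 / 2"
  shows "\<bar>matrix_inv A $ i $ j\<bar> \<le> 2"
proof -
  have lower: "v \<bullet> (A *v v) \<ge> (norm v)\<^sup>2 / 2" for v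
  proof -
    have "\<bar>v \<bullet> ((A - mat 1) *v v)\<bar> \<le> (real CARD('n))\<^sup>2 * p * (norm v)\<^sup>2"
      by (rule abs_quadratic_form_le) (use close in simp)
    also have "\<dots> \<le> 1 / 2 * (norm v)\<^sup>2" by (rule mult_right_mono[OF p]) simp
    finally have "\<bar>v \<bullet> (A *v v) - v \<bullet> v\<bar> \<le> (norm v)\<^sup>2 / 2"
      by (simp add: matrix_vector_mult_diff_rdistrib inner_diff_right)
    moreover have "v \<bullet> v = (norm v)\<^sup>2" by (simp add: power2_norm_eq_inner)
    ultimately show ?thesis by linarith
  qed
  have inv: "A ** matrix_inv A = mat 1"
  proof (rule posdef_inverse(1))
    fix v :: "real^'n" assume "v \<noteq> 0"
    then show "v \<bullet> (A *v v) > 0" using lower[of v] by (smt (verit) half_gt_zero zero_less_norm_iff zero_less_power)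
  qed
  define v where "v = matrix_inv A *v axis j 1"
  have "A *v v = axis j 1" by (simp add: v_def matrix_vector_mul_assoc inv)
  then have "(norm v)\<^sup>2 / 2 \<le> v \<bullet> axis j 1" using lower[of v] by simp
  also have "\<dots> \<le> norm v * norm (axis j 1 :: real^'n)" by (rule norm_cauchy_schwarz)
  finally have "norm v * norm v \<le> 2 * norm v" by (simp add: power2_eq_square norm_axis_1)
  then have "norm v \<le> 2" by (cases "norm v = 0") auto
  moreover have "\<bar>v $ i\<bar> \<le> norm v" by (rule component_le_norm_cart)
  moreover have "v $ i = matrix_inv A $ i $ j"
    by (simp add: v_def matrix_vector_mult_basis column_def)
  ultimately show ?thesis by simp
qed

lemma abs_det_le:
  fixes A :: "real^'n^'n"
  assumes "\<And>i j. \<bar>A $ i $ j\<bar> \<le> c"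
  shows "\<bar>det A\<bar> \<le> fact CARD('n) * c ^ CARD('n)"
proof -
  have "\<bar>det A\<bar> \<le> (\<Sum>p\<in>{p. p permutes (UNIV::'n set)}. \<bar>of_int (sign p) * (\<Prod>i\<in>UNIV. A $ i $ p i)\<bar>)"
    unfolding det_def by (rule sum_abs)
  also have "\<dots> \<le> (\<Sum>p\<in>{p. p permutes (UNIV::'n set)}. c ^ CARD('n))"
  proof (rule sum_mono)
    fix p :: "'n \<Rightarrow> 'n"
    have "\<bar>of_int (sign p) * (\<Prod>i\<in>UNIV. A $ i $ p i)\<bar> = (\<Prod>i\<in>UNIV. \<bar>A $ i $ p i\<bar>)"
      by (simp add: abs_mult abs_prod sign_def)
    also have "\<dots> \<le> (\<Prod>i\<in>(UNIV::'n set). c)" by (rule prod_mono) (use assms in auto)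
    finally show "\<bar>of_int (sign p) * (\<Prod>i\<in>UNIV. A $ i $ p i)\<bar> \<le> c ^ CARD('n)" by simp
  qed
  also have "\<dots> = fact CARD('n) * c ^ CARD('n)"
    by (simp add: card_permutations[of UNIV])
  finally show ?thesis .
qed

text \<open>The flow seen in the asymptotic chart. Decay is assumed from radius 2 on, since there
  the weight is \<open>norm y\<close>. The condition \<open>2 * \<delta> + 2 > real CARD('n)\<close>
  is the lower bound on \<delta> in the form in which it makes
  \<open>norm y powr (- (2 * \<delta> + 2))\<close> integrable at infinity.\<close>

locale af_flow =
  fixes T \<delta> C0 :: real and G :: "real \<Rightarrow> real^'n::finite \<Rightarrow> real^'n^'n"
  assumes T: "T > 0" and \<delta>: "\<delta> > 0" "2 * \<delta> + 2 > real CARD('n)"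
    and smooth_joint: "smooth_on ({0..T} \<times> {y. 1 < norm y}) (\<lambda>(t, y). G t y)"
    and smooth_slice: "\<And>t. t \<in> {0..T} \<Longrightarrow> msmooth {y. 1 < norm y} (G t)"
    and G_sym: "\<And>t y. t \<in> {0..T} \<Longrightarrow> 1 < norm y \<Longrightarrow> transpose (G t y) = G t y"
    and G_pos: "\<And>t y v. t \<in> {0..T} \<Longrightarrow> 1 < norm y \<Longrightarrow> v \<noteq> 0 \<Longrightarrow> v \<bullet> (G t y *v v) > 0"
    and ricci: "\<And>t y i j. t \<in> {0..T} \<Longrightarrow> 1 < norm y \<Longrightarrow>
        ((\<lambda>s. G s y $ i $ j) has_real_derivative - 2 * Rc ax (G t) y $ i $ j) (at t within {0..T})"
    and decay0: "\<And>t y i j. t \<in> {0..T} \<Longrightarrow> 2 \<le> norm y \<Longrightarrow> \<bar>G t y $ i $ j - mat 1 $ i $ j\<bar> \<le> C0 * norm y powr (- \<delta>)"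
    and decay1: "\<And>t y i j k. t \<in> {0..T} \<Longrightarrow> 2 \<le> norm y \<Longrightarrow>
        \<bar>dd (ax k) (\<lambda>z. G t z $ i $ j) y\<bar> \<le> C0 * norm y powr (- (\<delta> + 1))"
    and decay2: "\<And>t y i j k l. t \<in> {0..T} \<Longrightarrow> 2 \<le> norm y \<Longrightarrow>
        \<bar>dd (ax l) (dd (ax k) (\<lambda>z. G t z $ i $ j)) y\<bar> \<le> C0 * norm y powr (- (\<delta> + 2))"
begin

abbreviation "E \<equiv> {y::real^'n. 1 < norm y}"

lemma frame: "t \<in> {0..T} \<Longrightarrow> metric_frame E (G t)"
  by unfold_locales (use open_exterior smooth_slice G_sym G_pos in auto)

definition "Hh t y = matrix_inv (G t y)"
definition "Lm t a y = (\<chi> l k. (dd (ax a) (\<lambda>z. G t z $ k $ l) y + dd (ax k) (\<lambda>z. G t z $ a $ l) y - dd (ax l) (\<lambda>z. G t z $ a $ k) y) / 2)"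
definition "Mm t y = Hh t y ** Rc ax (G t) y"
abbreviation "Gm t a y \<equiv> Gam ax (G t) a y"
abbreviation "Rm t y \<equiv> Rc ax (G t) y"
abbreviation "Sm t y \<equiv> Sc ax (G t) y"

lemma frame_defs:
  assumes t: "t \<in> {0..T}"
  shows "metric_frame.H (G t) = Hh t" "metric_frame.M ax (G t) = Mm t" "metric_frame.Lam ax (G t) a = Lm t a"
proof -
  interpret metric_frame E ax "G t" by (rule frame[OF t])
  show 1: "H = Hh t" by (simp add: fun_eq_iff H_def Hh_def)
  show "M = Mm t" by (simp add: fun_eq_iff M_def Mm_def 1)
  show "Lam a = Lm t a" by (simp add: fun_eq_iff Lam_def Lm_def)
qed

lemmas slice_smooth_H = metric_frame.smooth_H[OF frame, unfolded frame_defs]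
lemmas slice_smooth_M = metric_frame.smooth_M[where e=ax, OF frame, unfolded frame_defs]
lemmas slice_smooth_Gam = metric_frame.smooth_Gam[where e=ax, OF frame]
lemmas slice_smooth_Rc = metric_frame.smooth_Rc[where e=ax, OF frame]
lemmas slice_smooth_Sc = metric_frame.smooth_Sc[where e=ax, OF frame]

text \<open>The second entry solves \<open>n^2 * max 1 C0 * r powr (- \<delta>) = 1 / 2\<close> for
  \<open>r\<close>, so that \<open>near_identity_inverse\<close> applies from this radius on. The 1
  keeps the base of the power positive.\<close>

definition r0 :: real where
  "r0 = max 2 ((2 * (real CARD('n))\<^sup>2 * max 1 C0) powr (1 / \<delta>))"

lemma r0: "r0 \<ge> 2" by (simp add: r0_def)

lemma r0_small:
  assumes "r0 \<le> norm y" shows "(real CARD('n))\<^sup>2 * (C0 * norm y powr (- \<delta>)) \<le> 1 / 2"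
proof -
  define c where "c = (real CARD('n))\<^sup>2 * max 1 C0"
  have pos: "c > 0" unfolding c_def by (intro mult_pos_pos) (auto simp: less_max_iff_disj)
  have "(2 * c) powr (1 / \<delta>) \<le> norm y" using assms by (simp add: r0_def c_def mult.assoc)
  then have "((2 * c) powr (1 / \<delta>)) powr \<delta> \<le> norm y powr \<delta>"
    by (rule powr_mono2[rotated 2]) (use \<delta> in auto)
  then have c: "2 * c \<le> norm y powr \<delta>" using \<delta> pos by (simp add: powr_powr)
  have y: "norm y powr \<delta> > 0" using c pos by linarith
  have "(real CARD('n))\<^sup>2 * C0 \<le> c" unfolding c_def by (intro mult_left_mono) auto
  then have "(real CARD('n))\<^sup>2 * C0 * norm y powr (- \<delta>) \<le> c * norm y powr (- \<delta>)"
    by (rule mult_right_mono) simp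
  also have "\<dots> = c / norm y powr \<delta>" by (simp add: powr_minus divide_inverse)
  also have "\<dots> \<le> c / (2 * c)" using c y pos by (intro divide_left_mono) auto
  also have "\<dots> = 1 / 2" using pos by simp
  finally show ?thesis by (simp add: mult.assoc)
qed

text \<open>\<open>f = O(|y|^(-p))\<close> uniformly in time. With the constant hidden, decay rates
  of composite expressions follow by rule application.\<close>

definition dec :: "real \<Rightarrow> (real \<Rightarrow> real^'n \<Rightarrow> real) \<Rightarrow> bool" where
  "dec p f \<longleftrightarrow> (\<exists>C. \<forall>t\<in>{0..T}. \<forall>y. r0 \<le> norm y \<longrightarrow> \<bar>f t y\<bar> \<le> C * norm y powr (- p))"

lemma decI: "(\<And>t y. t \<in> {0..T} \<Longrightarrow> r0 \<le> norm y \<Longrightarrow> \<bar>f t y\<bar> \<le> C * norm y powr (- p)) \<Longrightarrow> dec p f"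
  unfolding dec_def by blast

lemma decE:
  assumes "dec p f"
  obtains C where "C > 0" "\<And>t y. t \<in> {0..T} \<Longrightarrow> r0 \<le> norm y \<Longrightarrow> \<bar>f t y\<bar> \<le> C * norm y powr (- p)"
proof -
  obtain C where C: "\<And>t y. t \<in> {0..T} \<Longrightarrow> r0 \<le> norm y \<Longrightarrow> \<bar>f t y\<bar> \<le> C * norm y powr (- p)"
    using assms unfolding dec_def by blast
  have "\<bar>f t y\<bar> \<le> max 1 C * norm y powr (- p)" if "t \<in> {0..T}" "r0 \<le> norm y" for t y
    using C[OF that] by (rule order_trans) (simp add: mult_right_mono)
  then show ?thesis using that[of "max 1 C"] by auto
qed

lemma dec_cong:
  assumes "\<And>t y. t \<in> {0..T} \<Longrightarrow> 1 < norm y \<Longrightarrow> f t y = g t y"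
  shows "dec p f \<longleftrightarrow> dec p g"
proof -
  have "dec p g" if df: "dec p f" and eq: "\<And>t y. t \<in> {0..T} \<Longrightarrow> 1 < norm y \<Longrightarrow> f t y = g t y" for f g
  proof -
    obtain C where C: "C > 0" "\<And>t y. t \<in> {0..T} \<Longrightarrow> r0 \<le> norm y \<Longrightarrow> \<bar>f t y\<bar> \<le> C * norm y powr (- p)"
      using decE[OF df] by blast
    show ?thesis
    proof (rule decI)
      fix t and y :: "real^'n" assume ty: "t \<in> {0..T}" "r0 \<le> norm y"
      then show "\<bar>g t y\<bar> \<le> C * norm y powr (- p)" using C(2)[OF ty] eq[of t y] r0 by simp
    qed
  qed
  from this[of f g] this[of g f] show ?thesis using assms by metis
qed

lemma dec_mono: assumes "dec p f" "q \<le> p" shows "dec q f"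
proof -
  obtain C where C: "C > 0" "\<And>t y. t \<in> {0..T} \<Longrightarrow> r0 \<le> norm y \<Longrightarrow> \<bar>f t y\<bar> \<le> C * norm y powr (- p)"
    using decE[OF assms(1)] by blast
  show ?thesis
  proof (rule decI)
    fix t and y :: "real^'n" assume "t \<in> {0..T}" "r0 \<le> norm y"
    then have "\<bar>f t y\<bar> \<le> C * norm y powr (- p)" by (rule C(2))
    also have "\<dots> \<le> C * norm y powr (- q)"
      using C(1) r0 \<open>r0 \<le> norm y\<close> assms(2) by (intro mult_left_mono powr_mono) auto
    finally show "\<bar>f t y\<bar> \<le> C * norm y powr (- q)" .
  qed
qed

lemma dec_add: assumes "dec p f" "dec p g" shows "dec p (\<lambda>t y. f t y + g t y)"
proof -
  obtain C D where C: "\<And>t y. t \<in> {0..T} \<Longrightarrow> r0 \<le> norm y \<Longrightarrow> \<bar>f t y\<bar> \<le> C * norm y powr (- p)"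
    and D: "\<And>t y. t \<in> {0..T} \<Longrightarrow> r0 \<le> norm y \<Longrightarrow> \<bar>g t y\<bar> \<le> D * norm y powr (- p)"
    using assms unfolding dec_def by blast
  show ?thesis
    by (rule decI[where C="C + D"]) (use C D in \<open>fastforce simp: distrib_right intro: order_trans[OF abs_triangle_ineq] add_mono\<close>)
qed

lemma dec_uminus: "dec p f \<Longrightarrow> dec p (\<lambda>t y. - f t y)"
  unfolding dec_def by simp

lemma dec_diff: "dec p f \<Longrightarrow> dec p g \<Longrightarrow> dec p (\<lambda>t y. f t y - g t y)"
  using dec_add[OF _ dec_uminus, of p f g] by simp

lemma dec_mult: assumes "dec p f" "dec q g" shows "dec (p + q) (\<lambda>t y. f t y * g t y)"
proof -
  obtain C where C: "C > 0" "\<And>t y. t \<in> {0..T} \<Longrightarrow> r0 \<le> norm y \<Longrightarrow> \<bar>f t y\<bar> \<le> C * norm y powr (- p)"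
    using decE[OF assms(1)] by blast
  obtain D where D: "D > 0" "\<And>t y. t \<in> {0..T} \<Longrightarrow> r0 \<le> norm y \<Longrightarrow> \<bar>g t y\<bar> \<le> D * norm y powr (- q)"
    using decE[OF assms(2)] by blast
  show ?thesis
  proof (rule decI[where C="C * D"])
    fix t and y :: "real^'n" assume ty: "t \<in> {0..T}" "r0 \<le> norm y"
    have "\<bar>f t y * g t y\<bar> \<le> (C * norm y powr (- p)) * (D * norm y powr (- q))"
      unfolding abs_mult using C D ty by (intro mult_mono) auto
    also have "\<dots> = C * D * norm y powr (- (p + q))"
      by (simp add: powr_add[symmetric] mult_ac)
    finally show "\<bar>f t y * g t y\<bar> \<le> C * D * norm y powr (- (p + q))" .
  qed
qed

lemma dec_const: "dec 0 (\<lambda>t y. c)"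
  by (rule decI[where C="\<bar>c\<bar>"]) (use r0 in auto)

lemma dec_zero: "dec p (\<lambda>t y. 0)"
  by (rule decI[where C=0]) simp

lemma dec_cmult: "dec p f \<Longrightarrow> dec p (\<lambda>t y. c * f t y)"
  using dec_mult[OF dec_const] by fastforce

lemma dec_divide: "dec p f \<Longrightarrow> dec p (\<lambda>t y. f t y / c)"
  using dec_cmult[of p f "inverse c"] by (simp add: divide_inverse mult.commute)

lemma dec_sum: "(\<And>i. i \<in> I \<Longrightarrow> dec p (f i)) \<Longrightarrow> dec p (\<lambda>t y. \<Sum>i\<in>I. f i t y)"
  by (induction I rule: infinite_finite_induct) (auto intro: dec_zero dec_add)

lemma dec_matrix_mult:
  fixes A B :: "real \<Rightarrow> real^'n \<Rightarrow> real^'n^'n"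
  assumes "\<And>i j. dec p (\<lambda>t y. A t y $ i $ j)" "\<And>i j. dec q (\<lambda>t y. B t y $ i $ j)" "r \<le> p + q"
  shows "dec r (\<lambda>t y. (A t y ** B t y) $ i $ j)"
  unfolding matrix_mult_nth by (intro dec_sum dec_mono[OF dec_mult[OF assms(1,2)] assms(3)])

section \<open>Decay of the metric, the connection and the curvature\<close>

lemma dec_G: "dec \<delta> (\<lambda>t y. G t y $ i $ j - mat 1 $ i $ j)"
  by (rule decI[where C=C0]) (use decay0 r0 in auto)

lemma dec_dG: "dec (\<delta> + 1) (\<lambda>t y. dd (ax k) (\<lambda>z. G t z $ i $ j) y)"
  by (rule decI[where C=C0]) (use decay1 r0 in auto)

lemma dec_ddG: "dec (\<delta> + 2) (\<lambda>t y. dd (ax l) (dd (ax k) (\<lambda>z. G t z $ i $ j)) y)"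
  by (rule decI[where C=C0]) (use decay2 r0 in auto)

lemma Hh_bound: assumes "t \<in> {0..T}" "r0 \<le> norm y" shows "\<bar>Hh t y $ i $ j\<bar> \<le> 2"
  unfolding Hh_def
  by (rule near_identity_inverse[OF decay0[OF assms(1)] r0_small[OF assms(2)]]) (use assms r0 in auto)

lemma dec_H: "dec 0 (\<lambda>t y. Hh t y $ i $ j)"
  by (rule decI[where C=2]) (use Hh_bound r0 in auto)

lemma Hh_inverse:
  assumes "t \<in> {0..T}" "1 < norm y" shows "G t y ** Hh t y = mat 1" "Hh t y ** G t y = mat 1"
  using metric_frame.GH[OF frame[OF assms(1)], of y] assms by (auto simp: frame_defs)

lemma dec_H_minus: "dec \<delta> (\<lambda>t y. Hh t y $ i $ j - mat 1 $ i $ j)"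
proof -
  have key: "Hh t y - mat 1 = - (Hh t y ** (G t y - mat 1))" if "t \<in> {0..T}" "1 < norm y" for t y
    by (simp add: matrix_mult_distribs Hh_inverse(2)[OF that])
  then have eq: "Hh t y $ i $ j - mat 1 $ i $ j = - ((Hh t y ** (G t y - mat 1)) $ i $ j)" if "t \<in> {0..T}" "1 < norm y" for t y
    using arg_cong[OF key[OF that], of "\<lambda>A. A $ i $ j"] by simp
  have "dec \<delta> (\<lambda>t y. - ((Hh t y ** (G t y - mat 1)) $ i $ j))"
    by (intro dec_uminus dec_matrix_mult[OF dec_H]) (auto intro: dec_G)
  then show ?thesis using eq by (subst dec_cong) auto
qed

lemma dec_dH: "dec (\<delta> + 1) (\<lambda>t y. dM (ax k) (Hh t) y $ i $ j)"
proof -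
  have eq: "dM (ax k) (Hh t) y $ i $ j = - ((Hh t y ** dM (ax k) (G t) y ** Hh t y) $ i $ j)"
    if "t \<in> {0..T}" "1 < norm y" for t y
    using metric_frame.dM_H_general[OF frame[OF that(1)], of y "ax k"] that by (simp add: frame_defs)
  have "dec (\<delta> + 1) (\<lambda>t y. - ((Hh t y ** dM (ax k) (G t) y ** Hh t y) $ i $ j))"
    by (intro dec_uminus dec_matrix_mult[OF dec_matrix_mult[OF dec_H] dec_H]) (auto simp: dM_nth intro: dec_dG)
  then show ?thesis using eq by (subst dec_cong) auto
qed

lemma dec_Lm: "dec (\<delta> + 1) (\<lambda>t y. Lm t a y $ i $ j)"
  unfolding Lm_def by (simp, intro dec_divide dec_add dec_diff dec_dG)

lemma dM_Lm:
  assumes "t \<in> {0..T}" "1 < norm y"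
  shows "dM (ax b) (Lm t a) y $ l $ k = (dd (ax b) (dd (ax a) (\<lambda>z. G t z $ k $ l)) y
     + dd (ax b) (dd (ax k) (\<lambda>z. G t z $ a $ l)) y - dd (ax b) (dd (ax l) (\<lambda>z. G t z $ a $ k)) y) / 2"
proof -
  have yE: "y \<in> E" using assms(2) by simp
  note sm = msmoothD[OF smooth_slice[OF assms(1)]]
  show ?thesis
    by (simp add: dM_nth Lm_def dd_divide_const[OF open_exterior yE] dd_diff[OF open_exterior yE]
        dd_add[OF open_exterior yE] smooth sm open_exterior)
qed

lemma dec_dLm: "dec (\<delta> + 2) (\<lambda>t y. dM (ax b) (Lm t a) y $ l $ k)"
  by (subst dec_cong[OF dM_Lm], assumption, assumption) (intro dec_divide dec_add dec_diff dec_ddG)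

lemma Gm_eq: "t \<in> {0..T} \<Longrightarrow> Gm t a y = Hh t y ** Lm t a y"
  using metric_frame.Gam_eq[where e=ax, OF frame] by (simp add: frame_defs)

lemma dec_Gm: "dec (\<delta> + 1) (\<lambda>t y. Gm t a y $ i $ j)"
  by (subst dec_cong[OF arg_cong[OF Gm_eq, of _ "\<lambda>A. A $ i $ j"]], assumption)
     (rule dec_matrix_mult[OF dec_H dec_Lm], simp)

lemma dM_Gm:
  assumes "t \<in> {0..T}" "1 < norm y"
  shows "dM (ax b) (Gam ax (G t) a) y = dM (ax b) (Hh t) y ** Lm t a y + Hh t y ** dM (ax b) (Lm t a) y"
proof -
  interpret metric_frame E ax "G t" by (rule frame[OF assms(1)])
  have "Gam ax (G t) a = (\<lambda>y. H y ** Lam a y)" by (simp add: Gam_eq fun_eq_iff)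
  then show ?thesis
    using dM_mult[OF open_U _ smooth_H smooth_Lam, of y "ax b" a] assms by (simp add: frame_defs)
qed

lemma dec_dGm: "dec (\<delta> + 2) (\<lambda>t y. dM (ax b) (Gam ax (G t) a) y $ i $ j)"
proof -
  have "dec (\<delta> + 2) (\<lambda>t y. (dM (ax b) (Hh t) y ** Lm t a y + Hh t y ** dM (ax b) (Lm t a) y) $ i $ j)"
    using \<delta> by (simp, intro dec_add dec_matrix_mult[OF dec_dH dec_Lm] dec_matrix_mult[OF dec_H dec_dLm]) auto
  then show ?thesis by (subst dec_cong[OF arg_cong[OF dM_Gm, of _ _ "\<lambda>A. A $ i $ j"]]) auto
qed

lemma dec_Om: "dec (\<delta> + 2) (\<lambda>t y. Om ax (G t) a b y $ i $ j)"
  unfolding Om_def using \<delta>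
  by (simp, intro dec_add dec_diff dec_dGm dec_matrix_mult[OF dec_Gm dec_Gm]) auto

lemma dec_R: "dec (\<delta> + 2) (\<lambda>t y. Rm t y $ i $ j)"
  unfolding Rc_def by (simp, intro dec_sum dec_Om)

lemma dec_M: "dec (\<delta> + 2) (\<lambda>t y. Mm t y $ i $ j)"
  unfolding Mm_def by (rule dec_matrix_mult[OF dec_H dec_R]) simp

lemma dec_S: "dec (\<delta> + 2) (\<lambda>t y. Sm t y)"
proof -
  have "dec (0 + (\<delta> + 2)) (\<lambda>t y. \<Sum>i\<in>UNIV. \<Sum>j\<in>UNIV. Hh t y $ i $ j * Rm t y $ i $ j)"
    by (intro dec_sum dec_mult dec_H dec_R)
  then show ?thesis by (simp add: Sc_def Hh_def)
qed

text \<open>Raising the index with \<open>Hh\<close> instead of the identity costs a relative error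
  of order \<delta>, on top of the order \<open>\<delta> + 2\<close> of Ricci.\<close>

lemma dec_M_minus_R: "dec (2 * \<delta> + 2) (\<lambda>t y. Mm t y $ i $ j - Rm t y $ i $ j)"
proof -
  have key: "Mm t y - Rm t y = (Hh t y - mat 1) ** Rm t y" for t y
    by (simp add: Mm_def matrix_mult_distribs)
  have eq: "Mm t y $ i $ j - Rm t y $ i $ j = ((Hh t y - mat 1) ** Rm t y) $ i $ j" for t y
    using arg_cong[OF key[of t y], of "\<lambda>A. A $ i $ j"] by simp
  show ?thesis unfolding eq
    by (rule dec_matrix_mult[OF _ dec_R, of \<delta>]) (auto intro: dec_H_minus)
qed

lemma dec_S_minus_trace: "dec (2 * \<delta> + 2) (\<lambda>t y. Sm t y - trace (Rm t y))"
proof -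
  have "Sm t y - trace (Rm t y) = (\<Sum>i\<in>UNIV. Mm t y $ i $ i - Rm t y $ i $ i)" if "t \<in> {0..T}" "1 < norm y" for t y
    using metric_frame.S_eq[where e=ax, OF frame[OF that(1)], of y] that by (simp add: frame_defs trace_def sum_subtractf)
  moreover have "dec (2 * \<delta> + 2) (\<lambda>t y. \<Sum>i\<in>UNIV. Mm t y $ i $ i - Rm t y $ i $ i)"
    by (intro dec_sum dec_M_minus_R)
  ultimately show ?thesis by (subst dec_cong) auto
qed

definition "divV t y = (\<Sum>i\<in>UNIV. \<Sum>j\<in>UNIV. dd (ax i) (dd (ax j) (\<lambda>z. G t z $ i $ j)) y - dd (ax i) (dd (ax i) (\<lambda>z. G t z $ j $ j)) y)"

text \<open>At the Euclidean metric the scalar curvature linearises to the divergence of the mass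
  integrand. The rest is quadratic: two first derivatives of the metric, or metric minus identity
  times second derivatives, both of order \<open>2 * \<delta> + 2\<close>.\<close>

lemma dec_S_minus_div: "dec (2 * \<delta> + 2) (\<lambda>t y. Sm t y - divV t y)"
proof -
  \<comment> \<open>The trace of the linearised curvature is exactly \<open>divV\<close>; the second
    derivatives collapse by the symmetry of \<open>G\<close> and because derivatives
    commute.\<close>
  have lin: "(\<Sum>j\<in>UNIV. \<Sum>i\<in>UNIV. dM (ax i) (Lm t j) y $ i $ j - dM (ax j) (Lm t i) y $ i $ j) = divV t y"
    if ty: "t \<in> {0..T}" "1 < norm y" for t y
  proof -
    let ?d = "\<lambda>a b i j. dd (ax a) (dd (ax b) (\<lambda>z. G t z $ i $ j)) y"
    have s: "?d a b i j = ?d a b j i" for a b i j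
    proof (rule dd_cong[of E])
      fix x assume "x \<in> E"
      then show "dd (ax b) (\<lambda>z. G t z $ i $ j) x = dd (ax b) (\<lambda>z. G t z $ j $ i) x"
        by (intro dd_cong[of E] open_exterior) (use metric_frame.G_sym[OF frame[OF ty(1)]] in auto)
    qed (use ty open_exterior in auto)
    have c: "?d a b i j = ?d b a i j" for a b i j
      by (rule dd_commute[of E]) (use ty open_exterior msmoothD[OF smooth_slice[OF ty(1)]] in auto)
    have "dM (ax i) (Lm t j) y $ i $ j - dM (ax j) (Lm t i) y $ i $ j = ?d i j i j - ?d i i j j / 2 - ?d j j i i / 2" for i j
      unfolding dM_Lm[OF ty] using s[of i j j i] s[of j i j i] by (simp add: field_simps)
    then have "(\<Sum>j\<in>UNIV. \<Sum>i\<in>UNIV. dM (ax i) (Lm t j) y $ i $ j - dM (ax j) (Lm t i) y $ i $ j) =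
      (\<Sum>j\<in>UNIV. \<Sum>i\<in>UNIV. ?d i j i j) - (\<Sum>j\<in>UNIV. \<Sum>i\<in>UNIV. ?d i i j j) / 2 - (\<Sum>j\<in>UNIV. \<Sum>i\<in>UNIV. ?d j j i i) / 2"
      by (simp add: sum_subtractf sum_divide_distrib)
    also have "(\<Sum>j\<in>UNIV. \<Sum>i\<in>UNIV. ?d j j i i) = (\<Sum>j\<in>UNIV. \<Sum>i\<in>UNIV. ?d i i j j)" by (rule sum.swap)
    also have "(\<Sum>j\<in>UNIV. \<Sum>i\<in>UNIV. ?d i j i j) = (\<Sum>i\<in>UNIV. \<Sum>j\<in>UNIV. ?d i j i j)" by (rule sum.swap)
    also have "(\<Sum>j\<in>UNIV. \<Sum>i\<in>UNIV. ?d i i j j) = (\<Sum>i\<in>UNIV. \<Sum>j\<in>UNIV. ?d i i j j)" by (rule sum.swap)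
    finally show ?thesis by (simp add: divV_def sum_subtractf)
  qed
  have dGL: "dec (2 * \<delta> + 2) (\<lambda>t y. dM (ax b) (Gam ax (G t) a) y $ i $ j - dM (ax b) (Lm t a) y $ i $ j)" for a b i j
  proof -
    have key: "dM (ax b) (Gam ax (G t) a) y - dM (ax b) (Lm t a) y =
      dM (ax b) (Hh t) y ** Lm t a y + (Hh t y - mat 1) ** dM (ax b) (Lm t a) y" if "t \<in> {0..T}" "1 < norm y" for t y
      by (simp add: dM_Gm[OF that] matrix_mult_distribs)
    then have eq: "dM (ax b) (Gam ax (G t) a) y $ i $ j - dM (ax b) (Lm t a) y $ i $ j =
      (dM (ax b) (Hh t) y ** Lm t a y) $ i $ j + ((Hh t y - mat 1) ** dM (ax b) (Lm t a) y) $ i $ j" if "t \<in> {0..T}" "1 < norm y" for t y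
      using arg_cong[OF key[OF that], of "\<lambda>A. A $ i $ j"] by simp
    have "dec (2 * \<delta> + 2) (\<lambda>t y. (dM (ax b) (Hh t) y ** Lm t a y) $ i $ j + ((Hh t y - mat 1) ** dM (ax b) (Lm t a) y) $ i $ j)"
      by (intro dec_add dec_matrix_mult[OF dec_dH dec_Lm] dec_matrix_mult[OF _ dec_dLm, of \<delta>]) (auto intro: dec_H_minus)
    then show ?thesis using eq by (subst dec_cong) auto
  qed
  have "trace (Rm t y) - divV t y = (\<Sum>j\<in>UNIV. \<Sum>i\<in>UNIV.
      (dM (ax i) (Gam ax (G t) j) y $ i $ j - dM (ax i) (Lm t j) y $ i $ j) -
      (dM (ax j) (Gam ax (G t) i) y $ i $ j - dM (ax j) (Lm t i) y $ i $ j) +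
      (Gm t i y ** Gm t j y) $ i $ j - (Gm t j y ** Gm t i y) $ i $ j)" if ty: "t \<in> {0..T}" "1 < norm y" for t y
    unfolding lin[OF ty, symmetric] trace_def Rc_def Om_def by (simp add: sum_subtractf sum.distrib)
  moreover have "dec (2 * \<delta> + 2) (\<lambda>t y. \<Sum>j\<in>UNIV. \<Sum>i\<in>UNIV.
      (dM (ax i) (Gam ax (G t) j) y $ i $ j - dM (ax i) (Lm t j) y $ i $ j) -
      (dM (ax j) (Gam ax (G t) i) y $ i $ j - dM (ax j) (Lm t i) y $ i $ j) +
      (Gm t i y ** Gm t j y) $ i $ j - (Gm t j y ** Gm t i y) $ i $ j)"
    by (intro dec_sum dec_diff dec_add dGL dec_matrix_mult[OF dec_Gm dec_Gm]) auto
  ultimately have "dec (2 * \<delta> + 2) (\<lambda>t y. trace (Rm t y) - divV t y)" by (subst dec_cong) auto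
  from dec_add[OF dec_S_minus_trace this] show ?thesis by simp
qed

end

section \<open>Passing between space-time derivatives and slices\<close>

lemma dd_slice:
  fixes f :: "real \<times> 'a::euclidean_space \<Rightarrow> real"
  assumes "f differentiable (at (t, y))"
  shows "dd (0, v) f (t, y) = dd v (\<lambda>y. f (t, y)) y"
proof -
  have "((\<lambda>y. (t, y)) has_derivative (\<lambda>v. (0, v))) (at y)"
    by (intro has_derivative_Pair has_derivative_ident has_derivative_const)
  from dd_eqI[OF has_derivative_compose[OF this has_derivative_dd[OF assms]], of v]
  show ?thesis by simp
qed

lemma dd_time:
  fixes f :: "real \<times> 'a::euclidean_space \<Rightarrow> real"
  assumes "f differentiable (at (t, y))"
  shows "((\<lambda>s. f (s, y)) has_real_derivative dd (1, 0) f (t, y)) (at t)"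
proof -
  have "((\<lambda>s. (s, y)) has_derivative (\<lambda>h. (h, 0))) (at t)"
    by (intro has_derivative_Pair has_derivative_ident has_derivative_const)
  from has_derivative_compose[OF this has_derivative_dd[OF assms]]
  have "((\<lambda>s. f (s, y)) has_derivative (\<lambda>h. dd (h, 0) f (t, y))) (at t)" .
  moreover have "(\<lambda>h. dd (h, 0) f (t, y)) = (*) (dd (1, 0) f (t, y))"
  proof
    fix h
    show "dd (h, 0) f (t, y) = dd (1, 0) f (t, y) * h"
      using dd_cmult_direction[OF assms, of h "(1, 0)"] by (simp add: mult.commute)
  qed
  ultimately show ?thesis by (simp only: has_field_derivative_def)
qed

lemma continuous_on_det:
  fixes A :: "'a::topological_space \<Rightarrow> real^'n^'n"
  assumes "\<And>i j. continuous_on S (\<lambda>z. A z $ i $ j)"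
  shows "continuous_on S (\<lambda>z. det (A z))"
  unfolding det_def by (intro continuous_intros assms)

lemma continuous_on_matrix_inv:
  fixes A :: "'a::topological_space \<Rightarrow> real^'n^'n"
  assumes "\<And>i j. continuous_on S (\<lambda>z. A z $ i $ j)"
    and pos: "\<And>z v. z \<in> S \<Longrightarrow> v \<noteq> 0 \<Longrightarrow> v \<bullet> (A z *v v) > 0"
  shows "continuous_on S (\<lambda>z. matrix_inv (A z) $ i $ j)"
proof -
  have nz: "det (A z) \<noteq> 0" if "z \<in> S" for z
    by (rule posdef_inverse(3)) (rule pos[OF that])
  have "continuous_on S (\<lambda>z. if l = i then (axis j 1 :: real^'n) $ k else A z $ k $ l)" for k l
    using assms(1) by (cases "l = i") auto
  then have "continuous_on S (\<lambda>z. det (\<chi> k l. if l = i then (axis j 1 :: real^'n) $ k else A z $ k $ l) * inverse (det (A z)))"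
    by (intro continuous_on_mult continuous_on_inverse continuous_on_det ballI nz) (simp_all add: assms(1))
  then show ?thesis
    by (rule continuous_on_eq) (simp add: matrix_inv_cramer posdef_inverse(1)[OF pos] nz)
qed

section \<open>The space-time frame\<close>

context af_flow
begin

text \<open>Open in time, so that the calculus on open sets applies; the initial and the final time
  are reached later by continuity.\<close>

definition "U = {0<..<T} \<times> E"
definition "Gj p = G (fst p) (snd p)"
definition "be i = (0 :: real, ax i :: real^'n)"

lemma open_U: "open U"
  unfolding U_def by (intro open_Times open_exterior) auto

lemma smooth_Gj: "msmooth U Gj"
proof -
  have "smooth_on U (\<lambda>(t, y). G t y)"
    by (rule smooth_on_open_subset[OF open_U _ smooth_joint]) (auto simp: U_def)
  from smooth_on_linear[OF open_U bounded_linear_entry this] show ?thesis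
    by (simp add: msmooth_def Gj_def case_prod_unfold)
qed

lemma joint_metric_frame: "metric_frame U Gj"
  by unfold_locales (use open_U smooth_Gj G_sym G_pos in \<open>auto simp: U_def Gj_def\<close>)

lemma msmooth_dM_slice:
  assumes "msmooth U A" "(t, y) \<in> U" "\<And>s z. (s, z) \<in> U \<Longrightarrow> A (s, z) = B s z"
  shows "dM (be b) A (t, y) = dM (ax b) (B t) y"
proof -
  have "dd (be b) (\<lambda>z. A z $ i $ j) (t, y) = dd (ax b) (\<lambda>y. B t y $ i $ j) y" for i j
  proof -
    have "dd (be b) (\<lambda>z. A z $ i $ j) (t, y) = dd (ax b) (\<lambda>y. A (t, y) $ i $ j) y"
      unfolding be_def by (rule dd_slice[OF smooth_on_differentiable[OF open_U msmoothD[OF assms(1)] assms(2)]])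
    also have "\<dots> = dd (ax b) (\<lambda>y. B t y $ i $ j) y"
      by (rule dd_cong[OF open_exterior[of 1]]) (use assms(2,3) in \<open>auto simp: U_def\<close>)
    finally show ?thesis .
  qed
  then show ?thesis by (simp add: vec_eq_iff dM_nth)
qed

lemma Gam_slice: assumes "(t, y) \<in> U" shows "Gam be Gj a (t, y) = Gm t a y"
proof -
  have "dd (be b) (\<lambda>z. Gj z $ i $ j) (t, y) = dd (ax b) (\<lambda>y. G t y $ i $ j) y" for b i j
    using msmooth_dM_slice[OF smooth_Gj assms, of G b] by (simp add: Gj_def vec_eq_iff dM_nth)
  then show ?thesis by (simp add: vec_eq_iff Gam_def Chr_def) (simp add: Gj_def)
qed

lemma Rc_slice: assumes "(t, y) \<in> U" shows "Rc be Gj (t, y) = Rm t y"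
proof -
  note sm = metric_frame.smooth_Gam[where e=be, OF joint_metric_frame]
  have "Om be Gj a b (t, y) = Om ax (G t) a b y" for a b
    unfolding Om_def using msmooth_dM_slice[OF sm assms Gam_slice] Gam_slice[OF assms] by simp
  then show ?thesis by (simp add: Rc_def)
qed

lemma Sc_slice: "(t, y) \<in> U \<Longrightarrow> Sc be Gj (t, y) = Sm t y"
  by (simp add: Sc_def Rc_slice) (simp add: Gj_def)

lemma joint_ricci_flow: "ricci_flow_frame U be Gj (1, 0)"
proof (intro ricci_flow_frame.intro joint_metric_frame ricci_flow_frame_axioms.intro)
  fix z i j assume "z \<in> U"
  then obtain t y where z: "z = (t, y)" and ty: "(t, y) \<in> U" by (cases z) auto
  have t: "0 < t" "t < T" "1 < norm y" using ty by (auto simp: U_def)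
  have "((\<lambda>s. Gj (s, y) $ i $ j) has_real_derivative dd (1, 0) (\<lambda>z. Gj z $ i $ j) (t, y)) (at t)"
    by (rule dd_time[OF smooth_on_differentiable[OF open_U msmoothD[OF smooth_Gj] ty]])
  moreover have "((\<lambda>s. Gj (s, y) $ i $ j) has_real_derivative - 2 * Rm t y $ i $ j) (at t)"
    using ricci[of t y i j] t by (simp add: Gj_def at_within_Icc_at)
  ultimately show "dd (1, 0) (\<lambda>z. Gj z $ i $ j) z = - 2 * Rc be Gj z $ i $ j"
    using DERIV_unique Rc_slice[OF ty] z by metis
qed

text \<open>Taken from the space-time function, whose smoothness gives joint continuity of the time
  derivative.\<close>

definition "S' t y = dd (1, 0) (Sc be Gj) (t, y)"
text \<open>The gradient vector field of the scalar curvature.\<close>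

definition "W t i y = (\<Sum>k\<in>UNIV. Hh t y $ i $ k * dd (ax k) (Sc ax (G t)) y)"

lemma smooth_Sc_joint: "smooth_on U (Sc be Gj)"
  by (rule metric_frame.smooth_Sc[OF joint_metric_frame])

lemma continuous_S': "continuous_on ({0<..<T} \<times> E) (\<lambda>(t, y). S' t y)"
  using smooth_on_continuous_on[OF smooth_on_dd[OF open_U smooth_Sc_joint, of "(1, 0)"]]
  by (simp add: S'_def U_def case_prod_unfold)

lemma DERIV_S:
  assumes "0 < t" "t < T" "1 < norm y"
  shows "((\<lambda>s. Sm s y) has_real_derivative S' t y) (at t)"
proof -
  have ty: "(t, y) \<in> U" using assms by (simp add: U_def)
  have "((\<lambda>s. Sc be Gj (s, y)) has_real_derivative S' t y) (at t)"
    unfolding S'_def by (rule dd_time[OF smooth_on_differentiable[OF open_U smooth_Sc_joint ty]])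
  then show ?thesis
    by (rule has_field_derivative_transform_within_open[where S="{0<..<T}"]) (use assms in \<open>auto simp: Sc_slice U_def\<close>)
qed

lemma smooth_W: assumes "t \<in> {0..T}" shows "smooth_on E (W t i)"
  unfolding W_def using slice_smooth_Sc[OF assms] slice_smooth_H[OF assms, unfolded frame_defs[OF assms]] open_exterior[of 1]
  by (auto intro!: smooth simp: msmoothD)

lemma evolution:
  assumes "0 < t" "t < T" "1 < norm y"
  shows "S' t y = 2 * trace (Mm t y ** Mm t y) + (\<Sum>i\<in>UNIV. dd (ax i) (W t i) y)
    + (\<Sum>i\<in>UNIV. \<Sum>m\<in>UNIV. Gm t i y $ i $ m * W t m y)"
proof -
  interpret ricci_flow_frame U be Gj "(1, 0)" by (rule joint_ricci_flow)
  have ty: "(t, y) \<in> U" using assms by (simp add: U_def)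
  have Hs: "H (s, z) = Hh s z" for s z by (simp add: H_def Hh_def Gj_def)
  have Ms: "M (t, y) = Mm t y" by (simp add: M_def Mm_def Hs Rc_slice ty)
  have dS: "dd (be k) (Sc be Gj) (s, z) = dd (ax k) (Sc ax (G s)) z" if "(s, z) \<in> U" for s z k
  proof -
    have "dd (be k) (Sc be Gj) (s, z) = dd (ax k) (\<lambda>z. Sc be Gj (s, z)) z"
      unfolding be_def[of k] by (rule dd_slice[OF smooth_on_differentiable[OF open_U smooth_Sc_joint that]])
    also have "\<dots> = dd (ax k) (Sc ax (G s)) z"
      by (rule dd_cong[OF open_exterior[of 1]]) (use that in \<open>auto simp: U_def Sc_slice\<close>)
    finally show ?thesis .
  qed
  have Ws: "(\<Sum>k\<in>UNIV. H (s, z) $ i $ k * dd (be k) (Sc be Gj) (s, z)) = W s i z" if "(s, z) \<in> U" for s z i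
    by (simp add: W_def Hs dS that)
  have dW: "dd (be i) (\<lambda>z. \<Sum>k\<in>UNIV. H z $ i $ k * dd (be k) (Sc be Gj) z) (t, y) = dd (ax i) (W t i) y" for i
  proof -
    let ?f = "\<lambda>z. \<Sum>k\<in>UNIV. H z $ i $ k * dd (be k) (Sc be Gj) z"
    have "smooth_on U ?f"
      by (intro smooth open_U smooth_Sc_joint msmoothD[OF smooth_H])
    then have "dd (be i) ?f (t, y) = dd (ax i) (\<lambda>y. ?f (t, y)) y"
      unfolding be_def[of i] by (rule dd_slice[OF smooth_on_differentiable[OF open_U _ ty]])
    also have "\<dots> = dd (ax i) (W t i) y"
      by (rule dd_cong[OF open_exterior[of 1]]) (use assms in \<open>auto simp: Ws U_def\<close>)
    finally show ?thesis .
  qed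
  show ?thesis
    using scalar_evolution[OF ty] unfolding S'_def dW Ws[OF ty] Ms Gam_slice[OF ty] .
qed

lemma continuous_G: "continuous_on ({0..T} \<times> E) (\<lambda>p. G (fst p) (snd p) $ i $ j)"
  using bounded_linear.continuous_on[OF bounded_linear_entry smooth_on_continuous_on[OF smooth_joint], of i j]
  by (simp add: case_prod_unfold)

text \<open>Continuity of the curvature up to the initial and the final time is read off from the
  flow equation.\<close>

lemma continuous_Rm: "continuous_on ({0..T} \<times> E) (\<lambda>p. Rm (fst p) (snd p) $ i $ j)"
proof -
  let ?S = "{0..T} \<times> E" and ?f = "\<lambda>p. G (fst p) (snd p)"
  have "Ck_on (Suc 0) ?S ?f" using smooth_joint unfolding smooth_on_def case_prod_unfold by blast
  then have diff: "?f differentiable_on ?S"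
    and cont: "\<And>b. b \<in> Basis \<Longrightarrow> continuous_on ?S (\<lambda>p. frechet_derivative ?f (at p within ?S) b)"
    by auto
  have eq: "frechet_derivative ?f (at p within ?S) (1, 0) $ i $ j = - 2 * Rm (fst p) (snd p) $ i $ j" if p: "p \<in> ?S" for p
  proof -
    obtain t y where ty: "p = (t, y)" "t \<in> {0..T}" "y \<in> E" using p by auto
    let ?D = "frechet_derivative ?f (at p within ?S)"
    have D: "(?f has_derivative ?D) (at (t, y) within ?S)"
      using diff p ty by (auto simp: differentiable_on_def frechet_derivative_works)
    have "((\<lambda>s. (s, y)) has_derivative (\<lambda>h. (h, 0))) (at t within {0..T})"
      by (intro has_derivative_Pair has_derivative_ident has_derivative_const)
    moreover have "(?f has_derivative ?D) (at (t, y) within (\<lambda>s. (s, y)) ` {0..T})"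
      by (rule has_derivative_subset[OF D]) (use ty in auto)
    ultimately have "((\<lambda>s. ?f (s, y)) has_derivative (\<lambda>h. ?D (h, 0))) (at t within {0..T})"
      by (rule has_derivative_in_compose)
    from bounded_linear.has_derivative[OF bounded_linear_entry this, of i j]
    have "((\<lambda>s. G s y $ i $ j) has_derivative (\<lambda>h. ?D (h, 0) $ i $ j)) (at t within {0..T})" by simp
    moreover have "(\<lambda>h. ?D (h, 0) $ i $ j) = (*) (?D (1, 0) $ i $ j)"
    proof
      fix h
      show "?D (h, 0) $ i $ j = ?D (1, 0) $ i $ j * h"
        using linear_cmul[OF has_derivative_linear[OF D], of h "(1, 0)"] by (simp add: mult.commute)
    qed
    ultimately have "((\<lambda>s. G s y $ i $ j) has_real_derivative ?D (1, 0) $ i $ j) (at t within {0..T})"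
      by (simp only: has_field_derivative_def)
    moreover have "((\<lambda>s. G s y $ i $ j) has_real_derivative - 2 * Rm t y $ i $ j) (at t within {0..T})"
      by (rule ricci) (use ty in auto)
    moreover have "t islimpt {0..T}" using islimpt_Icc[OF T, of t] ty by simp
    then have "at t within {0..T} \<noteq> bot" by (simp add: trivial_limit_within)
    ultimately have "?D (1, 0) $ i $ j = - 2 * Rm t y $ i $ j"
      unfolding has_real_derivative_iff_has_vector_derivative by (intro vector_derivative_unique_within)
    then show ?thesis using ty by simp
  qed
  have "(1 :: real, 0 :: real^'n) \<in> Basis" by (simp add: Basis_prod_def)
  from continuous_on_eq[OF bounded_linear.continuous_on[OF bounded_linear_entry cont[OF this]], of i j "\<lambda>p. - 2 * Rm (fst p) (snd p) $ i $ j"] eq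
  have "continuous_on ?S (\<lambda>p. - 2 * Rm (fst p) (snd p) $ i $ j)" by simp
  from continuous_on_mult_left[OF this, of "- 1 / 2"] show ?thesis
    by (rule continuous_on_eq) simp
qed

lemma continuous_Sm: "continuous_on ({0..T} \<times> E) (\<lambda>(t, y). Sm t y)"
  unfolding Sc_def case_prod_unfold
  by (intro continuous_intros continuous_Rm continuous_on_matrix_inv continuous_G) (use G_pos in auto)

lemma continuous_Sm_slice: "t \<in> {0..T} \<Longrightarrow> continuous_on E (Sc ax (G t))"
  by (rule continuous_on_slice[OF continuous_Sm])

end

section \<open>Radial cutoffs\<close>

definition Ann :: "real \<Rightarrow> real \<Rightarrow> 'a::euclidean_space set" where
  "Ann p q = {y. p \<le> norm y \<and> norm y \<le> q}"

lemma compact_Ann: "compact (Ann p q)"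
  unfolding Ann_def by (rule compact_annulus)

lemma Ann_sets [measurable]: "Ann p q \<in> sets borel"
  using compact_Ann compact_imp_closed borel_closed by blast

text \<open>Written through \<open>y \<bullet> y\<close> to be differentiable at the origin as well.
  The transition takes place for \<open>norm y\<close> between \<rho> and
  \<open>sqrt 2 * \<rho>\<close>, inside \<open>Ann \<rho> (2 * \<rho>)\<close>.\<close>

definition cut :: "real \<Rightarrow> 'a::euclidean_space \<Rightarrow> real" where
  "cut \<rho> y = step ((y \<bullet> y) / \<rho>\<^sup>2)"

lemma cut_has_derivative:
  assumes h: "\<And>u. (h has_real_derivative h' u) (at u)"
  shows "((\<lambda>y. h ((y \<bullet> y) / \<rho>\<^sup>2)) has_derivative (\<lambda>v. h' ((y \<bullet> y) / \<rho>\<^sup>2) * (2 * (y \<bullet> v) / \<rho>\<^sup>2))) (at y)"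
proof -
  have "((\<lambda>y. (y \<bullet> y) / \<rho>\<^sup>2) has_derivative (\<lambda>v. 2 * (y \<bullet> v) / \<rho>\<^sup>2)) (at y)"
    by (auto intro!: derivative_eq_intros simp: inner_commute divide_inverse algebra_simps)
  from has_derivative_compose[OF this h[unfolded has_field_derivative_def]]
  show ?thesis by simp
qed

lemma dd_cut: "dd v (cut \<rho>) = (\<lambda>y. step1 ((y \<bullet> y) / \<rho>\<^sup>2) * (2 * (y \<bullet> v) / \<rho>\<^sup>2))"
  using dd_eqI[OF cut_has_derivative[OF DERIV_step]] by (auto simp: fun_eq_iff cut_def[abs_def])

lemma C1_cut: "C1_on UNIV (cut \<rho>)"
  unfolding cut_def[abs_def]
  by (rule C1_onI[OF cut_has_derivative[OF DERIV_step]])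
     (unfold divide_inverse, intro continuous_on_mult continuous_on_compose2[OF continuous_on_step(2)] continuous_intros subset_UNIV)

lemma dd_cut_has_derivative:
  "(dd v (cut \<rho>) has_derivative (\<lambda>u. step2 ((y \<bullet> y) / \<rho>\<^sup>2) * (2 * (y \<bullet> u) / \<rho>\<^sup>2) * (2 * (y \<bullet> v) / \<rho>\<^sup>2)
     + step1 ((y \<bullet> y) / \<rho>\<^sup>2) * (2 * (u \<bullet> v) / \<rho>\<^sup>2))) (at y)"
proof -
  have "((\<lambda>y. 2 * (y \<bullet> v) / \<rho>\<^sup>2) has_derivative (\<lambda>u. 2 * (u \<bullet> v) / \<rho>\<^sup>2)) (at y)"
    by (auto intro!: derivative_eq_intros simp: divide_inverse)
  from has_derivative_mult[OF cut_has_derivative[where \<rho>=\<rho>, OF DERIV_step1] this]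
  show ?thesis unfolding dd_cut by (simp only: add.commute)
qed

lemma dd_dd_cut: "dd u (dd v (cut \<rho>)) y = step2 ((y \<bullet> y) / \<rho>\<^sup>2) * (2 * (y \<bullet> u) / \<rho>\<^sup>2) * (2 * (y \<bullet> v) / \<rho>\<^sup>2)
     + step1 ((y \<bullet> y) / \<rho>\<^sup>2) * (2 * (u \<bullet> v) / \<rho>\<^sup>2)"
  by (rule dd_eqI[OF dd_cut_has_derivative])

lemma C1_dd_cut: "C1_on UNIV (dd v (cut \<rho>))"
  by (rule C1_onI[OF dd_cut_has_derivative])
     (unfold divide_inverse, intro continuous_on_add continuous_on_mult continuous_on_compose2[OF continuous_on_step(2)]
        continuous_on_compose2[OF continuous_on_step(3)] continuous_intros subset_UNIV)

lemma cut_inside: assumes "norm y \<le> \<rho>" "\<rho> > 0" shows "(y \<bullet> y) / \<rho>\<^sup>2 \<le> 1"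
  using assms power_mono[OF assms(1), of 2] by (simp add: power2_norm_eq_inner)

lemma cut_outside: assumes "2 * \<rho> \<le> norm y" "\<rho> > 0" shows "(y \<bullet> y) / \<rho>\<^sup>2 \<ge> 2"
proof -
  have "(2 * \<rho>)\<^sup>2 \<le> (norm y)\<^sup>2" using assms by (intro power_mono) auto
  then have "4 * \<rho>\<^sup>2 \<le> y \<bullet> y" by (simp add: power2_norm_eq_inner power_mult_distrib)
  moreover have "\<rho>\<^sup>2 > 0" using assms by simp
  ultimately show ?thesis using pos_le_divide_eq[of "\<rho>\<^sup>2" 2 "y \<bullet> y"] by linarith
qed

lemma cut_values:
  assumes "\<rho> > 0"
  shows "0 \<le> cut \<rho> y" "cut \<rho> y \<le> 1" "norm y \<le> \<rho> \<Longrightarrow> cut \<rho> y = 0" "2 * \<rho> \<le> norm y \<Longrightarrow> cut \<rho> y = 1"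
  using cut_inside[of y \<rho>] cut_outside[of \<rho> y] assms
  by (auto simp: cut_def step_bounds step_le_1 step_ge_2)

lemma cut_antimono: "0 < \<rho> \<Longrightarrow> \<rho> \<le> \<sigma> \<Longrightarrow> cut \<sigma> y \<le> cut \<rho> y"
  unfolding cut_def by (intro step_mono divide_left_mono power_mono mult_pos_pos) auto

lemma cut_bounds:
  obtains B where "B > 0"
    "\<And>\<rho> v (y::'a::euclidean_space). 0 < \<rho> \<Longrightarrow> norm v \<le> 1 \<Longrightarrow> \<bar>dd v (cut \<rho>) y\<bar> \<le> B / \<rho> * indicator (Ann \<rho> (2 * \<rho>)) y"
    "\<And>\<rho> u v (y::'a). 0 < \<rho> \<Longrightarrow> norm u \<le> 1 \<Longrightarrow> norm v \<le> 1 \<Longrightarrow>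
       \<bar>dd u (dd v (cut \<rho>)) y\<bar> \<le> B / \<rho>\<^sup>2 * indicator (Ann \<rho> (2 * \<rho>)) y"
proof -
  obtain b where b: "b > 0" "\<And>u. \<bar>step1 u\<bar> \<le> b" "\<And>u. \<bar>step2 u\<bar> \<le> b" using step_derivs_bounded by blast
  have in1: "\<bar>2 * (y \<bullet> v) / \<rho>\<^sup>2\<bar> \<le> 4 / \<rho>" if "0 < \<rho>" "norm v \<le> 1" "norm y \<le> 2 * \<rho>" for \<rho> and y v :: 'a
  proof -
    have "\<bar>y \<bullet> v\<bar> \<le> norm y * norm v" by (rule Cauchy_Schwarz_ineq2)
    also have "\<dots> \<le> (2 * \<rho>) * 1" using that by (intro mult_mono) auto
    finally have "\<bar>2 * (y \<bullet> v) / \<rho>\<^sup>2\<bar> \<le> (2 * (2 * \<rho>)) / \<rho>\<^sup>2"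
      using that by (simp add: abs_mult divide_right_mono)
    also have "\<dots> = 4 / \<rho>" using that by (simp add: power2_eq_square)
    finally show ?thesis .
  qed
  have z: "step1 ((y \<bullet> y) / \<rho>\<^sup>2) = 0" "step2 ((y \<bullet> y) / \<rho>\<^sup>2) = 0" if "y \<notin> Ann \<rho> (2 * \<rho>)" "0 < \<rho>" for \<rho> and y :: 'a
    using that cut_inside[of y \<rho>] cut_outside[of \<rho> y] by (auto simp: Ann_def not_le step_le_1 step_ge_2)
  show ?thesis
  \<comment> \<open>18 = 4 * 4 + 2: two factors \<open>4 / \<rho>\<close> accompany
    \<open>step2\<close>, one factor \<open>2 / \<rho>^2\<close> accompanies
    \<open>step1\<close>.\<close>
  proof (rule that[of "18 * b"])
    show "18 * b > 0" using b by simp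
    fix \<rho> :: real and u v y :: 'a
    assume \<rho>: "0 < \<rho>" and v: "norm v \<le> 1"
    show "\<bar>dd v (cut \<rho>) y\<bar> \<le> 18 * b / \<rho> * indicator (Ann \<rho> (2 * \<rho>)) y"
    proof (cases "y \<in> Ann \<rho> (2 * \<rho>)")
      case True
      then have "\<bar>dd v (cut \<rho>) y\<bar> \<le> b * (4 / \<rho>)"
        unfolding dd_cut abs_mult[of "step1 _"] using b in1[OF \<rho> v, of y] by (intro mult_mono) (auto simp: Ann_def)
      also have "\<dots> \<le> 18 * b / \<rho>" using b \<rho> by (simp add: field_simps)
      finally show ?thesis using True by simp
    qed (use z \<rho> in \<open>simp add: dd_cut\<close>)
    assume u: "norm u \<le> 1"
    show "\<bar>dd u (dd v (cut \<rho>)) y\<bar> \<le> 18 * b / \<rho>\<^sup>2 * indicator (Ann \<rho> (2 * \<rho>)) y"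
    proof (cases "y \<in> Ann \<rho> (2 * \<rho>)")
      case True
      have "\<bar>step2 ((y \<bullet> y) / \<rho>\<^sup>2) * (2 * (y \<bullet> u) / \<rho>\<^sup>2) * (2 * (y \<bullet> v) / \<rho>\<^sup>2)\<bar> \<le> b * (4 / \<rho>) * (4 / \<rho>)"
        unfolding abs_mult[of "_ * _"] abs_mult[of "step2 _"] using b \<rho> True in1[OF \<rho> v, of y] in1[OF \<rho> u, of y]
        by (intro mult_mono mult_nonneg_nonneg) (auto simp: Ann_def)
      moreover have "\<bar>step1 ((y \<bullet> y) / \<rho>\<^sup>2) * (2 * (u \<bullet> v) / \<rho>\<^sup>2)\<bar> \<le> b * (2 / \<rho>\<^sup>2)"
      proof -
        have "\<bar>u \<bullet> v\<bar> \<le> norm u * norm v" by (rule Cauchy_Schwarz_ineq2)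
        also have "\<dots> \<le> 1 * 1" using u v by (intro mult_mono) auto
        finally have "\<bar>2 * (u \<bullet> v) / \<rho>\<^sup>2\<bar> \<le> 2 / \<rho>\<^sup>2" by (simp add: abs_mult divide_right_mono)
        then show ?thesis unfolding abs_mult[of "step1 _"] using b by (intro mult_mono) auto
      qed
      ultimately have "\<bar>dd u (dd v (cut \<rho>)) y\<bar> \<le> b * (4 / \<rho>) * (4 / \<rho>) + b * (2 / \<rho>\<^sup>2)"
        unfolding dd_dd_cut by linarith
      also have "\<dots> = 18 * b / \<rho>\<^sup>2" by (simp add: power2_eq_square)
      finally show ?thesis using True by simp
    qed (use z \<rho> in \<open>simp add: dd_dd_cut\<close>)
  qed
qed

section \<open>Integrability of the scalar curvature\<close>

text \<open>A smooth convex approximation of the absolute value. Its derivative \<open>eta1\<close>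
  is the regularised sign, and convexity, \<open>eta2 \<ge> 0\<close>, gives the quadratic gradient
  term its sign.\<close>

definition eta :: "real \<Rightarrow> real \<Rightarrow> real" where "eta \<epsilon> s = sqrt (s\<^sup>2 + \<epsilon>\<^sup>2)"
definition eta1 :: "real \<Rightarrow> real \<Rightarrow> real" where "eta1 \<epsilon> s = s / sqrt (s\<^sup>2 + \<epsilon>\<^sup>2)"
definition eta2 :: "real \<Rightarrow> real \<Rightarrow> real" where "eta2 \<epsilon> s = \<epsilon>\<^sup>2 / (sqrt (s\<^sup>2 + \<epsilon>\<^sup>2)) ^ 3"

context
  fixes \<epsilon> :: real assumes \<epsilon>: "\<epsilon> > 0"
begin

lemma eta_pos: "s\<^sup>2 + \<epsilon>\<^sup>2 > 0"
  using \<epsilon> by (simp add: add_nonneg_pos)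

lemma DERIV_eta: "(eta \<epsilon> has_real_derivative eta1 \<epsilon> s) (at s)"
  unfolding eta_def[abs_def] eta1_def using eta_pos[of s]
  by (auto intro!: derivative_eq_intros simp: field_simps)

lemma DERIV_eta1: "(eta1 \<epsilon> has_real_derivative eta2 \<epsilon> s) (at s)"
proof -
  define q where "q = sqrt (s\<^sup>2 + \<epsilon>\<^sup>2)"
  have q: "q > 0" "q\<^sup>2 = s\<^sup>2 + \<epsilon>\<^sup>2" using eta_pos[of s] by (auto simp: q_def)
  have "((\<lambda>s. s / eta \<epsilon> s) has_real_derivative (1 * eta \<epsilon> s - s * eta1 \<epsilon> s) / (eta \<epsilon> s * eta \<epsilon> s)) (at s)"
    by (intro DERIV_divide DERIV_ident DERIV_eta) (use \<epsilon> in \<open>simp add: eta_def\<close>)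
  moreover have "(1 * eta \<epsilon> s - s * eta1 \<epsilon> s) / (eta \<epsilon> s * eta \<epsilon> s) = (q\<^sup>2 - s\<^sup>2) / q ^ 3"
  proof -
    have es: "eta \<epsilon> s = q" "eta1 \<epsilon> s = s / q" by (simp_all add: eta_def eta1_def q_def)
    show ?thesis unfolding es using q(1) by (simp add: field_simps power2_eq_square power3_eq_cube)
  qed
  moreover have "(q\<^sup>2 - s\<^sup>2) / q ^ 3 = eta2 \<epsilon> s" by (simp add: q(2) eta2_def q_def)
  moreover have "(\<lambda>s. s / eta \<epsilon> s) = eta1 \<epsilon>" by (simp add: fun_eq_iff eta_def eta1_def)
  ultimately show ?thesis by simp
qed

lemma continuous_eta: "continuous_on UNIV (eta \<epsilon>)" "continuous_on UNIV (eta1 \<epsilon>)" "continuous_on UNIV (eta2 \<epsilon>)"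
proof -
  have "sqrt (s\<^sup>2 + \<epsilon>\<^sup>2) \<noteq> 0" for s using \<epsilon> by simp
  then show "continuous_on UNIV (eta \<epsilon>)" "continuous_on UNIV (eta1 \<epsilon>)" "continuous_on UNIV (eta2 \<epsilon>)"
    unfolding eta_def[abs_def] eta1_def[abs_def] eta2_def[abs_def] by (auto intro!: continuous_intros)
qed

lemma eta_bounds: "\<bar>s\<bar> \<le> eta \<epsilon> s" "eta \<epsilon> s \<le> \<bar>s\<bar> + \<epsilon>" "\<bar>eta1 \<epsilon> s\<bar> \<le> 1" "eta2 \<epsilon> s \<ge> 0" "eta \<epsilon> s \<ge> 0"
proof -
  show 1: "\<bar>s\<bar> \<le> eta \<epsilon> s" unfolding eta_def by (rule real_le_rsqrt) simp
  show "eta \<epsilon> s \<le> \<bar>s\<bar> + \<epsilon>" unfolding eta_def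
    by (rule real_le_lsqrt) (use \<epsilon> in \<open>auto simp: power2_sum\<close>)
  have "eta \<epsilon> s > 0" using eta_pos[of s] by (simp add: eta_def)
  then show "\<bar>eta1 \<epsilon> s\<bar> \<le> 1" using 1 unfolding eta1_def eta_def[symmetric] by (simp add: abs_divide)
  show "eta2 \<epsilon> s \<ge> 0" "eta \<epsilon> s \<ge> 0" using eta_pos[of s] by (auto simp: eta2_def eta_def)
qed

end

context af_flow
begin

lemma abs_sum_sum_le:
  fixes f :: "'n \<Rightarrow> 'n \<Rightarrow> real"
  assumes "\<And>i k. \<bar>f i k\<bar> \<le> c"
  shows "\<bar>\<Sum>i\<in>UNIV. \<Sum>k\<in>UNIV. f i k\<bar> \<le> (real CARD('n))\<^sup>2 * c"
proof -
  have "\<bar>\<Sum>i\<in>UNIV. \<Sum>k\<in>UNIV. f i k\<bar> \<le> (\<Sum>i\<in>(UNIV::'n set). \<Sum>k\<in>(UNIV::'n set). c)"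
    by (intro order_trans[OF sum_abs] sum_mono) (rule assms)
  then show ?thesis by (simp add: power2_eq_square)
qed

lemma abs_sum_le:
  fixes f :: "'n \<Rightarrow> real"
  assumes "\<And>i. \<bar>f i\<bar> \<le> c"
  shows "\<bar>\<Sum>i\<in>UNIV. f i\<bar> \<le> real CARD('n) * c"
proof -
  have "\<bar>\<Sum>i\<in>UNIV. f i\<bar> \<le> (\<Sum>i\<in>(UNIV::'n set). c)"
    by (intro order_trans[OF sum_abs] sum_mono) (rule assms)
  then show ?thesis by simp
qed

text \<open>Besides the coordinate divergence of \<open>W\<close>, the Laplacian of \<open>S\<close>
  has a first-order part; \<open>PG\<close> is the coefficient vector of the gradient of
  \<open>S\<close> in it.\<close>

definition "PG t i y = (\<Sum>m\<in>UNIV. (\<Sum>j\<in>UNIV. Gm t j y $ j $ m) * Hh t y $ m $ i)"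
definition "th \<rho> y = cut r0 y - cut \<rho> (y::real^'n)"
definition "Bv \<rho> t i y = (\<Sum>k\<in>UNIV. dd (ax k) (th \<rho>) y * Hh t y $ k $ i)"
text \<open>The formal adjoint of the Laplacian applied to the cutoff \<open>th\<close>: what
  multiplies \<open>eta\<close> of the scalar curvature once no derivative is left on the
  latter.\<close>

definition "Zt \<rho> t y = (\<Sum>i\<in>UNIV. dd (ax i) (Bv \<rho> t i) y) - (\<Sum>i\<in>UNIV. dd (ax i) (\<lambda>y. th \<rho> y * PG t i y) y)"
text \<open>The size of the second derivatives of \<open>th\<close>: bounded on the fixed inner
  annulus, of order \<open>1 / \<rho>^2\<close> on the outer one.\<close>

definition "bt \<rho> y = indicator (Ann r0 (2 * r0)) y + indicator (Ann \<rho> (2 * \<rho>)) (y::real^'n) / \<rho>\<^sup>2"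

lemma smooth_Hh: "t \<in> {0..T} \<Longrightarrow> msmooth E (Hh t)"
  using slice_smooth_H frame_defs by metis

lemma smooth_Mm: "t \<in> {0..T} \<Longrightarrow> msmooth E (Mm t)"
  using slice_smooth_M frame_defs by metis

lemma smooth_PG: assumes "t \<in> {0..T}" shows "smooth_on E (PG t i)"
  unfolding PG_def using smooth_Hh[OF assms] slice_smooth_Gam[OF assms] open_exterior[of 1]
  by (auto intro!: smooth simp: msmoothD)

lemma dec_PG: "dec (\<delta> + 1) (\<lambda>t y. PG t i y)"
proof -
  have "dec (\<delta> + 1 + 0) (\<lambda>t y. \<Sum>m\<in>UNIV. (\<Sum>j\<in>UNIV. Gm t j y $ j $ m) * Hh t y $ m $ i)"
    by (intro dec_sum dec_mult dec_Gm dec_H)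
  then show ?thesis by (simp add: PG_def)
qed

lemma dec_dPG: "dec (\<delta> + 2) (\<lambda>t y. dd (ax k) (PG t i) y)"
proof -
  have eq: "dd (ax k) (PG t i) y = (\<Sum>m\<in>UNIV. (\<Sum>j\<in>UNIV. dM (ax k) (Gam ax (G t) j) y $ j $ m) * Hh t y $ m $ i
      + (\<Sum>j\<in>UNIV. Gm t j y $ j $ m) * dM (ax k) (Hh t) y $ m $ i)" if "t \<in> {0..T}" "1 < norm y" for t y
  proof -
    have y: "y \<in> E" using that by simp
    note sg = msmoothD[OF slice_smooth_Gam[OF that(1)]] and sh = msmoothD[OF smooth_Hh[OF that(1)]]
    have sG: "smooth_on E (\<lambda>y. \<Sum>j\<in>UNIV. Gm t j y $ j $ m)" for m
      by (intro smooth_on_sum open_exterior sg)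
    have "dd (ax k) (PG t i) y = (\<Sum>m\<in>UNIV. dd (ax k) (\<lambda>y. (\<Sum>j\<in>UNIV. Gm t j y $ j $ m) * Hh t y $ m $ i) y)"
      unfolding PG_def[abs_def] by (rule dd_sum[OF open_exterior y]) (intro smooth_on_mult sG sh open_exterior)
    then show ?thesis
      by (simp add: dd_mult[OF open_exterior y sG sh] dd_sum[OF open_exterior y sg] dM_nth)
  qed
  have "dec (\<delta> + 2) (\<lambda>t y. \<Sum>m\<in>UNIV. (\<Sum>j\<in>UNIV. dM (ax k) (Gam ax (G t) j) y $ j $ m) * Hh t y $ m $ i
      + (\<Sum>j\<in>UNIV. Gm t j y $ j $ m) * dM (ax k) (Hh t) y $ m $ i)"
    using \<delta> by (intro dec_sum dec_add dec_mono[OF dec_mult[OF dec_sum[OF dec_dGm] dec_H]] dec_mono[OF dec_mult[OF dec_sum[OF dec_Gm] dec_dH]]) auto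
  then show ?thesis using eq by (subst dec_cong) auto
qed

lemma C1_th: "C1_on UNIV (th \<rho>)" "dd v (th \<rho>) y = dd v (cut r0) y - dd v (cut \<rho>) y"
  "C1_on UNIV (dd v (th \<rho>))" "dd u (dd v (th \<rho>)) y = dd u (dd v (cut r0)) y - dd u (dd v (cut \<rho>)) y"
proof -
  show "C1_on UNIV (th \<rho>)" unfolding th_def[abs_def] by (rule C1_on_diff[OF C1_cut C1_cut])
  have eq: "dd v (th \<rho>) = (\<lambda>y. dd v (cut r0) y - dd v (cut \<rho>) y)" for v
    unfolding th_def[abs_def] by (rule ext, rule C1_on_diff(2)[OF C1_cut C1_cut]) simp
  then show "dd v (th \<rho>) y = dd v (cut r0) y - dd v (cut \<rho>) y" by simp
  show "C1_on UNIV (dd v (th \<rho>))" unfolding eq by (rule C1_on_diff[OF C1_dd_cut C1_dd_cut])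
  show "dd u (dd v (th \<rho>)) y = dd u (dd v (cut r0)) y - dd u (dd v (cut \<rho>)) y"
    unfolding eq by (rule C1_on_diff(2)[OF C1_dd_cut C1_dd_cut]) simp
qed

lemma th_values:
  assumes "r0 \<le> \<rho>"
  shows "0 \<le> th \<rho> y" "th \<rho> y \<le> 1" "y \<notin> Ann r0 (2 * \<rho>) \<Longrightarrow> th \<rho> y = 0"
    "2 * r0 \<le> norm y \<Longrightarrow> norm y \<le> \<rho> \<Longrightarrow> th \<rho> y = 1"
  using cut_values[of r0 y] cut_values[of \<rho> y] cut_antimono[of r0 \<rho> y] assms r0
  by (auto simp: th_def Ann_def not_le)

lemma powr_le_inverse: fixes x p :: real assumes "1 \<le> x" "1 \<le> p" shows "x powr (- p) \<le> 1 / x"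
proof -
  have "x powr (- p) \<le> x powr (- 1)" using assms by (intro powr_mono) auto
  then show ?thesis using assms by (simp add: powr_minus_divide)
qed

text \<open>A first derivative of the outer cutoff is of order \<open>1 / \<rho>\<close>. The
  missing factor comes from the coefficients it meets, which decay at least like
  \<open>1 / norm y\<close>.\<close>

lemma th_bounds:
  obtains B where "B > 0"
    "\<And>\<rho> y i k. r0 \<le> \<rho> \<Longrightarrow> \<bar>dd (ax i) (dd (ax k) (th \<rho>)) y\<bar> \<le> B * bt \<rho> y"
    "\<And>\<rho> y k. r0 \<le> \<rho> \<Longrightarrow> r0 \<le> norm y \<Longrightarrow> \<bar>dd (ax k) (th \<rho>) y\<bar> * norm y powr (- (\<delta> + 1)) \<le> B * bt \<rho> y"
proof -
  obtain B where B: "B > 0"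
    "\<And>\<rho> v (y::real^'n). 0 < \<rho> \<Longrightarrow> norm v \<le> 1 \<Longrightarrow> \<bar>dd v (cut \<rho>) y\<bar> \<le> B / \<rho> * indicator (Ann \<rho> (2 * \<rho>)) y"
    "\<And>\<rho> u v (y::real^'n). 0 < \<rho> \<Longrightarrow> norm u \<le> 1 \<Longrightarrow> norm v \<le> 1 \<Longrightarrow>
       \<bar>dd u (dd v (cut \<rho>)) y\<bar> \<le> B / \<rho>\<^sup>2 * indicator (Ann \<rho> (2 * \<rho>)) y"
    using cut_bounds by blast
  have pos: "r0 > 0" "1 \<le> r0" using r0 by auto
  show ?thesis
  proof (rule that[OF B(1)])
    fix \<rho> and y :: "real^'n" and i k :: 'n assume \<rho>: "r0 \<le> \<rho>"
    have "B / r0\<^sup>2 \<le> B / 1" using B(1) pos by (intro divide_left_mono) auto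
    then have "\<bar>dd (ax i) (dd (ax k) (cut r0)) y\<bar> \<le> B * indicator (Ann r0 (2 * r0)) y"
      using B(3)[of r0 "ax i" "ax k" y] pos by (auto simp: norm_axis_1 indicator_def split: if_splits)
    moreover have "\<bar>dd (ax i) (dd (ax k) (cut \<rho>)) y\<bar> \<le> B / \<rho>\<^sup>2 * indicator (Ann \<rho> (2 * \<rho>)) y"
      using B(3)[of \<rho> "ax i" "ax k" y] pos \<rho> by (simp add: norm_axis_1)
    ultimately show "\<bar>dd (ax i) (dd (ax k) (th \<rho>)) y\<bar> \<le> B * bt \<rho> y"
      unfolding C1_th bt_def by (simp add: distrib_left)
  next
    fix \<rho> and y :: "real^'n" and k :: 'n assume \<rho>: "r0 \<le> \<rho>" and y: "r0 \<le> norm y"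
    let ?w = "norm y powr (- (\<delta> + 1))"
    have w: "?w \<le> 1 / norm y" "?w \<ge> 0" using powr_le_inverse[of "norm y" "\<delta> + 1"] y pos \<delta> by auto
    have "1 \<le> norm y" using y pos by linarith
    then have "1 / norm y \<le> 1 / 1" by (intro divide_left_mono) auto
    then have w1: "?w \<le> 1" using w(1) by simp
    have "\<bar>dd (ax k) (cut r0) y\<bar> * ?w \<le> (B / r0 * indicator (Ann r0 (2 * r0)) y) * 1"
      using B(2)[of r0 "ax k" y] pos w w1 B(1) by (intro mult_mono) (auto simp: norm_axis_1)
    also have "\<dots> \<le> B * indicator (Ann r0 (2 * r0)) y"
      using B(1) pos divide_left_mono[of 1 r0 B] by (auto simp: indicator_def)
    finally have 1: "\<bar>dd (ax k) (cut r0) y\<bar> * ?w \<le> B * indicator (Ann r0 (2 * r0)) y" .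
    have 2: "\<bar>dd (ax k) (cut \<rho>) y\<bar> * ?w \<le> B * (indicator (Ann \<rho> (2 * \<rho>)) y / \<rho>\<^sup>2)"
    proof (cases "y \<in> Ann \<rho> (2 * \<rho>)")
      case True
      then have "1 / norm y \<le> 1 / \<rho>" using \<rho> pos by (intro frac_le) (auto simp: Ann_def)
      then have "\<bar>dd (ax k) (cut \<rho>) y\<bar> * ?w \<le> (B / \<rho>) * (1 / \<rho>)"
        using B(2)[of \<rho> "ax k" y] True \<rho> pos w B(1) by (intro mult_mono) (auto simp: norm_axis_1)
      then show ?thesis using True by (simp add: power2_eq_square)
    next
      case False
      then show ?thesis using B(2)[of \<rho> "ax k" y] \<rho> pos by (simp add: norm_axis_1)
    qed
    have "\<bar>dd (ax k) (th \<rho>) y\<bar> * ?w \<le> (\<bar>dd (ax k) (cut r0) y\<bar> + \<bar>dd (ax k) (cut \<rho>) y\<bar>) * ?w"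
      unfolding C1_th using w by (intro mult_right_mono) auto
    then show "\<bar>dd (ax k) (th \<rho>) y\<bar> * ?w \<le> B * bt \<rho> y"
      using 1 2 unfolding bt_def by (simp add: distrib_left distrib_right)
  qed
qed

lemma C1_Hh: "t \<in> {0..T} \<Longrightarrow> C1_on E (\<lambda>y. Hh t y $ i $ j)"
  by (rule C1_on_smooth[OF open_exterior msmoothD[OF smooth_Hh]])

lemma C1_Bv: assumes "t \<in> {0..T}" shows "C1_on E (Bv \<rho> t i)"
  unfolding Bv_def[abs_def]
  by (intro C1_on_sum(1) C1_on_mult(1) C1_on_subset[OF C1_th(3)] C1_Hh[OF assms] subset_UNIV)

lemma C1_thPG: assumes "t \<in> {0..T}" shows "C1_on E (\<lambda>y. th \<rho> y * PG t i y)"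
  by (intro C1_on_mult(1) C1_on_subset[OF C1_th(1)] C1_on_smooth[OF open_exterior smooth_PG[OF assms]] subset_UNIV)

lemma bt_nonneg: "bt \<rho> y \<ge> 0" by (simp add: bt_def)

lemma Zt_bound:
  obtains C where "C > 0" "\<And>\<rho> t y. r0 \<le> \<rho> \<Longrightarrow> t \<in> {0..T} \<Longrightarrow> r0 \<le> norm y \<Longrightarrow>
    \<bar>Zt \<rho> t y\<bar> \<le> C * (bt \<rho> y + norm y powr (- (\<delta> + 2)))"
proof -
  obtain B where B: "B > 0"
    "\<And>\<rho> y i k. r0 \<le> \<rho> \<Longrightarrow> \<bar>dd (ax i) (dd (ax k) (th \<rho>)) y\<bar> \<le> B * bt \<rho> y"
    "\<And>\<rho> y k. r0 \<le> \<rho> \<Longrightarrow> r0 \<le> norm y \<Longrightarrow> \<bar>dd (ax k) (th \<rho>) y\<bar> * norm y powr (- (\<delta> + 1)) \<le> B * bt \<rho> y"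
    using th_bounds by blast
  \<comment> \<open>\<open>dec\<close> provides a constant for each choice of indices; their sum
    serves for all choices at once.\<close>
  have uniform: "\<exists>C>0. \<forall>i k l. \<forall>t\<in>{0..T}. \<forall>y. r0 \<le> norm y \<longrightarrow> \<bar>f i k l t y\<bar> \<le> C * norm y powr (- p)"
    if "\<And>i k l. dec p (f i k l)" for p and f :: "'n \<Rightarrow> 'n \<Rightarrow> 'n \<Rightarrow> real \<Rightarrow> real^'n \<Rightarrow> real"
  proof -
    have "\<forall>x. \<exists>C. C > 0 \<and> (\<forall>t\<in>{0..T}. \<forall>y. r0 \<le> norm y \<longrightarrow> \<bar>f (fst x) (fst (snd x)) (snd (snd x)) t y\<bar> \<le> C * norm y powr (- p))"
      using decE[OF that] by metis
    then obtain C where C: "\<And>x. C x > 0" "\<And>x t y. t \<in> {0..T} \<Longrightarrow> r0 \<le> norm y \<Longrightarrow>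
        \<bar>f (fst x) (fst (snd x)) (snd (snd x)) t y\<bar> \<le> C x * norm y powr (- p)" by metis
    show ?thesis
    proof (intro exI[of _ "sum C UNIV"] conjI allI ballI impI)
      show "sum C UNIV > 0" using C(1) by (intro sum_pos) auto
      fix i k l t and y :: "real^'n" assume "t \<in> {0..T}" "r0 \<le> norm y"
      then have "\<bar>f i k l t y\<bar> \<le> C (i, k, l) * norm y powr (- p)" using C(2)[of t y "(i, k, l)"] by simp
      also have "\<dots> \<le> sum C UNIV * norm y powr (- p)"
        using C(1) by (intro mult_right_mono member_le_sum) (auto intro: less_imp_le)
      finally show "\<bar>f i k l t y\<bar> \<le> sum C UNIV * norm y powr (- p)" .
    qed
  qed
  obtain C1 where C1: "C1 > 0" "\<And>i k l t y. t \<in> {0..T} \<Longrightarrow> r0 \<le> norm y \<Longrightarrow> \<bar>dM (ax i) (Hh t) y $ k $ l\<bar> \<le> C1 * norm y powr (- (\<delta> + 1))"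
    using uniform[of "\<delta> + 1" "\<lambda>i k l t y. dM (ax i) (Hh t) y $ k $ l"] dec_dH by blast
  obtain C2 where C2: "C2 > 0" "\<And>i t y. t \<in> {0..T} \<Longrightarrow> r0 \<le> norm y \<Longrightarrow> \<bar>PG t i y\<bar> \<le> C2 * norm y powr (- (\<delta> + 1))"
    using uniform[of "\<delta> + 1" "\<lambda>i k l t y. PG t i y"] dec_PG by blast
  obtain C3 where C3: "C3 > 0" "\<And>i t y. t \<in> {0..T} \<Longrightarrow> r0 \<le> norm y \<Longrightarrow> \<bar>dd (ax i) (PG t i) y\<bar> \<le> C3 * norm y powr (- (\<delta> + 2))"
    using uniform[of "\<delta> + 2" "\<lambda>i k l t y. dd (ax i) (PG t i) y"] dec_dPG by blast
  let ?n = "real CARD('n)"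
  define C where "C = ?n\<^sup>2 * (2 * B + C1 * B) + ?n * (C2 * B + C3)"
  have "C > 0" unfolding C_def using B(1) C1(1) C2(1) C3(1)
    by (intro add_pos_pos mult_pos_pos) (auto simp: card_gt_0_iff)
  moreover have "\<bar>Zt \<rho> t y\<bar> \<le> C * (bt \<rho> y + norm y powr (- (\<delta> + 2)))" if \<rho>: "r0 \<le> \<rho>" and t: "t \<in> {0..T}" and y: "r0 \<le> norm y" for \<rho> t y
  proof -
    define E0 where "E0 = bt \<rho> y + norm y powr (- (\<delta> + 2))"
    have E0: "bt \<rho> y \<le> E0" "norm y powr (- (\<delta> + 2)) \<le> E0" "E0 \<ge> 0" using bt_nonneg[of \<rho> y] by (auto simp: E0_def)
    have yE: "y \<in> E" using y r0 by simp
    have dBv: "dd (ax i) (Bv \<rho> t i) y = (\<Sum>k\<in>UNIV. dd (ax k) (th \<rho>) y * dM (ax i) (Hh t) y $ k $ i + dd (ax i) (dd (ax k) (th \<rho>)) y * Hh t y $ k $ i)" for i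
    proof -
      have c: "C1_on E (dd (ax k) (th \<rho>))" for k by (rule C1_on_subset[OF C1_th(3)]) simp
      have "dd (ax i) (Bv \<rho> t i) y = (\<Sum>k\<in>UNIV. dd (ax i) (\<lambda>y. dd (ax k) (th \<rho>) y * Hh t y $ k $ i) y)"
        unfolding Bv_def[abs_def] by (rule C1_on_sum(2)[OF C1_on_mult(1)[OF c C1_Hh[OF t]] yE])
      then show ?thesis by (simp add: C1_on_mult(2)[OF c C1_Hh[OF t] yE] dM_nth)
    qed
    have dP: "dd (ax i) (\<lambda>y. th \<rho> y * PG t i y) y = th \<rho> y * dd (ax i) (PG t i) y + dd (ax i) (th \<rho>) y * PG t i y" for i
      by (rule C1_on_mult(2)[OF C1_on_subset[OF C1_th(1) subset_UNIV] C1_on_smooth[OF open_exterior smooth_PG[OF t]] yE])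
    have "\<bar>dd (ax k) (th \<rho>) y * dM (ax i) (Hh t) y $ k $ i + dd (ax i) (dd (ax k) (th \<rho>)) y * Hh t y $ k $ i\<bar> \<le> (2 * B + C1 * B) * E0" for i k
    proof -
      have "\<bar>dd (ax k) (th \<rho>) y * dM (ax i) (Hh t) y $ k $ i\<bar> \<le> \<bar>dd (ax k) (th \<rho>) y\<bar> * (C1 * norm y powr (- (\<delta> + 1)))"
        unfolding abs_mult using C1(2)[OF t y] by (intro mult_left_mono) auto
      also have "\<dots> = C1 * (\<bar>dd (ax k) (th \<rho>) y\<bar> * norm y powr (- (\<delta> + 1)))" by simp
      also have "\<dots> \<le> C1 * (B * E0)"
        using B(1) C1(1) E0(1) by (intro mult_left_mono order_trans[OF B(3)[OF \<rho> y]]) auto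
      finally have a: "\<bar>dd (ax k) (th \<rho>) y * dM (ax i) (Hh t) y $ k $ i\<bar> \<le> C1 * (B * E0)" .
      have "\<bar>dd (ax i) (dd (ax k) (th \<rho>)) y * Hh t y $ k $ i\<bar> \<le> (B * E0) * 2"
        unfolding abs_mult using B(1) E0 Hh_bound[OF t y]
        by (intro mult_mono order_trans[OF B(2)[OF \<rho>]] mult_left_mono) auto
      then show ?thesis using a by (simp add: algebra_simps)
    qed
    then have 1: "\<bar>\<Sum>i\<in>UNIV. dd (ax i) (Bv \<rho> t i) y\<bar> \<le> ?n\<^sup>2 * ((2 * B + C1 * B) * E0)"
      unfolding dBv by (rule abs_sum_sum_le)
    have "\<bar>th \<rho> y * dd (ax i) (PG t i) y + dd (ax i) (th \<rho>) y * PG t i y\<bar> \<le> (C2 * B + C3) * E0" for i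
    proof -
      have "\<bar>dd (ax i) (th \<rho>) y * PG t i y\<bar> \<le> \<bar>dd (ax i) (th \<rho>) y\<bar> * (C2 * norm y powr (- (\<delta> + 1)))"
        unfolding abs_mult using C2(2)[OF t y] by (intro mult_left_mono) auto
      also have "\<dots> = C2 * (\<bar>dd (ax i) (th \<rho>) y\<bar> * norm y powr (- (\<delta> + 1)))" by simp
      also have "\<dots> \<le> C2 * (B * E0)"
        using B(1) C2(1) E0(1) by (intro mult_left_mono order_trans[OF B(3)[OF \<rho> y]]) auto
      finally have a: "\<bar>dd (ax i) (th \<rho>) y * PG t i y\<bar> \<le> C2 * (B * E0)" .
      have "\<bar>th \<rho> y * dd (ax i) (PG t i) y\<bar> \<le> 1 * (C3 * E0)"
        unfolding abs_mult using th_values[OF \<rho>, of y] C3(1) E0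
        by (intro mult_mono order_trans[OF C3(2)[OF t y]] mult_left_mono) auto
      then show ?thesis using a by (simp add: algebra_simps)
    qed
    then have 2: "\<bar>\<Sum>i\<in>UNIV. dd (ax i) (\<lambda>y. th \<rho> y * PG t i y) y\<bar> \<le> ?n * ((C2 * B + C3) * E0)"
      unfolding dP by (rule abs_sum_le)
    show ?thesis using 1 2 unfolding Zt_def C_def E0_def[symmetric] by (simp add: algebra_simps)
  qed
  ultimately show ?thesis using that by blast
qed

text \<open>Collects the boundary terms of both integrations by parts: the one that removes the
  divergence of \<open>W\<close>, and the one that removes the gradient of \<open>eta\<close> from
  \<open>Bv\<close> and \<open>PG\<close>.\<close>

definition "Yv \<rho> \<epsilon> t i y = th \<rho> y * (eta1 \<epsilon> (Sm t y) * W t i y) - eta \<epsilon> (Sm t y) * Bv \<rho> t i y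
  + eta \<epsilon> (Sm t y) * (th \<rho> y * PG t i y)"

lemma C1_S: "t \<in> {0..T} \<Longrightarrow> C1_on E (Sc ax (G t))"
  by (rule C1_on_smooth[OF open_exterior slice_smooth_Sc])

lemma C1_Yv_parts:
  assumes "\<epsilon> > 0" "t \<in> {0..T}"
  shows "C1_on E (\<lambda>y. th \<rho> y * (eta1 \<epsilon> (Sm t y) * W t i y))" "C1_on E (\<lambda>y. eta \<epsilon> (Sm t y) * Bv \<rho> t i y)"
    "C1_on E (\<lambda>y. eta \<epsilon> (Sm t y) * (th \<rho> y * PG t i y))"
    "C1_on E (\<lambda>y. eta1 \<epsilon> (Sm t y) * W t i y)" "C1_on E (\<lambda>y. eta \<epsilon> (Sm t y))" "C1_on E (\<lambda>y. eta1 \<epsilon> (Sm t y))"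
    "C1_on E (W t i)" "C1_on E (th \<rho>)"
  by (intro C1_on_mult(1) C1_on_chain(1)[OF C1_S[OF assms(2)] DERIV_eta[OF assms(1)] continuous_eta(2)[OF assms(1)]]
     C1_on_chain(1)[OF C1_S[OF assms(2)] DERIV_eta1[OF assms(1)] continuous_eta(3)[OF assms(1)]]
     C1_Bv[OF assms(2)] C1_thPG[OF assms(2)] C1_on_smooth[OF open_exterior smooth_W[OF assms(2)]]
     C1_on_subset[OF C1_th(1) subset_UNIV])+

lemma C1_Yv: assumes "\<epsilon> > 0" "t \<in> {0..T}" shows "C1_on E (Yv \<rho> \<epsilon> t i)"
proof -
  have "C1_on E (\<lambda>y. - 1 * (eta \<epsilon> (Sm t y) * (th \<rho> y * PG t i y)))"
    by (intro C1_on_mult(1)[OF C1_on_smooth[OF open_exterior smooth_on_const[OF open_exterior]] C1_Yv_parts(3)[OF assms]])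
  from C1_on_diff(1)[OF C1_on_diff(1)[OF C1_Yv_parts(1,2)[OF assms]] this] show ?thesis
    by (simp add: Yv_def[abs_def])
qed

lemma dd_Yv:
  assumes \<epsilon>: "\<epsilon> > 0" and t: "t \<in> {0..T}" and y: "y \<in> E"
  shows "dd (ax i) (Yv \<rho> \<epsilon> t i) y =
    dd (ax i) (th \<rho>) y * (eta1 \<epsilon> (Sm t y) * W t i y)
    + th \<rho> y * (eta2 \<epsilon> (Sm t y) * dd (ax i) (Sc ax (G t)) y * W t i y + eta1 \<epsilon> (Sm t y) * dd (ax i) (W t i) y)
    - (eta1 \<epsilon> (Sm t y) * dd (ax i) (Sc ax (G t)) y * Bv \<rho> t i y + eta \<epsilon> (Sm t y) * dd (ax i) (Bv \<rho> t i) y)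
    + (eta1 \<epsilon> (Sm t y) * dd (ax i) (Sc ax (G t)) y * (th \<rho> y * PG t i y) + eta \<epsilon> (Sm t y) * dd (ax i) (\<lambda>y. th \<rho> y * PG t i y) y)"
proof -
  note c = C1_Yv_parts[OF \<epsilon> t]
  note d = C1_on_has_derivative[OF _ y]
  have e: "dd v (\<lambda>y. eta \<epsilon> (Sm t y)) y = eta1 \<epsilon> (Sm t y) * dd v (Sc ax (G t)) y" for v
    by (rule C1_on_chain(2)[OF C1_S[OF t] DERIV_eta[OF \<epsilon>] continuous_eta(2)[OF \<epsilon>] y])
  have e1: "dd v (\<lambda>y. eta1 \<epsilon> (Sm t y)) y = eta2 \<epsilon> (Sm t y) * dd v (Sc ax (G t)) y" for v
    by (rule C1_on_chain(2)[OF C1_S[OF t] DERIV_eta1[OF \<epsilon>] continuous_eta(3)[OF \<epsilon>] y])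
  have "(Yv \<rho> \<epsilon> t i has_derivative (\<lambda>v. dd v (\<lambda>y. th \<rho> y * (eta1 \<epsilon> (Sm t y) * W t i y)) y
      - dd v (\<lambda>y. eta \<epsilon> (Sm t y) * Bv \<rho> t i y) y + dd v (\<lambda>y. eta \<epsilon> (Sm t y) * (th \<rho> y * PG t i y)) y)) (at y)"
    unfolding Yv_def[abs_def] by (intro has_derivative_add has_derivative_diff d c)
  then have "dd (ax i) (Yv \<rho> \<epsilon> t i) y = dd (ax i) (\<lambda>y. th \<rho> y * (eta1 \<epsilon> (Sm t y) * W t i y)) y
      - dd (ax i) (\<lambda>y. eta \<epsilon> (Sm t y) * Bv \<rho> t i y) y + dd (ax i) (\<lambda>y. eta \<epsilon> (Sm t y) * (th \<rho> y * PG t i y)) y"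
    by (rule dd_eqI)
  then show ?thesis
    unfolding C1_on_mult(2)[OF c(8) c(4) y] C1_on_mult(2)[OF c(6,7) y] C1_on_mult(2)[OF c(5) C1_Bv[OF t] y]
      C1_on_mult(2)[OF c(5) C1_thPG[OF t] y] e e1
    by (simp add: algebra_simps)
qed

text \<open>The evolution equation is multiplied by \<open>th * eta1\<close>. Up to a divergence of
  compact support, undifferentiated curvature remains except in the last term, which will be
  dropped: it is nonnegative by convexity of \<open>eta\<close> and positivity of the inverse
  metric, and enters with a minus sign.\<close>

lemma divergence_identity:
  assumes \<epsilon>: "\<epsilon> > 0" and t: "0 < t" "t < T" and y: "1 < norm y"
  shows "th \<rho> y * eta1 \<epsilon> (Sm t y) * S' t y = 2 * th \<rho> y * eta1 \<epsilon> (Sm t y) * trace (Mm t y ** Mm t y)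
    + (\<Sum>i\<in>UNIV. dd (ax i) (Yv \<rho> \<epsilon> t i) y) + eta \<epsilon> (Sm t y) * Zt \<rho> t y
    - th \<rho> y * eta2 \<epsilon> (Sm t y) * (\<Sum>i\<in>UNIV. dd (ax i) (Sc ax (G t)) y * W t i y)"
proof -
  have t': "t \<in> {0..T}" and yE: "y \<in> E" using t y by auto
  let ?s = "\<lambda>i. dd (ax i) (Sc ax (G t)) y" and ?e = "eta \<epsilon> (Sm t y)" and ?e1 = "eta1 \<epsilon> (Sm t y)"
    and ?e2 = "eta2 \<epsilon> (Sm t y)" and ?w = "\<lambda>i. W t i y" and ?th = "th \<rho> y" and ?dth = "\<lambda>i. dd (ax i) (th \<rho>) y"
  have 1: "(\<Sum>i\<in>UNIV. ?dth i * ?w i) = (\<Sum>i\<in>UNIV. ?s i * Bv \<rho> t i y)"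
  proof -
    have "(\<Sum>i\<in>UNIV. ?dth i * ?w i) = (\<Sum>i\<in>UNIV. \<Sum>k\<in>UNIV. ?s k * (?dth i * Hh t y $ i $ k))"
      by (simp add: W_def sum_distrib_left mult_ac)
    also have "\<dots> = (\<Sum>k\<in>UNIV. \<Sum>i\<in>UNIV. ?s k * (?dth i * Hh t y $ i $ k))" by (rule sum.swap)
    finally show ?thesis by (simp add: Bv_def sum_distrib_left)
  qed
  have 2: "(\<Sum>i\<in>UNIV. ?s i * PG t i y) = (\<Sum>i\<in>UNIV. \<Sum>m\<in>UNIV. Gm t i y $ i $ m * ?w m)"
  proof -
    let ?g = "\<lambda>m. \<Sum>j\<in>UNIV. Gm t j y $ j $ m"
    have "(\<Sum>i\<in>UNIV. ?s i * PG t i y) = (\<Sum>i\<in>UNIV. \<Sum>m\<in>UNIV. ?g m * (Hh t y $ m $ i * ?s i))"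
      by (simp only: PG_def sum_distrib_left mult_ac)
    also have "\<dots> = (\<Sum>m\<in>UNIV. \<Sum>i\<in>UNIV. ?g m * (Hh t y $ m $ i * ?s i))" by (rule sum.swap)
    also have "\<dots> = (\<Sum>m\<in>UNIV. ?g m * ?w m)" by (simp add: W_def sum_distrib_left)
    also have "\<dots> = (\<Sum>m\<in>UNIV. \<Sum>i\<in>UNIV. Gm t i y $ i $ m * ?w m)" by (simp add: sum_distrib_right)
    also have "\<dots> = (\<Sum>i\<in>UNIV. \<Sum>m\<in>UNIV. Gm t i y $ i $ m * ?w m)" by (rule sum.swap)
    finally show ?thesis .
  qed
  have "(\<Sum>i\<in>UNIV. dd (ax i) (Yv \<rho> \<epsilon> t i) y) =
     ?e1 * (\<Sum>i\<in>UNIV. ?dth i * ?w i) + ?th * ?e2 * (\<Sum>i\<in>UNIV. ?s i * ?w i) + ?th * ?e1 * (\<Sum>i\<in>UNIV. dd (ax i) (W t i) y)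
     - ?e1 * (\<Sum>i\<in>UNIV. ?s i * Bv \<rho> t i y) - ?e * (\<Sum>i\<in>UNIV. dd (ax i) (Bv \<rho> t i) y)
     + ?e1 * ?th * (\<Sum>i\<in>UNIV. ?s i * PG t i y) + ?e * (\<Sum>i\<in>UNIV. dd (ax i) (\<lambda>y. th \<rho> y * PG t i y) y)"
    unfolding dd_Yv[OF \<epsilon> t' yE] sum_distrib_left sum.distrib[symmetric] sum_subtractf[symmetric]
    by (intro sum.cong refl) (simp add: algebra_simps)
  then show ?thesis
    unfolding evolution[OF t y] Zt_def 1 2 by (simp add: algebra_simps)
qed

end

section \<open>Integral bounds over annuli, uniform in time and radius\<close>

lemma integrable_Ann:
  fixes f :: "'a::euclidean_space \<Rightarrow> real"
  assumes "continuous_on (Ann p q) f"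
  shows "integrable lborel (\<lambda>y. indicator (Ann p q) y * f y)"
  using borel_integrable_compact[OF compact_Ann assms] by simp

lemma integrable_Ann_const: "integrable lborel (\<lambda>y. indicator (Ann p q :: 'a::euclidean_space set) y * (c::real))"
  by (rule integrable_Ann) simp

locale af_flow_L1 = af_flow T \<delta> C0 G for T \<delta> C0 and G :: "real \<Rightarrow> real^'n::finite \<Rightarrow> real^'n^'n" +
  assumes init: "\<exists>r1. set_integrable lborel {y. r1 < norm y} (Sc ax (G 0))"
begin

lemma Ann_subset_E: "1 < p \<Longrightarrow> Ann p q \<subseteq> E"
  by (auto simp: Ann_def)

definition "Q t \<rho> = (LINT y|lborel. indicator (Ann \<rho> (2 * \<rho>)) y * \<bar>Sm t y\<bar>)"

lemma integrable_Ann_S: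
  assumes "t \<in> {0..T}" "1 < p"
  shows "integrable lborel (\<lambda>y. indicator (Ann p q) y * \<bar>Sm t y\<bar>)"
  by (intro integrable_Ann continuous_intros continuous_on_subset[OF continuous_Sm_slice[OF assms(1)] Ann_subset_E[OF assms(2)]])

definition "\<Lambda> = (LINT y|lborel. indicator {y::real^'n. 1 \<le> norm y} y * norm y powr (- (2 * \<delta> + 2)))"

lemma integrable_weight: "integrable lborel (\<lambda>y::real^'n. indicator {y. 1 \<le> norm y} y * norm y powr (- (2 * \<delta> + 2)))"
  by (rule integrable_norm_powr) (use \<delta> in simp)

lemma C1_integrable_dd:
  assumes "C1_on E w" "\<And>y. y \<notin> Ann r0 q \<Longrightarrow> w y = 0"
  shows "integrable lborel (dd v w)" "(LINT y|lborel. dd v w y) = 0" "\<And>y. y \<notin> Ann r0 q \<Longrightarrow> dd v w y = 0"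
proof -
  have K: "compact (Ann r0 q :: (real^'n) set)" "Ann r0 q \<subseteq> E" using compact_Ann Ann_subset_E r0 by auto
  show z: "dd v w y = 0" if "y \<notin> Ann r0 q" for y
    by (rule dd_zero_outside[OF compact_imp_closed[OF K(1)] assms(2) that])
  show "integrable lborel (dd v w)"
    by (rule integrable_zero_extend[OF open_exterior K C1_on_dd_continuous[OF assms(1)] z])
  show "(LINT y|lborel. dd v w y) = 0"
    by (rule integral_dd_zero[OF open_exterior K assms])
qed

text \<open>Majorant of the integrand of the time derivative with the divergence removed. The four
  terms pay for the quadratic decaying terms, the inner cutoff, the outer cutoff and the
  regularisation.\<close>

definition "bnd A C \<epsilon> \<rho> t y = A * (indicator {y::real^'n. 1 \<le> norm y} y * norm y powr (- (2 * \<delta> + 2)))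
  + C * (indicator (Ann r0 (2 * r0)) y * 1) + C / \<rho>\<^sup>2 * (indicator (Ann \<rho> (2 * \<rho>)) y * \<bar>Sm t y\<bar>)
  + C * \<epsilon> * (indicator (Ann r0 (2 * \<rho>)) y * 1)"

lemma integral_bnd:
  assumes "t \<in> {0..T}" "r0 \<le> \<rho>"
  shows "integrable lborel (bnd A C \<epsilon> \<rho> t)"
    "(LINT y|lborel. bnd A C \<epsilon> \<rho> t y) = A * \<Lambda> + C * (LINT y|lborel. indicator (Ann r0 (2 * r0) :: (real^'n) set) y * 1)
      + C / \<rho>\<^sup>2 * Q t \<rho> + C * \<epsilon> * (LINT y|lborel. indicator (Ann r0 (2 * \<rho>) :: (real^'n) set) y * 1)"
proof -
  have r: "1 < \<rho>" using assms r0 by simp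
  note i = integrable_weight integrable_Ann_const[of r0 "2 * r0" 1, where 'a="real^'n"] integrable_Ann_S[OF assms(1) r, of "2 * \<rho>"]
    integrable_Ann_const[of r0 "2 * \<rho>" 1, where 'a="real^'n"]
  show "integrable lborel (bnd A C \<epsilon> \<rho> t)"
    unfolding bnd_def[abs_def] by (intro Bochner_Integration.integrable_add integrable_mult_right i)
  have m: "integrable lborel (\<lambda>y. c * f y)" if "integrable lborel f" for c and f :: "real^'n \<Rightarrow> real"
    using that by (rule integrable_mult_right)
  show "(LINT y|lborel. bnd A C \<epsilon> \<rho> t y) = A * \<Lambda> + C * (LINT y|lborel. indicator (Ann r0 (2 * r0) :: (real^'n) set) y * 1)
      + C / \<rho>\<^sup>2 * Q t \<rho> + C * \<epsilon> * (LINT y|lborel. indicator (Ann r0 (2 * \<rho>) :: (real^'n) set) y * 1)"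
    unfolding bnd_def \<Lambda>_def Q_def
    by (subst Bochner_Integration.integral_add Bochner_Integration.integral_mult_right_zero
        | intro Bochner_Integration.integrable_add m i)+ simp
qed

text \<open>With \<open>u = Hh t y *v v\<close> the form of the inverse metric at \<open>v\<close>
  is the form of the metric at \<open>u\<close>.\<close>

lemma quadratic_form_nonneg:
  assumes "t \<in> {0..T}" "1 < norm y"
  shows "(\<Sum>i\<in>UNIV. s i * (\<Sum>k\<in>UNIV. Hh t y $ i $ k * s k)) \<ge> 0"
proof -
  define v :: "real^'n" where "v = (\<chi> i. s i)"
  define u where "u = Hh t y *v v"
  have Gu: "G t y *v u = v" by (simp add: u_def matrix_vector_mul_assoc Hh_inverse(1)[OF assms])
  have "u \<bullet> (G t y *v u) \<ge> 0" using G_pos[OF assms, of u] by (cases "u = 0") auto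
  then have "u \<bullet> v \<ge> 0" by (simp add: Gu)
  then show ?thesis by (simp add: u_def v_def inner_vec_def matrix_vector_mult_def mult.commute)
qed

lemma measurable_exterior:
  assumes "t \<in> {0..T}" "1 < r"
  shows "(\<lambda>y. indicator {y. r \<le> norm y} y * \<bar>Sm t y\<bar>) \<in> borel_measurable borel"
proof -
  have "closed {y::real^'n. r \<le> norm y}" by (intro closed_Collect_le continuous_intros)
  moreover have "continuous_on {y. r \<le> norm y} (\<lambda>y. \<bar>Sm t y\<bar>)"
    by (intro continuous_intros continuous_on_subset[OF continuous_Sm_slice[OF assms(1)]]) (use assms(2) in auto)
  ultimately have "(\<lambda>y. indicator {y. r \<le> norm y} y *\<^sub>R \<bar>Sm t y\<bar>) \<in> borel_measurable borel"
    by (intro borel_measurable_continuous_on_indicator) (auto intro: borel_closed)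
  then show ?thesis by simp
qed

text \<open>Integrability is given beyond some radius \<open>r1\<close>; an annulus between
  \<open>r0\<close> and \<open>r1\<close> adds a compact piece.\<close>

lemma integrable_initial:
  shows "integrable lborel (\<lambda>y. indicator {y. r0 \<le> norm y} y * \<bar>Sm 0 y\<bar>)"
proof -
  have T0: "0 \<in> {0..T}" using T by simp
  obtain r1 where r1: "set_integrable lborel {y. r1 < norm y} (Sc ax (G 0))" using init by blast
  have i: "integrable lborel (\<lambda>y. indicator {y. r1 < norm y} y * \<bar>Sm 0 y\<bar> + indicator (Ann r0 r1) y * \<bar>Sm 0 y\<bar>)"
    using set_integrable_abs[OF r1] integrable_Ann_S[OF T0, of r0 r1] r0
    by (intro Bochner_Integration.integrable_add) (auto simp: set_integrable_def)
  have m: "(\<lambda>y. indicator {y. r0 \<le> norm y} y * \<bar>Sm 0 y\<bar>) \<in> borel_measurable lborel"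
    using measurable_exterior[OF T0, of r0] r0 by simp
  show ?thesis
    by (rule Bochner_Integration.integrable_bound[OF i m]) (auto simp: Ann_def indicator_def intro!: AE_I2)
qed

text \<open>The divergence identity is integrated in space and the gradient term dropped; what is
  left bounds the growth rate. \<open>A\<close> and \<open>C\<close> depend neither on \<rho> nor on
  \<epsilon> or time, and \<open>q\<close> enters through the outer annulus alone, divided by
  \<open>\<rho>^2\<close>.\<close>

lemma regularized_estimate:
  obtains A C where "A \<ge> 0" "C \<ge> 0"
    "\<And>\<rho> q \<epsilon> t. r0 \<le> \<rho> \<Longrightarrow> \<epsilon> > 0 \<Longrightarrow> t \<in> {0..T} \<Longrightarrow> (\<And>t. t \<in> {0..T} \<Longrightarrow> Q t \<rho> \<le> q) \<Longrightarrow>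
      (LINT y|lborel. th \<rho> y * eta \<epsilon> (Sm t y)) \<le> (LINT y|lborel. th \<rho> y * eta \<epsilon> (Sm 0 y))
        + T * (A + C / \<rho>\<^sup>2 * q + C * \<epsilon> * (LINT y|lborel. indicator (Ann r0 (2 * \<rho>) :: (real^'n) set) y * 1))"
proof -
  have "dec (2 * \<delta> + 4) (\<lambda>t y. trace (Mm t y ** Mm t y))"
    unfolding trace_def by (intro dec_sum dec_matrix_mult[OF dec_M dec_M]) simp
  then obtain CM where CM: "CM > 0" "\<And>t y. t \<in> {0..T} \<Longrightarrow> r0 \<le> norm y \<Longrightarrow> \<bar>trace (Mm t y ** Mm t y)\<bar> \<le> CM * norm y powr (- (2 * \<delta> + 4))"
    using decE by blast
  obtain CS where CS: "CS > 0" "\<And>t y. t \<in> {0..T} \<Longrightarrow> r0 \<le> norm y \<Longrightarrow> \<bar>Sm t y\<bar> \<le> CS * norm y powr (- (\<delta> + 2))"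
    using decE[OF dec_S] by blast
  obtain CZ where CZ: "CZ > 0" "\<And>\<rho> t y. r0 \<le> \<rho> \<Longrightarrow> t \<in> {0..T} \<Longrightarrow> r0 \<le> norm y \<Longrightarrow>
    \<bar>Zt \<rho> t y\<bar> \<le> CZ * (bt \<rho> y + norm y powr (- (\<delta> + 2)))" using Zt_bound by blast
  define A0 where "A0 = 2 * CM + CZ * CS"
  \<comment> \<open>\<open>CZ * CS\<close> pays for the inner annulus, where the scalar curvature is
    at most \<open>CS\<close>. In \<open>3 * CZ\<close> the 3 bounds \<open>bt\<close> plus the
    decaying weight, which are at most 2 and 1.\<close>
  define C where "C = max (CZ * CS) (3 * CZ)"
  define A where "A = A0 * \<Lambda> + C * (LINT y|lborel. indicator (Ann r0 (2 * r0) :: (real^'n) set) y * 1)"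
  have C: "C > 0" "CZ \<le> C" "CZ * CS \<le> C" "3 * CZ \<le> C" using CZ(1) CS(1) by (auto simp: C_def less_max_iff_disj le_max_iff_disj)
  have A0: "A0 > 0" using CM(1) CZ(1) CS(1) by (simp add: A0_def add_pos_pos)
  have L0: "\<Lambda> \<ge> 0" unfolding \<Lambda>_def by (intro Bochner_Integration.integral_nonneg) auto
  have A: "A \<ge> 0" unfolding A_def using A0 C L0 by (intro add_nonneg_nonneg mult_nonneg_nonneg Bochner_Integration.integral_nonneg) auto
  show ?thesis
  proof (rule that[of A C])
    show "A \<ge> 0" "C \<ge> 0" using A C by auto
    fix \<rho> q \<epsilon> t :: real assume \<rho>: "r0 \<le> \<rho>" and \<epsilon>: "\<epsilon> > 0" and t: "t \<in> {0..T}" and q: "\<And>t. t \<in> {0..T} \<Longrightarrow> Q t \<rho> \<le> q"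
    define K where "K = (Ann r0 (2 * \<rho>) :: (real^'n) set)"
    define v where "v = (LINT y|lborel. indicator K y * (1::real))"
    define L where "L = A + C / \<rho>\<^sup>2 * q + C * \<epsilon> * v"
    have K: "compact K" "K \<subseteq> E" using r0 by (auto simp: K_def compact_Ann intro!: Ann_subset_E)
    have thK: "th \<rho> y = 0" if "y \<notin> K" for y using th_values(3)[OF \<rho>] that by (simp add: K_def)
    have rho1: "\<rho> \<ge> 1" "\<rho> > 0" using \<rho> r0 by auto
    define I where "I t = (LINT y|lborel. th \<rho> y * eta \<epsilon> (Sm t y))" for t
    define f' where "f' t y = th \<rho> y * (eta1 \<epsilon> (Sm t y) * S' t y)" for t y
    have cth: "continuous_on (X \<times> E) (\<lambda>p. th \<rho> (snd p))" for X :: "real set"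
      by (rule continuous_on_compose2[OF C1_on_continuous[OF C1_th(1)]]) (auto intro!: continuous_intros)
    have cS: "continuous_on (X \<times> E) (\<lambda>p. Sm (fst p) (snd p))" if "X \<subseteq> {0..T}" for X
      by (rule continuous_on_subset[OF continuous_Sm[unfolded case_prod_unfold]]) (use that in auto)
    have cI: "continuous_on {0..T} I"
      unfolding I_def
    proof (rule continuous_on_lborel_param[OF open_exterior K])
      show "continuous_on ({0..T} \<times> E) (\<lambda>(t, y). th \<rho> y * eta \<epsilon> (Sm t y))"
        unfolding case_prod_unfold
        by (intro continuous_intros cth continuous_on_compose2[OF continuous_eta(1)[OF \<epsilon>]] cS) auto
    qed (use thK in auto)
    have cI': "continuous_on ({0<..<T} \<times> E) (\<lambda>(t, y). f' t y)"
      unfolding f'_def case_prod_unfold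
      by (intro continuous_intros cth continuous_on_compose2[OF continuous_eta(2)[OF \<epsilon>]] cS continuous_S'[unfolded case_prod_unfold]) auto
    have dI: "(I has_real_derivative (LINT y|lborel. f' t y)) (at t)" if t: "0 < t" "t < T" for t
    proof -
      have "((\<lambda>t. LINT y|lborel. th \<rho> y * eta \<epsilon> (Sm t y)) has_real_derivative (LINT y|lborel. f' t y)) (at t within {0<..<T})"
      proof (rule leibniz_lborel[OF open_exterior K])
        show "continuous_on ({0<..<T} \<times> E) (\<lambda>(t, y). th \<rho> y * eta \<epsilon> (Sm t y))"
          unfolding case_prod_unfold
          by (intro continuous_intros cth continuous_on_compose2[OF continuous_eta(1)[OF \<epsilon>]] cS) auto
        fix s y assume s: "s \<in> {0<..<T}" and "y \<in> K"
        then have "((\<lambda>s. Sm s y) has_real_derivative S' s y) (at s)" using K by (intro DERIV_S) auto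
        from DERIV_cmult[OF DERIV_chain2[OF DERIV_eta[OF \<epsilon>] this], of "th \<rho> y"]
        show "((\<lambda>s. th \<rho> y * eta \<epsilon> (Sm s y)) has_real_derivative f' s y) (at s within {0<..<T})"
          unfolding f'_def by (rule has_field_derivative_at_within)
      qed (use t thK cI' in \<open>auto simp: f'_def\<close>)
      then show ?thesis unfolding I_def[abs_def] using t by (simp add: at_within_open[of t "{0<..<T}"])
    qed
    have le: "(LINT y|lborel. f' s y) \<le> L" if s: "0 < s" "s < T" for s
    proof -
      have s': "s \<in> {0..T}" using s by simp
      have Y0: "Yv \<rho> \<epsilon> s i y = 0" if "y \<notin> K" for i y
      proof -
        have "dd v (th \<rho>) y = 0" for v by (rule dd_zero_outside[OF compact_imp_closed[OF K(1)] thK that])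
        then show ?thesis using thK[OF that] by (simp add: Yv_def Bv_def)
      qed
      note Y = C1_integrable_dd[OF C1_Yv[OF \<epsilon> s'] Y0[unfolded K_def]]
      let ?f = "\<lambda>y. f' s y - (\<Sum>i\<in>UNIV. dd (ax i) (Yv \<rho> \<epsilon> s i) y)"
      have if': "integrable lborel (f' s)"
        by (rule integrable_zero_extend[OF open_exterior K])
           (use continuous_on_slice[OF cI'] s thK in \<open>auto simp: f'_def\<close>)
      have iY: "integrable lborel (\<lambda>y. \<Sum>i\<in>UNIV. dd (ax i) (Yv \<rho> \<epsilon> s i) y)"
        by (intro Bochner_Integration.integrable_sum Y(1))
      have "(LINT y|lborel. (\<Sum>i\<in>UNIV. dd (ax i) (Yv \<rho> \<epsilon> s i) y)) = 0"
        using Y(1,2) by (subst Bochner_Integration.integral_sum) auto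
      then have "(LINT y|lborel. f' s y) = (LINT y|lborel. ?f y)"
        using if' iY by simp
      also have "\<dots> \<le> (LINT y|lborel. bnd A0 C \<epsilon> \<rho> s y)"
      proof (rule integral_mono)
        show "integrable lborel ?f" using if' iY by simp
        show "integrable lborel (bnd A0 C \<epsilon> \<rho> s)" by (rule integral_bnd(1)[OF s' \<rho>])
        fix y :: "real^'n"
        show "?f y \<le> bnd A0 C \<epsilon> \<rho> s y"
        proof (cases "y \<in> K")
          case False
          then have "?f y = 0" using Y(3) thK by (simp add: f'_def K_def)
          moreover have "bnd A0 C \<epsilon> \<rho> s y \<ge> 0" unfolding bnd_def using A0 C \<epsilon> by (intro add_nonneg_nonneg mult_nonneg_nonneg) auto
          ultimately show ?thesis by simp
        next
          case True
          then have y: "r0 \<le> norm y" "1 < norm y" "1 \<le> norm y" using r0 by (auto simp: K_def Ann_def)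
          let ?S = "Sm s y" and ?p = "norm y powr (- (2 * \<delta> + 2))" and ?d = "norm y powr (- (\<delta> + 2))"
          have p4: "norm y powr (- (2 * \<delta> + 4)) \<le> ?p" using y by (intro powr_mono) auto
          have d1: "?d \<le> 1"
          proof -
            have "?d \<le> norm y powr 0" using y \<delta> by (intro powr_mono) auto
            then show ?thesis using y by (cases "y = 0") auto
          qed
          have dd4: "?d * ?d \<le> ?p" using p4 by (simp add: powr_add[symmetric])
          have quad: "th \<rho> y * eta2 \<epsilon> ?S * (\<Sum>i\<in>UNIV. dd (ax i) (Sc ax (G s)) y * W s i y) \<ge> 0"
            unfolding W_def using quadratic_form_nonneg[OF s' y(2)] th_values(1)[OF \<rho>] eta_bounds(4)[OF \<epsilon>]
            by (intro mult_nonneg_nonneg) auto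
          have "?f y = 2 * th \<rho> y * eta1 \<epsilon> ?S * trace (Mm s y ** Mm s y) + eta \<epsilon> ?S * Zt \<rho> s y
            - th \<rho> y * eta2 \<epsilon> ?S * (\<Sum>i\<in>UNIV. dd (ax i) (Sc ax (G s)) y * W s i y)"
            using divergence_identity[OF \<epsilon> s y(2), of \<rho>] by (simp add: f'_def mult.assoc)
          also have "\<dots> \<le> 2 * th \<rho> y * eta1 \<epsilon> ?S * trace (Mm s y ** Mm s y) + eta \<epsilon> ?S * Zt \<rho> s y"
            using quad by simp
          also have "\<dots> \<le> 2 * (CM * ?p) + (\<bar>?S\<bar> + \<epsilon>) * (CZ * (bt \<rho> y + ?d))"
          proof (rule add_mono)
            have "\<bar>th \<rho> y * eta1 \<epsilon> ?S * trace (Mm s y ** Mm s y)\<bar> \<le> 1 * 1 * (CM * ?p)"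
              unfolding abs_mult using th_values[OF \<rho>, of y] eta_bounds(3)[OF \<epsilon>, of ?S] CM(1) p4
              by (intro mult_mono order_trans[OF CM(2)[OF s' y(1)]] mult_left_mono) auto
            then show "2 * th \<rho> y * eta1 \<epsilon> ?S * trace (Mm s y ** Mm s y) \<le> 2 * (CM * ?p)" by (simp add: abs_le_iff)
            have "\<bar>eta \<epsilon> ?S * Zt \<rho> s y\<bar> \<le> (\<bar>?S\<bar> + \<epsilon>) * (CZ * (bt \<rho> y + ?d))"
              unfolding abs_mult using eta_bounds(2,5)[OF \<epsilon>, of ?S] CZ(2)[OF \<rho> s' y(1)] \<epsilon> by (intro mult_mono) auto
            then show "eta \<epsilon> ?S * Zt \<rho> s y \<le> (\<bar>?S\<bar> + \<epsilon>) * (CZ * (bt \<rho> y + ?d))" by (simp add: abs_le_iff)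
          qed
          also have "\<dots> = 2 * (CM * ?p) + CZ * (\<bar>?S\<bar> * indicator (Ann r0 (2 * r0)) y)
              + CZ / \<rho>\<^sup>2 * (indicator (Ann \<rho> (2 * \<rho>)) y * \<bar>?S\<bar>) + CZ * (\<bar>?S\<bar> * ?d) + \<epsilon> * (CZ * (bt \<rho> y + ?d))"
            by (simp add: bt_def algebra_simps add_divide_distrib)
          also have "\<dots> \<le> 2 * (CM * ?p) + C * (indicator (Ann r0 (2 * r0)) y * 1)
              + C / \<rho>\<^sup>2 * (indicator (Ann \<rho> (2 * \<rho>)) y * \<bar>?S\<bar>) + CZ * CS * ?p + C * \<epsilon>"
          proof (intro add_mono order_refl)
            have S1: "\<bar>?S\<bar> \<le> CS" using CS(2)[OF s' y(1)] d1 CS(1) mult_left_le[of ?d CS] by linarith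
            have "CZ * (\<bar>?S\<bar> * indicator (Ann r0 (2 * r0)) y) \<le> CZ * (CS * indicator (Ann r0 (2 * r0)) y)"
              using S1 CZ(1) by (intro mult_left_mono mult_right_mono) auto
            also have "\<dots> \<le> C * (indicator (Ann r0 (2 * r0)) y * 1)"
              using C(3) by (simp add: mult.assoc[symmetric] mult_right_mono)
            finally show "CZ * (\<bar>?S\<bar> * indicator (Ann r0 (2 * r0)) y) \<le> C * (indicator (Ann r0 (2 * r0)) y * 1)" .
            show "CZ / \<rho>\<^sup>2 * (indicator (Ann \<rho> (2 * \<rho>)) y * \<bar>?S\<bar>) \<le> C / \<rho>\<^sup>2 * (indicator (Ann \<rho> (2 * \<rho>)) y * \<bar>?S\<bar>)"
              using C by (intro mult_right_mono divide_right_mono) auto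
            have "\<bar>?S\<bar> * ?d \<le> (CS * ?d) * ?d" using CS(2)[OF s' y(1)] by (intro mult_right_mono) auto
            also have "\<dots> \<le> CS * ?p" using dd4 CS(1) by (simp add: mult.assoc mult_left_mono)
            finally show "CZ * (\<bar>?S\<bar> * ?d) \<le> CZ * CS * ?p" using CZ(1) by (simp add: mult.assoc mult_left_mono)
            have "1 / \<rho>\<^sup>2 \<le> 1" using rho1 by simp
            then have "bt \<rho> y \<le> 1 + 1" unfolding bt_def by (intro add_mono) (auto simp: indicator_def)
            then have "CZ * (bt \<rho> y + ?d) \<le> CZ * 3" using d1 CZ(1) by (intro mult_left_mono) auto
            also have "\<dots> \<le> C" using C by simp
            finally show "\<epsilon> * (CZ * (bt \<rho> y + ?d)) \<le> C * \<epsilon>" using \<epsilon> by (simp add: mult.commute mult_left_mono)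
          qed
          also have "\<dots> = bnd A0 C \<epsilon> \<rho> s y"
            using True y by (simp add: bnd_def A0_def K_def algebra_simps)
          finally show ?thesis .
        qed
      qed
      also have "\<dots> = A + C / \<rho>\<^sup>2 * Q s \<rho> + C * \<epsilon> * v"
        unfolding integral_bnd(2)[OF s' \<rho>] by (simp add: A_def v_def K_def)
      also have "\<dots> \<le> L"
        unfolding L_def using mult_left_mono[OF q[OF s'], of "C / \<rho>\<^sup>2"] C by simp
      finally show ?thesis .
    qed
    have L: "L \<ge> 0"
    proof -
      have "0 \<le> Q 0 \<rho>" unfolding Q_def by (intro Bochner_Integration.integral_nonneg) auto
      then have "0 \<le> q" using q[of 0] T by simp
      moreover have "v \<ge> 0" unfolding v_def by (intro Bochner_Integration.integral_nonneg) auto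
      ultimately show ?thesis unfolding L_def using A C \<epsilon> by (intro add_nonneg_nonneg mult_nonneg_nonneg) auto
    qed
    have "I t \<le> I 0 + T * L"
    proof (cases "t = 0")
      case True
      then show ?thesis using L T by simp
    next
      case False
      then have t0: "0 < t" "t \<le> T" using t by auto
      \<comment> \<open>The evolution equation holds at interior times; the mean value theorem asks
        for continuity of \<open>I\<close> alone at the ends.\<close>
      have "\<exists>l z. 0 < z \<and> z < t \<and> (I has_real_derivative l) (at z) \<and> I t - I 0 = (t - 0) * l"
      proof (rule MVT[OF t0(1)])
        show "continuous_on {0..t} I" by (rule continuous_on_subset[OF cI]) (use t0 in auto)
        show "I differentiable (at x)" if "0 < x" "x < t" for x
          by (rule differentiableI[OF dI[unfolded has_field_derivative_def]]) (use that t0 in auto)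
      qed
      then obtain l z where z: "0 < z" "z < t" "(I has_real_derivative l) (at z)" "I t - I 0 = t * l" by auto
      have "l = (LINT y|lborel. f' z y)" by (rule DERIV_unique[OF z(3) dI]) (use z t0 in auto)
      then have "l \<le> L" using le[of z] z t0 by simp
      then have "t * l \<le> T * L" using t0 L by (intro order_trans[OF mult_left_mono mult_right_mono]) auto
      then show ?thesis using z(4) by simp
    qed
    then show "(LINT y|lborel. th \<rho> y * eta \<epsilon> (Sm t y)) \<le> (LINT y|lborel. th \<rho> y * eta \<epsilon> (Sm 0 y))
        + T * (A + C / \<rho>\<^sup>2 * q + C * \<epsilon> * (LINT y|lborel. indicator (Ann r0 (2 * \<rho>) :: (real^'n) set) y * 1))"
      unfolding I_def L_def v_def K_def .
  qed
qed

end

lemma measure_Ann_le: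
  assumes "p \<ge> 0" "0 < q"
  shows "(LINT y|lborel. indicator (Ann p q :: 'a::euclidean_space set) y * (1::real)) \<le> measure lborel (ball (0::'a) 1) * (2 * q) ^ DIM('a)"
proof -
  have "(LINT y|lborel. indicator (Ann p q :: 'a set) y * (1::real)) = measure lborel (Ann p q :: 'a set)"
    by simp
  also have "\<dots> \<le> measure lborel (ball (0::'a) (2 * q))"
    using assms emeasure_lborel_ball_finite[of "0::'a" "2 * q"]
    by (intro measure_mono_fmeasurable) (auto simp: Ann_def fmeasurable_def intro: Ann_sets[unfolded Ann_def])
  also have "\<dots> = measure lborel (ball (0::'a) 1) * (2 * q) ^ DIM('a)"
    using content_ball_conv_unit_ball[of "2 * q" "0::'a"] assms by (simp add: mult.commute)
  finally show ?thesis .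
qed

context af_flow_L1
begin

lemma integrable_th:
  assumes "t \<in> {0..T}" "r0 \<le> \<rho>" "continuous_on UNIV h"
  shows "integrable lborel (\<lambda>y. th \<rho> y * h (Sm t y))"
proof (rule integrable_zero_extend[OF open_exterior[of 1] compact_Ann[of r0 "2 * \<rho>"]])
  show "continuous_on E (\<lambda>y. th \<rho> y * h (Sm t y))"
    by (intro continuous_intros continuous_on_subset[OF C1_on_continuous[OF C1_th(1)]]
        continuous_on_compose2[OF assms(3) continuous_Sm_slice[OF assms(1)]]) auto
qed (use r0 th_values(3)[OF assms(2)] in \<open>auto simp: Ann_def\<close>)

text \<open>Lets \<epsilon> tend to zero at fixed \<rho>, where the \<epsilon>-terms multiply the
  finite volume of an annulus; the regularised absolute value becomes the absolute value.\<close>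

lemma L1_step:
  obtains A C where "A \<ge> 0" "C \<ge> 0"
    "\<And>\<rho> q t. r0 \<le> \<rho> \<Longrightarrow> t \<in> {0..T} \<Longrightarrow> (\<And>t. t \<in> {0..T} \<Longrightarrow> Q t \<rho> \<le> q) \<Longrightarrow>
      (LINT y|lborel. th \<rho> y * \<bar>Sm t y\<bar>) \<le> A + C / \<rho>\<^sup>2 * q"
proof -
  obtain A C where AC: "A \<ge> 0" "C \<ge> 0"
    "\<And>\<rho> q \<epsilon> t. r0 \<le> \<rho> \<Longrightarrow> \<epsilon> > 0 \<Longrightarrow> t \<in> {0..T} \<Longrightarrow> (\<And>t. t \<in> {0..T} \<Longrightarrow> Q t \<rho> \<le> q) \<Longrightarrow>
      (LINT y|lborel. th \<rho> y * eta \<epsilon> (Sm t y)) \<le> (LINT y|lborel. th \<rho> y * eta \<epsilon> (Sm 0 y))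
        + T * (A + C / \<rho>\<^sup>2 * q + C * \<epsilon> * (LINT y|lborel. indicator (Ann r0 (2 * \<rho>) :: (real^'n) set) y * 1))"
    using regularized_estimate by blast
  define N where "N = (LINT y|lborel. indicator {y. r0 \<le> norm y} y * \<bar>Sm 0 y\<bar>)"
  have N: "N \<ge> 0" unfolding N_def by (intro Bochner_Integration.integral_nonneg) auto
  have T0: "0 \<in> {0..T}" using T by simp
  show ?thesis
  proof (rule that[of "N + T * A" "T * C"])
    show "N + T * A \<ge> 0" "T * C \<ge> 0" using N AC T by auto
    fix \<rho> q t :: real assume \<rho>: "r0 \<le> \<rho>" and t: "t \<in> {0..T}" and q: "\<And>t. t \<in> {0..T} \<Longrightarrow> Q t \<rho> \<le> q"
    define v where "v = (LINT y|lborel. indicator (Ann r0 (2 * \<rho>) :: (real^'n) set) y * (1::real))"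
    have est: "(LINT y|lborel. th \<rho> y * \<bar>Sm t y\<bar>) \<le> (N + T * A + T * C / \<rho>\<^sup>2 * q) + \<epsilon> * (v + T * (C * v))" if \<epsilon>: "\<epsilon> > 0" for \<epsilon>
    proof -
      have iabs: "integrable lborel (\<lambda>y. th \<rho> y * \<bar>Sm t y\<bar>)" if "t \<in> {0..T}" for t
        by (rule integrable_th[OF that \<rho>]) (intro continuous_intros)
      have "(LINT y|lborel. th \<rho> y * \<bar>Sm t y\<bar>) \<le> (LINT y|lborel. th \<rho> y * eta \<epsilon> (Sm t y))"
        by (intro integral_mono iabs[OF t] integrable_th[OF t \<rho> continuous_eta(1)[OF \<epsilon>]] mult_left_mono eta_bounds(1)[OF \<epsilon>] th_values(1)[OF \<rho>])
      also have "\<dots> \<le> (LINT y|lborel. th \<rho> y * eta \<epsilon> (Sm 0 y)) + T * (A + C / \<rho>\<^sup>2 * q + C * \<epsilon> * v)"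
        unfolding v_def by (rule AC(3)[OF \<rho> \<epsilon> t q])
      also have "(LINT y|lborel. th \<rho> y * eta \<epsilon> (Sm 0 y)) \<le>
          (LINT y|lborel. indicator {y. r0 \<le> norm y} y * \<bar>Sm 0 y\<bar> + \<epsilon> * (indicator (Ann r0 (2 * \<rho>)) y * 1))"
      proof (rule integral_mono)
        show "integrable lborel (\<lambda>y. th \<rho> y * eta \<epsilon> (Sm 0 y))" by (rule integrable_th[OF T0 \<rho> continuous_eta(1)[OF \<epsilon>]])
        show "integrable lborel (\<lambda>y. indicator {y. r0 \<le> norm y} y * \<bar>Sm 0 y\<bar> + \<epsilon> * (indicator (Ann r0 (2 * \<rho>)) y * 1))"
          by (intro Bochner_Integration.integrable_add integrable_initial integrable_mult_right integrable_Ann_const)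
        fix y :: "real^'n"
        show "th \<rho> y * eta \<epsilon> (Sm 0 y) \<le> indicator {y. r0 \<le> norm y} y * \<bar>Sm 0 y\<bar> + \<epsilon> * (indicator (Ann r0 (2 * \<rho>)) y * 1)"
        proof (cases "y \<in> Ann r0 (2 * \<rho>)")
          case True
          have "th \<rho> y * eta \<epsilon> (Sm 0 y) \<le> 1 * (\<bar>Sm 0 y\<bar> + \<epsilon>)"
            using th_values[OF \<rho>, of y] eta_bounds(2,5)[OF \<epsilon>] \<epsilon> by (intro mult_mono) auto
          then show ?thesis using True by (simp add: Ann_def)
        next
          case False
          then show ?thesis using th_values(3)[OF \<rho> False] by simp
        qed
      qed
      also have "\<dots> = N + \<epsilon> * v"
        unfolding N_def v_def using integrable_initial integrable_Ann_const[of r0 "2 * \<rho>" 1, where 'a="real^'n"]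
        by (subst Bochner_Integration.integral_add) (auto intro!: integrable_mult_right)
      finally show ?thesis by (simp add: algebra_simps)
    qed
    define b where "b = N + T * A + T * C / \<rho>\<^sup>2 * q"
    define c where "c = v + T * (C * v)"
    have c: "c \<ge> 0"
    proof -
      have "v \<ge> 0" unfolding v_def by (intro Bochner_Integration.integral_nonneg) auto
      then show ?thesis unfolding c_def using AC T by simp
    qed
    have "(LINT y|lborel. th \<rho> y * \<bar>Sm t y\<bar>) \<le> b"
    proof (rule field_le_epsilon)
      fix e :: real assume e: "0 < e"
      \<comment> \<open>\<open>c\<close> is known to be nonnegative, possibly zero, hence
        \<open>c + 1\<close> in the denominator.\<close>
      have "(LINT y|lborel. th \<rho> y * \<bar>Sm t y\<bar>) \<le> b + (e / (c + 1)) * c"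
        using est[of "e / (c + 1)"] e c by (simp add: b_def c_def)
      also have "(e / (c + 1)) * c \<le> e" using e c by (simp add: field_simps)
      finally show "(LINT y|lborel. th \<rho> y * \<bar>Sm t y\<bar>) \<le> b + e" by simp
    qed
    then show "(LINT y|lborel. th \<rho> y * \<bar>Sm t y\<bar>) \<le> N + T * A + T * C / \<rho>\<^sup>2 * q"
      unfolding b_def .
  qed
qed

lemma S_bounded: obtains CS where "CS > 0" "\<And>t y. t \<in> {0..T} \<Longrightarrow> r0 \<le> norm y \<Longrightarrow> \<bar>Sm t y\<bar> \<le> CS"
proof -
  obtain CS where CS: "CS > 0" "\<And>t y. t \<in> {0..T} \<Longrightarrow> r0 \<le> norm y \<Longrightarrow> \<bar>Sm t y\<bar> \<le> CS * norm y powr (- (\<delta> + 2))"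
    using decE[OF dec_S] by blast
  have "\<bar>Sm t y\<bar> \<le> CS" if "t \<in> {0..T}" "r0 \<le> norm y" for t y
  proof -
    have "norm y powr (- (\<delta> + 2)) \<le> norm y powr 0" using that r0 \<delta> by (intro powr_mono) auto
    also have "\<dots> = 1" using that r0 by auto
    finally have "CS * norm y powr (- (\<delta> + 2)) \<le> CS" using CS(1) by (simp add: mult_left_le)
    then show ?thesis using CS(2)[OF that] by simp
  qed
  then show ?thesis using that CS(1) by blast
qed

lemma integral_S_Ann_le:
  assumes "t \<in> {0..T}" "r0 \<le> p" "0 < q" "\<And>y. r0 \<le> norm y \<Longrightarrow> \<bar>Sm t y\<bar> \<le> CS" "CS > 0"
  shows "(LINT y|lborel. indicator (Ann p q) y * \<bar>Sm t y\<bar>) \<le> CS * (measure lborel (ball (0::real^'n) 1) * (2 * q) ^ CARD('n))"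
proof -
  have "(LINT y|lborel. indicator (Ann p q) y * \<bar>Sm t y\<bar>) \<le> (LINT y|lborel. CS * (indicator (Ann p q :: (real^'n) set) y * 1))"
  proof (rule integral_mono)
    show "integrable lborel (\<lambda>y. indicator (Ann p q) y * \<bar>Sm t y\<bar>)" using assms r0 by (intro integrable_Ann_S) auto
    show "integrable lborel (\<lambda>y::real^'n. CS * (indicator (Ann p q) y * 1))"
      by (intro integrable_mult_right integrable_Ann_const)
  qed (use assms in \<open>auto simp: indicator_def Ann_def\<close>)
  also have "\<dots> = CS * (LINT y|lborel. indicator (Ann p q :: (real^'n) set) y * 1)" by simp
  also have "\<dots> \<le> CS * (measure lborel (ball (0::real^'n) 1) * (2 * q) ^ DIM(real^'n))"
    using assms r0 by (intro mult_left_mono measure_Ann_le) auto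
  finally show ?thesis by simp
qed

text \<open>The estimate gains a factor \<open>\<rho>\<^sup>2\<close> each time it is applied, starting from the trivial
  bound by the volume of the annulus.\<close>

lemma Q_polynomial_bound: "\<exists>C\<ge>0. \<forall>\<rho>\<ge>r0. \<forall>t\<in>{0..T}. Q t \<rho> \<le> C * \<rho> ^ (2 * (CARD('n) - k))"
proof (induction k)
  case 0
  obtain CS where CS: "CS > 0" "\<And>t y. t \<in> {0..T} \<Longrightarrow> r0 \<le> norm y \<Longrightarrow> \<bar>Sm t y\<bar> \<le> CS" using S_bounded by blast
  let ?c = "CS * (measure lborel (ball (0::real^'n) 1) * 4 ^ CARD('n))"
  show ?case
  proof (intro exI[of _ ?c] conjI allI impI ballI)
    show "?c \<ge> 0" using CS by simp
    fix \<rho> t assume \<rho>: "r0 \<le> \<rho>" and t: "t \<in> {0..T}"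
    have "Q t \<rho> \<le> CS * (measure lborel (ball (0::real^'n) 1) * (2 * (2 * \<rho>)) ^ CARD('n))"
      unfolding Q_def by (rule integral_S_Ann_le[OF t \<rho>]) (use CS t \<rho> r0 in auto)
    also have "\<dots> = ?c * \<rho> ^ CARD('n)" by (simp add: power_mult_distrib)
    \<comment> \<open>Rounding the exponent up to \<open>2 * CARD('n)\<close> makes every gain of
      \<open>\<rho>^2\<close> one step of the induction, which ends with exponent 0 after
      \<open>CARD('n)\<close> steps.\<close>
    also have "\<dots> \<le> ?c * \<rho> ^ (2 * CARD('n))"
      using CS \<rho> r0 by (intro mult_left_mono power_increasing) auto
    finally show "Q t \<rho> \<le> ?c * \<rho> ^ (2 * (CARD('n) - 0))" by simp
  qed
next
  case (Suc k)
  show ?case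
  proof (cases "k < CARD('n)")
    case False
    then show ?thesis using Suc by simp
  next
    case True
    define m where "m = CARD('n) - Suc k"
    have m: "CARD('n) - k = Suc m" using True by (simp add: m_def)
    obtain C0 where C0: "C0 \<ge> 0" "\<And>\<rho> t. r0 \<le> \<rho> \<Longrightarrow> t \<in> {0..T} \<Longrightarrow> Q t \<rho> \<le> C0 * \<rho> ^ (2 * Suc m)"
      using Suc unfolding m by blast
    obtain A C where AC: "A \<ge> 0" "C \<ge> 0"
      "\<And>\<rho> q t. r0 \<le> \<rho> \<Longrightarrow> t \<in> {0..T} \<Longrightarrow> (\<And>t. t \<in> {0..T} \<Longrightarrow> Q t \<rho> \<le> q) \<Longrightarrow>
      (LINT y|lborel. th \<rho> y * \<bar>Sm t y\<bar>) \<le> A + C / \<rho>\<^sup>2 * q"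
      using L1_step by blast
    obtain CS where CS: "CS > 0" "\<And>t y. t \<in> {0..T} \<Longrightarrow> r0 \<le> norm y \<Longrightarrow> \<bar>Sm t y\<bar> \<le> CS" using S_bounded by blast
    define V where "V = CS * (measure lborel (ball (0::real^'n) 1) * (2 * (4 * r0)) ^ CARD('n))"
    have V: "V \<ge> 0" using CS r0 by (simp add: V_def)
    let ?c = "V + A + C * C0 * 4 ^ m"
    show ?thesis
    proof (intro exI[of _ ?c] conjI allI impI ballI)
      show "?c \<ge> 0" using V AC C0 by simp
      fix \<rho> t assume \<rho>: "r0 \<le> \<rho>" and t: "t \<in> {0..T}"
      have r1: "1 \<le> \<rho> ^ (2 * m)" using \<rho> r0 by (intro one_le_power) auto
      have "Q t \<rho> \<le> V + A + C * C0 * 4 ^ m * \<rho> ^ (2 * m)"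
      proof (cases "\<rho> < 2 * r0")
        case True
        \<comment> \<open>Below \<open>2 * r0\<close> the inner cutoff need not equal 1 on the
          annulus, but the annulus lies in a fixed compact one, with the fixed bound
          \<open>V\<close>.\<close>
        have "Q t \<rho> \<le> (LINT y|lborel. indicator (Ann r0 (4 * r0)) y * \<bar>Sm t y\<bar>)"
          unfolding Q_def by (intro integral_mono integrable_Ann_S t) (use True \<rho> r0 in \<open>auto simp: indicator_def Ann_def\<close>)
        also have "\<dots> \<le> V" unfolding V_def by (rule integral_S_Ann_le[OF t]) (use CS t r0 in auto)
        also have "\<dots> \<le> V + A + C * C0 * 4 ^ m * \<rho> ^ (2 * m)" using AC C0 \<rho> r0 by simp
        finally show ?thesis .
      next
        case False
        have \<rho>2: "r0 \<le> 2 * \<rho>" using \<rho> r0 by simp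
        \<comment> \<open>The cutoff with outer radius \<open>2 * \<rho>\<close> equals 1 on the
          annulus at \<rho>. So \<open>Q\<close> at \<rho> is controlled by \<open>Q\<close> at
          \<open>2 * \<rho>\<close> divided by \<open>(2 * \<rho>)^2\<close>.\<close>
        have "Q t \<rho> \<le> (LINT y|lborel. th (2 * \<rho>) y * \<bar>Sm t y\<bar>)"
          unfolding Q_def
        proof (rule integral_mono)
          show "integrable lborel (\<lambda>y. indicator (Ann \<rho> (2 * \<rho>)) y * \<bar>Sm t y\<bar>)" using \<rho> r0 by (intro integrable_Ann_S t) auto
          show "integrable lborel (\<lambda>y. th (2 * \<rho>) y * \<bar>Sm t y\<bar>)" by (rule integrable_th[OF t \<rho>2]) (intro continuous_intros)
          fix y
          show "indicator (Ann \<rho> (2 * \<rho>)) y * \<bar>Sm t y\<bar> \<le> th (2 * \<rho>) y * \<bar>Sm t y\<bar>"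
            using th_values[OF \<rho>2, of y] False by (auto simp: indicator_def Ann_def)
        qed
        also have "\<dots> \<le> A + C / (2 * \<rho>)\<^sup>2 * (C0 * (2 * \<rho>) ^ (2 * Suc m))"
          by (rule AC(3)[OF \<rho>2 t]) (rule C0(2)[OF \<rho>2])
        also have "(2 * \<rho>) ^ (2 * Suc m) = (2 * \<rho>)\<^sup>2 * (4 ^ m * \<rho> ^ (2 * m))"
          by (simp add: power_mult_distrib power_mult power2_eq_square)
        also have "A + C / (2 * \<rho>)\<^sup>2 * (C0 * ((2 * \<rho>)\<^sup>2 * (4 ^ m * \<rho> ^ (2 * m)))) = A + C * C0 * 4 ^ m * \<rho> ^ (2 * m)"
          using \<rho> r0 by simp
        also have "\<dots> \<le> V + A + C * C0 * 4 ^ m * \<rho> ^ (2 * m)" using V by simp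
        finally show ?thesis .
      qed
      also have "\<dots> \<le> ?c * \<rho> ^ (2 * m)"
        using mult_left_mono[OF r1, of "V + A"] V AC by (simp add: distrib_right)
      finally show "Q t \<rho> \<le> ?c * \<rho> ^ (2 * (CARD('n) - Suc k))" by (simp add: m_def)
    qed
  qed
qed

lemma Q_bounded: obtains q where "q \<ge> 0" "\<And>\<rho> t. r0 \<le> \<rho> \<Longrightarrow> t \<in> {0..T} \<Longrightarrow> Q t \<rho> \<le> q"
  using Q_polynomial_bound[of "CARD('n)"] by auto

text \<open>With \<open>Q\<close> bounded, \<open>L1_step\<close> bounds the integrals over all
  annuli from \<open>r0\<close> outwards; monotone convergence does the rest.\<close>

lemma integrable_scalar:
  assumes t: "t \<in> {0..T}"
  shows "integrable lborel (\<lambda>y. indicator {y. r0 \<le> norm y} y * \<bar>Sm t y\<bar>)"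
proof -
  obtain q where q: "q \<ge> 0" "\<And>\<rho> t. r0 \<le> \<rho> \<Longrightarrow> t \<in> {0..T} \<Longrightarrow> Q t \<rho> \<le> q" using Q_bounded by blast
  obtain A C where AC: "A \<ge> 0" "C \<ge> 0"
      "\<And>\<rho> q t. r0 \<le> \<rho> \<Longrightarrow> t \<in> {0..T} \<Longrightarrow> (\<And>t. t \<in> {0..T} \<Longrightarrow> Q t \<rho> \<le> q) \<Longrightarrow>
      (LINT y|lborel. th \<rho> y * \<bar>Sm t y\<bar>) \<le> A + C / \<rho>\<^sup>2 * q"
    using L1_step by blast
  let ?u = "\<lambda>y. indicator {y. r0 \<le> norm y} y * \<bar>Sm t y\<bar>"
  let ?f = "\<lambda>n y. indicator (Ann r0 (real n)) y * \<bar>Sm t y\<bar>"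
  let ?V = "LINT y|lborel. indicator (Ann r0 (2 * r0)) y * \<bar>Sm t y\<bar>"
  have i: "integrable lborel (?f n)" for n using r0 by (intro integrable_Ann_S t) auto
  have inc: "incseq (\<lambda>n. LINT y|lborel. ?f n y)"
    by (intro incseq_SucI integral_mono i) (auto simp: indicator_def Ann_def)
  have bd: "(LINT y|lborel. ?f n y) \<le> ?V + (A + C * q)" for n
  proof -
    define \<rho> where "\<rho> = max r0 (real n)"
    have \<rho>: "r0 \<le> \<rho>" "real n \<le> \<rho>" "1 \<le> \<rho>" using r0 by (auto simp: \<rho>_def)
    have ith: "integrable lborel (\<lambda>y. th \<rho> y * \<bar>Sm t y\<bar>)" by (rule integrable_th[OF t \<rho>(1)]) (intro continuous_intros)
    have iV: "integrable lborel (\<lambda>y. indicator (Ann r0 (2 * r0)) y * \<bar>Sm t y\<bar>)" using r0 by (intro integrable_Ann_S t) auto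
    have "(LINT y|lborel. ?f n y) \<le> (LINT y|lborel. indicator (Ann r0 (2 * r0)) y * \<bar>Sm t y\<bar> + th \<rho> y * \<bar>Sm t y\<bar>)"
    proof (rule integral_mono[OF i])
      show "integrable lborel (\<lambda>y. indicator (Ann r0 (2 * r0)) y * \<bar>Sm t y\<bar> + th \<rho> y * \<bar>Sm t y\<bar>)" using ith iV by simp
      fix y
      show "?f n y \<le> indicator (Ann r0 (2 * r0)) y * \<bar>Sm t y\<bar> + th \<rho> y * \<bar>Sm t y\<bar>"
        using th_values[OF \<rho>(1), of y] \<rho>(2) by (cases "norm y \<le> 2 * r0") (auto simp: indicator_def Ann_def)
    qed
    also have "\<dots> = ?V + (LINT y|lborel. th \<rho> y * \<bar>Sm t y\<bar>)" using ith iV by simp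
    also have "(LINT y|lborel. th \<rho> y * \<bar>Sm t y\<bar>) \<le> A + C / \<rho>\<^sup>2 * q" by (rule AC(3)[OF \<rho>(1) t q(2)[OF \<rho>(1)]])
    also have "C / \<rho>\<^sup>2 * q \<le> C * q"
    proof -
      have "C / \<rho>\<^sup>2 \<le> C / 1" using AC \<rho> by (intro divide_left_mono) auto
      then show ?thesis using mult_right_mono[of "C / \<rho>\<^sup>2" C q] q(1) by simp
    qed
    finally show ?thesis by simp
  qed
  obtain x where x: "(\<lambda>n. LINT y|lborel. ?f n y) \<longlonglongrightarrow> x"
    using incseq_convergent[OF inc] bd by blast
  show ?thesis
  proof (rule integrable_monotone_convergence[OF i _ _ x])
    show "AE y in lborel. mono (\<lambda>n. ?f n y)"
      by (intro AE_I2 monoI) (auto simp: indicator_def Ann_def)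
    show "AE y in lborel. (\<lambda>n. ?f n y) \<longlonglongrightarrow> ?u y"
    proof (rule AE_I2)
      fix y :: "real^'n"
      obtain N where N: "norm y \<le> real N" using real_arch_simple by blast
      have "?f n y = ?u y" if "N \<le> n" for n using N that by (auto simp: indicator_def Ann_def)
      then have "eventually (\<lambda>n. ?f n y = ?u y) sequentially" by (rule eventually_sequentiallyI)
      then show "(\<lambda>n. ?f n y) \<longlonglongrightarrow> ?u y" by (rule tendsto_eventually)
    qed
    show "?u \<in> borel_measurable lborel" using measurable_exterior[OF t, of r0] r0 by simp
  qed
qed

end

section \<open>Conservation of the mass\<close>

context af_flow_L1
begin

text \<open>The vector field whose flux through large spheres defines the ADM mass.\<close>

definition "Vm t i y = (\<Sum>j\<in>UNIV. dd (ax j) (\<lambda>z. G t z $ i $ j) y - dd (ax i) (\<lambda>z. G t z $ j $ j) y)"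
definition "fm t y = (\<Sum>i\<in>UNIV. Vm t i y * (y $ i / norm y))"
definition "dv t y = (\<Sum>i\<in>UNIV. dd (ax i) (Vm t i) y)"

lemma smooth_Vm: assumes "t \<in> {0..T}" shows "smooth_on E (Vm t i)"
  unfolding Vm_def using msmoothD[OF smooth_slice[OF assms]] by (intro smooth_on_sum smooth_on_diff smooth_on_dd open_exterior)

lemma flux_field: assumes "t \<in> {0..T}" shows "flux_field 1 (Vm t) (fm t) (dv t)"
proof
  show "C1_on E (Vm t i)" for i by (rule C1_on_smooth[OF open_exterior smooth_Vm[OF assms]])
  have [measurable]: "Vm t i \<in> borel_measurable borel" for i unfolding Vm_def by measurable
  have [measurable]: "(\<lambda>y::real^'n. y $ i) \<in> borel_measurable borel" for i
    by (intro borel_measurable_continuous_onI continuous_intros)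
  show "fm t \<in> borel_measurable borel" "dv t \<in> borel_measurable borel"
    unfolding fm_def dv_def by measurable
qed (auto simp: fm_def dv_def)

lemma dv_eq_divV:
  assumes "t \<in> {0..T}" "1 < norm y" shows "dv t y = divV t y"
proof -
  have y: "y \<in> E" using assms by simp
  have "dd (ax i) (Vm t i) y = (\<Sum>j\<in>UNIV. dd (ax i) (dd (ax j) (\<lambda>z. G t z $ i $ j)) y - dd (ax i) (dd (ax i) (\<lambda>z. G t z $ j $ j)) y)" for i
  proof -
    note sm = smooth_on_dd[OF open_exterior msmoothD[OF smooth_slice[OF assms(1)]]]
    show ?thesis
      unfolding Vm_def[abs_def]
      by (simp add: dd_sum[OF open_exterior y] dd_diff[OF open_exterior y sm sm] smooth_on_diff[OF open_exterior sm sm])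
  qed
  then show ?thesis by (simp add: dv_def divV_def)
qed

lemma adm_flux_eq:
  assumes "t \<in> {0..T}" "0 < r" shows "adm_flux (G t) r = sphint (fm t) r"
proof -
  interpret F: flux_field 1 "Vm t" "fm t" "dv t" by (rule flux_field[OF assms(1)])
  have "adm_flux (G t) r = (LINT y|sphere_measure r. fm t y)"
    by (simp add: adm_flux_def fm_def Vm_def pd_eq_dd)
  then show ?thesis using integral_sphere_measure[OF assms(2) F.f] by simp
qed

text \<open>The divergence differs from the integrable scalar curvature by an integrable error of
  order \<open>2 * \<delta> + 2\<close>.\<close>

lemma dv_integrable:
  assumes t: "t \<in> {0..T}" shows "set_integrable lborel {y. r0 < norm y} (dv t)"
proof -
  obtain C where C: "C > 0" "\<And>t y. t \<in> {0..T} \<Longrightarrow> r0 \<le> norm y \<Longrightarrow> \<bar>Sm t y - divV t y\<bar> \<le> C * norm y powr (- (2 * \<delta> + 2))"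
    using decE[OF dec_S_minus_div] by blast
  interpret F: flux_field 1 "Vm t" "fm t" "dv t" by (rule flux_field[OF t])
  have i: "integrable lborel (\<lambda>y. indicator {y. r0 \<le> norm y} y * \<bar>Sm t y\<bar> + C * (indicator {y::real^'n. 1 \<le> norm y} y * norm y powr (- (2 * \<delta> + 2))))"
    by (intro Bochner_Integration.integrable_add integrable_scalar t integrable_mult_right integrable_weight)
  show ?thesis
    unfolding set_integrable_def
  proof (rule Bochner_Integration.integrable_bound[OF i])
    have "{y::real^'n. r0 < norm y} \<in> sets borel" by (rule borel_open[OF open_exterior])
    then show "(\<lambda>y. indicator {y. r0 < norm y} y *\<^sub>R dv t y) \<in> borel_measurable lborel"
      using F.dv by (intro borel_measurable_scaleR borel_measurable_indicator) auto
    show "AE y in lborel. norm (indicator {y. r0 < norm y} y *\<^sub>R dv t y) \<le>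
      norm (indicator {y. r0 \<le> norm y} y * \<bar>Sm t y\<bar> + C * (indicator {y::real^'n. 1 \<le> norm y} y * norm y powr (- (2 * \<delta> + 2))))"
    proof (rule AE_I2)
      fix y :: "real^'n"
      show "norm (indicator {y. r0 < norm y} y *\<^sub>R dv t y) \<le>
        norm (indicator {y. r0 \<le> norm y} y * \<bar>Sm t y\<bar> + C * (indicator {y::real^'n. 1 \<le> norm y} y * norm y powr (- (2 * \<delta> + 2))))"
      proof (cases "r0 < norm y")
        case True
        then have "\<bar>dv t y\<bar> \<le> \<bar>Sm t y\<bar> + C * norm y powr (- (2 * \<delta> + 2))"
          using C(2)[OF t, of y] dv_eq_divV[OF t, of y] r0 by simp
        also have "\<dots> \<le> \<bar>\<bar>Sm t y\<bar> + C * norm y powr (- (2 * \<delta> + 2))\<bar>" by (rule abs_ge_self)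
        finally show ?thesis using True r0 by simp
      qed simp
    qed
  qed
qed

lemma flux_limit: assumes "t \<in> {0..T}" shows "\<exists>m. (sphint (fm t) \<longlongrightarrow> m) at_top"
proof -
  interpret F: flux_field 1 "Vm t" "fm t" "dv t" by (rule flux_field[OF assms])
  show ?thesis by (rule F.flux_converges[OF dv_integrable[OF assms]]) (use r0 in simp)
qed

definition "Aver t \<rho> = (LINT y|lborel. (\<Sum>i\<in>UNIV. Vm t i y * dd (ax i) (cut \<rho>) y))"

text \<open>In polar coordinates \<open>Aver\<close> is a weighted mean of the fluxes through
  spheres of radius between \<rho> and \<open>2 * \<rho>\<close>: the radial derivative of the
  cutoff is nonnegative with integral 1.\<close>

lemma Aver_tendsto:
  assumes t: "t \<in> {0..T}" and m: "(sphint (fm t) \<longlongrightarrow> m) at_top"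
  shows "(Aver t \<longlongrightarrow> m) at_top"
proof (rule tendstoI)
  interpret F: flux_field 1 "Vm t" "fm t" "dv t" by (rule flux_field[OF t])
  let ?F = "sphint (fm t)"
  fix e :: real assume e: "e > 0"
  obtain R where R: "\<And>r. R \<le> r \<Longrightarrow> \<bar>?F r - m\<bar> < e / 2"
    using tendstoD[OF m, of "e / 2"] e by (auto simp: eventually_at_top_linorder dist_real_def)
  show "eventually (\<lambda>\<rho>. dist (Aver t \<rho>) m < e) at_top"
    unfolding eventually_at_top_linorder
  proof (intro exI[of _ "max R 2"] allI impI)
    fix \<rho> assume "max R 2 \<le> \<rho>"
    then have \<rho>: "R \<le> \<rho>" "2 \<le> \<rho>" by auto
    define g where "g r = step1 (r\<^sup>2 / \<rho>\<^sup>2) * (2 * r / \<rho>\<^sup>2)" for r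
    have g0: "g r = 0" if "r \<notin> {\<rho>..2 * \<rho>}" "r > 0" for r
    proof -
      have "r\<^sup>2 / \<rho>\<^sup>2 \<le> 1 \<or> r\<^sup>2 / \<rho>\<^sup>2 \<ge> 2"
      proof (cases "r < \<rho>")
        case True
        then have "r\<^sup>2 \<le> \<rho>\<^sup>2" using that by (intro power_mono) auto
        then show ?thesis using \<rho> by simp
      next
        case False
        then have "(2 * \<rho>)\<^sup>2 \<le> r\<^sup>2" using that \<rho> by (intro power_mono) auto
        then have "4 * \<rho>\<^sup>2 \<le> r\<^sup>2" by (simp add: power_mult_distrib)
        then have "2 * \<rho>\<^sup>2 \<le> r\<^sup>2" using zero_le_power2[of \<rho>] by linarith
        then show ?thesis using \<rho> pos_le_divide_eq[of "\<rho>\<^sup>2" 2 "r\<^sup>2"] by simp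
      qed
      then show ?thesis using step_le_1 step_ge_2 by (auto simp: g_def)
    qed
    \<comment> \<open>\<open>g\<close> is odd and need not vanish at negative radii, whereas
      \<open>integral_radial\<close> asks for a weight that is zero outside the interval.\<close>
    define gg where "gg r = (if 0 < r then g r else 0)" for r
    have cg: "continuous_on UNIV g" unfolding g_def divide_inverse
      by (intro continuous_on_mult continuous_on_compose2[OF continuous_on_step(2)] continuous_intros subset_UNIV)
    have cgg: "continuous_on {1<..} gg"
      by (rule continuous_on_eq[OF continuous_on_subset[OF cg]]) (auto simp: gg_def)
    have eq: "(\<Sum>i\<in>UNIV. Vm t i y * dd (ax i) (cut \<rho>) y) = gg (norm y) * fm t y" for y
    proof (cases "y = 0")
      case False
      have "dd (ax i) (cut \<rho>) y = g (norm y) * (y $ i / norm y)" for i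
        using False by (simp add: dd_cut g_def power2_norm_eq_inner inner_axis)
      then show ?thesis using False by (simp add: gg_def fm_def sum_distrib_left mult_ac)
    qed (simp add: dd_cut gg_def)
    have A: "Aver t \<rho> = integral {\<rho>..2 * \<rho>} (\<lambda>r. gg r * ?F r)"
      unfolding Aver_def eq
      by (rule integral_radial[OF zero_le_one _ cgg _ F.f F.cont_f]) (use \<rho> g0 in \<open>auto simp: gg_def\<close>)
    have "((\<lambda>r. step (r\<^sup>2 / \<rho>\<^sup>2)) has_real_derivative g r) (at r within {\<rho>..2 * \<rho>})" for r
    proof -
      have "((\<lambda>r. r\<^sup>2 / \<rho>\<^sup>2) has_real_derivative 2 * r / \<rho>\<^sup>2) (at r)"
        by (auto intro!: derivative_eq_intros simp: divide_inverse)
      from DERIV_chain2[OF DERIV_step this] show ?thesis unfolding g_def by (rule has_field_derivative_at_within)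
    qed
    then have "(g has_integral (step ((2 * \<rho>)\<^sup>2 / \<rho>\<^sup>2) - step (\<rho>\<^sup>2 / \<rho>\<^sup>2))) {\<rho>..2 * \<rho>}"
      using \<rho> by (intro fundamental_theorem_of_calculus) (auto simp flip: has_real_derivative_iff_has_vector_derivative)
    moreover have "step ((2 * \<rho>)\<^sup>2 / \<rho>\<^sup>2) - step (\<rho>\<^sup>2 / \<rho>\<^sup>2) = 1"
      using \<rho> by (simp add: power_mult_distrib step_ge_2 step_le_1)
    ultimately have "(g has_integral 1) {\<rho>..2 * \<rho>}" by simp
    then have hg: "(gg has_integral 1) {\<rho>..2 * \<rho>}"
      by (rule has_integral_eq[rotated]) (use \<rho> in \<open>auto simp: gg_def\<close>)
    have gnn: "gg r \<ge> 0" for r using step1_nonneg by (auto simp: gg_def g_def)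
    have cF: "continuous_on {\<rho>..2 * \<rho>} ?F"
      by (rule continuous_on_subset[OF continuous_on_sphint[OF F.f zero_le_one F.cont_f]]) (use \<rho> in auto)
    have i: "(\<lambda>r. gg r * ?F r) integrable_on {\<rho>..2 * \<rho>}"
      by (intro integrable_continuous_real continuous_intros cF continuous_on_subset[OF cgg]) (use \<rho> in auto)
    have up: "integral {\<rho>..2 * \<rho>} (\<lambda>r. gg r * ?F r) \<le> 1 * (m + e / 2)"
    proof (rule has_integral_le[OF integrable_integral[OF i] has_integral_mult_left[OF hg]])
      fix r assume "r \<in> {\<rho>..2 * \<rho>}"
      then have "\<bar>?F r - m\<bar> < e / 2" using R[of r] \<rho> by simp
      then have "?F r \<le> m + e / 2" by linarith
      then show "gg r * ?F r \<le> gg r * (m + e / 2)" using gnn by (rule mult_left_mono)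
    qed
    have lo: "1 * (m - e / 2) \<le> integral {\<rho>..2 * \<rho>} (\<lambda>r. gg r * ?F r)"
    proof (rule has_integral_le[OF has_integral_mult_left[OF hg] integrable_integral[OF i]])
      fix r assume "r \<in> {\<rho>..2 * \<rho>}"
      then have "\<bar>?F r - m\<bar> < e / 2" using R[of r] \<rho> by simp
      then have "m - e / 2 \<le> ?F r" by linarith
      then show "gg r * (m - e / 2) \<le> gg r * ?F r" using gnn by (rule mult_left_mono)
    qed
    show "dist (Aver t \<rho>) m < e" using up lo e by (simp add: A dist_real_def)
  qed
qed

definition "Hess \<rho> i j y = dd (ax j) (dd (ax i) (cut \<rho>)) (y::real^'n)"

text \<open>Pairs \<open>P\<close> with the Hessian of the cutoff minus its Laplacian times the
  identity, which is the adjoint of the linearised scalar curvature applied to the cutoff.\<close>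

definition "Lin (P :: real^'n \<Rightarrow> real^'n^'n) \<rho> y = (\<Sum>i\<in>UNIV. \<Sum>j\<in>UNIV. P y $ i $ j * Hess \<rho> i j y - P y $ j $ j * Hess \<rho> i i y)"

lemma Hess_zero: "0 < \<rho> \<Longrightarrow> y \<notin> Ann \<rho> (2 * \<rho>) \<Longrightarrow> Hess \<rho> i j y = 0" "0 < \<rho> \<Longrightarrow> y \<notin> Ann \<rho> (2 * \<rho>) \<Longrightarrow> dd (ax i) (cut \<rho>) y = 0"
proof -
  obtain B where B: "B > 0"
    "\<And>\<rho> v (y::real^'n). 0 < \<rho> \<Longrightarrow> norm v \<le> 1 \<Longrightarrow> \<bar>dd v (cut \<rho>) y\<bar> \<le> B / \<rho> * indicator (Ann \<rho> (2 * \<rho>)) y"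
    "\<And>\<rho> u v (y::real^'n). 0 < \<rho> \<Longrightarrow> norm u \<le> 1 \<Longrightarrow> norm v \<le> 1 \<Longrightarrow>
       \<bar>dd u (dd v (cut \<rho>)) y\<bar> \<le> B / \<rho>\<^sup>2 * indicator (Ann \<rho> (2 * \<rho>)) y"
    using cut_bounds by blast
  show "0 < \<rho> \<Longrightarrow> y \<notin> Ann \<rho> (2 * \<rho>) \<Longrightarrow> Hess \<rho> i j y = 0" "0 < \<rho> \<Longrightarrow> y \<notin> Ann \<rho> (2 * \<rho>) \<Longrightarrow> dd (ax i) (cut \<rho>) y = 0"
    using B(2)[of \<rho> "ax i" y] B(3)[of \<rho> "ax j" "ax i" y] by (auto simp: Hess_def norm_axis_1)
qed

lemma continuous_Hess: "continuous_on X (Hess \<rho> i j)"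
  unfolding Hess_def[abs_def] by (rule continuous_on_subset[OF C1_on_dd_continuous[OF C1_dd_cut]]) simp

lemma C1_comp_dcut:
  assumes "C1_on E w" shows "C1_on E (\<lambda>y. w y * dd (ax i) (cut \<rho>) y)"
    "y \<in> E \<Longrightarrow> dd (ax j) (\<lambda>y. w y * dd (ax i) (cut \<rho>) y) y = w y * Hess \<rho> i j y + dd (ax j) w y * dd (ax i) (cut \<rho>) y"
proof -
  have c: "C1_on E (dd (ax i) (cut \<rho>))" by (rule C1_on_subset[OF C1_dd_cut]) simp
  show "C1_on E (\<lambda>y. w y * dd (ax i) (cut \<rho>) y)" by (rule C1_on_mult(1)[OF assms c])
  show "y \<in> E \<Longrightarrow> dd (ax j) (\<lambda>y. w y * dd (ax i) (cut \<rho>) y) y = w y * Hess \<rho> i j y + dd (ax j) w y * dd (ax i) (cut \<rho>) y"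
    unfolding Hess_def by (rule C1_on_mult(2)[OF assms c])
qed

lemma integrable_cut_support:
  fixes u :: "real^'n \<Rightarrow> real"
  assumes "1 < \<rho>" "continuous_on E u" "\<And>y. y \<notin> Ann \<rho> (2 * \<rho>) \<Longrightarrow> u y = 0"
  shows "integrable lborel u"
  by (rule integrable_zero_extend[OF open_exterior compact_Ann Ann_subset_E[OF assms(1)] assms(2)]) (rule assms(3))

lemma ibp_dcut:
  assumes \<rho>: "1 < \<rho>" and w: "C1_on E w"
  shows "(LINT y|lborel. w y * Hess \<rho> i j y) + (LINT y|lborel. dd (ax j) w y * dd (ax i) (cut \<rho>) y) = 0"
    "integrable lborel (\<lambda>y. w y * Hess \<rho> i j y)" "integrable lborel (\<lambda>y. dd (ax j) w y * dd (ax i) (cut \<rho>) y)"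
proof -
  have z: "y \<notin> Ann \<rho> (2 * \<rho>) \<Longrightarrow> Hess \<rho> i j y = 0" "y \<notin> Ann \<rho> (2 * \<rho>) \<Longrightarrow> dd (ax i) (cut \<rho>) y = 0" for y i j
    using Hess_zero[of \<rho> y] \<rho> by auto
  have cX: "continuous_on E (dd (ax i) (cut \<rho>))"
    by (rule continuous_on_subset[OF C1_on_continuous[OF C1_dd_cut]]) simp
  show i1: "integrable lborel (\<lambda>y. w y * Hess \<rho> i j y)"
    by (rule integrable_cut_support[OF \<rho>]) (use z in \<open>auto intro!: continuous_intros C1_on_continuous[OF w] continuous_Hess\<close>)
  show i2: "integrable lborel (\<lambda>y. dd (ax j) w y * dd (ax i) (cut \<rho>) y)"
    by (rule integrable_cut_support[OF \<rho>]) (use z in \<open>auto intro!: continuous_intros C1_on_dd_continuous[OF w] cX\<close>)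
  let ?u = "\<lambda>y. w y * dd (ax i) (cut \<rho>) y"
  have u0: "?u y = 0" if "y \<notin> Ann \<rho> (2 * \<rho>)" for y using z that by simp
  have "(LINT y|lborel. dd (ax j) ?u y) = 0"
    by (rule integral_dd_zero[OF open_exterior compact_Ann Ann_subset_E[OF \<rho>] C1_comp_dcut(1)[OF w] u0])
  moreover have "dd (ax j) ?u y = w y * Hess \<rho> i j y + dd (ax j) w y * dd (ax i) (cut \<rho>) y" for y
  proof (cases "y \<in> E")
    case False
    then have n: "y \<notin> Ann \<rho> (2 * \<rho>)" using \<rho> by (auto simp: Ann_def)
    then have "dd (ax j) ?u y = 0" by (intro dd_zero_outside[OF compact_imp_closed[OF compact_Ann] u0])
    then show ?thesis using z n by simp
  qed (rule C1_comp_dcut(2)[OF w])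
  ultimately have "(LINT y|lborel. w y * Hess \<rho> i j y + dd (ax j) w y * dd (ax i) (cut \<rho>) y) = 0" by simp
  then show "(LINT y|lborel. w y * Hess \<rho> i j y) + (LINT y|lborel. dd (ax j) w y * dd (ax i) (cut \<rho>) y) = 0"
    using i1 i2 by simp
qed

text \<open>One integration by parts moves the remaining derivative onto the cutoff. The time
  derivative can then be taken by inserting the flow equation, and no derivative of Ricci
  appears.\<close>

lemma Aver_eq:
  assumes t: "t \<in> {0..T}" and \<rho>: "1 < \<rho>"
  shows "Aver t \<rho> = - (LINT y|lborel. Lin (G t) \<rho> y)"
proof -
  have C: "C1_on E (\<lambda>y. G t y $ i $ j)" for i j by (rule C1_on_smooth[OF open_exterior msmoothD[OF smooth_slice[OF t]]])
  note b = ibp_dcut[OF \<rho> C]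
  have "Aver t \<rho> = (LINT y|lborel. (\<Sum>i\<in>UNIV. \<Sum>j\<in>UNIV. dd (ax j) (\<lambda>z. G t z $ i $ j) y * dd (ax i) (cut \<rho>) y
      - dd (ax i) (\<lambda>z. G t z $ j $ j) y * dd (ax i) (cut \<rho>) y))"
    by (simp add: Aver_def Vm_def sum_distrib_right left_diff_distrib)
  also have "\<dots> = (\<Sum>i\<in>UNIV. \<Sum>j\<in>UNIV. (LINT y|lborel. dd (ax j) (\<lambda>z. G t z $ i $ j) y * dd (ax i) (cut \<rho>) y)
      - (LINT y|lborel. dd (ax i) (\<lambda>z. G t z $ j $ j) y * dd (ax i) (cut \<rho>) y))"
    using b(3) by (simp add: Bochner_Integration.integral_sum)
  also have "\<dots> = (\<Sum>i\<in>UNIV. \<Sum>j\<in>UNIV. - (LINT y|lborel. G t y $ i $ j * Hess \<rho> i j y) + (LINT y|lborel. G t y $ j $ j * Hess \<rho> i i y))"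
  proof (intro sum.cong refl)
    fix i j
    show "(LINT y|lborel. dd (ax j) (\<lambda>z. G t z $ i $ j) y * dd (ax i) (cut \<rho>) y)
      - (LINT y|lborel. dd (ax i) (\<lambda>z. G t z $ j $ j) y * dd (ax i) (cut \<rho>) y) =
      - (LINT y|lborel. G t y $ i $ j * Hess \<rho> i j y) + (LINT y|lborel. G t y $ j $ j * Hess \<rho> i i y)"
      using b(1)[of i j i j] b(1)[of j j i i] by linarith
  qed
  also have "\<dots> = - (\<Sum>i\<in>UNIV. \<Sum>j\<in>UNIV. (LINT y|lborel. G t y $ i $ j * Hess \<rho> i j y) - (LINT y|lborel. G t y $ j $ j * Hess \<rho> i i y))"
    by (simp add: sum_negf[symmetric])
  also have "\<dots> = - (LINT y|lborel. Lin (G t) \<rho> y)"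
    unfolding Lin_def using b(2) by (simp add: Bochner_Integration.integral_sum)
  finally show ?thesis .
qed

lemma DERIV_Aver:
  assumes t: "t \<in> {0..T}" and \<rho>: "1 < \<rho>"
  shows "((\<lambda>t. Aver t \<rho>) has_real_derivative 2 * (LINT y|lborel. Lin (Rc ax (G t)) \<rho> y)) (at t within {0..T})"
proof -
  have z: "Lin P \<rho> y = 0" if "y \<notin> Ann \<rho> (2 * \<rho>)" for P y
    using Hess_zero(1)[of \<rho> y] \<rho> that by (simp add: Lin_def)
  have cH: "continuous_on ({0..T} \<times> E) (\<lambda>p. Hess \<rho> i j (snd p))" for i j
    by (rule continuous_on_compose2[OF continuous_Hess]) (auto intro!: continuous_intros)
  have "((\<lambda>t. LINT y|lborel. Lin (G t) \<rho> y) has_real_derivative (LINT y|lborel. - 2 * Lin (Rc ax (G t)) \<rho> y)) (at t within {0..T})"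
  proof (rule leibniz_lborel[OF open_exterior compact_Ann Ann_subset_E[OF \<rho>] _ t])
    show "continuous_on ({0..T} \<times> E) (\<lambda>(t, y). Lin (G t) \<rho> y)"
      unfolding Lin_def case_prod_unfold by (intro continuous_intros continuous_G cH)
    show "continuous_on ({0..T} \<times> E) (\<lambda>(t, y). - 2 * Lin (Rc ax (G t)) \<rho> y)"
      unfolding Lin_def case_prod_unfold by (intro continuous_intros continuous_Rm cH)
    fix s and y :: "real^'n" assume s: "s \<in> {0..T}" and y: "y \<in> Ann \<rho> (2 * \<rho>)"
    then have y1: "1 < norm y" using \<rho> by (auto simp: Ann_def)
    have "((\<lambda>s. Lin (G s) \<rho> y) has_real_derivative
      (\<Sum>i\<in>UNIV. \<Sum>j\<in>UNIV. - 2 * Rm s y $ i $ j * Hess \<rho> i j y - - 2 * Rm s y $ j $ j * Hess \<rho> i i y)) (at s within {0..T})"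
      unfolding Lin_def by (intro DERIV_sum DERIV_diff DERIV_cmult_right ricci s y1)
    also have "(\<Sum>i\<in>UNIV. \<Sum>j\<in>UNIV. - 2 * Rm s y $ i $ j * Hess \<rho> i j y - - 2 * Rm s y $ j $ j * Hess \<rho> i i y) = - 2 * Lin (Rc ax (G s)) \<rho> y"
      unfolding Lin_def sum_distrib_left by (intro sum.cong refl) (simp add: algebra_simps)
    finally show "((\<lambda>s. Lin (G s) \<rho> y) has_real_derivative - 2 * Lin (Rc ax (G s)) \<rho> y) (at s within {0..T})" .
  qed (use z in auto)
  from DERIV_minus[OF this]
  have "((\<lambda>t. - (LINT y|lborel. Lin (G t) \<rho> y)) has_real_derivative 2 * (LINT y|lborel. Lin (Rc ax (G t)) \<rho> y)) (at t within {0..T})"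
    by simp
  then show ?thesis
    by (rule has_field_derivative_transform_within[OF _ zero_less_one t]) (simp add: Aver_eq \<rho>)
qed

end

section \<open>The averaged flux changes by at most a multiple of the inverse square of the
  radius\<close>

context af_flow_L1
begin

lemma dec_abs: "dec p f \<Longrightarrow> dec p (\<lambda>t y. \<bar>f t y\<bar>)"
  unfolding dec_def by simp

lemma Hess_sym: "Hess \<rho> i j y = Hess \<rho> j i y"
  unfolding Hess_def dd_dd_cut by (simp add: inner_commute mult_ac)

text \<open>The Christoffel terms of the contracted Bianchi identity, of the quadratic order
  \<open>2 * \<delta> + 3\<close>.\<close>

definition "Bt t a y = (\<Sum>i\<in>UNIV. \<Sum>m\<in>UNIV. Gm t a y $ i $ m * Mm t y $ m $ i) - (\<Sum>i\<in>UNIV. \<Sum>m\<in>UNIV. Gm t i y $ i $ m * Mm t y $ m $ a)"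

lemma dec_Bt: "dec (2 * \<delta> + 3) (\<lambda>t y. Bt t a y)"
proof -
  have "dec ((\<delta> + 1) + (\<delta> + 2)) (\<lambda>t y. Bt t a y)"
    unfolding Bt_def by (intro dec_diff dec_sum dec_mult dec_Gm dec_M)
  then show ?thesis by (rule dec_mono) simp
qed

lemma bianchi:
  assumes "t \<in> {0..T}" "1 < norm y"
  shows "(\<Sum>i\<in>UNIV. dd (ax i) (\<lambda>z. Mm t z $ i $ a) y) = dd (ax a) (Sc ax (G t)) y / 2 + Bt t a y"
  using metric_frame.contracted_bianchi[where e=ax, OF frame[OF assms(1)], of y a] assms(2)
  by (simp add: frame_defs[OF assms(1)] Bt_def)

text \<open>Pointwise decay of Ricci would give order \<open>\<rho> powr (n - \<delta> - 4)\<close>,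
  which need not tend to zero. Integration by parts with the contracted Bianchi identity replaces
  Ricci by the scalar curvature, whose integrals \<open>Q\<close> are bounded, up to errors of
  integrable order.\<close>

lemma Lin_R_bound:
  obtains C where "\<And>\<rho> t. r0 \<le> \<rho> \<Longrightarrow> t \<in> {0..T} \<Longrightarrow> \<bar>LINT y|lborel. Lin (Rc ax (G t)) \<rho> y\<bar> \<le> C / \<rho>\<^sup>2"
proof -
  obtain B where B: "B > 0"
    "\<And>\<rho> v (y::real^'n). 0 < \<rho> \<Longrightarrow> norm v \<le> 1 \<Longrightarrow> \<bar>dd v (cut \<rho>) y\<bar> \<le> B / \<rho> * indicator (Ann \<rho> (2 * \<rho>)) y"
    "\<And>\<rho> u v (y::real^'n). 0 < \<rho> \<Longrightarrow> norm u \<le> 1 \<Longrightarrow> norm v \<le> 1 \<Longrightarrow>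
       \<bar>dd u (dd v (cut \<rho>)) y\<bar> \<le> B / \<rho>\<^sup>2 * indicator (Ann \<rho> (2 * \<rho>)) y"
    using cut_bounds by blast
  have "dec (2 * \<delta> + 2) (\<lambda>t y. \<Sum>a\<in>UNIV. \<Sum>i\<in>UNIV. \<bar>Mm t y $ i $ a - Rm t y $ i $ a\<bar>)"
    by (intro dec_sum dec_abs dec_M_minus_R)
  then obtain C1 where C1: "C1 > 0" "\<And>t y. t \<in> {0..T} \<Longrightarrow> r0 \<le> norm y \<Longrightarrow>
     \<bar>\<Sum>a\<in>UNIV. \<Sum>i\<in>UNIV. \<bar>Mm t y $ i $ a - Rm t y $ i $ a\<bar>\<bar> \<le> C1 * norm y powr (- (2 * \<delta> + 2))" using decE by blast
  have "dec (2 * \<delta> + 3) (\<lambda>t y. \<Sum>a\<in>UNIV. \<bar>Bt t a y\<bar>)"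
    by (intro dec_sum dec_abs dec_Bt)
  then obtain C2 where C2: "C2 > 0" "\<And>t y. t \<in> {0..T} \<Longrightarrow> r0 \<le> norm y \<Longrightarrow>
     \<bar>\<Sum>a\<in>UNIV. \<bar>Bt t a y\<bar>\<bar> \<le> C2 * norm y powr (- (2 * \<delta> + 3))" using decE by blast
  obtain C3 where C3: "C3 > 0" "\<And>t y. t \<in> {0..T} \<Longrightarrow> r0 \<le> norm y \<Longrightarrow> \<bar>Sm t y - trace (Rm t y)\<bar> \<le> C3 * norm y powr (- (2 * \<delta> + 2))"
    using decE[OF dec_S_minus_trace] by blast
  obtain q where q: "q \<ge> 0" "\<And>\<rho> t. r0 \<le> \<rho> \<Longrightarrow> t \<in> {0..T} \<Longrightarrow> Q t \<rho> \<le> q" using Q_bounded by blast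
  let ?n = "real CARD('n)"
  define k1 where "k1 = ?n * B"
  define k2 where "k2 = C1 * B + C2 * B + C3 * (?n * B)"
  have k: "k1 \<ge> 0" "k2 \<ge> 0" using B(1) C1(1) C2(1) C3(1) by (auto simp: k1_def k2_def)
  show ?thesis
  proof (rule that[of "k1 * q + k2 * \<Lambda>"])
    fix \<rho> t assume \<rho>: "r0 \<le> \<rho>" and t: "t \<in> {0..T}"
    have \<rho>1: "1 < \<rho>" "0 < \<rho>" using \<rho> r0 by auto
    let ?X = "\<lambda>a. dd (ax a) (cut \<rho> :: real^'n \<Rightarrow> real)" and ?L = "\<lambda>y. \<Sum>a\<in>UNIV. Hess \<rho> a a y"
    have CM: "C1_on E (\<lambda>y. Mm t y $ i $ a)" for i a by (rule C1_on_smooth[OF open_exterior msmoothD[OF smooth_Mm[OF t]]])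
    note bM = ibp_dcut[OF \<rho>1(1) CM] and bS = ibp_dcut[OF \<rho>1(1) C1_S[OF t]]
    have CR: "continuous_on E (\<lambda>y. Rm t y $ i $ j)" for i j
      by (rule smooth_on_continuous_on[OF msmoothD[OF slice_smooth_Rc[OF t]]])
    \<comment> \<open>Each \<open>z1 a i\<close> and each \<open>z2 a\<close> is an integration by
      parts against the cutoff, so \<open>Z\<close> has integral zero. In \<open>Z\<close> the
      derivatives of \<open>Mm\<close> and \<open>Sm\<close> cancel up to \<open>Bt\<close>, and the
      rest trades Ricci against the Hessian for scalar curvature against the Laplacian of the
      cutoff.\<close>
    define z1 where "z1 a i y = Mm t y $ i $ a * Hess \<rho> a i y + dd (ax i) (\<lambda>y. Mm t y $ i $ a) y * ?X a y" for a i y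
    define z2 where "z2 a y = Sm t y * Hess \<rho> a a y + dd (ax a) (Sc ax (G t)) y * ?X a y" for a y
    define Z where "Z y = (\<Sum>a\<in>UNIV. \<Sum>i\<in>UNIV. z1 a i y) - (\<Sum>a\<in>UNIV. z2 a y) / 2" for y
    have z1: "integrable lborel (z1 a i)" "(LINT y|lborel. z1 a i y) = 0" for a i
      unfolding z1_def using bM(1)[of i a a i] bM(2)[of i a a i] bM(3)[where i=a and j=i] by auto
    have z2: "integrable lborel (z2 a)" "(LINT y|lborel. z2 a y) = 0" for a
      unfolding z2_def using bS(1)[of a a] bS(2)[of a a] bS(3)[of a a] by auto
    have iZ: "integrable lborel Z" unfolding Z_def using z1(1) z2(1) by auto
    have Z0: "(LINT y|lborel. Z y) = 0" unfolding Z_def using z1 z2 by (simp add: Bochner_Integration.integral_sum)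
    have zL: "Lin P \<rho> y = 0" if "y \<notin> Ann \<rho> (2 * \<rho>)" for P y
      using Hess_zero(1)[OF \<rho>1(2) that] by (simp add: Lin_def)
    have iL: "integrable lborel (Lin (Rc ax (G t)) \<rho>)"
      by (rule integrable_cut_support[OF \<rho>1(1)]) (use zL in \<open>auto simp: Lin_def[abs_def] intro!: continuous_intros CR continuous_Hess\<close>)
    let ?u = "\<lambda>y. k1 / \<rho>\<^sup>2 * (indicator (Ann \<rho> (2 * \<rho>)) y * \<bar>Sm t y\<bar>) + k2 / \<rho>\<^sup>2 * (indicator {y::real^'n. 1 \<le> norm y} y * norm y powr (- (2 * \<delta> + 2)))"
    have iu: "integrable lborel ?u"
      by (intro Bochner_Integration.integrable_add integrable_mult_right integrable_weight integrable_Ann_S[OF t \<rho>1(1)])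
    have bound: "\<bar>Lin (Rc ax (G t)) \<rho> y - Z y\<bar> \<le> ?u y" for y
    proof (cases "y \<in> Ann \<rho> (2 * \<rho>)")
      case False
      then have "Lin (Rc ax (G t)) \<rho> y - Z y = 0"
        using zL Hess_zero[OF \<rho>1(2) False] by (simp add: Z_def z1_def z2_def)
      moreover have "?u y \<ge> 0" using k by (intro add_nonneg_nonneg mult_nonneg_nonneg) auto
      ultimately show ?thesis by simp
    next
      case True
      then have y: "\<rho> \<le> norm y" "r0 \<le> norm y" "1 < norm y" "1 \<le> norm y" using \<rho> \<rho>1 by (auto simp: Ann_def)
      have H: "\<bar>Hess \<rho> i j y\<bar> \<le> B / \<rho>\<^sup>2" for i j
        using B(3)[OF \<rho>1(2), of "ax j" "ax i" y] True by (simp add: Hess_def norm_axis_1)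
      have X: "\<bar>?X a y\<bar> \<le> B / \<rho>" for a using B(2)[OF \<rho>1(2), of "ax a" y] True by (simp add: norm_axis_1)
      let ?w = "norm y powr (- (2 * \<delta> + 2))"
      have w3: "norm y powr (- (2 * \<delta> + 3)) \<le> ?w / \<rho>"
      proof -
        have "norm y powr (- (2 * \<delta> + 3)) = norm y powr (- (2 * \<delta> + 2) - 1)" by (simp add: algebra_simps)
        also have "\<dots> = ?w / norm y" using y by (subst powr_diff) auto
        also have "\<dots> \<le> ?w / \<rho>" using y \<rho>1 by (intro divide_left_mono mult_pos_pos) auto
        finally show ?thesis .
      qed
      have L: "\<bar>?L y\<bar> \<le> ?n * (B / \<rho>\<^sup>2)" by (rule abs_sum_le) (rule H)
      have tr: "(\<Sum>j\<in>UNIV. Rm t y $ j $ j) = trace (Rm t y)" by (simp add: trace_def)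
      have 1: "Lin (Rc ax (G t)) \<rho> y = (\<Sum>a\<in>UNIV. \<Sum>i\<in>UNIV. Rm t y $ i $ a * Hess \<rho> a i y) - trace (Rm t y) * ?L y"
      proof -
        have "Lin (Rc ax (G t)) \<rho> y = (\<Sum>i\<in>UNIV. \<Sum>a\<in>UNIV. Rm t y $ i $ a * Hess \<rho> a i y) - (\<Sum>i\<in>UNIV. \<Sum>j\<in>UNIV. Rm t y $ j $ j * Hess \<rho> i i y)"
          unfolding Lin_def by (simp add: sum_subtractf Hess_sym)
        also have "(\<Sum>i\<in>UNIV. \<Sum>j\<in>UNIV. Rm t y $ j $ j * Hess \<rho> i i y) = trace (Rm t y) * ?L y"
          by (simp add: tr[symmetric] sum_distrib_right[symmetric] sum_distrib_left)
        also have "(\<Sum>i\<in>UNIV. \<Sum>a\<in>UNIV. Rm t y $ i $ a * Hess \<rho> a i y) = (\<Sum>a\<in>UNIV. \<Sum>i\<in>UNIV. Rm t y $ i $ a * Hess \<rho> a i y)"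
          by (rule sum.swap)
        finally show ?thesis .
      qed
      have 2: "(\<Sum>a\<in>UNIV. \<Sum>i\<in>UNIV. z1 a i y) = (\<Sum>a\<in>UNIV. \<Sum>i\<in>UNIV. Mm t y $ i $ a * Hess \<rho> a i y)
          + (\<Sum>a\<in>UNIV. (dd (ax a) (Sc ax (G t)) y / 2 + Bt t a y) * ?X a y)"
        unfolding z1_def sum.distrib by (simp add: sum_distrib_right[symmetric] bianchi[OF t y(3)])
      have 3: "(\<Sum>a\<in>UNIV. z2 a y) = Sm t y * ?L y + (\<Sum>a\<in>UNIV. dd (ax a) (Sc ax (G t)) y * ?X a y)"
        by (simp add: z2_def sum.distrib sum_distrib_left)
      have eq: "Lin (Rc ax (G t)) \<rho> y - Z y = - (\<Sum>a\<in>UNIV. \<Sum>i\<in>UNIV. (Mm t y $ i $ a - Rm t y $ i $ a) * Hess \<rho> a i y)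
          - (\<Sum>a\<in>UNIV. Bt t a y * ?X a y) + (Sm t y - trace (Rm t y)) * ?L y - Sm t y * ?L y / 2"
        unfolding Z_def 1 2 3
        by (simp add: sum.distrib sum_subtractf distrib_right left_diff_distrib sum_divide_distrib add_divide_distrib)
      have le: "\<bar>Lin (Rc ax (G t)) \<rho> y - Z y\<bar> \<le> C1 * ?w * (B / \<rho>\<^sup>2) + C2 * (?w / \<rho>) * (B / \<rho>) + C3 * ?w * (?n * (B / \<rho>\<^sup>2)) + \<bar>Sm t y\<bar> * (?n * (B / \<rho>\<^sup>2))"
      proof -
        have a1: "\<bar>\<Sum>a\<in>UNIV. \<Sum>i\<in>UNIV. (Mm t y $ i $ a - Rm t y $ i $ a) * Hess \<rho> a i y\<bar> \<le> C1 * ?w * (B / \<rho>\<^sup>2)"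
        proof -
          have "\<bar>\<Sum>a\<in>UNIV. \<Sum>i\<in>UNIV. (Mm t y $ i $ a - Rm t y $ i $ a) * Hess \<rho> a i y\<bar>
            \<le> (\<Sum>a\<in>UNIV. \<Sum>i\<in>UNIV. \<bar>Mm t y $ i $ a - Rm t y $ i $ a\<bar> * (B / \<rho>\<^sup>2))"
            by (intro order_trans[OF sum_abs] sum_mono) (unfold abs_mult, rule mult_left_mono[OF H abs_ge_zero])
          also have "\<dots> = (\<Sum>a\<in>UNIV. \<Sum>i\<in>UNIV. \<bar>Mm t y $ i $ a - Rm t y $ i $ a\<bar>) * (B / \<rho>\<^sup>2)"
            by (simp add: sum_distrib_right sum_divide_distrib)
          also have "\<dots> \<le> C1 * ?w * (B / \<rho>\<^sup>2)"
            using C1(2)[OF t y(2)] B(1) by (intro mult_right_mono) auto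
          finally show ?thesis .
        qed
        have a2: "\<bar>\<Sum>a\<in>UNIV. Bt t a y * ?X a y\<bar> \<le> C2 * (?w / \<rho>) * (B / \<rho>)"
        proof -
          have "\<bar>\<Sum>a\<in>UNIV. Bt t a y * ?X a y\<bar> \<le> (\<Sum>a\<in>UNIV. \<bar>Bt t a y\<bar> * (B / \<rho>))"
            by (intro order_trans[OF sum_abs] sum_mono) (unfold abs_mult, rule mult_left_mono[OF X abs_ge_zero])
          also have "\<dots> = (\<Sum>a\<in>UNIV. \<bar>Bt t a y\<bar>) * (B / \<rho>)" by (simp add: sum_distrib_right sum_divide_distrib)
          also have "\<dots> \<le> (C2 * norm y powr (- (2 * \<delta> + 3))) * (B / \<rho>)"
            using C2(2)[OF t y(2)] B(1) \<rho>1 by (intro mult_right_mono) auto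
          also have "\<dots> \<le> C2 * (?w / \<rho>) * (B / \<rho>)"
            using w3 C2(1) B(1) \<rho>1 by (intro mult_right_mono mult_left_mono) auto
          finally show ?thesis .
        qed
        have a3: "\<bar>(Sm t y - trace (Rm t y)) * ?L y\<bar> \<le> C3 * ?w * (?n * (B / \<rho>\<^sup>2))"
          unfolding abs_mult using C3(2)[OF t y(2)] C3(1) by (intro mult_mono L) auto
        have a4: "\<bar>Sm t y * ?L y\<bar> \<le> \<bar>Sm t y\<bar> * (?n * (B / \<rho>\<^sup>2))"
          unfolding abs_mult by (intro mult_left_mono L) auto
        have a5: "\<bar>Sm t y * ?L y / 2\<bar> \<le> \<bar>Sm t y * ?L y\<bar>" by simp
        show ?thesis unfolding eq using a1 a2 a3 a4 a5 by linarith
      qed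
      have "C1 * ?w * (B / \<rho>\<^sup>2) + C2 * (?w / \<rho>) * (B / \<rho>) + C3 * ?w * (?n * (B / \<rho>\<^sup>2)) + \<bar>Sm t y\<bar> * (?n * (B / \<rho>\<^sup>2))
        = k1 / \<rho>\<^sup>2 * \<bar>Sm t y\<bar> + k2 / \<rho>\<^sup>2 * ?w"
        using \<rho>1 by (simp add: k1_def k2_def field_simps power2_eq_square)
      moreover have "?u y = k1 / \<rho>\<^sup>2 * \<bar>Sm t y\<bar> + k2 / \<rho>\<^sup>2 * ?w" using True y by simp
      ultimately show ?thesis using le by (simp only:)
    qed
    have "(LINT y|lborel. Lin (Rc ax (G t)) \<rho> y) = (LINT y|lborel. Lin (Rc ax (G t)) \<rho> y - Z y)"
      using iL iZ Z0 by simp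
    then have "\<bar>LINT y|lborel. Lin (Rc ax (G t)) \<rho> y\<bar> = \<bar>LINT y|lborel. Lin (Rc ax (G t)) \<rho> y - Z y\<bar>" by simp
    also have "\<dots> \<le> (LINT y|lborel. \<bar>Lin (Rc ax (G t)) \<rho> y - Z y\<bar>)" by (rule integral_abs_bound)
    also have "\<dots> \<le> (LINT y|lborel. ?u y)"
      by (rule integral_mono[OF _ iu bound]) (use iL iZ in auto)
    also have "\<dots> = k1 / \<rho>\<^sup>2 * Q t \<rho> + k2 / \<rho>\<^sup>2 * \<Lambda>"
    proof -
      have "integrable lborel (\<lambda>y. k1 / \<rho>\<^sup>2 * (indicator (Ann \<rho> (2 * \<rho>)) y * \<bar>Sm t y\<bar>))"
        "integrable lborel (\<lambda>y::real^'n. k2 / \<rho>\<^sup>2 * (indicator {y. 1 \<le> norm y} y * norm y powr (- (2 * \<delta> + 2))))"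
        by (intro integrable_mult_right integrable_weight integrable_Ann_S[OF t \<rho>1(1)])+
      from Bochner_Integration.integral_add[OF this] show ?thesis
        unfolding Q_def \<Lambda>_def by (simp only: integral_mult_right_zero)
    qed
    also have "\<dots> \<le> k1 / \<rho>\<^sup>2 * q + k2 / \<rho>\<^sup>2 * \<Lambda>"
      using mult_left_mono[OF q(2)[OF \<rho> t], of "k1 / \<rho>\<^sup>2"] k by simp
    also have "\<dots> = (k1 * q + k2 * \<Lambda>) / \<rho>\<^sup>2" by (simp add: add_divide_distrib)
    finally show "\<bar>LINT y|lborel. Lin (Rc ax (G t)) \<rho> y\<bar> \<le> (k1 * q + k2 * \<Lambda>) / \<rho>\<^sup>2" .
  qed
qed

text \<open>The mean value theorem in time and \<open>Lin_R_bound\<close> make the averages at two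
  times differ by order \<open>1 / \<rho>^2\<close>; the averages converge to the flux
  limits.\<close>

lemma limit_constant:
  assumes t: "t \<in> {0..T}" and m: "(sphint (fm t) \<longlongrightarrow> m) at_top" and m0: "(sphint (fm 0) \<longlongrightarrow> m0) at_top"
  shows "m = m0"
proof -
  have T0: "0 \<in> {0..T}" using T by simp
  obtain C where C: "\<And>\<rho> t. r0 \<le> \<rho> \<Longrightarrow> t \<in> {0..T} \<Longrightarrow> \<bar>LINT y|lborel. Lin (Rc ax (G t)) \<rho> y\<bar> \<le> C / \<rho>\<^sup>2"
    using Lin_R_bound by blast
  have diff: "\<bar>Aver t \<rho> - Aver 0 \<rho>\<bar> \<le> T * (2 * (C / \<rho>\<^sup>2))" if \<rho>: "r0 \<le> \<rho>" for \<rho>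
  proof (cases "t = 0")
    case True
    have "0 \<le> C / \<rho>\<^sup>2" using C[OF \<rho> T0] by linarith
    then have "0 \<le> T * (2 * (C / \<rho>\<^sup>2))" using T by (intro mult_nonneg_nonneg) auto
    then show ?thesis using True by simp
  next
    case False
    then have t0: "0 < t" "t \<le> T" using t by auto
    have \<rho>1: "1 < \<rho>" using \<rho> r0 by simp
    let ?D = "\<lambda>s. 2 * (LINT y|lborel. Lin (Rc ax (G s)) \<rho> y)"
    have D: "((\<lambda>t. Aver t \<rho>) has_real_derivative ?D s) (at s)" if "0 < s" "s < t" for s
      using DERIV_Aver[of s \<rho>] \<rho>1 that t0 by (simp add: at_within_Icc_at)
    have "\<exists>l z. 0 < z \<and> z < t \<and> ((\<lambda>t. Aver t \<rho>) has_real_derivative l) (at z) \<and> Aver t \<rho> - Aver 0 \<rho> = (t - 0) * l"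
    proof (rule MVT[OF t0(1)])
      have "continuous_on {0..T} (\<lambda>t. Aver t \<rho>)" using DERIV_Aver[OF _ \<rho>1] by (rule DERIV_continuous_on)
      then show "continuous_on {0..t} (\<lambda>t. Aver t \<rho>)" by (rule continuous_on_subset) (use t0 in auto)
      show "(\<lambda>t. Aver t \<rho>) differentiable (at x)" if "0 < x" "x < t" for x
        by (rule differentiableI[OF D[unfolded has_field_derivative_def]]) (use that in auto)
    qed
    then obtain l z where z: "0 < z" "z < t" "((\<lambda>t. Aver t \<rho>) has_real_derivative l) (at z)" "Aver t \<rho> - Aver 0 \<rho> = t * l" by auto
    have "l = ?D z" by (rule DERIV_unique[OF z(3) D]) (use z in auto)
    then have l: "\<bar>l\<bar> \<le> 2 * (C / \<rho>\<^sup>2)" using C[OF \<rho>, of z] z t0 by (simp add: abs_mult)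
    have "\<bar>Aver t \<rho> - Aver 0 \<rho>\<bar> = t * \<bar>l\<bar>" using z(4) t0 by (simp add: abs_mult)
    also have "\<dots> \<le> T * (2 * (C / \<rho>\<^sup>2))" using l t0 by (intro mult_mono) auto
    finally show ?thesis .
  qed
  have "((\<lambda>\<rho>. Aver t \<rho> - Aver 0 \<rho>) \<longlongrightarrow> m - m0) at_top"
    by (intro tendsto_diff Aver_tendsto t T0 m m0)
  moreover have "((\<lambda>\<rho>. Aver t \<rho> - Aver 0 \<rho>) \<longlongrightarrow> 0) at_top"
  proof (rule Lim_null_comparison)
    show "\<forall>\<^sub>F \<rho> in at_top. norm (Aver t \<rho> - Aver 0 \<rho>) \<le> T * (2 * (C / \<rho>\<^sup>2))"
      unfolding eventually_at_top_linorder using diff by auto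
    have "((\<lambda>\<rho>. inverse (\<rho>\<^sup>2)) \<longlongrightarrow> (0::real)) at_top"
      by (intro tendsto_inverse_0_at_top filterlim_pow_at_top filterlim_ident) simp
    from tendsto_mult_right_zero[OF this, of "T * (2 * C)"]
    show "((\<lambda>\<rho>. T * (2 * (C / \<rho>\<^sup>2))) \<longlongrightarrow> 0) at_top"
      by (simp add: divide_inverse mult.assoc)
  qed
  ultimately have "m - m0 = 0" by (rule tendsto_unique[OF trivial_limit_at_top_linorder])
  then show ?thesis by simp
qed

theorem mass_conserved: "\<exists>m. \<forall>t\<in>{0..T}. (adm_flux (G t) \<longlongrightarrow> m) at_top"
proof -
  have T0: "0 \<in> {0..T}" using T by simp
  obtain m0 where m0: "(sphint (fm 0) \<longlongrightarrow> m0) at_top" using flux_limit[OF T0] by blast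
  show ?thesis
  proof (intro exI ballI)
    fix t assume t: "t \<in> {0..T}"
    obtain m where m: "(sphint (fm t) \<longlongrightarrow> m) at_top" using flux_limit[OF t] by blast
    have "(sphint (fm t) \<longlongrightarrow> m0) at_top" using m limit_constant[OF t m m0] by simp
    then show "(adm_flux (G t) \<longlongrightarrow> m0) at_top"
      by (rule Lim_transform_eventually)
         (use adm_flux_eq[OF t] in \<open>auto simp: eventually_at_top_dense intro!: exI[of _ 0]\<close>)
  qed
qed

end

section \<open>Positive definite matrices and tensor norms\<close>

text \<open>The segment from the identity to \<open>A\<close> consists of positive definite
  matrices, so the determinant has no zero along it and keeps its sign.\<close>

lemma posdef_det_pos:
  fixes A :: "real^'n^'n"
  assumes pos: "\<And>v. v \<noteq> 0 \<Longrightarrow> v \<bullet> (A *v v) > 0"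
  shows "det A > 0"
proof (rule ccontr)
  let ?B = "\<lambda>s::real. (1 - s) *\<^sub>R mat 1 + s *\<^sub>R A"
  assume "\<not> 0 < det A"
  moreover have "continuous_on {0..1} (\<lambda>s. det (?B s))"
    by (rule continuous_on_det) (auto intro!: continuous_intros)
  ultimately obtain s where s: "0 \<le> s" "s \<le> 1" "det (?B s) = 0"
    using IVT2'[of "\<lambda>s. det (?B s)" 1 0 0] by (auto simp: det_I)
  have "v \<bullet> (?B s *v v) > 0" if v: "v \<noteq> 0" for v
  proof -
    have "v \<bullet> (?B s *v v) = (1 - s) * (v \<bullet> v) + s * (v \<bullet> (A *v v))"
      by (simp add: matrix_vector_mult_add_rdistrib inner_add_right scaleR_matrix_vector_assoc[symmetric])
    moreover have "v \<bullet> v > 0" "v \<bullet> (A *v v) > 0" using v pos by auto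
    ultimately show ?thesis using s by (cases "s = 0") (auto intro!: add_nonneg_pos)
  qed
  then show False using posdef_inverse(3)[of "?B s"] s by blast
qed

lemma matrix_inv_unique:
  fixes A B :: "real^'n^'n"
  assumes "A ** B = mat 1"
  shows "matrix_inv A = B"
proof -
  have BA: "B ** A = mat 1" using assms by (simp add: matrix_left_right_inverse)
  then have "\<exists>X. A ** X = mat 1 \<and> X ** A = mat 1" using assms by blast
  then have "A ** matrix_inv A = mat 1 \<and> matrix_inv A ** A = mat 1"
    unfolding matrix_inv_def by (rule someI_ex)
  then have "B ** (A ** matrix_inv A) = B" by simp
  then show ?thesis by (simp add: matrix_mul_assoc BA)
qed

text \<open>The Jacobian factors cancel under the trace; with \<open>R\<close> the Ricci matrix this
  is the independence of the scalar curvature from the chart.\<close>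

lemma trace_inv_congruence:
  fixes G R J :: "real^'n^'n"
  assumes "det (transpose J ** G ** J) \<noteq> 0"
  shows "trace (matrix_inv (transpose J ** G ** J) ** transpose (transpose J ** R ** J))
    = trace (matrix_inv G ** transpose R)"
proof -
  have "det J \<noteq> 0" "det G \<noteq> 0" using assms by (auto simp: det_mul)
  then obtain K L where K: "J ** K = mat 1" "K ** J = mat 1" and L: "G ** L = mat 1"
    unfolding invertible_det_nz[symmetric] invertible_def by blast
  have K': "transpose J ** transpose K = mat 1" "transpose K ** transpose J = mat 1"
    using K by (metis matrix_transpose_mul transpose_mat)+
  have L': "matrix_inv G = L" by (rule matrix_inv_unique[OF L])
  have "(transpose J ** G ** J) ** (K ** L ** transpose K) = transpose J ** (G ** (J ** K) ** L) ** transpose K"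
    by (simp only: matrix_mul_assoc)
  also have "\<dots> = mat 1" by (simp add: K L K')
  finally have 1: "matrix_inv (transpose J ** G ** J) = K ** L ** transpose K" by (rule matrix_inv_unique)
  have "(K ** L ** transpose K) ** transpose (transpose J ** R ** J)
      = K ** (L ** (transpose K ** transpose J) ** transpose R) ** J"
    by (simp only: matrix_transpose_mul transpose_transpose matrix_mul_assoc)
  also have "trace \<dots> = trace (J ** (K ** (L ** (transpose K ** transpose J) ** transpose R)))"
    by (rule trace_mul_sym)
  also have "\<dots> = trace (L ** transpose R)" by (simp add: matrix_mul_assoc K K')
  finally show ?thesis by (simp add: 1 L')
qed

lemma Sc_eq_trace: "Sc e G y = trace (matrix_inv (G y) ** transpose (Rc e G y))"
  by (simp add: Sc_def trace_def matrix_mult_nth transpose_nth)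

text \<open>Symmetric elimination, one pivot per induction step: \<open>C\<close> is the remaining
  Schur complement, zero in the rows already treated and positive on the vectors that avoid
  them.\<close>

lemma cholesky_partial:
  fixes B :: "real^'n^'n"
  assumes "finite S" and sym: "transpose B = B" and pos: "\<And>v. v \<noteq> 0 \<Longrightarrow> v \<bullet> (B *v v) > 0"
  shows "\<exists>(P :: real^'n^'n) C. (\<forall>i j. B $ i $ j = (\<Sum>a\<in>S. P $ i $ a * P $ j $ a) + C $ i $ j) \<and> transpose C = C \<and>
    (\<forall>i\<in>S. \<forall>j. C $ i $ j = 0) \<and> (\<forall>v. v \<noteq> 0 \<and> (\<forall>i\<in>S. v $ i = 0) \<longrightarrow> v \<bullet> (C *v v) > 0)"
  using assms(1)
proof (induction S)
  case empty
  show ?case by (rule exI[of _ 0], rule exI[of _ B]) (use sym pos in auto)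
next
  case (insert s S)
  then obtain P C :: "real^'n^'n" where B: "\<And>i j. B $ i $ j = (\<Sum>a\<in>S. P $ i $ a * P $ j $ a) + C $ i $ j"
    and symC: "transpose C = C" and zero: "\<And>i j. i \<in> S \<Longrightarrow> C $ i $ j = 0"
    and posC: "\<And>v. v \<noteq> 0 \<Longrightarrow> (\<And>i. i \<in> S \<Longrightarrow> v $ i = 0) \<Longrightarrow> v \<bullet> (C *v v) > 0" by blast
  have C_sym: "C $ i $ j = C $ j $ i" for i j by (subst symC[symmetric]) (simp add: transpose_nth)
  define c where "c = C $ s $ s"
  have "axis s 1 \<bullet> (C *v axis s 1) > 0"
    by (rule posC) (use insert.hyps in \<open>auto simp: axis_def vec_eq_iff\<close>)
  then have c: "c > 0" by (simp add: c_def matrix_vector_mult_basis column_def inner_axis')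
  let ?P = "\<chi> i a. if a = s then C $ i $ s / sqrt c else P $ i $ a"
  let ?C = "\<chi> i j. C $ i $ j - C $ i $ s * C $ j $ s / c"
  have 1: "B $ i $ j = (\<Sum>a\<in>insert s S. ?P $ i $ a * ?P $ j $ a) + ?C $ i $ j" for i j
  proof -
    have "(\<Sum>a\<in>S. ?P $ i $ a * ?P $ j $ a) = (\<Sum>a\<in>S. P $ i $ a * P $ j $ a)"
      by (rule sum.cong) (use insert.hyps in auto)
    then show ?thesis using insert.hyps c by (simp add: B)
  qed
  have 2: "transpose ?C = ?C" by (simp add: vec_eq_iff transpose_nth C_sym mult.commute)
  have 3: "?C $ i $ j = 0" if "i \<in> insert s S" for i j
    using that zero[of i] c by (auto simp: c_def[symmetric] C_sym[of s j])
  have 4: "v \<bullet> (?C *v v) > 0" if v: "v \<noteq> 0" "\<And>i. i \<in> insert s S \<Longrightarrow> v $ i = 0" for v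
  proof -
    define l where "l = (\<Sum>j\<in>UNIV. C $ s $ j * v $ j)"
    \<comment> \<open>Completes the square in direction \<open>s\<close>: the new complement at
      \<open>v\<close> takes the value of the old one at \<open>?w\<close>, the minimum along the
      pivot direction.\<close>
    let ?w = "v - (l / c) *\<^sub>R axis s 1"
    have Cv: "axis s 1 \<bullet> (C *v v) = l" by (simp add: inner_axis' matrix_vector_mult_def l_def)
    have vC: "v \<bullet> (C *v axis s 1) = l"
      by (simp add: matrix_vector_mult_basis column_def inner_vec_def l_def C_sym[of s] mult.commute)
    have cc: "axis s 1 \<bullet> (C *v axis s 1) = c" by (simp add: c_def matrix_vector_mult_basis column_def inner_axis')
    have "v \<bullet> (?C *v v) = (\<Sum>i\<in>UNIV. \<Sum>j\<in>UNIV. v $ i * (C $ i $ j * v $ j)) - (\<Sum>i\<in>UNIV. \<Sum>j\<in>UNIV. (C $ s $ i * v $ i) * (C $ s $ j * v $ j) / c)"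
      by (simp add: inner_vec_def matrix_vector_mult_def sum_distrib_left sum_subtractf[symmetric] algebra_simps C_sym[of _ s])
    also have "(\<Sum>i\<in>UNIV. \<Sum>j\<in>UNIV. v $ i * (C $ i $ j * v $ j)) = v \<bullet> (C *v v)"
      by (simp add: inner_vec_def matrix_vector_mult_def sum_distrib_left)
    also have "(\<Sum>i\<in>UNIV. \<Sum>j\<in>UNIV. (C $ s $ i * v $ i) * (C $ s $ j * v $ j) / c) = l * l / c"
      by (simp add: l_def sum_product sum_divide_distrib)
    also have "v \<bullet> (C *v v) - l * l / c = ?w \<bullet> (C *v ?w)"
    proof -
      have "C *v ?w = C *v v - (l / c) *\<^sub>R (C *v axis s 1)"
        by (simp add: matrix_vector_mult_diff_distrib matrix_vector_mult_scaleR)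
      then have "?w \<bullet> (C *v ?w) = v \<bullet> (C *v v) - (l / c) * l - (l / c) * (l - (l / c) * c)"
        by (simp add: inner_diff_left inner_diff_right Cv vC cc)
      then show ?thesis using c by simp
    qed
    also have "\<dots> > 0"
    proof (rule posC)
      show "?w \<noteq> 0"
      proof
        assume w: "?w = 0"
        have "v $ i = 0" for i
        proof (cases "i = s")
          case False
          then show ?thesis using w by (auto simp: vec_eq_iff axis_def dest!: spec[of _ i])
        qed (use v(2) in auto)
        then show False using v(1) by (simp add: vec_eq_iff)
      qed
      show "?w $ i = 0" if "i \<in> S" for i using that v(2)[of i] insert.hyps by (auto simp: axis_def)
    qed
    finally show ?thesis .
  qed
  show ?case by (rule exI[of _ ?P], rule exI[of _ ?C]) (use 1 2 3 4 in blast)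
qed

lemma cholesky:
  fixes B :: "real^'n^'n"
  assumes "transpose B = B" "\<And>v. v \<noteq> 0 \<Longrightarrow> v \<bullet> (B *v v) > 0"
  obtains P :: "real^'n^'n" where "\<And>i j. B $ i $ j = (\<Sum>a\<in>UNIV. P $ i $ a * P $ j $ a)"
  using cholesky_partial[OF finite_class.finite_UNIV assms] by auto

lemma posdef_matrix_inv:
  fixes A :: "real^'n^'n"
  assumes sym: "transpose A = A" and pos: "\<And>v. v \<noteq> 0 \<Longrightarrow> v \<bullet> (A *v v) > 0"
  shows "transpose (matrix_inv A) = matrix_inv A" "v \<noteq> 0 \<Longrightarrow> v \<bullet> (matrix_inv A *v v) > 0"
proof -
  note inv = posdef_inverse[OF pos]
  have "A ** transpose (matrix_inv A) = transpose (matrix_inv A ** A)"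
    by (simp add: matrix_transpose_mul sym)
  then have "A ** transpose (matrix_inv A) = mat 1" by (simp add: inv)
  then show "transpose (matrix_inv A) = matrix_inv A" by (rule matrix_inv_unique[symmetric])
  assume v: "v \<noteq> 0"
  let ?w = "matrix_inv A *v v"
  have Aw: "A *v ?w = v" by (simp add: matrix_vector_mul_assoc inv)
  then have "?w \<noteq> 0" using v by auto
  then have "?w \<bullet> (A *v ?w) > 0" by (rule pos)
  then show "v \<bullet> ?w > 0" by (simp add: Aw inner_commute)
qed

section \<open>Tensor norms in an orthonormal frame\<close>

lemma sum_lists_Suc:
  fixes f :: "'n::finite list \<Rightarrow> real"
  shows "(\<Sum>I | length I = Suc m. f I) = (\<Sum>k\<in>UNIV. \<Sum>J | length J = m. f (k # J))"
proof -
  have "(\<Sum>I | length I = Suc m. f I) = (\<Sum>(k, J)\<in>UNIV \<times> {J. length J = m}. f (k # J))"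
    by (rule sum.reindex_bij_witness[of _ "\<lambda>(k, J). k # J" "\<lambda>I. (hd I, tl I)"]) (auto simp: length_Suc_conv)
  then show ?thesis by (simp add: sum.cartesian_product)
qed

lemma finite_lists_length [simp]: "finite {I :: 'n::finite list. length I = m}"
  using finite_lists_length_eq[of "UNIV :: 'n set" m] by simp

lemma prod_sum_lists:
  fixes f :: "'n::finite \<Rightarrow> 'n \<Rightarrow> 'n \<Rightarrow> real"
  assumes "length I = m" "length J = m"
  shows "(\<Prod>q<m. \<Sum>a\<in>UNIV. f (I ! q) (J ! q) a) = (\<Sum>K | length K = m. \<Prod>q<m. f (I ! q) (J ! q) (K ! q))"
  using assms
proof (induction m arbitrary: I J)
  case (Suc m)
  obtain i I' where I: "I = i # I'" "length I' = m" using Suc.prems by (auto simp: length_Suc_conv)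
  obtain j J' where J: "J = j # J'" "length J' = m" using Suc.prems by (auto simp: length_Suc_conv)
  show ?case
    by (simp add: I J sum_lists_Suc prod.lessThan_Suc_shift Suc.IH[OF I(2) J(2)] sum_product del: prod.lessThan_Suc)
qed simp

text \<open>The columns of \<open>P\<close> form an orthonormal frame, in which the norm is
  Euclidean. This makes visible that it dominates every single frame component.\<close>

lemma tensor_norm_frame:
  fixes G :: "real^'n::finite \<Rightarrow> real^'n^'n" and P :: "real^'n^'n"
  assumes P: "\<And>i j. matrix_inv (G y) $ i $ j = (\<Sum>a\<in>UNIV. P $ i $ a * P $ j $ a)"
  shows "tensor_norm G m F y = sqrt (\<Sum>K | length K = m. (\<Sum>I | length I = m. (\<Prod>q<m. P $ (I ! q) $ (K ! q)) * F I y)\<^sup>2)"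
proof -
  let ?L = "{I :: 'n list. length I = m}"
  have "(\<Sum>I\<in>?L. \<Sum>J\<in>?L. (\<Prod>q<m. matrix_inv (G y) $ (I ! q) $ (J ! q)) * F I y * F J y)
    = (\<Sum>I\<in>?L. \<Sum>J\<in>?L. \<Sum>K\<in>?L. ((\<Prod>q<m. P $ (I ! q) $ (K ! q)) * F I y) * ((\<Prod>q<m. P $ (J ! q) $ (K ! q)) * F J y))"
    unfolding P by (intro sum.cong refl)
      (simp add: prod_sum_lists[where f="\<lambda>i j a. P $ i $ a * P $ j $ a"] prod.distrib sum_distrib_left sum_distrib_right mult_ac)
  also have "\<dots> = (\<Sum>I\<in>?L. \<Sum>K\<in>?L. \<Sum>J\<in>?L. ((\<Prod>q<m. P $ (I ! q) $ (K ! q)) * F I y) * ((\<Prod>q<m. P $ (J ! q) $ (K ! q)) * F J y))"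
    by (intro sum.cong refl sum.swap)
  also have "\<dots> = (\<Sum>K\<in>?L. \<Sum>I\<in>?L. \<Sum>J\<in>?L. ((\<Prod>q<m. P $ (I ! q) $ (K ! q)) * F I y) * ((\<Prod>q<m. P $ (J ! q) $ (K ! q)) * F J y))"
    by (rule sum.swap)
  also have "\<dots> = (\<Sum>K\<in>?L. (\<Sum>I\<in>?L. (\<Prod>q<m. P $ (I ! q) $ (K ! q)) * F I y)\<^sup>2)"
    by (simp add: power2_eq_square sum_product)
  finally show ?thesis by (simp add: tensor_norm_def)
qed

lemma frame_component_le_tensor_norm:
  fixes G :: "real^'n::finite \<Rightarrow> real^'n^'n" and P :: "real^'n^'n"
  assumes "\<And>i j. matrix_inv (G y) $ i $ j = (\<Sum>a\<in>UNIV. P $ i $ a * P $ j $ a)" and "length K = m"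
  shows "\<bar>\<Sum>I | length I = m. (\<Prod>q<m. P $ (I ! q) $ (K ! q)) * F I y\<bar> \<le> tensor_norm G m F y"
proof -
  have "(\<Sum>I | length I = m. (\<Prod>q<m. P $ (I ! q) $ (K ! q)) * F I y)\<^sup>2
      \<le> (\<Sum>K | length K = m. (\<Sum>I | length I = m. (\<Prod>q<m. P $ (I ! q) $ (K ! q)) * F I y)\<^sup>2)"
    by (rule member_le_sum) (use assms in auto)
  then show ?thesis unfolding tensor_norm_frame[where P=P and G=G and y=y, OF assms(1)] by (intro real_le_rsqrt) simp
qed

lemma component_le_tensor_norm:
  fixes G :: "real^'n::finite \<Rightarrow> real^'n^'n"
  assumes G: "G y = mat 1" and K: "length K = m"
  shows "\<bar>F K y\<bar> \<le> tensor_norm G m F y"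
proof -
  have inv: "matrix_inv (G y) = mat 1" unfolding G by (rule matrix_inv_unique) simp
  have *: "(\<Prod>q<m. (mat 1 :: real^'n^'n) $ (I ! q) $ (K ! q)) = (if I = K then 1 else 0)" if I: "length I = m" for I
  proof (cases "I = K")
    case False
    then obtain q where "q < m" "I ! q \<noteq> K ! q" using I K by (auto simp: list_eq_iff_nth_eq)
    then show ?thesis using False by (auto intro!: prod_zero simp: mat_def)
  qed (simp add: mat_def)
  have "(\<Sum>I | length I = m. (\<Prod>q<m. (mat 1 :: real^'n^'n) $ (I ! q) $ (K ! q)) * F I y) = (\<Sum>I | length I = m. if I = K then F I y else 0)"
    by (rule sum.cong) (auto simp: *)
  also have "\<dots> = F K y" using K by simp
  finally have eq: "(\<Sum>I | length I = m. (\<Prod>q<m. (mat 1 :: real^'n^'n) $ (I ! q) $ (K ! q)) * F I y) = F K y" .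
  have "matrix_inv (G y) $ i $ j = (\<Sum>a\<in>UNIV. mat 1 $ i $ a * (mat 1 :: real^'n^'n) $ j $ a)" for i j
  proof -
    have "(\<Sum>a\<in>UNIV. mat 1 $ i $ a * (mat 1 :: real^'n^'n) $ j $ a) = (mat 1 ** transpose (mat 1)) $ i $ j"
      by (simp only: matrix_mult_nth transpose_nth)
    then show ?thesis by (simp add: inv)
  qed
  from frame_component_le_tensor_norm[where P="mat 1" and G=G and y=y, OF this K, of F] show ?thesis unfolding eq .
qed

lemma sum_reorder:
  fixes f :: "'n::finite \<Rightarrow> 'n \<Rightarrow> 'n \<Rightarrow> 'n \<Rightarrow> 'n \<Rightarrow> 'n \<Rightarrow> real"
  shows "(\<Sum>i\<in>UNIV. \<Sum>j\<in>UNIV. \<Sum>k\<in>UNIV. \<Sum>a\<in>UNIV. \<Sum>u\<in>UNIV. \<Sum>v\<in>UNIV. f i j k a v u)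
    = (\<Sum>v\<in>UNIV. \<Sum>u\<in>UNIV. \<Sum>a\<in>UNIV. \<Sum>i\<in>UNIV. \<Sum>k\<in>UNIV. \<Sum>j\<in>UNIV. f i j k a v u)"
  unfolding sum.cartesian_product case_prod_unfold UNIV_Times_UNIV
  by (rule sum.reindex_bij_witness[of _ "\<lambda>(v, u, a, i, k, j). (i, j, k, a, u, v)" "\<lambda>(i, j, k, a, u, v). (v, u, a, i, k, j)"]) auto

text \<open>In an orthonormal frame the scalar curvature is a sum of \<open>n^2\<close> components
  of the curvature tensor, each dominated by the norm.\<close>

lemma scal_le_tensor_norm:
  fixes G :: "real^'n::finite \<Rightarrow> real^'n^'n"
  assumes sym: "transpose (G y) = G y" and pos: "\<And>v. v \<noteq> 0 \<Longrightarrow> v \<bullet> (G y *v v) > 0"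
  shows "\<bar>scal G y\<bar> \<le> (real CARD('n))\<^sup>2 * tensor_norm G 4 (riemann_lowered G) y"
proof -
  obtain P :: "real^'n^'n" where P: "\<And>i j. matrix_inv (G y) $ i $ j = (\<Sum>a\<in>UNIV. P $ i $ a * P $ j $ a)"
    using cholesky[OF posdef_matrix_inv[OF sym pos]] by blast
  let ?F = "\<lambda>I. riemann_lowered G I y" and ?H = "matrix_inv (G y)"
  have raise: "riemann G k i j l y = (\<Sum>a\<in>UNIV. ?H $ k $ a * ?F [a, i, j, l])" for k i j l
  proof -
    have "(\<Sum>a\<in>UNIV. ?H $ k $ a * ?F [a, i, j, l]) = (\<Sum>m\<in>UNIV. (?H ** G y) $ k $ m * riemann G m i j l y)"
      unfolding riemann_lowered_def matrix_mult_nth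
      by (simp add: sum_distrib_left sum_distrib_right mult.assoc) (rule sum.swap)
    also have "\<dots> = riemann G k i j l y"
      by (simp add: posdef_inverse(2)[OF pos] mat_def if_distrib[of "\<lambda>x. x * _"] cong: if_cong)
    finally show ?thesis by simp
  qed
  \<comment> \<open>The component \<open>R(u, v, u, v)\<close> of the lowered curvature in the frame
    given by the columns of \<open>P\<close>.\<close>
  define t where "t u v = (\<Sum>I | length I = 4. (\<Prod>q<4. P $ (I ! q) $ ([u, v, u, v] ! q)) * ?F I)" for u v
  have t: "t u v = (\<Sum>a\<in>UNIV. \<Sum>i\<in>UNIV. \<Sum>k\<in>UNIV. \<Sum>j\<in>UNIV. (P $ a $ u * P $ k $ u) * (P $ i $ v * P $ j $ v) * ?F [a, i, k, j])" for u v
    by (simp add: t_def numeral_eq_Suc sum_lists_Suc prod.lessThan_Suc_shift mult_ac del: prod.lessThan_Suc)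
  have "scal G y = (\<Sum>i\<in>UNIV. \<Sum>j\<in>UNIV. \<Sum>k\<in>UNIV. \<Sum>a\<in>UNIV. \<Sum>u\<in>UNIV. \<Sum>v\<in>UNIV. (P $ a $ u * P $ k $ u) * (P $ i $ v * P $ j $ v) * ?F [a, i, k, j])"
    by (simp add: scal_def ricci_def raise P sum_distrib_left sum_distrib_right sum_product mult_ac)
  also have "\<dots> = (\<Sum>v\<in>UNIV. \<Sum>u\<in>UNIV. t u v)"
    unfolding t by (rule sum_reorder)
  finally have eq: "scal G y = (\<Sum>v\<in>UNIV. \<Sum>u\<in>UNIV. t u v)" .
  have "\<bar>scal G y\<bar> \<le> (\<Sum>v\<in>(UNIV::'n set). \<Sum>u\<in>(UNIV::'n set). tensor_norm G 4 (riemann_lowered G) y)"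
    unfolding eq by (intro order_trans[OF sum_abs] sum_mono)
       (simp add: t_def frame_component_le_tensor_norm[where P=P and G=G and y=y, OF P])
  also have "\<dots> = (real CARD('n))\<^sup>2 * tensor_norm G 4 (riemann_lowered G) y" by (simp add: power2_eq_square)
  finally show ?thesis .
qed

section \<open>Volume measures and scalar curvature along the flow\<close>

lemma is_chartD:
  assumes "is_chart c"
  shows "open (fst c)" "open (chart_image c)" "continuous_on (fst c) (snd c)"
    "continuous_on (chart_image c) (inv_into (fst c) (snd c))"
    "p \<in> fst c \<Longrightarrow> inv_into (fst c) (snd c) (snd c p) = p"
  using assms by (auto simp: is_chart_def homeomorphism_def)

lemma bij_chart_image:
  assumes "is_chart c"
  shows "snd c ` (fst c \<inter> B) = chart_image c \<inter> inv_into (fst c) (snd c) -` B"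
  using is_chartD(5)[OF assms] by (auto simp: image_iff)

lemma atlas_chart: "smooth_structure A \<Longrightarrow> c \<in> A \<Longrightarrow> is_chart c"
  unfolding smooth_structure_def by (elim conjE bspec)

lemma atlas_Union: "smooth_structure A \<Longrightarrow> (\<Union>c\<in>A. fst c) = UNIV"
  unfolding smooth_structure_def by (elim conjE)

lemma atlas_cover:
  assumes "smooth_structure A" obtains c where "c \<in> A" "p \<in> fst c"
proof -
  have "p \<in> (\<Union>c\<in>A. fst c)" using atlas_Union[OF assms] by simp
  then show thesis using that by blast
qed

lemma chart_at:
  assumes "smooth_structure A" shows "chart_at A p \<in> A" "p \<in> fst (chart_at A p)"
proof -
  have "\<exists>c. c \<in> A \<and> p \<in> fst c" by (rule atlas_cover[OF assms, of p]) blast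
  from someI_ex[OF this] show "chart_at A p \<in> A" "p \<in> fst (chart_at A p)" by (auto simp: chart_at_def)
qed

lemma continuous_on_atlas:
  assumes A: "smooth_structure A" and f: "\<And>c. c \<in> A \<Longrightarrow> continuous_on (fst c) f"
  shows "continuous_on UNIV f"
proof -
  have "continuous_on (\<Union>c\<in>A. fst c) f"
    by (rule continuous_on_open_UN) (use f is_chartD(1)[OF atlas_chart[OF A]] in auto)
  then show ?thesis by (simp only: atlas_Union[OF A])
qed

lemma riemannian_metricD:
  assumes A: "smooth_structure A" and g: "riemannian_metric A g" and c: "c \<in> A"
  shows "metric_frame (chart_image c) (g c)" "p \<in> fst c \<Longrightarrow> det (g c (snd c p)) > 0"
    "continuous_on (chart_image c) (\<lambda>y. det (g c y))"
proof -
  note o = is_chartD(2)[OF atlas_chart[OF A c]]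
  have s: "smooth_on (chart_image c) (g c)" using g c by (simp add: riemannian_metric_def)
  have m: "msmooth (chart_image c) (g c)"
    unfolding msmooth_def using smooth_on_linear[OF o bounded_linear_entry s] by blast
  have p: "transpose (g c y) = g c y \<and> (\<forall>v. v \<noteq> 0 \<longrightarrow> v \<bullet> (g c y *v v) > 0)" if "y \<in> chart_image c" for y
    using g c that unfolding riemannian_metric_def by blast
  show "metric_frame (chart_image c) (g c)" by unfold_locales (use o m p in auto)
  show "p \<in> fst c \<Longrightarrow> det (g c (snd c p)) > 0" by (rule posdef_det_pos) (use p in auto)
  show "continuous_on (chart_image c) (\<lambda>y. det (g c y))"
    by (rule smooth_on_continuous_on[OF smooth_on_det[OF o m]])
qed

definition "jac c d p = matrix (frechet_derivative (transition c d) (at (snd c p)))"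

lemma metric_transform:
  assumes "riemannian_metric A g" "c \<in> A" "d \<in> A" "p \<in> fst c" "p \<in> fst d"
  shows "g c (snd c p) = transpose (jac c d p) ** g d (snd d p) ** jac c d p"
proof -
  have "\<forall>p\<in>fst c \<inter> fst d. g c (snd c p) = transpose (jac c d p) ** g d (snd d p) ** jac c d p"
    using assms(1-3) unfolding riemannian_metric_def jac_def Let_def by blast
  then show ?thesis using assms(4,5) by blast
qed

lemma continuous_on_in_chart:
  assumes "is_chart c" "continuous_on (chart_image c) u" "\<And>p. p \<in> fst c \<Longrightarrow> f p = u (snd c p)"
  shows "continuous_on (fst c) f"
proof -
  have "continuous_on (fst c) (\<lambda>p. u (snd c p))"
    by (rule continuous_on_compose2[OF assms(2) is_chartD(3)[OF assms(1)]]) auto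
  then show ?thesis by (rule continuous_on_eq) (simp add: assms(3))
qed

text \<open>Evaluated on sets, \<open>is_volume_measure\<close> identifies the volume measure on the
  chart domain with the image of a weighted Lebesgue measure under the inverse chart; integrals
  follow. The inverse chart is measurable on the chart image, hence the restricted spaces.\<close>

lemma nn_integral_chart:
  fixes F :: "'m::{t2_space, second_countable_topology} \<Rightarrow> ennreal" and c :: "('m, 'n::finite) chart"
  assumes A: "smooth_structure A" and g: "riemannian_metric A g" and \<mu>: "is_volume_measure A g \<mu>"
    and c: "c \<in> A" and F: "F \<in> borel_measurable borel"
  shows "(\<integral>\<^sup>+p. F p * indicator (fst c) p \<partial>\<mu>) =
    (\<integral>\<^sup>+y. F (inv_into (fst c) (snd c) y) * ennreal (sqrt (det (g c y))) * indicator (chart_image c) y \<partial>lborel)"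
proof -
  let ?D = "chart_image c" and ?\<phi> = "inv_into (fst c) (snd c)" and ?w = "\<lambda>y. ennreal (sqrt (det (g c y)))"
  note ch = atlas_chart[OF A c]
  have sets: "sets \<mu> = sets borel" using \<mu> by (simp add: is_volume_measure_def)
  have D: "?D \<in> sets borel" "fst c \<in> sets borel" using is_chartD(1,2)[OF ch] by auto
  let ?L = "restrict_space lborel ?D" and ?L' = "restrict_space (borel :: (real^'n) measure) ?D"
  have L: "sets ?L = sets ?L'" by (rule sets_restrict_space_cong) simp
  have "(\<lambda>y. sqrt (det (g c y))) \<in> borel_measurable ?L'"
    by (rule borel_measurable_continuous_on_restrict) (intro continuous_intros riemannian_metricD[OF A g c])
  then have w: "?w \<in> borel_measurable ?L"
    by (subst measurable_cong_sets[OF L refl]) (rule measurable_compose[OF _ measurable_ennreal])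
  have "?\<phi> \<in> borel_measurable ?L'"
    by (rule borel_measurable_continuous_on_restrict[OF is_chartD(4)[OF ch]])
  then have \<phi>: "?\<phi> \<in> borel_measurable ?L" by (subst measurable_cong_sets[OF L refl])
  then have \<phi>': "?\<phi> \<in> borel_measurable (density ?L ?w)" by simp
  have restrict: "(\<integral>\<^sup>+y. u y \<partial>?L) = (\<integral>\<^sup>+y. u y * indicator ?D y \<partial>lborel)" for u
    using D by (intro nn_integral_restrict_space) simp
  have ind: "indicator (fst c) \<in> borel_measurable \<mu>" using D sets by simp
  have Fm: "F \<in> borel_measurable \<mu>" using F measurable_cong_sets[OF sets refl, of borel] by blast
  let ?M = "density \<mu> (indicator (fst c))" and ?N = "distr (density ?L ?w) borel ?\<phi>"
  have MN: "?M = ?N"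
  proof (rule measure_eqI)
    show "sets ?M = sets ?N" by (simp add: sets)
    fix B assume "B \<in> sets ?M"
    then have B: "B \<in> sets borel" by (simp add: sets)
    have "emeasure ?M B = (\<integral>\<^sup>+ p. indicator (fst c) p * indicator B p \<partial>\<mu>)"
      by (rule emeasure_density[OF ind]) (use B sets in simp)
    also have "\<dots> = (\<integral>\<^sup>+ p. indicator (fst c \<inter> B) p \<partial>\<mu>)" by (simp add: indicator_inter_arith)
    also have "\<dots> = emeasure \<mu> (fst c \<inter> B)" using B D sets by (intro nn_integral_indicator) auto
    also have "\<dots> = (\<integral>\<^sup>+ y. ?w y * indicator (snd c ` (fst c \<inter> B)) y \<partial>lborel)"
    proof -
      have "fst c \<inter> B \<in> sets borel" "fst c \<inter> B \<subseteq> fst c" using B D by auto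
      then show ?thesis using \<mu> c unfolding is_volume_measure_def by blast
    qed
    also have "\<dots> = (\<integral>\<^sup>+ y. ?w y * indicator (?\<phi> -` B \<inter> space ?L) y \<partial>?L)"
      unfolding restrict bij_chart_image[OF ch]
      by (intro nn_integral_cong) (auto simp: space_restrict_space split: split_indicator)
    also have "\<dots> = emeasure (density ?L ?w) (?\<phi> -` B \<inter> space ?L)"
      by (rule emeasure_density[OF w measurable_sets[OF \<phi> B], symmetric])
    also have "\<dots> = emeasure ?N B" using emeasure_distr[OF \<phi>' B] by simp
    finally show "emeasure ?M B = emeasure ?N B" .
  qed
  have "(\<integral>\<^sup>+p. F p * indicator (fst c) p \<partial>\<mu>) = (\<integral>\<^sup>+p. F p \<partial>?M)"
    by (subst nn_integral_density[OF ind Fm]) (simp add: mult.commute)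
  also have "\<dots> = (\<integral>\<^sup>+y. F (?\<phi> y) \<partial>density ?L ?w)"
    unfolding MN by (rule nn_integral_distr[OF \<phi>']) (use F in simp)
  also have "\<dots> = (\<integral>\<^sup>+y. ?w y * F (?\<phi> y) \<partial>?L)"
    by (rule nn_integral_density[OF w measurable_compose[OF \<phi> F]])
  finally show ?thesis by (simp add: restrict mult_ac)
qed

text \<open>Every point has a coordinate ball on whose closure the volume density is bounded, and
  finitely many such balls cover \<open>K\<close>.\<close>

lemma volume_compact_finite:
  fixes A :: "('m::{t2_space, second_countable_topology}, 'n::finite) chart set"
  assumes A: "smooth_structure A" and g: "riemannian_metric A g" and \<mu>: "is_volume_measure A g \<mu>"
    and K: "compact K"
  shows "emeasure \<mu> K < \<infinity>"
proof -
  have sets: "sets \<mu> = sets borel" using \<mu> by (simp add: is_volume_measure_def)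
  have "\<exists>N. open N \<and> p \<in> N \<and> emeasure \<mu> N < \<infinity>" for p
  proof -
    obtain c where c: "c \<in> A" "p \<in> fst c" by (rule atlas_cover[OF A])
    note ch = atlas_chart[OF A c(1)]
    obtain e where e: "e > 0" "cball (snd c p) e \<subseteq> chart_image c"
      using is_chartD(2)[OF ch] c(2) by (meson image_eqI open_contains_cball)
    let ?B = "cball (snd c p) e"
    define N where "N = snd c -` ball (snd c p) e \<inter> fst c"
    have N: "open N" "p \<in> N"
      using is_chartD(1,3)[OF ch] c(2) e continuous_on_open_vimage[OF is_chartD(1)[OF ch], of "snd c"] by (auto simp: N_def)
    have "continuous_on ?B (\<lambda>y. sqrt (det (g c y)))"
      by (intro continuous_intros continuous_on_subset[OF riemannian_metricD(3)[OF A g c(1)] e(2)])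
    moreover have "?B \<noteq> {}" using e(1) by simp
    ultimately have "\<exists>y0\<in>?B. \<forall>y\<in>?B. sqrt (det (g c y)) \<le> sqrt (det (g c y0))"
      by (intro continuous_attains_sup compact_cball)
    then obtain y0 where y0: "\<And>y. y \<in> ?B \<Longrightarrow> sqrt (det (g c y)) \<le> sqrt (det (g c y0))" by blast
    have "emeasure \<mu> N = (\<integral>\<^sup>+ y. ennreal (sqrt (det (g c y))) * indicator (snd c ` N) y \<partial>lborel)"
    proof -
      have "N \<in> sets borel" "N \<subseteq> fst c" using N by (auto simp: N_def)
      then show ?thesis using \<mu> c unfolding is_volume_measure_def by blast
    qed
    also have "\<dots> \<le> (\<integral>\<^sup>+ y. ennreal (sqrt (det (g c y0))) * indicator ?B y \<partial>lborel)"
      using y0 by (intro nn_integral_mono) (auto simp: N_def split: split_indicator intro!: ennreal_leI)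
    also have "\<dots> < \<infinity>"
      using emeasure_lborel_cball_finite[of "snd c p" e] by (simp add: nn_integral_cmult_indicator ennreal_mult_less_top)
    finally show ?thesis using N by blast
  qed
  then obtain N where N: "\<And>p. open (N p)" "\<And>p. p \<in> N p" "\<And>p. emeasure \<mu> (N p) < \<infinity>" by metis
  then have "K \<subseteq> (\<Union>p\<in>K. N p)" by blast
  then obtain P where P: "P \<subseteq> K" "finite P" "K \<subseteq> (\<Union>p\<in>P. N p)"
    by (rule compactE_image[OF K N(1)])
  have Ns: "N p \<in> sets \<mu>" for p using N(1) sets by simp
  then have "emeasure \<mu> K \<le> emeasure \<mu> (\<Union>p\<in>P. N p)" using P by (intro emeasure_mono) auto
  also have "\<dots> \<le> (\<Sum>p\<in>P. emeasure \<mu> (N p))" using Ns P by (intro emeasure_subadditive_finite) auto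
  also have "\<dots> < \<infinity>" using N(3) P(2) by (simp add: ennreal_sum_less_top)
  finally show ?thesis .
qed

section \<open>Chart-independent quantities along the flow\<close>

locale manifold_flow =
  fixes A :: "('m::{t2_space, second_countable_topology}, 'n::finite) chart set" and T :: real
    and g :: "real \<Rightarrow> ('m, 'n) field2"
  assumes manifold: "smooth_structure A" and T: "0 < T" and flow: "ricci_flow A T g"
begin

lemma metric: "t \<in> {0..T} \<Longrightarrow> riemannian_metric A (g t)"
  using flow by (simp add: ricci_flow_def)

lemma ricci:
  assumes "c \<in> A" "y \<in> chart_image c" "t \<in> {0..T}"
  shows "((\<lambda>s. g s c y $ i $ j) has_real_derivative - 2 * Rc ax (g t c) y $ i $ j) (at t within {0..T})"
  using flow assms unfolding ricci_flow_def ricci_eq by blast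

text \<open>The Jacobian of a change of charts does not depend on time, so the flow equation carries
  the transformation rule from the metric over to its Ricci curvature.\<close>

lemma Rc_transform:
  assumes t: "t \<in> {0..T}" and cd: "c \<in> A" "d \<in> A" "p \<in> fst c" "p \<in> fst d"
  shows "Rc ax (g t c) (snd c p) = transpose (jac c d p) ** Rc ax (g t d) (snd d p) ** jac c d p"
proof -
  let ?J = "jac c d p"
  have "t islimpt {0..T}" using islimpt_Icc[OF T, of t] t by simp
  then have nb: "at t within {0..T} \<noteq> bot" by (simp add: trivial_limit_within)
  have nth: "(transpose ?J ** B ** ?J) $ i $ j = (\<Sum>l\<in>UNIV. (\<Sum>k\<in>UNIV. ?J $ k $ i * B $ k $ l) * ?J $ l $ j)" for B i j
    by (simp add: matrix_mult_nth transpose_nth)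
  have "Rc ax (g t c) (snd c p) $ i $ j = (transpose ?J ** Rc ax (g t d) (snd d p) ** ?J) $ i $ j" for i j
  proof -
    have 1: "((\<lambda>s. g s c (snd c p) $ i $ j) has_real_derivative - 2 * Rc ax (g t c) (snd c p) $ i $ j) (at t within {0..T})"
      by (rule ricci) (use t cd in auto)
    let ?d = "\<Sum>l\<in>UNIV. (\<Sum>k\<in>UNIV. ?J $ k $ i * (- 2 * Rc ax (g t d) (snd d p) $ k $ l)) * ?J $ l $ j"
    have "((\<lambda>s. \<Sum>l\<in>UNIV. (\<Sum>k\<in>UNIV. ?J $ k $ i * g s d (snd d p) $ k $ l) * ?J $ l $ j) has_real_derivative ?d) (at t within {0..T})"
      by (intro DERIV_sum DERIV_cmult DERIV_cmult_right ricci) (use t cd in auto)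
    then have "((\<lambda>s. g s c (snd c p) $ i $ j) has_real_derivative ?d) (at t within {0..T})"
      unfolding has_field_derivative_def
      by (rule has_derivative_transform[rotated 2])
         (use t in \<open>simp_all add: metric_transform[OF metric cd] nth\<close>)
    then have "- 2 * Rc ax (g t c) (snd c p) $ i $ j = ?d"
      using 1 nb unfolding has_real_derivative_iff_has_vector_derivative by (intro vector_derivative_unique_within)
    also have "\<dots> = - 2 * (transpose ?J ** Rc ax (g t d) (snd d p) ** ?J) $ i $ j"
      by (simp add: nth sum_distrib_left sum_distrib_right mult_ac sum_negf)
    finally show ?thesis by simp
  qed
  then show ?thesis by (simp add: vec_eq_iff)
qed

text \<open>Makes \<open>scalar_curvature\<close>, which is defined through an arbitrarily chosen
  chart at each point, computable in every chart.\<close>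

lemma Sc_transform:
  assumes t: "t \<in> {0..T}" and cd: "c \<in> A" "d \<in> A" "p \<in> fst c" "p \<in> fst d"
  shows "Sc ax (g t c) (snd c p) = Sc ax (g t d) (snd d p)"
  using riemannian_metricD(2)[OF manifold metric[OF t] cd(1,3)]
  unfolding Sc_eq_trace Rc_transform[OF t cd] metric_transform[OF metric[OF t] cd]
  by (intro trace_inv_congruence) simp

lemma scalar_curvature_chart:
  assumes "t \<in> {0..T}" "c \<in> A" "p \<in> fst c"
  shows "scalar_curvature A (g t) p = Sc ax (g t c) (snd c p)"
  using Sc_transform[OF assms(1) chart_at(1)[OF manifold] assms(2) chart_at(2)[OF manifold] assms(3)]
  by (simp add: scalar_curvature_def Let_def scal_eq)

lemma continuous_scalar_curvature:
  assumes t: "t \<in> {0..T}" shows "continuous_on UNIV (scalar_curvature A (g t))"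
proof (rule continuous_on_atlas[OF manifold])
  fix c assume c: "c \<in> A"
  have "continuous_on (chart_image c) (Sc ax (g t c))"
    by (rule smooth_on_continuous_on[OF metric_frame.smooth_Sc[OF riemannian_metricD(1)[OF manifold metric[OF t] c]]])
  then show "continuous_on (fst c) (scalar_curvature A (g t))"
    by (rule continuous_on_in_chart[OF atlas_chart[OF manifold c]]) (rule scalar_curvature_chart[OF t c])
qed

text \<open>A volume measure is at hand for \<open>g 0\<close> only. That of \<open>g t\<close>
  arises from it by this density, a ratio in which the Jacobians of a change of charts cancel; no
  gluing over charts is involved.\<close>

definition "vol_ratio t p =
  (let c = chart_at A p in sqrt (det (g t c (snd c p))) / sqrt (det (g 0 c (snd c p))))"

lemma vol_ratio_chart:
  assumes t: "t \<in> {0..T}" and c: "c \<in> A" "p \<in> fst c"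
  shows "vol_ratio t p = sqrt (det (g t c (snd c p))) / sqrt (det (g 0 c (snd c p)))"
proof -
  let ?d = "chart_at A p"
  have d: "?d \<in> A" "p \<in> fst ?d" using chart_at[OF manifold] by auto
  have T0: "0 \<in> {0..T}" using T by simp
  have "det (jac ?d c p) \<noteq> 0"
    using riemannian_metricD(2)[OF manifold metric[OF t] d] metric_transform[OF metric[OF t] d(1) c(1) d(2) c(2)]
    by (auto simp: det_mul)
  then show ?thesis
    unfolding vol_ratio_def Let_def metric_transform[OF metric[OF t] d(1) c(1) d(2) c(2)]
      metric_transform[OF metric[OF T0] d(1) c(1) d(2) c(2)]
    by (simp add: det_mul real_sqrt_mult)
qed

lemma continuous_vol_ratio:
  assumes t: "t \<in> {0..T}" shows "continuous_on UNIV (vol_ratio t)"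
proof (rule continuous_on_atlas[OF manifold])
  fix c assume c: "c \<in> A"
  have T0: "0 \<in> {0..T}" using T by simp
  have "continuous_on (chart_image c) (\<lambda>y. sqrt (det (g t c y)) / sqrt (det (g 0 c y)))"
    by (intro continuous_intros riemannian_metricD(3)[OF manifold metric c] t T0)
       (use riemannian_metricD(2)[OF manifold metric[OF T0] c] in fastforce)
  then show "continuous_on (fst c) (vol_ratio t)"
    by (rule continuous_on_in_chart[OF atlas_chart[OF manifold c]]) (rule vol_ratio_chart[OF t c])
qed

lemma volume_measure_density:
  assumes t: "t \<in> {0..T}" and \<mu>: "is_volume_measure A (g 0) \<mu>"
  shows "is_volume_measure A (g t) (density \<mu> (\<lambda>p. ennreal (vol_ratio t p)))"
proof -
  have T0: "0 \<in> {0..T}" using T by simp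
  have sets: "sets \<mu> = sets borel" using \<mu> by (simp add: is_volume_measure_def)
  have f: "(\<lambda>p. ennreal (vol_ratio t p)) \<in> borel_measurable borel"
    by (intro measurable_compose[OF _ measurable_ennreal] borel_measurable_continuous_onI continuous_vol_ratio[OF t])
  then have f': "(\<lambda>p. ennreal (vol_ratio t p)) \<in> borel_measurable \<mu>"
    using measurable_cong_sets[OF sets refl, of borel] by blast
  show ?thesis
    unfolding is_volume_measure_def
  proof (intro conjI ballI impI)
    show "sets (density \<mu> (\<lambda>p. ennreal (vol_ratio t p))) = sets borel" by (simp add: sets)
    fix c B assume c: "c \<in> A" and B: "B \<in> sets borel" "B \<subseteq> fst c"
    note ch = atlas_chart[OF manifold c]
    let ?\<phi> = "inv_into (fst c) (snd c)"
    have "emeasure (density \<mu> (\<lambda>p. ennreal (vol_ratio t p))) B = (\<integral>\<^sup>+p. ennreal (vol_ratio t p) * indicator B p \<partial>\<mu>)"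
      by (rule emeasure_density[OF f']) (use B sets in simp)
    also have "\<dots> = (\<integral>\<^sup>+p. (ennreal (vol_ratio t p) * indicator B p) * indicator (fst c) p \<partial>\<mu>)"
      by (rule nn_integral_cong) (use B in \<open>auto split: split_indicator\<close>)
    also have "\<dots> = (\<integral>\<^sup>+y. (ennreal (vol_ratio t (?\<phi> y)) * indicator B (?\<phi> y)) * ennreal (sqrt (det (g 0 c y))) * indicator (chart_image c) y \<partial>lborel)"
      by (rule nn_integral_chart[OF manifold metric[OF T0] \<mu> c])
         (use f B in \<open>intro borel_measurable_times_ennreal borel_measurable_indicator; simp\<close>)
    also have "\<dots> = (\<integral>\<^sup>+y. ennreal (sqrt (det (g t c y))) * indicator (snd c ` B) y \<partial>lborel)"
    proof (rule nn_integral_cong)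
      fix y
      show "(ennreal (vol_ratio t (?\<phi> y)) * indicator B (?\<phi> y)) * ennreal (sqrt (det (g 0 c y))) * indicator (chart_image c) y
        = ennreal (sqrt (det (g t c y))) * indicator (snd c ` B) y"
      proof (cases "y \<in> chart_image c")
        case True
        then obtain p where p: "p \<in> fst c" "y = snd c p" by blast
        have \<phi>: "?\<phi> y = p" using p is_chartD(5)[OF ch] by simp
        have "fst c \<inter> B = B" using B by blast
        then have mem: "y \<in> snd c ` B \<longleftrightarrow> p \<in> B" using bij_chart_image[OF ch, of B] True \<phi> by auto
        have "vol_ratio t p * sqrt (det (g 0 c y)) = sqrt (det (g t c y))"
          using riemannian_metricD(2)[OF manifold metric[OF T0] c p(1)] by (simp add: vol_ratio_chart[OF t c p(1)] p(2))
        moreover have "vol_ratio t p \<ge> 0"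
          using riemannian_metricD(2)[OF manifold metric[OF T0] c p(1)] riemannian_metricD(2)[OF manifold metric[OF t] c p(1)]
          by (simp add: vol_ratio_chart[OF t c p(1)])
        ultimately have "ennreal (vol_ratio t p) * ennreal (sqrt (det (g 0 c y))) = ennreal (sqrt (det (g t c y)))"
          by (simp add: ennreal_mult'[symmetric])
        then show ?thesis using True by (auto simp: \<phi> mem split: split_indicator)
      next
        case False
        then have "y \<notin> snd c ` B" using B by auto
        then show ?thesis using False by simp
      qed
    qed
    finally show "emeasure (density \<mu> (\<lambda>p. ennreal (vol_ratio t p))) B = (\<integral>\<^sup>+y. ennreal (sqrt (det (g t c y))) * indicator (snd c ` B) y \<partial>lborel)" .
  qed
qed

lemma nn_integral_scalar_curvature_chart:
  assumes t: "t \<in> {0..T}" and \<mu>: "is_volume_measure A (g t) \<mu>" and c: "c \<in> A"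
  shows "(\<integral>\<^sup>+p. ennreal \<bar>scalar_curvature A (g t) p\<bar> * indicator (fst c) p \<partial>\<mu>) =
    (\<integral>\<^sup>+y. ennreal (\<bar>Sc ax (g t c) y\<bar> * sqrt (det (g t c y))) * indicator (chart_image c) y \<partial>lborel)"
proof -
  note ch = atlas_chart[OF manifold c]
  have "(\<lambda>p. \<bar>scalar_curvature A (g t) p\<bar>) \<in> borel_measurable borel"
    by (intro borel_measurable_continuous_onI continuous_intros continuous_scalar_curvature[OF t])
  then have "(\<integral>\<^sup>+p. ennreal \<bar>scalar_curvature A (g t) p\<bar> * indicator (fst c) p \<partial>\<mu>) =
    (\<integral>\<^sup>+y. ennreal \<bar>scalar_curvature A (g t) (inv_into (fst c) (snd c) y)\<bar> * ennreal (sqrt (det (g t c y))) * indicator (chart_image c) y \<partial>lborel)"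
    by (intro nn_integral_chart[OF manifold metric[OF t] \<mu> c] measurable_compose[OF _ measurable_ennreal])
  also have "\<dots> = (\<integral>\<^sup>+y. ennreal (\<bar>Sc ax (g t c) y\<bar> * sqrt (det (g t c y))) * indicator (chart_image c) y \<partial>lborel)"
  proof (rule nn_integral_cong)
    fix y
    show "ennreal \<bar>scalar_curvature A (g t) (inv_into (fst c) (snd c) y)\<bar> * ennreal (sqrt (det (g t c y))) * indicator (chart_image c) y
      = ennreal (\<bar>Sc ax (g t c) y\<bar> * sqrt (det (g t c y))) * indicator (chart_image c) y"
    proof (cases "y \<in> chart_image c")
      case True
      then obtain p where p: "p \<in> fst c" "y = snd c p" by blast
      then show ?thesis using is_chartD(5)[OF ch] True
        by (simp add: scalar_curvature_chart[OF t c] ennreal_mult')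
    qed simp
  qed
  finally show ?thesis .
qed

text \<open>On the compact \<open>K\<close> the curvature is bounded and the volume finite; the
  complement is a single chart domain, where the integral is computed in coordinates.\<close>

lemma integrable_scalar_curvature:
  assumes t: "t \<in> {0..T}" and \<mu>: "is_volume_measure A (g t) \<mu>" and K: "compact K" and c: "(- K, x) \<in> A"
    and fin: "(\<integral>\<^sup>+y. ennreal (\<bar>Sc ax (g t (- K, x)) y\<bar> * sqrt (det (g t (- K, x) y))) * indicator (x ` (- K)) y \<partial>lborel) < \<infinity>"
  shows "integrable \<mu> (scalar_curvature A (g t))"
proof -
  let ?S = "scalar_curvature A (g t)"
  have sets: "sets \<mu> = sets borel" using \<mu> by (simp add: is_volume_measure_def)
  have "?S \<in> borel_measurable borel" by (rule borel_measurable_continuous_onI[OF continuous_scalar_curvature[OF t]])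
  then have S: "?S \<in> borel_measurable \<mu>" using measurable_cong_sets[OF sets refl, of borel] by blast
  have Ks: "K \<in> sets \<mu>" using compact_imp_closed[OF K] sets by simp
  have "bounded (?S ` K)"
    by (rule compact_imp_bounded[OF compact_continuous_image[OF continuous_on_subset[OF continuous_scalar_curvature[OF t]] K]]) simp
  then obtain b where b: "\<And>p. p \<in> K \<Longrightarrow> \<bar>?S p\<bar> \<le> b" by (auto simp: bounded_iff)
  have "(\<integral>\<^sup>+p. ennreal (norm (?S p)) \<partial>\<mu>) = (\<integral>\<^sup>+p. ennreal \<bar>?S p\<bar> * indicator K p + ennreal \<bar>?S p\<bar> * indicator (- K) p \<partial>\<mu>)"
    by (rule nn_integral_cong) (auto split: split_indicator)
  also have "\<dots> = (\<integral>\<^sup>+p. ennreal \<bar>?S p\<bar> * indicator K p \<partial>\<mu>) + (\<integral>\<^sup>+p. ennreal \<bar>?S p\<bar> * indicator (- K) p \<partial>\<mu>)"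
  proof (rule nn_integral_add)
    have "- K \<in> sets \<mu>" using compact_imp_closed[OF K] sets by (simp add: borel_open)
    then show "(\<lambda>p. ennreal \<bar>?S p\<bar> * indicator K p) \<in> borel_measurable \<mu>" "(\<lambda>p. ennreal \<bar>?S p\<bar> * indicator (- K) p) \<in> borel_measurable \<mu>"
      using S Ks by measurable
  qed
  also have "\<dots> < \<infinity>"
  proof -
    have "(\<integral>\<^sup>+p. ennreal \<bar>?S p\<bar> * indicator K p \<partial>\<mu>) \<le> (\<integral>\<^sup>+p. ennreal b * indicator K p \<partial>\<mu>)"
      using b by (intro nn_integral_mono) (auto split: split_indicator intro!: ennreal_leI)
    also have "\<dots> < \<infinity>"
      using volume_compact_finite[OF manifold metric[OF t] \<mu> K] Ks
      by (simp add: nn_integral_cmult_indicator ennreal_mult_less_top)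
    finally have "(\<integral>\<^sup>+p. ennreal \<bar>?S p\<bar> * indicator K p \<partial>\<mu>) < \<infinity>" .
    moreover have "(\<integral>\<^sup>+p. ennreal \<bar>?S p\<bar> * indicator (- K) p \<partial>\<mu>) < \<infinity>"
      using nn_integral_scalar_curvature_chart[OF t \<mu> c] fin by simp
    ultimately show ?thesis by simp
  qed
  finally show ?thesis using S by (intro integrableI_bounded)
qed

end

section \<open>Decay in asymptotic coordinates\<close>

lemma weighted_Ck_normD:
  assumes C: "weighted_Ck_norm A h \<rho> S k \<delta> f \<le> C" "C < \<infinity>" and l: "l \<le> k"
    and cp: "c \<in> A" "p \<in> fst c" "p \<in> S" and \<rho>: "\<rho> p > 0"
  shows "tensor_norm (h c) (l + 2) ((cov_deriv (h c) ^^ l) (tensor2 (f c))) (snd c p) \<le> enn2real C * \<rho> p powr (- (\<delta> + real l))"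
proof -
  let ?n = "\<lambda>l c p. tensor_norm (h c) (l + 2) ((cov_deriv (h c) ^^ l) (tensor2 (f c))) (snd c p)"
  let ?s = "\<lambda>l. SUP (c, p)\<in>{(c, p). c \<in> A \<and> p \<in> fst c \<inter> S}. ennreal (\<rho> p powr (\<delta> + real l) * ?n l c p)"
  have "ennreal (\<rho> p powr (\<delta> + real l) * ?n l c p) \<le> ?s l"
    by (rule SUP_upper2[of "(c, p)"]) (use cp in auto)
  also have "\<dots> \<le> (\<Sum>l\<le>k. ?s l)" using member_le_sum[of l "{..k}" ?s] l by simp
  also have "\<dots> \<le> C" using C(1) by (simp add: weighted_Ck_norm_def)
  also have "\<dots> = ennreal (enn2real C)" using C(2) by simp
  finally have "\<rho> p powr (\<delta> + real l) * ?n l c p \<le> enn2real C" by (subst (asm) ennreal_le_iff) auto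
  from mult_left_mono[OF this, of "\<rho> p powr (- (\<delta> + real l))"]
  have "(\<rho> p powr (- (\<delta> + real l)) * \<rho> p powr (\<delta> + real l)) * ?n l c p \<le> enn2real C * \<rho> p powr (- (\<delta> + real l))"
    by (simp add: mult_ac)
  then show ?thesis using \<rho> by (simp only: powr_add[symmetric]) simp
qed

section \<open>Covariant derivatives for a Euclidean background metric\<close>

context
  fixes U :: "(real^'n::finite) set" and h :: "real^'n \<Rightarrow> real^'n^'n"
  assumes U: "open U" and h: "\<And>z. z \<in> U \<Longrightarrow> h z = mat 1"
begin

lemma cov_deriv_flat:
  assumes y: "y \<in> U" shows "cov_deriv h F (k # J) y = dd (ax k) (F J) y"
proof -
  have "pd i (\<lambda>z. h z $ j $ l) y = 0" for i j l
    unfolding pd_eq_dd using dd_cong[OF U y, of "\<lambda>z. h z $ j $ l" "\<lambda>z. mat 1 $ j $ l"] h by simp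
  then have "christoffel h l k j y = 0" for l k j by (simp add: christoffel_def)
  then show ?thesis by (simp add: cov_deriv_def pd_eq_dd)
qed

context
  fixes B :: "real^'n \<Rightarrow> real^'n^'n" assumes B: "msmooth U B"
begin

abbreviation "diff_tensor \<equiv> tensor2 (\<lambda>z. B z - h z)"

lemma cov_deriv_tensor2_flat:
  assumes y: "y \<in> U"
  shows "cov_deriv h diff_tensor [k, i, j] y = dd (ax k) (\<lambda>z. B z $ i $ j) y"
proof -
  have "dd (ax k) (diff_tensor [i, j]) y = dd (ax k) (\<lambda>z. B z $ i $ j - mat 1 $ i $ j) y"
    by (rule dd_cong[OF U y]) (simp add: tensor2_def h)
  also have "\<dots> = dd (ax k) (\<lambda>z. B z $ i $ j) y"
    by (subst dd_diff[OF U y]) (use msmoothD[OF B] smooth_on_const[OF U] in simp_all)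
  finally show ?thesis by (simp add: cov_deriv_flat[OF y])
qed

lemma cov_deriv2_tensor2_flat:
  assumes y: "y \<in> U"
  shows "cov_deriv h (cov_deriv h diff_tensor) [l, k, i, j] y = dd (ax l) (dd (ax k) (\<lambda>z. B z $ i $ j)) y"
  unfolding cov_deriv_flat[OF y] by (rule dd_cong[OF U y]) (rule cov_deriv_tensor2_flat)

end
end

text \<open>In the asymptotic chart the background is the identity, so covariant derivatives are
  partial ones and components are bounded by norms. The bounds keep the weight \<open>w y\<close>:
  it is \<open>norm y\<close> from radius 2 on, and below that it still controls the metric up to
  the inner edge of the chart.\<close>

lemma asymptotic_decay:
  fixes A :: "('m::{t2_space, second_countable_topology}, 'n::finite) chart set"
  assumes A: "smooth_structure A" and coords: "asymptotic_coordinates A K0 x"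
    and bg: "background_metric A K0 x h" and g: "riemannian_metric A g"
    and C: "weighted_Ck_norm A h \<rho> (- K0) 2 \<delta> (\<lambda>c y. g c y - h c y) \<le> C" "C < \<infinity>"
    and w: "\<forall>p. p \<notin> K0 \<longrightarrow> \<rho> p = w (x p)" "\<And>y. w y > 0" and y: "1 < norm y"
  shows "\<bar>g (- K0, x) y $ i $ j - mat 1 $ i $ j\<bar> \<le> enn2real C * w y powr (- \<delta>)"
    and "\<bar>dd (ax k) (\<lambda>z. g (- K0, x) z $ i $ j) y\<bar> \<le> enn2real C * w y powr (- (\<delta> + 1))"
    and "\<bar>dd (ax l) (dd (ax k) (\<lambda>z. g (- K0, x) z $ i $ j)) y\<bar> \<le> enn2real C * w y powr (- (\<delta> + 2))"
proof -
  let ?c = "(- K0, x)" and ?E = "{y::real^'n. 1 < norm y}"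
  have c: "?c \<in> A" and img: "x ` (- K0) = ?E"
    using coords by (auto simp: asymptotic_coordinates_def)
  have h: "h ?c z = mat 1" if "z \<in> ?E" for z using bg img that unfolding background_metric_def by blast
  have B: "msmooth ?E (g ?c)"
    using metric_frame.smooth_G[OF riemannian_metricD(1)[OF A g c]] img by simp
  obtain p where p: "p \<notin> K0" "x p = y" using y img by (metis ComplD image_iff mem_Collect_eq)
  have yE: "y \<in> ?E" using y by simp
  note hy = h[OF yE]
  have n: "tensor_norm (h ?c) (l + 2) ((cov_deriv (h ?c) ^^ l) (tensor2 (\<lambda>y. g ?c y - h ?c y))) y
      \<le> enn2real C * w y powr (- (\<delta> + real l))" if "l \<le> 2" for l
    using weighted_Ck_normD[OF C that c, of p] p w by simp
  have "\<bar>tensor2 (\<lambda>z. g ?c z - h ?c z) [i, j] y\<bar> \<le> enn2real C * w y powr (- \<delta>)"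
    using component_le_tensor_norm[where G="h ?c" and F="tensor2 (\<lambda>z. g ?c z - h ?c z)" and K="[i, j]" and m=2, OF hy] n[of 0] by (simp add: numeral_2_eq_2)
  then show "\<bar>g ?c y $ i $ j - mat 1 $ i $ j\<bar> \<le> enn2real C * w y powr (- \<delta>)"
    by (simp add: tensor2_def hy)
  have "\<bar>cov_deriv (h ?c) (tensor2 (\<lambda>z. g ?c z - h ?c z)) [k, i, j] y\<bar> \<le> enn2real C * w y powr (- (\<delta> + 1))"
    using component_le_tensor_norm[where G="h ?c" and F="cov_deriv (h ?c) (tensor2 (\<lambda>z. g ?c z - h ?c z))" and K="[k, i, j]" and m=3, OF hy] n[of 1] by (simp add: numeral_3_eq_3)
  then show "\<bar>dd (ax k) (\<lambda>z. g ?c z $ i $ j) y\<bar> \<le> enn2real C * w y powr (- (\<delta> + 1))"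
    using cov_deriv_tensor2_flat[where h="h ?c", OF open_exterior h B yE, of k i j] by simp
  have "\<bar>cov_deriv (h ?c) (cov_deriv (h ?c) (tensor2 (\<lambda>z. g ?c z - h ?c z))) [l, k, i, j] y\<bar> \<le> enn2real C * w y powr (- (\<delta> + 2))"
    using component_le_tensor_norm[where G="h ?c" and F="cov_deriv (h ?c) (cov_deriv (h ?c) (tensor2 (\<lambda>z. g ?c z - h ?c z)))" and K="[l, k, i, j]" and m=4, OF hy] n[of 2]
    by (simp add: numeral_eq_Suc)
  then show "\<bar>dd (ax l) (dd (ax k) (\<lambda>z. g ?c z $ i $ j)) y\<bar> \<le> enn2real C * w y powr (- (\<delta> + 2))"
    using cov_deriv2_tensor2_flat[where h="h ?c", OF open_exterior h B yE, of l k i j] by simp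
qed

theorem theorem3:
  fixes A :: "('m::{t2_space, second_countable_topology}, 'n::finite) chart set"
    and K0 :: "'m set" and x :: "'m \<Rightarrow> real^'n"
    and h g0 :: "('m, 'n) field2" and \<rho> :: "'m \<Rightarrow> real"
    and g :: "real \<Rightarrow> ('m, 'n) field2" and \<delta> T :: real
  assumes manifold: "smooth_structure A"
    and coords: "asymptotic_coordinates A K0 x"
    and background: "background_metric A K0 x h"
    and weight: "weight_function K0 x \<rho>"
    and metric: "riemannian_metric A g0"
    and decay: "\<delta> > (real CARD('n) - 2) / 2"
    and flat: "asymptotically_flat A K0 h \<rho> 2 \<delta> g0"
    and integrable: "scalar_curvature_L1 A g0"
    and flow: "shi_solution A T g"
    and initial: "g 0 = g0"
    and uniformly_flat: "\<exists>C<\<infinity>. \<forall>t\<in>{0..T}.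
          weighted_Ck_norm A h \<rho> (- K0) 2 \<delta> (\<lambda>c y. g t c y - h c y) \<le> C"
  shows "(\<forall>t\<in>{0<..T}. scalar_curvature_L1 A (g t)) \<and>
    (\<forall>t\<in>{0..T}.
       (adm_flux (g t (- K0, x)) \<longlongrightarrow> adm_mass (g t (- K0, x))) at_top \<and>
       adm_mass (g t (- K0, x)) = adm_mass (g0 (- K0, x)))"
proof -
  interpret M: manifold_flow A T g
    by unfold_locales (use manifold flow in \<open>auto simp: shi_solution_def\<close>)
  let ?c = "(- K0, x)" and ?E = "{y::real^'n. 1 < norm y}"
  define G where "G t = g t ?c" for t
  have T0: "0 \<in> {0..T}" using M.T by simp
  have c: "?c \<in> A" and K0: "compact K0" and img: "x ` (- K0) = ?E"
    using coords by (auto simp: asymptotic_coordinates_def)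
  have img': "chart_image ?c = ?E" using img by simp
  have \<delta>: "\<delta> > 0" using flat by (simp add: asymptotically_flat_def)
  obtain w where w: "smooth_on UNIV w" "\<And>y. w y > 0" "\<And>y. norm y \<ge> 2 \<Longrightarrow> w y = norm y"
    and \<rho>: "\<forall>p. p \<notin> K0 \<longrightarrow> \<rho> p = w (x p)"
    using weight unfolding weight_function_def by auto
  obtain C where C: "C < \<infinity>" "\<And>t. t \<in> {0..T} \<Longrightarrow> weighted_Ck_norm A h \<rho> (- K0) 2 \<delta> (\<lambda>c y. g t c y - h c y) \<le> C"
    using uniformly_flat by blast
  define D where "D = enn2real C"
  note dec = asymptotic_decay[OF manifold coords background M.metric C(2) C(1) \<rho> w(2), folded D_def, folded G_def]
  have frame: "metric_frame ?E (G t)" if "t \<in> {0..T}" for t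
    using riemannian_metricD(1)[OF manifold M.metric[OF that] c] unfolding img' G_def .
  interpret F: af_flow T \<delta> D G
  proof
    show "T > 0" by (rule M.T)
    show "\<delta> > 0" "2 * \<delta> + 2 > real CARD('n)" using \<delta> decay by auto
    have "smooth_on ({0..T} \<times> chart_image ?c) (\<lambda>(t, y). g t ?c y)"
      using flow c unfolding shi_solution_def ricci_flow_def by blast
    then show "smooth_on ({0..T} \<times> ?E) (\<lambda>(t, y). G t y)" by (simp only: img' G_def)
    fix t :: real and y :: "real^'n" and i j k l :: 'n assume t: "t \<in> {0..T}"
    show "msmooth ?E (G t)" by (rule metric_frame.smooth_G[OF frame[OF t]])
    { assume y: "1 < norm y"
      then have yE: "y \<in> ?E" by simp
      show "transpose (G t y) = G t y" by (rule metric_frame.sym_G[OF frame[OF t] yE])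
      show "v \<bullet> (G t y *v v) > 0" if "v \<noteq> 0" for v by (rule metric_frame.pos_G[OF frame[OF t] yE that])
      show "((\<lambda>s. G s y $ i $ j) has_real_derivative - 2 * Rc ax (G t) y $ i $ j) (at t within {0..T})"
        using M.ricci[OF c _ t, of y i j] yE unfolding img' G_def by blast }
    assume y: "2 \<le> norm y"
    then have y1: "1 < norm y" by simp
    show "\<bar>G t y $ i $ j - mat 1 $ i $ j\<bar> \<le> D * norm y powr (- \<delta>)"
      using dec(1)[OF t t y1, of i j] w(3)[OF y] by simp
    show "\<bar>dd (ax k) (\<lambda>z. G t z $ i $ j) y\<bar> \<le> D * norm y powr (- (\<delta> + 1))"
      using dec(2)[OF t t y1, of k i j] w(3)[OF y] by simp
    show "\<bar>dd (ax l) (dd (ax k) (\<lambda>z. G t z $ i $ j)) y\<bar> \<le> D * norm y powr (- (\<delta> + 2))"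
      using dec(3)[OF t t y1, of l k i j] w(3)[OF y] by simp
  qed
  have det_pos: "det (G t y) > 0" if "t \<in> {0..T}" "1 < norm y" for t y
    by (rule posdef_det_pos) (rule F.G_pos[OF that])
  obtain \<mu> where \<mu>: "is_volume_measure A (g 0) \<mu>" "integrable \<mu> (scalar_curvature A (g 0))"
    using integrable initial unfolding scalar_curvature_L1_def by auto
  let ?u = "\<lambda>y. indicator ?E y *\<^sub>R (\<bar>Sc ax (G 0) y\<bar> * sqrt (det (G 0 y)))"
  \<comment> \<open>The integrability hypothesis refers to the Riemannian volume, the analysis in
    the chart to Lebesgue measure; a lower bound for the volume density beyond \<open>F.r0\<close>
    connects the two.\<close>
  interpret L: af_flow_L1 T \<delta> D G
  proof
    have Es: "?E \<in> sets borel" by (rule borel_open[OF open_exterior])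
    have cS: "continuous_on ?E (Sc ax (G 0))"
      by (rule smooth_on_continuous_on[OF F.slice_smooth_Sc[OF T0]])
    have "continuous_on ?E (\<lambda>y. det (G 0 y))"
      using riemannian_metricD(3)[OF manifold M.metric[OF T0] c] by (simp only: img' G_def)
    then have u: "?u \<in> borel_measurable borel"
      by (intro borel_measurable_continuous_on_indicator Es continuous_intros cS)
    have "(\<integral>\<^sup>+y. ennreal (?u y) \<partial>lborel) = (\<integral>\<^sup>+p. ennreal \<bar>scalar_curvature A (g 0) p\<bar> * indicator (- K0) p \<partial>\<mu>)"
      using M.nn_integral_scalar_curvature_chart[OF T0 \<mu>(1) c]
      unfolding img' G_def by (simp add: indicator_mult_ennreal mult.commute)
    also have "\<dots> \<le> (\<integral>\<^sup>+p. ennreal (norm (scalar_curvature A (g 0) p)) \<partial>\<mu>)"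
      by (intro nn_integral_mono) (auto split: split_indicator)
    also have "\<dots> < \<infinity>" using \<mu>(2) by (simp add: integrable_iff_bounded)
    finally have fin: "(\<integral>\<^sup>+y. ennreal (?u y) \<partial>lborel) < \<infinity>" .
    \<comment> \<open>The entries of the inverse metric are at most 2, so its determinant is at most
      \<kappa> and that of the metric at least \<open>1 / \<kappa>\<close>.\<close>
    define \<kappa> :: real where "\<kappa> = fact CARD('n) * 2 ^ CARD('n)"
    have low: "1 \<le> sqrt \<kappa> * sqrt (det (G 0 y))" if y: "F.r0 < norm y" for y
    proof -
      have y1: "1 < norm y" using y F.r0 by simp
      have "\<bar>det (F.Hh 0 y)\<bar> \<le> \<kappa>" unfolding \<kappa>_def by (rule abs_det_le) (use F.Hh_bound[OF T0] y in simp)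
      moreover have "det (F.Hh 0 y) * det (G 0 y) = 1"
        using F.Hh_inverse[OF T0 y1] by (simp add: det_mul[symmetric])
      ultimately have "1 \<le> \<kappa> * det (G 0 y)"
        using mult_right_mono[of "det (F.Hh 0 y)" \<kappa> "det (G 0 y)"] det_pos[OF T0 y1] by simp
      then show ?thesis by (simp add: real_sqrt_mult[symmetric])
    qed
    have "integrable lborel (\<lambda>y. indicator {y. F.r0 < norm y} y *\<^sub>R Sc ax (G 0) y)"
    proof (rule integrableI_bounded)
      show "(\<lambda>y. indicator {y. F.r0 < norm y} y *\<^sub>R Sc ax (G 0) y) \<in> borel_measurable lborel"
      proof -
        have "{y. F.r0 < norm y} \<subseteq> ?E" using F.r0 by auto
        from borel_measurable_continuous_on_indicator[OF borel_open[OF open_exterior] continuous_on_subset[OF cS this]]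
        show ?thesis by simp
      qed
      have "(\<integral>\<^sup>+y. ennreal (norm (indicator {y. F.r0 < norm y} y *\<^sub>R Sc ax (G 0) y)) \<partial>lborel)
        \<le> (\<integral>\<^sup>+y. ennreal (sqrt \<kappa>) * ennreal (?u y) \<partial>lborel)"
      proof (intro nn_integral_mono)
        fix y
        have "norm (indicator {y. F.r0 < norm y} y *\<^sub>R Sc ax (G 0) y) \<le> sqrt \<kappa> * ?u y"
        proof (cases "F.r0 < norm y")
          case True
          then have "\<bar>Sc ax (G 0) y\<bar> * 1 \<le> \<bar>Sc ax (G 0) y\<bar> * (sqrt \<kappa> * sqrt (det (G 0 y)))"
            by (intro mult_left_mono low) auto
          then show ?thesis using True F.r0 by (simp add: mult_ac)
        next
          case False
          have "0 \<le> sqrt \<kappa>" by (simp add: \<kappa>_def)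
          moreover have "0 \<le> ?u y" using less_imp_le[OF det_pos[OF T0, of y]] by (simp add: indicator_def)
          ultimately show ?thesis using False by simp
        qed
        then show "ennreal (norm (indicator {y. F.r0 < norm y} y *\<^sub>R Sc ax (G 0) y)) \<le> ennreal (sqrt \<kappa>) * ennreal (?u y)"
          by (simp add: ennreal_mult'[symmetric] \<kappa>_def ennreal_leI)
      qed
      also have "\<dots> = ennreal (sqrt \<kappa>) * (\<integral>\<^sup>+y. ennreal (?u y) \<partial>lborel)"
        by (rule nn_integral_cmult) (use u in simp)
      also have "\<dots> < \<infinity>" using fin by (simp add: ennreal_mult_less_top)
      finally show "(\<integral>\<^sup>+y. ennreal (norm (indicator {y. F.r0 < norm y} y *\<^sub>R Sc ax (G 0) y)) \<partial>lborel) < \<infinity>" .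
    qed
    then show "\<exists>r1. set_integrable lborel {y. r1 < norm y} (Sc ax (G 0))"
      unfolding set_integrable_def by blast
  qed
  \<comment> \<open>The decay estimates start at \<open>F.r0\<close>; Shi's curvature bound covers
    the rest of the chart down to radius 1.\<close>
  obtain Cs where Cs: "\<And>t c y. t \<in> {0..T} \<Longrightarrow> c \<in> A \<Longrightarrow> y \<in> chart_image c \<Longrightarrow> tensor_norm (g t c) 4 (riemann_lowered (g t c)) y \<le> Cs"
    using flow unfolding shi_solution_def by blast
  define s where "s = (real CARD('n))\<^sup>2 * Cs"
  have S_bound: "\<bar>Sc ax (G t) y\<bar> \<le> s" if t: "t \<in> {0..T}" and y: "1 < norm y" for t y
  proof -
    have "\<bar>scal (G t) y\<bar> \<le> (real CARD('n))\<^sup>2 * tensor_norm (G t) 4 (riemann_lowered (G t)) y"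
      by (rule scal_le_tensor_norm) (use F.G_sym[OF t y] F.G_pos[OF t y] in auto)
    also have "\<dots> \<le> s" unfolding s_def G_def using Cs[OF t c] y img' by (intro mult_left_mono) auto
    finally show ?thesis by (simp add: scal_eq)
  qed
  \<comment> \<open>The weight has a positive lower bound, as it attains a minimum on the ball of
    radius 2 and is at least 2 outside. Hence the metric components and the volume density stay
    bounded near the inner edge.\<close>
  obtain m where m: "m > 0" "\<And>y. m \<le> w y"
  proof -
    have "continuous_on (cball 0 2) w" by (rule continuous_on_subset[OF smooth_on_continuous_on[OF w(1)]]) simp
    then have "\<exists>y1\<in>cball 0 2. \<forall>y\<in>cball 0 2. w y1 \<le> w y"
      by (intro continuous_attains_inf compact_cball) auto
    then obtain y1 where y1: "\<And>y. y \<in> cball 0 2 \<Longrightarrow> w y1 \<le> w y" by blast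
    have "min (w y1) 2 \<le> w y" for y using y1[of y] w(3)[of y] by (cases "norm y \<le> 2") auto
    then show thesis using that[of "min (w y1) 2"] w(2) by auto
  qed
  define b where "b = 1 + D * m powr (- \<delta>)"
  define d where "d = fact CARD('n) * b ^ CARD('n)"
  have det_bound: "sqrt (det (G t y)) \<le> sqrt d" if t: "t \<in> {0..T}" and y: "1 < norm y" for t y
  proof -
    have "\<bar>G t y $ i $ j\<bar> \<le> b" for i j
    proof -
      have "\<bar>G t y $ i $ j - mat 1 $ i $ j\<bar> \<le> D * w y powr (- \<delta>)" by (rule dec(1)[OF t t y])
      also have "\<dots> \<le> D * m powr (- \<delta>)"
        using m \<delta> by (intro mult_left_mono powr_mono2') (auto simp: D_def)
      finally show ?thesis by (auto simp: b_def mat_def split: if_splits)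
    qed
    from abs_det_le[OF this] show ?thesis by (auto simp: d_def)
  qed
  have L1: "scalar_curvature_L1 A (g t)" if t: "t \<in> {0..T}" for t
    unfolding scalar_curvature_L1_def
  proof (intro exI conjI)
    show v: "is_volume_measure A (g t) (density \<mu> (\<lambda>p. ennreal (M.vol_ratio t p)))"
      by (rule M.volume_measure_density[OF t \<mu>(1)])
    \<comment> \<open>Majorant in coordinates: Shi's bound inside radius \<open>F.r0\<close>, the
      integrable curvature outside, and \<open>sqrt d\<close> for the volume density
      throughout.\<close>
    let ?v = "\<lambda>y. sqrt d * (s * indicator (cball 0 F.r0) y + indicator {y. F.r0 \<le> norm y} y * \<bar>Sc ax (G t) y\<bar>)"
    have "integrable lborel (\<lambda>y::real^'n. s * indicator (cball 0 F.r0) y)"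
      by (intro integrable_mult_right integrable_real_indicator) (use emeasure_lborel_cball_finite[of "0 :: real^'n" F.r0] in auto)
    from Bochner_Integration.integrable_add[OF this L.integrable_scalar[OF t]]
    have "integrable lborel ?v" by (rule integrable_mult_right)
    then have fin: "(\<integral>\<^sup>+y. ennreal (norm (?v y)) \<partial>lborel) < \<infinity>"
      unfolding integrable_iff_bounded by (rule conjunct2)
    show "integrable (density \<mu> (\<lambda>p. ennreal (M.vol_ratio t p))) (scalar_curvature A (g t))"
    proof (rule M.integrable_scalar_curvature[OF t v K0 c], rule le_less_trans[OF nn_integral_mono fin])
      fix y :: "real^'n"
      show "ennreal (\<bar>Sc ax (g t ?c) y\<bar> * sqrt (det (g t ?c y))) * indicator (x ` (- K0)) y \<le> ennreal (norm (?v y))"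
        unfolding img G_def[symmetric]
      proof (cases "1 < norm y")
        case True
        have s0: "0 \<le> s" "0 \<le> sqrt d" "0 \<le> sqrt (det (G t y))"
          using S_bound[OF t True] det_bound[OF t True] det_pos[OF t True] by auto
        have "\<bar>Sc ax (G t) y\<bar> \<le> s * indicator (cball 0 F.r0) y + indicator {y. F.r0 \<le> norm y} y * \<bar>Sc ax (G t) y\<bar>"
          using S_bound[OF t True] s0 by (auto simp: indicator_def)
        then have "\<bar>Sc ax (G t) y\<bar> * sqrt (det (G t y)) \<le> (s * indicator (cball 0 F.r0) y + indicator {y. F.r0 \<le> norm y} y * \<bar>Sc ax (G t) y\<bar>) * sqrt d"
          using det_bound[OF t True] s0 by (intro mult_mono) auto
        also have "\<dots> \<le> norm (?v y)" by (simp add: mult.commute)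
        finally show "ennreal (\<bar>Sc ax (G t) y\<bar> * sqrt (det (G t y))) * indicator ?E y \<le> ennreal (norm (?v y))"
          using True by (simp add: ennreal_leI)
      qed simp
    qed
  qed
  obtain m0 where m0: "\<And>t. t \<in> {0..T} \<Longrightarrow> (adm_flux (G t) \<longlongrightarrow> m0) at_top"
    using L.mass_conserved by blast
  have mass: "adm_mass (G t) = m0" if "t \<in> {0..T}" for t
    unfolding adm_mass_def by (rule tendsto_Lim[OF trivial_limit_at_top_linorder m0[OF that]])
  show ?thesis
    using L1 m0 mass mass[OF T0] unfolding G_def initial by auto
qed

end
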